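(* Let $p$ be a prime and let $(Q,u)$ be a filtered $\mathbb Z_p$-algebra which is a standard filtered artinian ring, carrying a commuting skew derivation $(\sigma,\delta)$ which is quasi-compatible with $u$. Suppose there exists $t\in Q$ such that $\delta(q)=tq-\sigma(q)t$ for all $q\in Q$. For $m\in\mathbb N$ set $T_m=(-1)^{p+1}t^{p^m}$, $X_m=(x-t)^{p^m}+T_m$, $\Sigma_m=\sigma^{p^m}$, $\Delta_m(q)=T_mq-\Sigma_m(q)T_m$. Suppose that $(\Sigma_m,\Delta_m)$ is compatible with $u$ for sufficiently large $m$, and that no positive power of $\sigma$ is inner as an automorphism of $Q$. Then: (1) If $\mathrm{char}(Q)=p$, then the localisation $Q^+[[x;\sigma,\delta]]_{(x-t)}$ is a simple ring. (2) If $\mathrm{char}(Q)=0$ and $u(t)\ge 0$, then $Q^+[[x;\sigma,\delta]]_{(x-t)}\cong\big(Q^+[[X_m;\Sigma_m,\Delta_m]]_{(X_m-T_m)}\big)^k$ for some $k,m\in\mathbb N$ such that $Q^+[[X_m;\Sigma_m,\Delta_m]]_{(X_m-T_m)}$ is a simple ring.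
   Context: A filtration on a ring $R$ is a function $u:R\to\mathbb Z\cup\{\infty\}$ with $u(a+b)\ge\min\{u(a),u(b)\}$, $u(a)=\infty$ iff $a=0$, $u(1)=0$, $u(ab)\ge u(a)+u(b)$; $F_nR=u^{-1}([n,\infty])$. $(R,u)$ is a filtered $\mathbb Z_p$-algebra if $R$ is a $\mathbb Z_p$-algebra and $u(n\cdot1)\ge v_p(n)$ for all $n\in\mathbb Z_p$. An additive endomorphism $f$ is filtered if $f(F_nR)\subseteq F_{n+d}R$ for all $n$, for some $d\in\mathbb Z$; $\deg_u(f)$ is the largest such $d$. A skew derivation $(\sigma,\delta)$ is $\sigma\in\mathrm{Aut}(R)$ with an additive $\delta$ satisfying $\delta(rs)=\delta(r)s+\sigma(r)\delta(s)$; commuting means $\sigma\delta=\delta\sigma$. It is compatible with $u$ if $u(\sigma(r)-r)>u(r)$ and $u(\delta(r))>u(r)$ for all $r\ne0$. A commuting one is quasi-compatible with $u$ if $\sigma,\sigma^{-1},\delta$ are filtered, the degrees $\deg_u(\sigma^i\delta^j)$ ($i\in\mathbb Z,j\in\mathbb N$) have a common lower bound, and $\deg_u(\delta^N)>0$ for some $N$. For a complete filtered ring $(S,w)$ with quasi-compatible commuting $(\sigma,\delta)$, $S^+[[x;\sigma,\delta]]$ is the ring of power series $\sum_ns_nx^n$ with $w(s_n)$ bounded below, with multiplication $(\sum a_ix^i)(\sum b_jx^j)=\sum_k\big(\sum_{0\le e\le k}\sum_{i\ge e}\binom ie a_i\sigma^e\delta^{i-e}(b_{k-e})\big)x^k$.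 Under the hypotheses (which force $\sigma(t)=t$), in each of cases (1) and (2), $(\Sigma_m,\Delta_m)$ is quasi-compatible, $Q^+[[X_m;\Sigma_m,\Delta_m]]$ is identified with the subring of $Q^+[[x;\sigma,\delta]]$ of all series $\sum_kq_kX_m^k$ with $u(q_k)$ bounded below, $x-t$ is a regular normal element, and $X_m-T_m=(x-t)^{p^m}$. For a regular normal element $y$ of a ring $S$, $S_{(y)}$ denotes the localisation of $S$ at $\{y^r:r\in\mathbb N\}$. Discrete valuation ring: a Noetherian domain $D$, not a division ring, such that for each nonzero $x$ in its division ring of fractions $F$, $x\in D$ or $x^{-1}\in D$; then $J(D)=\pi D$ with $\pi$ normal, and $v(x)=\max\{n\in\mathbb Z:x\in\pi^nD\}$ is the induced valuation on $F$. $(Q,u)$ is a standard filtered artinian ring if $Q=M_s(F)$ for some $s\ge1$ (for a suitable choice of matrix units) with $F$ the division ring of fractions of a complete discrete valuation ring $D$, and $u((x_{ij}))=\min_{i,j}v(x_{ij})$. *)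

theory Defs
  imports "HOL-Algebra.Algebra" "HOL-Library.Extended" "HOL-Computational_Algebra.Primes"
begin

section \<open>Noncommutative rings\<close>

text \<open>
  Rings are the unital, not necessarily commutative rings of HOL-Algebra; the library's
  domain and field locales are commutative and hence are not used.
\<close>

definition ring_char :: "('a, 'm) ring_scheme \<Rightarrow> nat" where
  "ring_char R = (if \<exists>n>0. add_pow R (n::nat) \<one>\<^bsub>R\<^esub> = \<zero>\<^bsub>R\<^esub>
                  then LEAST n. n > 0 \<and> add_pow R n \<one>\<^bsub>R\<^esub> = \<zero>\<^bsub>R\<^esub> else 0)"

definition simple_ring :: "('a, 'm) ring_scheme \<Rightarrow> bool" where
  "simple_ring R \<longleftrightarrow> ring R \<and> \<one>\<^bsub>R\<^esub> \<noteq> \<zero>\<^bsub>R\<^esub> \<and>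
     (\<forall>I. ideal I R \<longrightarrow> I = {\<zero>\<^bsub>R\<^esub>} \<or> I = carrier R)"

definition is_division_ring :: "('a, 'm) ring_scheme \<Rightarrow> bool" where
  "is_division_ring R \<longleftrightarrow> ring R \<and> \<one>\<^bsub>R\<^esub> \<noteq> \<zero>\<^bsub>R\<^esub> \<and> carrier R - {\<zero>\<^bsub>R\<^esub>} \<subseteq> Units R"

definition is_nc_domain :: "('a, 'm) ring_scheme \<Rightarrow> bool" where
  "is_nc_domain R \<longleftrightarrow> ring R \<and> \<one>\<^bsub>R\<^esub> \<noteq> \<zero>\<^bsub>R\<^esub> \<and>
     (\<forall>a\<in>carrier R. \<forall>b\<in>carrier R. a \<otimes>\<^bsub>R\<^esub> b = \<zero>\<^bsub>R\<^esub> \<longrightarrow> a = \<zero>\<^bsub>R\<^esub> \<or> b = \<zero>\<^bsub>R\<^esub>)"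

definition left_ideal :: "'a set \<Rightarrow> ('a, 'm) ring_scheme \<Rightarrow> bool" where
  "left_ideal I R \<longleftrightarrow> additive_subgroup I R \<and> (\<forall>r\<in>carrier R. \<forall>a\<in>I. r \<otimes>\<^bsub>R\<^esub> a \<in> I)"

definition right_ideal :: "'a set \<Rightarrow> ('a, 'm) ring_scheme \<Rightarrow> bool" where
  "right_ideal I R \<longleftrightarrow> additive_subgroup I R \<and> (\<forall>r\<in>carrier R. \<forall>a\<in>I. a \<otimes>\<^bsub>R\<^esub> r \<in> I)"

definition is_noetherian :: "('a, 'm) ring_scheme \<Rightarrow> bool" where
  "is_noetherian R \<longleftrightarrow>
     (\<nexists>I :: nat \<Rightarrow> 'a set. \<forall>n. left_ideal (I n) R \<and> I n \<subset> I (Suc n)) \<and>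
     (\<nexists>I :: nat \<Rightarrow> 'a set. \<forall>n. right_ideal (I n) R \<and> I n \<subset> I (Suc n))"

definition maximal_right_ideal :: "'a set \<Rightarrow> ('a, 'm) ring_scheme \<Rightarrow> bool" where
  "maximal_right_ideal M R \<longleftrightarrow> right_ideal M R \<and> M \<noteq> carrier R \<and>
     (\<forall>I. right_ideal I R \<and> M \<subseteq> I \<longrightarrow> I = M \<or> I = carrier R)"

definition jacobson_radical :: "('a, 'm) ring_scheme \<Rightarrow> 'a set" where
  "jacobson_radical R = carrier R \<inter> \<Inter>{M. maximal_right_ideal M R}"

definition inner_automorphism :: "('a, 'm) ring_scheme \<Rightarrow> ('a \<Rightarrow> 'a) \<Rightarrow> bool" where
  "inner_automorphism R \<tau> \<longleftrightarrow>
     (\<exists>a\<in>Units R. \<forall>r\<in>carrier R. \<tau> r = a \<otimes>\<^bsub>R\<^esub> r \<otimes>\<^bsub>R\<^esub> inv\<^bsub>R\<^esub> a)"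

definition matrix_ring :: "nat \<Rightarrow> ('a, 'm) ring_scheme \<Rightarrow> (nat \<times> nat \<Rightarrow> 'a) ring" where
  "matrix_ring s R =
     \<lparr> carrier = {..<s} \<times> {..<s} \<rightarrow>\<^sub>E carrier R,
       monoid.mult = (\<lambda>A B. \<lambda>(i, j)\<in>{..<s} \<times> {..<s}. \<Oplus>\<^bsub>R\<^esub>k\<in>{..<s}. A (i, k) \<otimes>\<^bsub>R\<^esub> B (k, j)),
       monoid.one = (\<lambda>(i, j)\<in>{..<s} \<times> {..<s}. if i = j then \<one>\<^bsub>R\<^esub> else \<zero>\<^bsub>R\<^esub>),
       ring.zero = (\<lambda>(i, j)\<in>{..<s} \<times> {..<s}. \<zero>\<^bsub>R\<^esub>),
       ring.add = (\<lambda>A B. \<lambda>(i, j)\<in>{..<s} \<times> {..<s}. A (i, j) \<oplus>\<^bsub>R\<^esub> B (i, j)) \<rparr>"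

section \<open>Localisation at the powers of a regular normal element\<close>

text \<open>
  For \<open>y\<close> regular and normal in \<open>S\<close> the powers of \<open>y\<close> form an Ore set, and every element of the
  localisation is a left fraction \<open>y\<^sup>-\<^sup>r s\<close>, represented by the pair \<open>(r, s)\<close>.  Fractions are
  multiplied by moving \<open>s\<close> past the second denominator:
  \<open>y\<^sup>-\<^sup>r s \<cdot> y\<^sup>-\<^sup>q s' = y\<^sup>-\<^sup>(\<^sup>r\<^sup>+\<^sup>q\<^sup>) (y\<^sup>q s y\<^sup>-\<^sup>q) s'\<close>, where \<open>y\<^sup>q s y\<^sup>-\<^sup>q\<close> is the unique
  \<open>s''\<close> in \<open>S\<close> with \<open>s'' y\<^sup>q = y\<^sup>q s\<close>.  The construction is only meaningful for regular normal \<open>y\<close>.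
\<close>

definition frac_rel :: "('a, 'm) ring_scheme \<Rightarrow> 'a \<Rightarrow> ((nat \<times> 'a) \<times> (nat \<times> 'a)) set" where
  "frac_rel S y = {((r, s), (q, s')). s \<in> carrier S \<and> s' \<in> carrier S \<and>
     y [^]\<^bsub>S\<^esub> q \<otimes>\<^bsub>S\<^esub> s = y [^]\<^bsub>S\<^esub> r \<otimes>\<^bsub>S\<^esub> s'}"

definition move_past :: "('a, 'm) ring_scheme \<Rightarrow> 'a \<Rightarrow> nat \<Rightarrow> 'a \<Rightarrow> 'a" where
  "move_past S y q s = (THE s''. s'' \<in> carrier S \<and> s'' \<otimes>\<^bsub>S\<^esub> y [^]\<^bsub>S\<^esub> q = y [^]\<^bsub>S\<^esub> q \<otimes>\<^bsub>S\<^esub> s)"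

definition localisation :: "('a, 'm) ring_scheme \<Rightarrow> 'a \<Rightarrow> (nat \<times> 'a) set ring" where
  "localisation S y =
     \<lparr> carrier = (UNIV \<times> carrier S) // frac_rel S y,
       monoid.mult = (\<lambda>A B. \<Union>(r, s)\<in>A. \<Union>(q, s')\<in>B.
          frac_rel S y `` {(r + q, move_past S y q s \<otimes>\<^bsub>S\<^esub> s')}),
       monoid.one = frac_rel S y `` {(0, \<one>\<^bsub>S\<^esub>)},
       ring.zero = frac_rel S y `` {(0, \<zero>\<^bsub>S\<^esub>)},
       ring.add = (\<lambda>A B. \<Union>(r, s)\<in>A. \<Union>(q, s')\<in>B.
          frac_rel S y `` {(r + q, y [^]\<^bsub>S\<^esub> q \<otimes>\<^bsub>S\<^esub> s \<oplus>\<^bsub>S\<^esub> y [^]\<^bsub>S\<^esub> r \<otimes>\<^bsub>S\<^esub> s')}) \<rparr>"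

section \<open>Filtrations\<close>

text \<open>
  The value set is the integers together with \<open>Pinf\<close>; the remaining element \<open>Minf\<close> of the
  library type is excluded explicitly.
\<close>

definition filtration :: "('a, 'm) ring_scheme \<Rightarrow> ('a \<Rightarrow> int extended) \<Rightarrow> bool" where
  "filtration R u \<longleftrightarrow> ring R \<and>
     (\<forall>a\<in>carrier R. u a \<noteq> Minf) \<and>
     (\<forall>a\<in>carrier R. u a = Pinf \<longleftrightarrow> a = \<zero>\<^bsub>R\<^esub>) \<and>
     u \<one>\<^bsub>R\<^esub> = 0 \<and>
     (\<forall>a\<in>carrier R. \<forall>b\<in>carrier R. min (u a) (u b) \<le> u (a \<oplus>\<^bsub>R\<^esub> b)) \<and>
     (\<forall>a\<in>carrier R. \<forall>b\<in>carrier R. u a + u b \<le> u (a \<otimes>\<^bsub>R\<^esub> b))"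

definition filt_level :: "('a, 'm) ring_scheme \<Rightarrow> ('a \<Rightarrow> int extended) \<Rightarrow> int \<Rightarrow> 'a set" where
  "filt_level R u n = {r \<in> carrier R. Fin n \<le> u r}"

definition filt_sums ::
  "('a, 'm) ring_scheme \<Rightarrow> ('a \<Rightarrow> int extended) \<Rightarrow> (nat \<Rightarrow> 'a) \<Rightarrow> 'a \<Rightarrow> bool" where
  "filt_sums R u f l \<longleftrightarrow> l \<in> carrier R \<and>
     (\<forall>c::int. \<exists>N. \<forall>n\<ge>N. Fin c \<le> u ((\<Oplus>\<^bsub>R\<^esub>i\<in>{..<n}. f i) \<ominus>\<^bsub>R\<^esub> l))"

definition filt_suminf ::
  "('a, 'm) ring_scheme \<Rightarrow> ('a \<Rightarrow> int extended) \<Rightarrow> (nat \<Rightarrow> 'a) \<Rightarrow> 'a" where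
  "filt_suminf R u f = (THE l. filt_sums R u f l)"

definition filt_complete :: "('a, 'm) ring_scheme \<Rightarrow> ('a \<Rightarrow> int extended) \<Rightarrow> bool" where
  "filt_complete R u \<longleftrightarrow>
     (\<forall>f :: nat \<Rightarrow> 'a. (\<forall>n. f n \<in> carrier R) \<and>
        (\<forall>c::int. \<exists>N. \<forall>m\<ge>N. \<forall>n\<ge>N. Fin c \<le> u (f m \<ominus>\<^bsub>R\<^esub> f n)) \<longrightarrow>
        (\<exists>l\<in>carrier R. \<forall>c::int. \<exists>N. \<forall>n\<ge>N. Fin c \<le> u (f n \<ominus>\<^bsub>R\<^esub> l)))"

definition filtered_of_degree ::
  "('a, 'm) ring_scheme \<Rightarrow> ('a \<Rightarrow> int extended) \<Rightarrow> ('a \<Rightarrow> 'a) \<Rightarrow> int \<Rightarrow> bool" where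
  "filtered_of_degree R u f d \<longleftrightarrow> f \<in> hom (add_monoid R) (add_monoid R) \<and>
     (\<forall>n. f ` filt_level R u n \<subseteq> filt_level R u (n + d))"

definition filtered_map ::
  "('a, 'm) ring_scheme \<Rightarrow> ('a \<Rightarrow> int extended) \<Rightarrow> ('a \<Rightarrow> 'a) \<Rightarrow> bool" where
  "filtered_map R u f \<longleftrightarrow> (\<exists>d. filtered_of_degree R u f d)"

text \<open>
  The degree is \<open>Pinf\<close> if every integer is admissible, which happens exactly for the zero map.
\<close>

definition filt_deg ::
  "('a, 'm) ring_scheme \<Rightarrow> ('a \<Rightarrow> int extended) \<Rightarrow> ('a \<Rightarrow> 'a) \<Rightarrow> int extended" where
  "filt_deg R u f = (if \<forall>d. filtered_of_degree R u f d then Pinf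
                     else Fin (GREATEST d. filtered_of_degree R u f d))"

section \<open>The \<open>p\<close>-adic integers and filtered algebras over them\<close>

text \<open>
  The inverse limit of the rings \<open>\<int>/p\<^sup>n\<close>, an element being the sequence of its least nonnegative
  residues; \<open>p\<^sup>n\<close> divides \<open>a\<close> iff \<open>a n = 0\<close>.
\<close>

definition padic_int :: "nat \<Rightarrow> (nat \<Rightarrow> int) ring" where
  "padic_int p =
     \<lparr> carrier = {a. \<forall>n. a n \<in> {0..<int p ^ n} \<and> a (Suc n) mod int p ^ n = a n},
       monoid.mult = (\<lambda>a b n. (a n * b n) mod int p ^ n),
       monoid.one = (\<lambda>n. 1 mod int p ^ n),
       ring.zero = (\<lambda>n. 0),
       ring.add = (\<lambda>a b n. (a n + b n) mod int p ^ n) \<rparr>"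

definition padic_val :: "(nat \<Rightarrow> int) \<Rightarrow> int extended" where
  "padic_val a = (if \<forall>n. a n = 0 then Pinf else Fin (int (GREATEST n. a n = 0)))"

definition filtered_Zp_algebra ::
  "nat \<Rightarrow> ('a, 'm) ring_scheme \<Rightarrow> ('a \<Rightarrow> int extended) \<Rightarrow> ((nat \<Rightarrow> int) \<Rightarrow> 'a) \<Rightarrow> bool" where
  "filtered_Zp_algebra p R u \<eta> \<longleftrightarrow> filtration R u \<and>
     \<eta> \<in> ring_hom (padic_int p) R \<and>
     (\<forall>n\<in>carrier (padic_int p). \<forall>r\<in>carrier R. \<eta> n \<otimes>\<^bsub>R\<^esub> r = r \<otimes>\<^bsub>R\<^esub> \<eta> n) \<and>
     (\<forall>n\<in>carrier (padic_int p). padic_val n \<le> u (\<eta> n))"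

section \<open>Discrete valuation rings and standard filtered artinian rings\<close>

definition division_ring_of_fractions :: "'a set \<Rightarrow> ('a, 'm) ring_scheme \<Rightarrow> bool" where
  "division_ring_of_fractions D F \<longleftrightarrow> is_division_ring F \<and> subring D F \<and>
     (\<forall>x\<in>carrier F. (\<exists>a\<in>D. \<exists>b\<in>D - {\<zero>\<^bsub>F\<^esub>}. x = a \<otimes>\<^bsub>F\<^esub> inv\<^bsub>F\<^esub> b) \<and>
                    (\<exists>a\<in>D. \<exists>b\<in>D - {\<zero>\<^bsub>F\<^esub>}. x = inv\<^bsub>F\<^esub> b \<otimes>\<^bsub>F\<^esub> a))"

definition discrete_valuation_ring :: "'a set \<Rightarrow> ('a, 'm) ring_scheme \<Rightarrow> bool" where
  "discrete_valuation_ring D F \<longleftrightarrow>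
     division_ring_of_fractions D F \<and>
     is_nc_domain (F\<lparr>carrier := D\<rparr>) \<and> is_noetherian (F\<lparr>carrier := D\<rparr>) \<and>
     \<not> is_division_ring (F\<lparr>carrier := D\<rparr>) \<and>
     (\<forall>x\<in>carrier F - {\<zero>\<^bsub>F\<^esub>}. x \<in> D \<or> inv\<^bsub>F\<^esub> x \<in> D)"

text \<open>
  A normal generator \<open>\<pi>\<close> of \<open>J(D)\<close>.  It always exists, and the induced valuation does not depend
  on its choice.
\<close>

definition is_uniformiser :: "'a set \<Rightarrow> ('a, 'm) ring_scheme \<Rightarrow> 'a \<Rightarrow> bool" where
  "is_uniformiser D F \<pi> \<longleftrightarrow> \<pi> \<in> D \<and>
     jacobson_radical (F\<lparr>carrier := D\<rparr>) = \<pi> <#\<^bsub>F\<^esub> D \<and> \<pi> <#\<^bsub>F\<^esub> D = D #>\<^bsub>F\<^esub> \<pi>"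

definition induced_val :: "'a set \<Rightarrow> ('a, 'm) ring_scheme \<Rightarrow> 'a \<Rightarrow> 'a \<Rightarrow> int extended" where
  "induced_val D F \<pi> x = (if x = \<zero>\<^bsub>F\<^esub> then Pinf
                           else Fin (GREATEST n::int. x \<in> (\<pi> [^]\<^bsub>F\<^esub> n) <#\<^bsub>F\<^esub> D))"

text \<open>
  A choice of matrix units in \<open>Q\<close> amounts to an isomorphism onto a matrix ring over \<open>F\<close>.  As \<open>F\<close>
  embeds in \<open>Q\<close>, it is no restriction to look for \<open>F\<close> on the element type of \<open>Q\<close>.
\<close>

definition standard_filtered_artinian :: "('a, 'm) ring_scheme \<Rightarrow> ('a \<Rightarrow> int extended) \<Rightarrow> bool" where
  "standard_filtered_artinian Q u \<longleftrightarrow> ring Q \<and>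
     (\<exists>(s::nat) (F :: 'a ring) D \<pi> \<phi>.
        s \<ge> 1 \<and> discrete_valuation_ring D F \<and> is_uniformiser D F \<pi> \<and>
        filt_complete (F\<lparr>carrier := D\<rparr>) (induced_val D F \<pi>) \<and>
        \<phi> \<in> ring_iso Q (matrix_ring s F) \<and>
        (\<forall>x\<in>carrier Q. u x = Min ((\<lambda>ij. induced_val D F \<pi> (\<phi> x ij)) ` ({..<s} \<times> {..<s}))))"

section \<open>Skew derivations\<close>

definition skew_derivation :: "('a, 'm) ring_scheme \<Rightarrow> ('a \<Rightarrow> 'a) \<Rightarrow> ('a \<Rightarrow> 'a) \<Rightarrow> bool" where
  "skew_derivation R \<sigma> \<delta> \<longleftrightarrow> \<sigma> \<in> ring_iso R R \<and> \<delta> \<in> hom (add_monoid R) (add_monoid R) \<and>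
     (\<forall>r\<in>carrier R. \<forall>s\<in>carrier R. \<delta> (r \<otimes>\<^bsub>R\<^esub> s) = \<delta> r \<otimes>\<^bsub>R\<^esub> s \<oplus>\<^bsub>R\<^esub> \<sigma> r \<otimes>\<^bsub>R\<^esub> \<delta> s)"

definition commuting_skew_derivation ::
  "('a, 'm) ring_scheme \<Rightarrow> ('a \<Rightarrow> 'a) \<Rightarrow> ('a \<Rightarrow> 'a) \<Rightarrow> bool" where
  "commuting_skew_derivation R \<sigma> \<delta> \<longleftrightarrow> skew_derivation R \<sigma> \<delta> \<and>
     (\<forall>r\<in>carrier R. \<sigma> (\<delta> r) = \<delta> (\<sigma> r))"

definition compatible ::
  "('a, 'm) ring_scheme \<Rightarrow> ('a \<Rightarrow> int extended) \<Rightarrow> ('a \<Rightarrow> 'a) \<Rightarrow> ('a \<Rightarrow> 'a) \<Rightarrow> bool" where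
  "compatible R u \<sigma> \<delta> \<longleftrightarrow> skew_derivation R \<sigma> \<delta> \<and>
     (\<forall>r\<in>carrier R - {\<zero>\<^bsub>R\<^esub>}. u r < u (\<sigma> r \<ominus>\<^bsub>R\<^esub> r) \<and> u r < u (\<delta> r))"

definition aut_pow :: "('a, 'm) ring_scheme \<Rightarrow> ('a \<Rightarrow> 'a) \<Rightarrow> int \<Rightarrow> 'a \<Rightarrow> 'a" where
  "aut_pow R \<sigma> i = (if 0 \<le> i then \<sigma> ^^ nat i else inv_into (carrier R) \<sigma> ^^ nat (- i))"

definition quasi_compatible ::
  "('a, 'm) ring_scheme \<Rightarrow> ('a \<Rightarrow> int extended) \<Rightarrow> ('a \<Rightarrow> 'a) \<Rightarrow> ('a \<Rightarrow> 'a) \<Rightarrow> bool" where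
  "quasi_compatible R u \<sigma> \<delta> \<longleftrightarrow> commuting_skew_derivation R \<sigma> \<delta> \<and>
     filtered_map R u \<sigma> \<and> filtered_map R u (inv_into (carrier R) \<sigma>) \<and> filtered_map R u \<delta> \<and>
     (\<exists>c::int. \<forall>(i::int) (j::nat). Fin c \<le> filt_deg R u (aut_pow R \<sigma> i \<circ> (\<delta> ^^ j))) \<and>
     (\<exists>N. 0 < filt_deg R u (\<delta> ^^ N))"

section \<open>Bounded skew power series rings\<close>

text \<open>
  The series \<open>\<Sum>\<^sub>n a\<^sub>n x\<^sup>n\<close> is its coefficient sequence.  In the product the inner sum over \<open>i \<ge> e\<close> is
  reindexed by \<open>i = e + j\<close> and taken in the topology of the filtration; it converges if \<open>R\<close> is
  complete and \<open>(\<sigma>, \<delta>)\<close> is quasi-compatible.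
\<close>

definition skew_series_ring ::
  "('a, 'm) ring_scheme \<Rightarrow> ('a \<Rightarrow> int extended) \<Rightarrow> ('a \<Rightarrow> 'a) \<Rightarrow> ('a \<Rightarrow> 'a) \<Rightarrow> (nat \<Rightarrow> 'a) ring" where
  "skew_series_ring R u \<sigma> \<delta> =
     \<lparr> carrier = {a. (\<forall>n. a n \<in> carrier R) \<and> (\<exists>c::int. \<forall>n. Fin c \<le> u (a n))},
       monoid.mult = (\<lambda>a b k. \<Oplus>\<^bsub>R\<^esub>e\<in>{..k}. filt_suminf R u
          (\<lambda>j. add_pow R ((e + j) choose e) (a (e + j) \<otimes>\<^bsub>R\<^esub> (\<sigma> ^^ e) ((\<delta> ^^ j) (b (k - e)))))),
       monoid.one = (\<lambda>n. if n = 0 then \<one>\<^bsub>R\<^esub> else \<zero>\<^bsub>R\<^esub>),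
       ring.zero = (\<lambda>n. \<zero>\<^bsub>R\<^esub>),
       ring.add = (\<lambda>a b n. a n \<oplus>\<^bsub>R\<^esub> b n) \<rparr>"

definition series_var :: "('a, 'm) ring_scheme \<Rightarrow> nat \<Rightarrow> 'a" where
  "series_var R = (\<lambda>n. if n = 1 then \<one>\<^bsub>R\<^esub> else \<zero>\<^bsub>R\<^esub>)"

definition series_const :: "('a, 'm) ring_scheme \<Rightarrow> 'a \<Rightarrow> nat \<Rightarrow> 'a" where
  "series_const R r = (\<lambda>n. if n = 0 then r else \<zero>\<^bsub>R\<^esub>)"

text \<open>
  A bounded skew power series ring \<open>A\<close> over \<open>R\<close>, with formal variable written \<open>X\<close>, is identified
  with the subring of a second one \<open>S\<close> formed by all series in an element \<open>z\<close> of \<open>S\<close>: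
  \<open>\<Sum>\<^sub>k q\<^sub>k X\<^sup>k\<close> in \<open>A\<close> corresponds to the coefficientwise sum of the \<open>q\<^sub>k z\<^sup>k\<close> in \<open>S\<close>.
\<close>

definition subseries_ring_in ::
  "('a, 'm) ring_scheme \<Rightarrow> ('a \<Rightarrow> int extended) \<Rightarrow> (nat \<Rightarrow> 'a) ring \<Rightarrow> (nat \<Rightarrow> 'a) ring \<Rightarrow>
   (nat \<Rightarrow> 'a) \<Rightarrow> bool" where
  "subseries_ring_in R u A S z \<longleftrightarrow> z \<in> carrier S \<and>
     (\<exists>\<iota>\<in>ring_hom A S. inj_on \<iota> (carrier A) \<and>
        (\<forall>q\<in>carrier A. \<forall>n.
           filt_sums R u (\<lambda>k. (series_const R (q k) \<otimes>\<^bsub>S\<^esub> z [^]\<^bsub>S\<^esub> k) n) (\<iota> q n)))"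

end

theory Submission
 imports Defs
begin

text \<open>Put \<open>N = p\<^sup>m\<close> with \<open>m\<close> large, \<open>y = x - t\<close> and \<open>z = y\<^sup>N + T\<close>. Since \<open>p\<close> divides the middle binomial
 coefficients, \<open>z\<close> is congruent to \<open>x\<^sup>N\<close> modulo positive filtration degree, so its powers behave like
 those of \<open>x\<^sup>N\<close>: the series in \<open>z\<close> form a subring \<open>B\<close>, isomorphic to the power series ring of the
 compatible skew derivation \<open>(\<Sigma>, \<Delta>)\<close>, over which \<open>1, y, \<dots>, y\<^bsup>N-1\<^esup>\<close> is a basis. Weierstrass division
 turns any nonzero ideal of \<open>B\<close> into one containing a monic polynomial in \<open>z - T = y\<^sup>N\<close>; one of least
 degree is a power of \<open>y\<^sup>N\<close>, because no positive power of \<open>\<sigma>\<close> is inner. So \<open>B\<close> localised at \<open>y\<^sup>N\<close> is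
 simple, and the localisation of the whole ring at \<open>y\<close> is graded over it by the cyclic group of
 order \<open>N\<close>. It is simple because its centre is a domain: central elements have pairwise commuting
 coefficients, and \<open>Q\<close> has the descending chain condition on left ideals.

 This covers both cases. In (2) one may take \<open>k = 1\<close> and \<open>m = 0\<close>: then \<open>T = \<plusminus>t\<close>, and replacing \<open>x\<close> by
 \<open>\<plusminus>x\<close> identifies the two localisations.\<close>

text \<open>Weierstrass division needs \<sigma> to be the identity and \<delta> to be zero modulo
  higher filtration degree. This is given for (\<Sigma>, \<Delta>) with m large but may fail for
  (\<sigma>, \<delta>) itself, which forces the detour through B. The sign of T is dictated by
  convergence: for m \<ge> 1 it equals -(-t)^N, minus the constant coefficient of y^N, so z has no
  constant term and each coefficient of a series in z is a finite sum. Both cases of the theorem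
  serve to give every p t^i positive degree: in characteristic p it is 0, and otherwise u(t) \<ge>
  0. Simplicity does not pass from B to a ring graded over it: the group algebra of a nontrivial
  cyclic group over a field is not simple. What survives is that a nonzero ideal contains a nonzero
  central element, so all rests on the centre. As Q may have zero divisors, lowest coefficients of
  central elements may multiply to zero; before they are compared they are multiplied by an element
  of Q that is minimal under left divisibility.\<close>

lemma (in abelian_monoid) finsum_lessThan_Suc:
 "(\<And>i. f i \<in> carrier G) ==> (\<Oplus>i\<in>{..<Suc n}. f i) = (\<Oplus>i\<in>{..<n}. f i) \<oplus> f n"
 unfolding lessThan_Suc by (subst finsum_insert) (auto simp: a_comm)

section \<open>Filtered rings and convergent sums\<close>

locale filtered_ring = ring Q for Q :: "('a, 'm) ring_scheme" (structure) +
 fixes u :: "'a \<Rightarrow> int extended"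
 assumes filt: "filtration Q u"
  and u_minus_one: "0 \<le> u (\<ominus> \<one>)"
  and compl: "filt_complete Q u"
begin

definition G :: "int \<Rightarrow> 'a set" where "G = filt_level Q u"

lemma G_iff: "a \<in> G c \<longleftrightarrow> a \<in> carrier Q \<and> Fin c \<le> u a"
 by (auto simp: G_def filt_level_def)

lemma G_carrier [simp, intro]: "a \<in> G c ==> a \<in> carrier Q"
 by (simp add: G_iff)

lemma G_add: assumes "a \<in> G c" "b \<in> G c" shows "a \<oplus> b \<in> G c"
proof -
 have "min (u a) (u b) \<le> u (a \<oplus> b)" using filt assms unfolding filtration_def G_iff by blast
 thus ?thesis using assms unfolding G_iff by (auto simp: min_def split: if_splits)
qed

lemma G_mult: assumes "a \<in> G c" "b \<in> G d" shows "a \<otimes> b \<in> G (c + d)"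
proof -
 have "u a + u b \<le> u (a \<otimes> b)" using filt assms unfolding filtration_def G_iff by blast
 thus ?thesis using assms unfolding G_iff
  by (cases "u a"; cases "u b"; cases "u (a \<otimes> b)") auto
qed

lemma G_mult': "a \<in> G c ==> b \<in> G d ==> e \<le> c + d ==> a \<otimes> b \<in> G e"
 using G_mult[of a c b d] unfolding G_iff
 by (metis dual_order.trans less_eq_extended.simps(1))

lemma G_mono: "a \<in> G c ==> d \<le> c ==> a \<in> G d"
 unfolding G_iff by (metis dual_order.trans less_eq_extended.simps(1))

lemma u_zero: "u \<zero> = \<infinity>" using filt by (simp add: filtration_def)

lemma G_zero [simp, intro]: "\<zero> \<in> G c"
 by (simp add: G_iff u_zero)

lemma G_one: "\<one> \<in> G 0"
 using filt by (simp add: G_iff filtration_def zero_extended_def)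

text \<open>The axioms of a filtration bound u(-1) only from above, by 2 u(-1) \<le> u(1) = 0. The
  locale's \<open>0 \<le> u (\<ominus> \<one>)\<close> is what makes the levels additive
  subgroups.\<close>

lemma G_neg: assumes "a \<in> G c" shows "\<ominus> a \<in> G c"
proof -
 have "\<ominus> \<one> \<in> G 0" using u_minus_one by (simp add: G_iff zero_extended_def)
 from G_mult[OF this assms] have "\<ominus> \<one> \<otimes> a \<in> G c" by simp
 moreover have "\<ominus> \<one> \<otimes> a = \<ominus> a" using assms by (simp add: l_minus)
 ultimately show ?thesis by simp
qed

lemma G_diff: "a \<in> G c ==> b \<in> G c ==> a \<ominus> b \<in> G c"
 by (simp add: minus_eq G_add G_neg)

lemma G_exhaust: assumes "a \<in> carrier Q" obtains c where "a \<in> G c"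
proof (cases "u a")
 case Minf thus ?thesis using filt assms by (auto simp: filtration_def)
qed (use assms that in \<open>auto simp: G_iff\<close>)

lemma G_sep: assumes "a \<in> carrier Q" "\<And>c. a \<in> G c" shows "a = \<zero>"
proof -
 have "u a = \<infinity>" using assms(2) unfolding G_iff
  by (cases "u a") (auto, metis gt_ex linorder_not_less)
 thus ?thesis using filt assms(1) by (simp add: filtration_def)
qed

lemma G_sep': assumes "a \<in> carrier Q" "\<And>c. c \<ge> c0 ==> a \<in> G c" shows "a = \<zero>"
 by (rule G_sep[OF assms(1)]) (meson G_mono assms(2) max.cobounded1 max.cobounded2)

lemma G_eq: assumes "a \<in> carrier Q" "b \<in> carrier Q" "\<And>c. a \<ominus> b \<in> G c" shows "a = b"
proof -
 have "a \<ominus> b = \<zero>" using assms by (intro G_sep) auto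
 thus ?thesis using assms by (simp add: r_right_minus_eq)
qed

lemma one_not_zero: "\<one> \<noteq> \<zero>"
 proof
 assume "\<one> = \<zero>"
 hence "Fin 0 = (\<infinity> :: int extended)" using filt u_zero by (simp add: filtration_def zero_extended_def)
 thus False by simp
qed

lemma G_finsum: "(\<And>i. i \<in> A ==> f i \<in> G c) ==> (\<Oplus>i\<in>A. f i) \<in> G c"
proof (induction A rule: infinite_finite_induct)
 case (insert x F)
 then show ?case by (subst finsum_insert) (auto intro!: G_add)
qed auto

lemma G_one_pow: "a \<in> G 0 ==> a [^] (n::nat) \<in> G 0"
 by (induction n) (auto intro: G_one G_mult')

lemma G_nat: "a \<in> G c ==> add_pow Q (n::nat) a \<in> G c"
 by (induction n) (auto intro: G_add)

lemma diff_swap: "a \<in> carrier Q ==> b \<in> carrier Q ==> \<ominus> (a \<ominus> b) = b \<ominus> a"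
 by (simp add: minus_eq minus_add a_comm)

lemma G_trans:
 assumes "a \<ominus> b \<in> G c" "b \<ominus> d \<in> G c" "a \<in> carrier Q" "b \<in> carrier Q" "d \<in> carrier Q"
 shows "a \<ominus> d \<in> G c"
proof -
 have "a \<ominus> d = (a \<ominus> b) \<oplus> (b \<ominus> d)" using assms(3-) by (simp add: minus_eq a_assoc r_neg1)
 thus ?thesis using assms by (simp add: G_add)
qed

lemma G_sym: "a \<ominus> b \<in> G c ==> a \<in> carrier Q ==> b \<in> carrier Q ==> b \<ominus> a \<in> G c"
 using G_neg[of "a \<ominus> b" c] diff_swap by simp

lemma G_diff_cancel: "a \<ominus> b \<in> G c ==> b \<in> G c ==> a \<in> carrier Q ==> a \<in> G c"
 using G_trans[of a b c \<zero>] by (simp add: minus_eq)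

definition amap :: "('a \<Rightarrow> 'a) \<Rightarrow> bool" where
 "amap h \<longleftrightarrow> (\<forall>a\<in>carrier Q. h a \<in> carrier Q) \<and>
   (\<forall>a\<in>carrier Q. \<forall>b\<in>carrier Q. h (a \<oplus> b) = h a \<oplus> h b)"

lemma amap_closed: "amap h ==> a \<in> carrier Q ==> h a \<in> carrier Q"
 by (simp add: amap_def)

lemma amap_add: "amap h ==> a \<in> carrier Q ==> b \<in> carrier Q ==> h (a \<oplus> b) = h a \<oplus> h b"
 by (simp add: amap_def)

lemma amap_zero: assumes "amap h" shows "h \<zero> = \<zero>"
proof -
 have "h \<zero> \<oplus> h \<zero> = h \<zero> \<oplus> \<zero>" using assms amap_add[OF assms, of \<zero> \<zero>] amap_closed[OF assms] by simp
 thus ?thesis using amap_closed[OF assms] by (subst (asm) add.l_cancel) auto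
qed

lemma amap_neg: assumes "amap h" "a \<in> carrier Q" shows "h (\<ominus> a) = \<ominus> h a"
proof -
 have "h (\<ominus> a) \<oplus> h a = \<zero>"
  using assms amap_add[OF assms(1), of "\<ominus> a" a] by (simp add: l_neg amap_zero)
 thus ?thesis using assms amap_closed minus_equality by fastforce
qed

lemma amap_diff: "amap h ==> a \<in> carrier Q ==> b \<in> carrier Q ==> h (a \<ominus> b) = h a \<ominus> h b"
 by (simp add: minus_eq amap_add amap_neg amap_closed)

lemma amap_finsum: assumes "amap h" "\<And>i. i \<in> A ==> f i \<in> carrier Q"
 shows "h (\<Oplus>i\<in>A. f i) = (\<Oplus>i\<in>A. h (f i))"
 using assms(2)
proof (induction A rule: infinite_finite_induct)
 case (insert x F)
 then show ?case using assms(1)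
  by (subst (1 2) finsum_insert) (auto simp: amap_add amap_closed)
qed (auto simp: amap_zero assms(1))

lemma amap_comp: "amap g ==> amap h ==> amap (\<lambda>a. g (h a))"
 by (simp add: amap_def)

lemma amap_funpow: "amap h ==> amap (h ^^ n)"
 by (induction n) (auto simp: amap_def)

lemma amap_add_pow: assumes "amap h" "a \<in> carrier Q"
 shows "h (add_pow Q (n::nat) a) = add_pow Q n (h a)"
 using assms by (induction n) (auto simp: amap_zero amap_add amap_closed)

text \<open>Convergence as in \<open>filt_sums\<close>, with the terms required to lie in the ring,
  so that the partial sums can be manipulated.\<close>

definition hsum :: "(nat \<Rightarrow> 'a) \<Rightarrow> 'a \<Rightarrow> bool" where
 "hsum f l \<longleftrightarrow> (\<forall>n. f n \<in> carrier Q) \<and> l \<in> carrier Q \<and>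
   (\<forall>c. \<exists>N. \<forall>n\<ge>N. (\<Oplus>i\<in>{..<n}. f i) \<ominus> l \<in> G c)"

definition null :: "(nat \<Rightarrow> 'a) \<Rightarrow> bool" where
 "null f \<longleftrightarrow> (\<forall>n. f n \<in> carrier Q) \<and> (\<forall>c. \<exists>N. \<forall>n\<ge>N. f n \<in> G c)"

lemma filt_sums_iff: "(\<And>n. f n \<in> carrier Q) ==> filt_sums Q u f l \<longleftrightarrow> hsum f l"
 unfolding filt_sums_def hsum_def G_iff by auto

lemma sumsD: "hsum f l ==> f n \<in> carrier Q" "hsum f l ==> l \<in> carrier Q"
 by (auto simp: hsum_def)

lemma sums_unique: assumes "hsum f l" "hsum f m" shows "l = m"
proof (rule G_eq)
 show lm: "l \<in> carrier Q" "m \<in> carrier Q" using assms by (auto simp: hsum_def)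
 fix c
 obtain N N' where N: "\<And>n. n \<ge> N ==> (\<Oplus>i\<in>{..<n}. f i) \<ominus> l \<in> G c"
   "\<And>n. n \<ge> N' ==> (\<Oplus>i\<in>{..<n}. f i) \<ominus> m \<in> G c" using assms unfolding hsum_def by meson
 have f: "(\<Oplus>i\<in>{..<max N N'}. f i) \<in> carrier Q" using assms by (auto simp: hsum_def)
 show "l \<ominus> m \<in> G c"
  by (rule G_trans[OF G_sym[OF N(1)[of "max N N'"]] N(2)[of "max N N'"]]) (use f lm in auto)
qed

lemma filt_suminf_eq: assumes "hsum f l" shows "filt_suminf Q u f = l"
proof -
 have "\<And>n. f n \<in> carrier Q" using assms sumsD by auto
 hence "filt_sums Q u f = hsum f" using filt_sums_iff by blast
 thus ?thesis unfolding filt_suminf_def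
  using assms sums_unique by (auto intro!: the_equality)
qed

lemma finsum_split_diff:
 assumes "\<And>i. f i \<in> carrier Q" "n \<le> (m::nat)"
 shows "(\<Oplus>i\<in>{..<m}. f i) \<ominus> (\<Oplus>i\<in>{..<n}. f i) = (\<Oplus>i\<in>{n..<m}. f i)"
proof -
 have "{..<m} = {..<n} \<union> {n..<m}" using assms(2) by auto
 hence "(\<Oplus>i\<in>{..<m}. f i) = (\<Oplus>i\<in>{..<n}. f i) \<oplus> (\<Oplus>i\<in>{n..<m}. f i)"
  using assms(1) by (simp add: finsum_Un_disjoint ivl_disj_int)
 thus ?thesis using assms(1)
  by (simp add: minus_eq a_comm[of "finsum Q f {..<n}"] a_assoc r_neg)
qed

text \<open>The levels are additive subgroups, so a block of terms from \<open>G c\<close> has its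
  sum in \<open>G c\<close>. Terms tending to zero therefore already make the partial sums
  Cauchy.\<close>

lemma null_sums: assumes "null f" obtains l where "hsum f l"
proof -
 have f: "\<And>n. f n \<in> carrier Q" using assms by (simp add: null_def)
 have gen: "\<exists>N. \<forall>m\<ge>N. \<forall>n\<ge>N. (\<Oplus>i\<in>{..<m}. f i) \<ominus> (\<Oplus>i\<in>{..<n}. f i) \<in> G c" for c
 proof -
  obtain N where N: "\<And>n. n \<ge> N ==> f n \<in> G c" using assms unfolding null_def by meson
  have *: "(\<Oplus>i\<in>{..<m}. f i) \<ominus> (\<Oplus>i\<in>{..<n}. f i) \<in> G c" if "N \<le> n" "n \<le> m" for m n
   using finsum_split_diff[OF f that(2)] N that by (auto intro!: G_finsum)
  show ?thesis
  proof (rule exI[of _ N], intro allI impI)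
   fix m n assume "N \<le> m" "N \<le> n"
   show "(\<Oplus>i\<in>{..<m}. f i) \<ominus> (\<Oplus>i\<in>{..<n}. f i) \<in> G c"
    using *[of n m] G_sym[OF *[of m n]] \<open>N \<le> m\<close> \<open>N \<le> n\<close> f by (cases "n \<le> m") auto
  qed
 qed
 have "\<exists>l\<in>carrier Q. \<forall>c. \<exists>N. \<forall>n\<ge>N. Fin c \<le> u ((\<Oplus>i\<in>{..<n}. f i) \<ominus> l)"
  by (rule compl[unfolded filt_complete_def, rule_format])
    (use f gen in \<open>auto simp: G_iff\<close>)
 then obtain l where l: "l \<in> carrier Q" "\<forall>c. \<exists>N. \<forall>n\<ge>N. Fin c \<le> u ((\<Oplus>i\<in>{..<n}. f i) \<ominus> l)"
  by blast
 have "hsum f l" unfolding hsum_def G_iff using f l by auto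
 thus ?thesis using that by blast
qed

lemma sums_tail: assumes "hsum f l" "\<And>i. i \<ge> n ==> f i \<in> G c"
 shows "l \<ominus> (\<Oplus>i\<in>{..<n}. f i) \<in> G c"
proof -
 have f: "\<And>n. f n \<in> carrier Q" "l \<in> carrier Q" using assms sumsD by auto
 obtain N where N: "\<And>n. n \<ge> N ==> (\<Oplus>i\<in>{..<n}. f i) \<ominus> l \<in> G c"
  using assms(1) unfolding hsum_def by meson
 define m where "m = max N n"
 have 1: "(\<Oplus>i\<in>{..<m}. f i) \<ominus> (\<Oplus>i\<in>{..<n}. f i) \<in> G c"
  by (subst finsum_split_diff[OF f(1)]) (auto simp: m_def intro!: G_finsum assms(2))
 show ?thesis
  by (rule G_trans[OF G_sym[OF N[of m]] 1]) (use f in \<open>auto simp: m_def\<close>)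
qed

lemma sums_G: assumes "hsum f l" "\<And>i. f i \<in> G c" shows "l \<in> G c"
 using sums_tail[OF assms(1), of 0 c] assms sumsD(2)[OF assms(1)] by (simp add: minus_eq)

lemma sums_null: assumes "hsum f l" shows "null f"
 unfolding null_def
proof (intro conjI allI)
 show f: "f n \<in> carrier Q" for n using assms sumsD by auto
 have l: "l \<in> carrier Q" using assms sumsD by auto
 fix c
 obtain N where N: "\<And>n. n \<ge> N ==> (\<Oplus>i\<in>{..<n}. f i) \<ominus> l \<in> G c"
  using assms(1) unfolding hsum_def by meson
 have "f n \<in> G c" if "n \<ge> N" for n
 proof -
  have "(\<Oplus>i\<in>{..<Suc n}. f i) \<ominus> (\<Oplus>i\<in>{..<n}. f i) \<in> G c"
   by (rule G_trans[OF N G_sym[OF N]]) (use that f l in auto)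
  thus ?thesis using finsum_split_diff[of f n "Suc n"] f by simp
 qed
 thus "\<exists>N. \<forall>n\<ge>N. f n \<in> G c" by blast
qed

lemma sums_finite: assumes "\<And>i. f i \<in> carrier Q" "\<And>i. i \<ge> n ==> f i = \<zero>"
 shows "hsum f (\<Oplus>i\<in>{..<n}. f i)"
 unfolding hsum_def
proof (intro conjI allI exI[of _ n] impI)
 fix c m assume "n \<le> m"
 show "(\<Oplus>i\<in>{..<m}. f i) \<ominus> (\<Oplus>i\<in>{..<n}. f i) \<in> G c"
  by (subst finsum_split_diff[OF assms(1) \<open>n \<le> m\<close>]) (auto intro!: G_finsum simp: assms(2))
qed (use assms(1) in auto)

lemma sums_add: assumes "hsum f l" "hsum g m" shows "hsum (\<lambda>n. f n \<oplus> g n) (l \<oplus> m)"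
 unfolding hsum_def
proof (intro conjI allI)
 have f: "\<And>n. f n \<in> carrier Q" "\<And>n. g n \<in> carrier Q" "l \<in> carrier Q" "m \<in> carrier Q"
  using assms sumsD by auto
 show "f n \<oplus> g n \<in> carrier Q" for n using f by auto
 show "l \<oplus> m \<in> carrier Q" using f by auto
 fix c
 obtain N N' where N: "\<And>n. n \<ge> N ==> (\<Oplus>i\<in>{..<n}. f i) \<ominus> l \<in> G c"
   "\<And>n. n \<ge> N' ==> (\<Oplus>i\<in>{..<n}. g i) \<ominus> m \<in> G c" using assms unfolding hsum_def by meson
 have "(\<Oplus>i\<in>{..<n}. f i \<oplus> g i) \<ominus> (l \<oplus> m) \<in> G c" if "n \<ge> max N N'" for n
 proof -
  have "(\<Oplus>i\<in>{..<n}. f i \<oplus> g i) \<ominus> (l \<oplus> m) = ((\<Oplus>i\<in>{..<n}. f i) \<ominus> l) \<oplus> ((\<Oplus>i\<in>{..<n}. g i) \<ominus> m)"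
   using f by (simp add: finsum_addf minus_eq minus_add a_ac)
  thus ?thesis using N that by (auto intro!: G_add)
 qed
 thus "\<exists>N. \<forall>n\<ge>N. (\<Oplus>i\<in>{..<n}. f i \<oplus> g i) \<ominus> (l \<oplus> m) \<in> G c" by blast
qed

text \<open>The constant \<open>d\<close> bounds the loss of filtration under \<open>h\<close>; this
  is the continuity needed to exchange \<open>h\<close> with the limit.\<close>

lemma sums_amap: assumes "hsum f l" "amap h" "\<And>c a. a \<in> G c ==> h a \<in> G (c + d)"
 shows "hsum (\<lambda>n. h (f n)) (h l)"
 unfolding hsum_def
proof (intro conjI allI)
 have f: "\<And>n. f n \<in> carrier Q" "l \<in> carrier Q" using assms sumsD by auto
 show "h (f n) \<in> carrier Q" for n using f assms amap_closed by auto
 show "h l \<in> carrier Q" using f assms amap_closed by auto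
 fix c
 obtain N where N: "\<And>n. n \<ge> N ==> (\<Oplus>i\<in>{..<n}. f i) \<ominus> l \<in> G (c - d)"
  using assms(1) unfolding hsum_def by meson
 have "(\<Oplus>i\<in>{..<n}. h (f i)) \<ominus> h l \<in> G c" if "n \<ge> N" for n
 proof -
  have "(\<Oplus>i\<in>{..<n}. h (f i)) \<ominus> h l = h ((\<Oplus>i\<in>{..<n}. f i) \<ominus> l)"
   using f assms(2) by (simp add: amap_diff amap_finsum)
  thus ?thesis using assms(3)[OF N[OF that]] by simp
 qed
 thus "\<exists>N. \<forall>n\<ge>N. (\<Oplus>i\<in>{..<n}. h (f i)) \<ominus> h l \<in> G c" by blast
qed

lemma amap_lmult: "a \<in> carrier Q ==> amap (\<lambda>b. a \<otimes> b)"
 and amap_rmult: "a \<in> carrier Q ==> amap (\<lambda>b. b \<otimes> a)"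
 by (auto simp: amap_def r_distr l_distr)

lemma sums_lmult: assumes "hsum f l" "a \<in> carrier Q" shows "hsum (\<lambda>n. a \<otimes> f n) (a \<otimes> l)"
proof -
 obtain d where "a \<in> G d" using G_exhaust assms by blast
 thus ?thesis by (intro sums_amap[OF assms(1) amap_lmult, where d = d]) (auto intro: G_mult' assms)
qed

lemma sums_rmult: assumes "hsum f l" "a \<in> carrier Q" shows "hsum (\<lambda>n. f n \<otimes> a) (l \<otimes> a)"
proof -
 obtain d where "a \<in> G d" using G_exhaust assms by blast
 thus ?thesis by (intro sums_amap[OF assms(1) amap_rmult, where d = d]) (auto intro: G_mult' assms)
qed

lemma sums_neg: "hsum f l ==> hsum (\<lambda>n. \<ominus> f n) (\<ominus> l)"
 by (rule sums_amap[where d = 0]) (auto simp: amap_def minus_add a_ac intro: G_neg)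

text \<open>Prepending a term lets a series be compared with one whose index is larger by one, as
  happens when a variable is moved past coefficients.\<close>

lemma sums_shift: assumes "hsum f l" "z \<in> carrier Q"
 shows "hsum (\<lambda>n. case n of 0 \<Rightarrow> z | Suc k \<Rightarrow> f k) (z \<oplus> l)"
proof -
 let ?g = "\<lambda>n. case n of 0 \<Rightarrow> z | Suc k \<Rightarrow> f k"
 have f: "\<And>n. f n \<in> carrier Q" "l \<in> carrier Q" using assms sumsD by auto
 have g: "\<And>n. ?g n \<in> carrier Q" using f assms(2) by (auto split: nat.splits)
 have eq: "(\<Oplus>i\<in>{..<Suc n}. ?g i) = z \<oplus> (\<Oplus>i\<in>{..<n}. f i)" for n
 proof (induction n)
  case 0 show ?case using g[of 0] assms(2) by (simp add: finsum_lessThan_Suc[of ?g 0, OF g])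
 next
  case (Suc n)
  show ?case using f assms(2)
   by (simp add: finsum_lessThan_Suc[of ?g "Suc n", OF g] Suc finsum_lessThan_Suc a_assoc)
 qed
 show ?thesis unfolding hsum_def
 proof (intro conjI allI)
  show "z \<oplus> l \<in> carrier Q" using f assms by auto
  fix c
  obtain N where N: "\<And>n. n \<ge> N ==> (\<Oplus>i\<in>{..<n}. f i) \<ominus> l \<in> G c"
   using assms(1) unfolding hsum_def by meson
  have "(\<Oplus>i\<in>{..<n}. ?g i) \<ominus> (z \<oplus> l) \<in> G c" if n: "n \<ge> Suc N" for n
  proof -
   obtain k where k: "n = Suc k" "k \<ge> N" using n Suc_le_D by auto
   have "(\<Oplus>i\<in>{..<n}. ?g i) \<ominus> (z \<oplus> l) = (\<Oplus>i\<in>{..<k}. f i) \<ominus> l"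
    unfolding k eq using f assms(2) by (simp add: minus_eq minus_add a_ac r_neg r_neg1 r_neg2)
   thus ?thesis using N[OF k(2)] by simp
  qed
  thus "\<exists>N. \<forall>n\<ge>N. (\<Oplus>i\<in>{..<n}. ?g i) \<ominus> (z \<oplus> l) \<in> G c" by blast
 qed (rule g)
qed

lemma sums_zero: "hsum (\<lambda>_. \<zero>) \<zero>"
 using sums_finite[of "\<lambda>_. \<zero>" 0] by simp

lemma sums_single: assumes "z \<in> carrier Q" shows "hsum (\<lambda>n. if n = k then z else \<zero>) z"
proof -
 let ?f = "\<lambda>n. if n = k then z else \<zero>"
 have "(\<Oplus>i\<in>{..<Suc k}. ?f i) = (\<Oplus>i\<in>{..<k}. ?f i) \<oplus> z"
  using assms by (subst finsum_lessThan_Suc) auto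
 also have "(\<Oplus>i\<in>{..<k}. ?f i) = (\<Oplus>i\<in>{..<k}. \<zero>)"
  by (rule finsum_cong') auto
 finally show ?thesis using sums_finite[of ?f "Suc k"] assms by simp
qed

lemma sums_finsum: assumes "finite A" "\<And>a. a \<in> A ==> hsum (f a) (l a)"
 shows "hsum (\<lambda>i. \<Oplus>a\<in>A. f a i) (\<Oplus>a\<in>A. l a)"
 using assms
proof (induction A)
 case (insert x F)
 have "\<And>i. (\<Oplus>a\<in>insert x F. f a i) = f x i \<oplus> (\<Oplus>a\<in>F. f a i)"
   "(\<Oplus>a\<in>insert x F. l a) = l x \<oplus> (\<Oplus>a\<in>F. l a)"
  using insert sumsD(1)[OF insert.prems] sumsD(2)[OF insert.prems]
  by (auto intro!: finsum_insert)
 thus ?case using insert by (auto intro!: sums_add)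
qed (simp add: sums_zero)

text \<open>Outside the square i, j < n all terms lie in \<open>G c\<close>. Hence both iterated
  sums agree modulo \<open>G c\<close> with the finite double sum over the square, where the order
  does not matter; as c is arbitrary they are equal.\<close>

lemma fubini:
 assumes f: "\<And>i j. f i j \<in> carrier Q"
  and small: "\<And>c. \<exists>n. \<forall>i j. n \<le> i \<or> n \<le> j \<longrightarrow> f i j \<in> G c"
  and r: "\<And>i. hsum (f i) (r i)" and s: "\<And>j. hsum (\<lambda>i. f i j) (s j)"
 obtains a where "hsum r a" "hsum s a"
proof -
 have rc: "\<And>i. r i \<in> carrier Q" and sc: "\<And>i. s i \<in> carrier Q"
  using sumsD(2)[OF r] sumsD(2)[OF s] by auto
 have "null r" "null s" unfolding null_def using rc sc small sums_G[OF r] sums_G[OF s] by meson+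
 then obtain a b where a: "hsum r a" and b: "hsum s b" using null_sums by metis
 have "a = b"
 proof (rule G_eq)
  show ab: "a \<in> carrier Q" "b \<in> carrier Q" using a b sumsD by auto
  fix c
  obtain n where n: "\<And>i j. n \<le> i \<or> n \<le> j ==> f i j \<in> G c" using small by meson
  \<comment> \<open>Stated for arbitrary \<open>f\<close> and \<open>r\<close>, so that it serves
    the rows and, transposed, the columns.\<close>
  have fin: "(\<Oplus>i\<in>{..<n}. r i) \<ominus> (\<Oplus>i\<in>{..<n}. \<Oplus>j\<in>{..<n}. f i j) \<in> G c"
   if "\<And>i. hsum (f i) (r i)" "\<And>i j. n \<le> i \<or> n \<le> j ==> f i j \<in> G c" "\<And>i j. f i j \<in> carrier Q"
    "\<And>i. r i \<in> carrier Q" for f r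
  proof -
   have m: "(\<Oplus>i\<in>{..<n}. \<ominus> (\<Oplus>j\<in>{..<n}. f i j)) = \<ominus> (\<Oplus>i\<in>{..<n}. \<Oplus>j\<in>{..<n}. f i j)"
    by (rule amap_finsum[symmetric, where h = "\<lambda>a. \<ominus> a"])
      (auto simp: amap_def minus_add a_ac that)
   have "(\<Oplus>i\<in>{..<n}. r i \<ominus> (\<Oplus>j\<in>{..<n}. f i j)) \<in> G c"
    by (intro G_finsum sums_tail that)  auto
   thus ?thesis using that(3,4) by (simp add: minus_eq finsum_addf m)
  qed
  have swap: "(\<Oplus>i\<in>{..<n}. \<Oplus>j\<in>{..<n}. f i j) = (\<Oplus>j\<in>{..<n}. \<Oplus>i\<in>{..<n}. f i j)"
  proof -
   have "(\<Oplus>i\<in>{..<m}. \<Oplus>j\<in>{..<n}. f i j) = (\<Oplus>j\<in>{..<n}. \<Oplus>i\<in>{..<m}. f i j)" for m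
    by (induction m) (auto simp: finsum_lessThan_Suc f finsum_addf)
   thus ?thesis by simp
  qed
  have 1: "(\<Oplus>i\<in>{..<n}. r i) \<ominus> (\<Oplus>i\<in>{..<n}. s i) \<in> G c"
   (is "?r \<ominus> ?s \<in> _")
  proof -
   have x: "?r \<ominus> (\<Oplus>i\<in>{..<n}. \<Oplus>j\<in>{..<n}. f i j) \<in> G c"
    by (rule fin) (use r n f rc in auto)
   have y: "?s \<ominus> (\<Oplus>j\<in>{..<n}. \<Oplus>i\<in>{..<n}. f i j) \<in> G c"
    by (rule fin) (use s n f sc in auto)
   show ?thesis
    by (rule G_trans[OF x[unfolded swap] G_sym[OF y]]) (use f rc sc in auto)
  qed
  have 2: "a \<ominus> (\<Oplus>i\<in>{..<n}. r i) \<in> G c" by (rule sums_tail[OF a]) (metis n r sums_G)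
  have 3: "b \<ominus> (\<Oplus>i\<in>{..<n}. s i) \<in> G c" by (rule sums_tail[OF b]) (metis n s sums_G)
  show "a \<ominus> b \<in> G c"
   by (rule G_trans[OF 2 G_trans[OF 1 G_sym[OF 3]]]) (use rc sc ab in auto)
 qed
 thus ?thesis using a b that by blast
qed

end

text \<open>Serves the change of index i = e + j in the definition of the product, where the terms
  with i < e vanish.\<close>

lemma (in filtered_ring) sums_drop:
 assumes "hsum g l" "\<And>i. i < e ==> g i = \<zero>"
 shows "hsum (\<lambda>j. g (e + j)) l"
proof -
 have g: "\<And>n. g n \<in> carrier Q" "l \<in> carrier Q" using assms sumsD by auto
 have eq: "(\<Oplus>i\<in>{..<e + n}. g i) = (\<Oplus>j\<in>{..<n}. g (e + j))" for n
 proof (induction n)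
  case 0
  have "(\<Oplus>i\<in>{..<e}. g i) = (\<Oplus>i\<in>{..<e}. \<zero>)" by (rule finsum_cong') (auto simp: assms)
  thus ?case by simp
 qed (simp add: finsum_lessThan_Suc g)
 show ?thesis unfolding hsum_def
 proof (intro conjI allI)
  fix c
  obtain N where N: "\<And>n. n \<ge> N ==> (\<Oplus>i\<in>{..<n}. g i) \<ominus> l \<in> G c"
   using assms(1) unfolding hsum_def by meson
  have "(\<Oplus>j\<in>{..<n}. g (e + j)) \<ominus> l \<in> G c" if "n \<ge> N" for n
   using N[of "e + n"] that by (simp add: eq)
  thus "\<exists>N. \<forall>n\<ge>N. (\<Oplus>j\<in>{..<n}. g (e + j)) \<ominus> l \<in> G c" by blast
 qed (use g in auto)
qed

section \<open>Bounded skew power series rings\<close>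

text \<open>Quasi-compatibility in numbers: all \<sigma>^i \<delta>^j with i \<ge> 0 have degree at
  least -C, and \<delta>^N0 has positive degree, so \<delta>^j gains \<open>j div N0\<close> at the
  cost of a single constant.\<close>

locale skew = filtered_ring Q u for Q :: "('a, 'm) ring_scheme" (structure) and u +
 fixes \<sigma> \<delta> :: "'a \<Rightarrow> 'a" and C :: int and N0 :: nat
 assumes \<sigma>_amap: "amap \<sigma>" and \<delta>_amap: "amap \<delta>"
  and \<sigma>_mult: "[| r \<in> carrier Q; s \<in> carrier Q |] ==> \<sigma> (r \<otimes> s) = \<sigma> r \<otimes> \<sigma> s"
  and \<sigma>_one [simp]: "\<sigma> \<one> = \<one>"
  and \<sigma>_bij: "bij_betw \<sigma> (carrier Q) (carrier Q)"
  and leib: "[| r \<in> carrier Q; s \<in> carrier Q |] ==> \<delta> (r \<otimes> s) = \<delta> r \<otimes> s \<oplus> \<sigma> r \<otimes> \<delta> s"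
  and comm: "r \<in> carrier Q ==> \<sigma> (\<delta> r) = \<delta> (\<sigma> r)"
  and C_nonneg: "0 \<le> C" and N0_pos: "0 < N0"
  and adm: "q \<in> G n ==> (\<sigma> ^^ i) ((\<delta> ^^ j) q) \<in> G (n + int (j div N0) - C)"
begin

lemma \<sigma>_closed [simp, intro]: "r \<in> carrier Q ==> \<sigma> r \<in> carrier Q"
 and \<delta>_closed [simp, intro]: "r \<in> carrier Q ==> \<delta> r \<in> carrier Q"
 using amap_closed[OF \<sigma>_amap] amap_closed[OF \<delta>_amap] by auto

lemma \<sigma>_pow_closed [simp, intro]: "r \<in> carrier Q ==> (\<sigma> ^^ i) r \<in> carrier Q"
 and \<delta>_pow_closed [simp, intro]: "r \<in> carrier Q ==> (\<delta> ^^ i) r \<in> carrier Q"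
 by (rule amap_closed[OF amap_funpow[OF \<sigma>_amap]], assumption)
  (rule amap_closed[OF amap_funpow[OF \<delta>_amap]])

lemmas \<sigma>_simps = amap_add[OF \<sigma>_amap] amap_neg[OF \<sigma>_amap] amap_diff[OF \<sigma>_amap]
 amap_finsum[OF \<sigma>_amap] amap_add_pow[OF \<sigma>_amap]
lemmas \<delta>_simps = amap_add[OF \<delta>_amap] amap_neg[OF \<delta>_amap] amap_diff[OF \<delta>_amap]
 amap_finsum[OF \<delta>_amap] amap_add_pow[OF \<delta>_amap]

lemma \<sigma>_zero [simp]: "\<sigma> \<zero> = \<zero>" and \<delta>_zero [simp]: "\<delta> \<zero> = \<zero>"
 by (rule amap_zero[OF \<sigma>_amap], rule amap_zero[OF \<delta>_amap])

lemma \<delta>_one [simp]: "\<delta> \<one> = \<zero>"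
proof -
 have "\<delta> \<one> \<oplus> \<zero> = \<delta> \<one> \<oplus> \<delta> \<one>" using leib[of \<one> \<one>] by simp
 thus ?thesis by (subst (asm) add.l_cancel) auto
qed

lemma \<sigma>_pow_\<delta>: "r \<in> carrier Q ==> (\<sigma> ^^ i) (\<delta> r) = \<delta> ((\<sigma> ^^ i) r)"
 by (induction i) (auto simp: comm)

lemma adm0: "q \<in> G n ==> (\<sigma> ^^ i) ((\<delta> ^^ j) q) \<in> G (n - C)"
 using adm[of q n i j] by (rule G_mono) auto

lemma \<sigma>_G: "q \<in> G n ==> \<sigma> q \<in> G (n - C)" using adm0[of q n 1 0] by simp
lemma \<delta>_G: "q \<in> G n ==> \<delta> q \<in> G (n - C)" using adm0[of q n 0 1] by simp

definition S :: "(nat \<Rightarrow> 'a) ring" where "S = skew_series_ring Q u \<sigma> \<delta>"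

definition bnd :: "int \<Rightarrow> (nat \<Rightarrow> 'a) set" where "bnd c = {a. \<forall>n. a n \<in> G c}"

lemma S_carrier: "a \<in> carrier S \<longleftrightarrow> (\<exists>c. a \<in> bnd c)"
 by (auto simp: S_def skew_series_ring_def bnd_def G_iff)

lemma bnd_S [intro]: "a \<in> bnd c ==> a \<in> carrier S"
 using S_carrier by blast

lemma S_coeff: "a \<in> carrier S ==> a n \<in> carrier Q"
 by (auto simp: S_carrier bnd_def)

lemma S_coeffs: "a \<in> carrier S ==> \<forall>n. a n \<in> carrier Q"
 using S_coeff by blast

lemma S_add: "a \<oplus>\<^bsub>S\<^esub> b = (\<lambda>n. a n \<oplus> b n)" and S_zero: "\<zero>\<^bsub>S\<^esub> = (\<lambda>n. \<zero>)"
 and S_one: "\<one>\<^bsub>S\<^esub> = (\<lambda>n. if n = 0 then \<one> else \<zero>)"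
 by (auto simp: S_def skew_series_ring_def)

lemma bnd_mono: "a \<in> bnd c ==> d \<le> c ==> a \<in> bnd d"
 by (auto simp: bnd_def intro: G_mono)

lemma bnd_add: "a \<in> bnd c ==> b \<in> bnd c ==> (\<lambda>n. a n \<oplus> b n) \<in> bnd c"
 by (auto simp: bnd_def intro: G_add)

lemma S_add_closed: "a \<in> carrier S ==> b \<in> carrier S ==> (\<lambda>n. a n \<oplus> b n) \<in> carrier S"
 unfolding S_carrier
proof safe
 fix c d assume "a \<in> bnd c" "b \<in> bnd d"
 hence "a \<in> bnd (min c d)" "b \<in> bnd (min c d)" using bnd_mono by auto
 thus "\<exists>c. (\<lambda>n. a n \<oplus> b n) \<in> bnd c" using bnd_add by blast
qed

text \<open>Left multiplication by x: from x q = \<sigma>(q) x + \<delta>(q), coefficient k of x b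
  collects \<sigma>(b (k - 1)) and \<delta>(b k).\<close>

definition xi :: "(nat \<Rightarrow> 'a) \<Rightarrow> nat \<Rightarrow> 'a" where
 "xi b = (\<lambda>k. case k of 0 \<Rightarrow> \<delta> (b 0) | Suc j \<Rightarrow> \<sigma> (b j) \<oplus> \<delta> (b (Suc j)))"

lemma xi_0: "xi b 0 = \<delta> (b 0)" and xi_Suc: "xi b (Suc j) = \<sigma> (b j) \<oplus> \<delta> (b (Suc j))"
 by (auto simp: xi_def)

lemma xi_closed: "(\<And>n. b n \<in> carrier Q) ==> xi b k \<in> carrier Q"
 by (cases k) (auto simp: xi_0 xi_Suc)

lemma xi_pow_closed: "(\<And>n. b n \<in> carrier Q) ==> (xi ^^ i) b k \<in> carrier Q"
 by (induction i arbitrary: k) (auto intro: xi_closed)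

text \<open>Since \<sigma> and \<delta> commute, x^i b expands binomially; the induction step is
  Pascal's rule.\<close>

lemma xi_pow_eq:
 assumes b: "\<And>n. b n \<in> carrier Q"
 shows "(xi ^^ i) b k =
   (\<Oplus>e\<in>{..k}. add_pow Q (i choose e) ((\<sigma> ^^ e) ((\<delta> ^^ (i - e)) (b (k - e)))))"
proof (induction i arbitrary: k)
 case 0
 have "(\<Oplus>e\<in>{..k}. add_pow Q (0 choose e) ((\<sigma> ^^ e) ((\<delta> ^^ (0 - e)) (b (k - e)))))
   = (\<Oplus>e\<in>{..k}. if e = 0 then b k else \<zero>)"
  by (rule finsum_cong') (auto simp: b gr0_conv_Suc)
 also have "\<dots> = b k" using add.finprod_singleton[of 0 "{..k}" "\<lambda>_. b k"]
  by (simp add: b finsum_def eq_commute[of 0])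
 finally show ?case by simp
next
 case (Suc i)
 let ?t = "\<lambda>i k e. add_pow Q (i choose e) ((\<sigma> ^^ e) ((\<delta> ^^ (i - e)) (b (k - e))))"
 have t: "?t i k e \<in> carrier Q" for i k e by (simp add: b)
 have dt: "\<delta> (?t i k e) = add_pow Q (i choose e) ((\<sigma> ^^ e) ((\<delta> ^^ (Suc i - e)) (b (k - e))))" for k e
 proof (cases "e \<le> i")
  case True
  have "\<delta> (?t i k e) = add_pow Q (i choose e) (\<delta> ((\<sigma> ^^ e) ((\<delta> ^^ (i - e)) (b (k - e)))))"
   by (rule amap_add_pow[OF \<delta>_amap]) (simp add: b)
  also have "\<delta> ((\<sigma> ^^ e) ((\<delta> ^^ (i - e)) (b (k - e)))) = (\<sigma> ^^ e) ((\<delta> ^^ Suc (i - e)) (b (k - e)))"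
   by (subst \<sigma>_pow_\<delta>[symmetric]) (simp_all add: b)
  finally show ?thesis using True by (simp only: Suc_diff_le)
 qed (simp add: binomial_eq_0)
 have D: "\<delta> ((xi ^^ i) b k) =
   (\<Oplus>e\<in>{..k}. add_pow Q (i choose e) ((\<sigma> ^^ e) ((\<delta> ^^ (Suc i - e)) (b (k - e)))))" for k
  unfolding Suc.IH by (subst amap_finsum[OF \<delta>_amap t]) (simp only: dt)
 show ?case
 proof (cases k)
  case 0
  thus ?thesis using D[of 0] by (simp add: xi_0 b)
 next
  case (Suc k')
  have "\<sigma> ((xi ^^ i) b k') = (\<Oplus>e\<in>{..k'}. add_pow Q (i choose e) ((\<sigma> ^^ Suc e) ((\<delta> ^^ (i - e)) (b (k' - e)))))"
   unfolding Suc.IH by (subst amap_finsum[OF \<sigma>_amap t]) (simp add: amap_add_pow[OF \<sigma>_amap] b)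
  moreover have "(\<Oplus>e\<in>{..Suc k'}. ?t (Suc i) (Suc k') e)
    = (\<Oplus>e\<in>{..k'}. ?t (Suc i) (Suc k') (Suc e)) \<oplus> ?t (Suc i) (Suc k') 0"
   by (subst finsum_Suc2) (auto simp: b)
  moreover have "(\<Oplus>e\<in>{..k'}. ?t (Suc i) (Suc k') (Suc e)) =
    (\<Oplus>e\<in>{..k'}. add_pow Q (i choose e) ((\<sigma> ^^ Suc e) ((\<delta> ^^ (i - e)) (b (k' - e)))) \<oplus>
      add_pow Q (i choose Suc e) ((\<sigma> ^^ Suc e) ((\<delta> ^^ (i - e)) (b (k' - e)))))"
   by (rule finsum_cong') (auto simp only: binomial_Suc_Suc diff_Suc_Suc b add.nat_pow_mult \<sigma>_pow_closed \<delta>_pow_closed add.nat_pow_closed a_closed)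
  moreover have "\<delta> ((xi ^^ i) b (Suc k')) = (\<Oplus>e\<in>{..k'}. add_pow Q (i choose Suc e) ((\<sigma> ^^ Suc e) ((\<delta> ^^ (i - e)) (b (k' - e)))))
    \<oplus> (\<delta> ^^ Suc i) (b (Suc k'))"
   unfolding D by (subst finsum_Suc2) (auto simp: b simp del: funpow.simps)
  moreover have "(\<Oplus>e\<in>{..k'}. f e \<oplus> g e) \<oplus> z = (\<Oplus>e\<in>{..k'}. f e) \<oplus> ((\<Oplus>e\<in>{..k'}. g e) \<oplus> z)"
   if "\<And>e. f e \<in> carrier Q" "\<And>e. g e \<in> carrier Q" "z \<in> carrier Q" for f g z
   using that by (simp add: finsum_addf a_assoc)
  moreover have "(xi ^^ Suc i) b (Suc k') = \<sigma> ((xi ^^ i) b k') \<oplus> \<delta> ((xi ^^ i) b (Suc k'))"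
   by (simp add: xi_Suc)
  ultimately show ?thesis unfolding Suc
   by (simp add: b del: funpow.simps)
 qed
qed

text \<open>Coefficient k of x^i b involves at most k factors \<sigma>, hence at least i - k factors
  \<delta>, and these raise the filtration.\<close>

lemma xi_pow_G: assumes "b \<in> bnd \<beta>"
 shows "(xi ^^ i) b k \<in> G (\<beta> + int ((i - k) div N0) - C)"
proof -
 have b: "\<And>n. b n \<in> carrier Q" using assms by (auto simp: bnd_def)
 show ?thesis unfolding xi_pow_eq[OF b]
 proof (intro G_finsum G_nat)
  fix e assume e: "e \<in> {..k}"
  have "b (k - e) \<in> G \<beta>" using assms by (auto simp: bnd_def)
  from adm[OF this, of e "i - e"]
  show "(\<sigma> ^^ e) ((\<delta> ^^ (i - e)) (b (k - e))) \<in> G (\<beta> + int ((i - k) div N0) - C)"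
   by (rule G_mono) (use e in \<open>auto intro!: div_le_mono\<close>)
 qed
qed

lemma xi_pow_bnd: "b \<in> bnd \<beta> ==> (xi ^^ i) b \<in> bnd (\<beta> - C)"
 using xi_pow_G[of b \<beta> i] unfolding bnd_def[of "\<beta> - C"]
 by (auto intro!: G_mono[OF xi_pow_G])

lemma xi_pow_S: "b \<in> carrier S ==> (xi ^^ i) b \<in> carrier S"
 unfolding S_carrier using xi_pow_bnd by blast

lemma xi_S: "b \<in> carrier S ==> xi b \<in> carrier S"
 using xi_pow_S[of b 1] by simp

definition tail_index :: "int \<Rightarrow> nat" where "tail_index c = N0 * nat c"

text \<open>The terms of the series defining coefficient \<open>k\<close> of a product of \<open>a \<in> bnd \<alpha>\<close> and
 \<open>b \<in> bnd \<beta>\<close> lie in \<open>G c\<close> beyond an index depending on \<open>\<alpha>, \<beta>, c, k\<close> only.\<close>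

lemma xi_pow_small: assumes "b \<in> bnd \<beta>" "k + tail_index (c + C - \<beta>) \<le> i"
 shows "(xi ^^ i) b k \<in> G c"
proof (rule G_mono[OF xi_pow_G[OF assms(1), of i k]])
 have "N0 * nat (c + C - \<beta>) \<le> i - k" using assms(2) by (simp add: tail_index_def)
 hence "nat (c + C - \<beta>) \<le> (i - k) div N0" using N0_pos
  by (simp add: less_eq_div_iff_mult_less_eq mult.commute)
 thus "c \<le> \<beta> + int ((i - k) div N0) - C" by linarith
qed

lemma xi_pow_null: assumes "b \<in> carrier S" shows "null (\<lambda>i. (xi ^^ i) b k)"
proof -
 obtain \<beta> where b: "b \<in> bnd \<beta>" using assms S_carrier by auto
 show ?thesis unfolding null_def
 proof (intro conjI allI)
  fix c show "\<exists>N. \<forall>i\<ge>N. (xi ^^ i) b k \<in> G c" using xi_pow_small[OF b, of k] by blast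
 qed (rule S_coeff[OF xi_pow_S[OF assms]])
qed

lemma null_mult: assumes "a \<in> carrier S" "null f" shows "null (\<lambda>i. a i \<otimes> f i)"
 unfolding null_def
proof (intro conjI allI)
 show "a n \<otimes> f n \<in> carrier Q" for n using assms(2) S_coeff[OF assms(1)] by (auto simp: null_def)
 fix c
 obtain \<alpha> where a: "a \<in> bnd \<alpha>" using assms S_carrier by auto
 obtain N where "\<forall>n\<ge>N. f n \<in> G (c - \<alpha>)" using assms(2) unfolding null_def by meson
 moreover have "a n \<in> G \<alpha>" for n using a by (simp add: bnd_def)
 ultimately show "\<exists>N. \<forall>n\<ge>N. a n \<otimes> f n \<in> G c" by (auto intro!: exI[of _ N] G_mult'[of _ \<alpha>])
qed

text \<open>The product in the form \<Sum> a_i (x^i b), with one infinite sum per coefficient. The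
  ring axioms are proved for this form.\<close>

definition pr :: "(nat \<Rightarrow> 'a) \<Rightarrow> (nat \<Rightarrow> 'a) \<Rightarrow> nat \<Rightarrow> 'a" where
 "pr a b = (\<lambda>k. filt_suminf Q u (\<lambda>i. a i \<otimes> (xi ^^ i) b k))"

lemma pr_hsum: assumes "a \<in> carrier S" "b \<in> carrier S"
 shows "hsum (\<lambda>i. a i \<otimes> (xi ^^ i) b k) (pr a b k)"
proof -
 obtain l where l: "hsum (\<lambda>i. a i \<otimes> (xi ^^ i) b k) l"
  using null_sums[OF null_mult[OF assms(1) xi_pow_null[OF assms(2)]]] .
 thus ?thesis using filt_suminf_eq[OF l] by (simp add: pr_def)
qed

lemma pr_bnd: assumes "a \<in> bnd \<alpha>" "b \<in> bnd \<beta>" shows "pr a b \<in> bnd (\<alpha> + \<beta> - C)"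
 unfolding bnd_def mem_Collect_eq
proof
 fix k
 have "a i \<otimes> (xi ^^ i) b k \<in> G (\<alpha> + \<beta> - C)" for i
  by (rule G_mult'[of _ \<alpha> _ "\<beta> - C"])
    (use assms xi_pow_bnd[OF assms(2)] in \<open>auto simp: bnd_def\<close>)
 thus "pr a b k \<in> G (\<alpha> + \<beta> - C)" using sums_G[OF pr_hsum] assms by blast
qed

lemma pr_closed: "a \<in> carrier S ==> b \<in> carrier S ==> pr a b \<in> carrier S"
 unfolding S_carrier using pr_bnd by blast

text \<open>The finite sum over e is exchanged with the infinite sum over i. For i < e the binomial
  coefficient is 0, which permits the index j = i - e of the definition.\<close>

lemma S_mult: assumes "a \<in> carrier S" "b \<in> carrier S" shows "a \<otimes>\<^bsub>S\<^esub> b = pr a b"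
proof
 fix k
 define g where "g e i = a i \<otimes> add_pow Q (i choose e) ((\<sigma> ^^ e) ((\<delta> ^^ (i - e)) (b (k - e))))" for e i
 obtain \<beta> where b: "b \<in> bnd \<beta>" using assms S_carrier by auto
 have n: "null (\<lambda>i. add_pow Q (i choose e) ((\<sigma> ^^ e) ((\<delta> ^^ (i - e)) (b (k - e)))))" for e
  unfolding null_def
 proof (intro conjI allI)
  fix c
  have "add_pow Q (i choose e) ((\<sigma> ^^ e) ((\<delta> ^^ (i - e)) (b (k - e)))) \<in> G c"
   if "i \<ge> e + tail_index (c + C - \<beta>)" for i
  proof (rule G_nat, rule G_mono[OF adm[of _ \<beta>]])
   have "N0 * nat (c + C - \<beta>) \<le> i - e" using that by (simp add: tail_index_def)
   hence "nat (c + C - \<beta>) \<le> (i - e) div N0" using N0_pos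
    by (simp add: less_eq_div_iff_mult_less_eq mult.commute)
   thus "c \<le> \<beta> + int ((i - e) div N0) - C" by linarith
  qed (use b in \<open>auto simp: bnd_def\<close>)
  thus "\<exists>N. \<forall>i\<ge>N. add_pow Q (i choose e) ((\<sigma> ^^ e) ((\<delta> ^^ (i - e)) (b (k - e)))) \<in> G c" by blast
 qed (use S_coeff[OF assms(2)] in auto)
 have "\<exists>l. hsum (g e) l" for e
 proof -
  have "null (g e)" unfolding g_def by (rule null_mult[OF assms(1) n])
  thus ?thesis by (meson null_sums)
 qed
 hence "\<exists>l. \<forall>e. hsum (g e) (l e)" by (intro choice allI)
 then obtain l where l: "\<And>e. hsum (g e) (l e)" by blast
 have "hsum (\<lambda>i. \<Oplus>e\<in>{..k}. g e i) (\<Oplus>e\<in>{..k}. l e)" by (rule sums_finsum) (use l in auto)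
 moreover have "(\<Oplus>e\<in>{..k}. g e i) = a i \<otimes> (xi ^^ i) b k" for i
  unfolding g_def xi_pow_eq[OF S_coeff[OF assms(2)]] using S_coeff[OF assms(1)] S_coeff[OF assms(2)]
  by (subst finsum_rdistr) auto
 ultimately have "hsum (\<lambda>i. a i \<otimes> (xi ^^ i) b k) (\<Oplus>e\<in>{..k}. l e)" by simp
 hence 1: "(\<Oplus>e\<in>{..k}. l e) = pr a b k" by (rule sums_unique[OF _ pr_hsum[OF assms]])
 have "filt_suminf Q u (\<lambda>j. add_pow Q ((e + j) choose e) (a (e + j) \<otimes> (\<sigma> ^^ e) ((\<delta> ^^ j) (b (k - e))))) = l e" for e
 proof (rule filt_suminf_eq)
  have "hsum (\<lambda>j. g e (e + j)) (l e)"
   by (rule sums_drop[OF l]) (use S_coeff[OF assms(1)] in \<open>auto simp: g_def binomial_eq_0\<close>)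
  thus "hsum (\<lambda>j. add_pow Q ((e + j) choose e) (a (e + j) \<otimes> (\<sigma> ^^ e) ((\<delta> ^^ j) (b (k - e))))) (l e)"
   unfolding g_def using S_coeff[OF assms(1)] S_coeff[OF assms(2)] by (simp add: add_pow_rdistr)
 qed
 thus "(a \<otimes>\<^bsub>S\<^esub> b) k = pr a b k" using 1 by (simp add: S_def skew_series_ring_def)
qed

end

context skew begin

text \<open>Convergence in each coefficient together with a common lower bound on the filtration.
  The bound keeps the limit in \<open>S\<close> and makes multiplication continuous; coefficientwise
  convergence does not imply it.\<close>

definition csum :: "(nat \<Rightarrow> nat \<Rightarrow> 'a) \<Rightarrow> (nat \<Rightarrow> 'a) \<Rightarrow> bool" where
 "csum F l \<longleftrightarrow> (\<exists>\<gamma>. \<forall>j. F j \<in> bnd \<gamma>) \<and> (\<forall>n. hsum (\<lambda>j. F j n) (l n))"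

lemma csum_bnd: "csum F l ==> (\<And>j. F j \<in> bnd \<gamma>) ==> l \<in> bnd \<gamma>"
proof -
 assume "csum F l" and F: "\<And>j. F j \<in> bnd \<gamma>"
 hence "hsum (\<lambda>j. F j n) (l n)" for n by (simp add: csum_def)
 hence "l n \<in> G \<gamma>" for n by (rule sums_G) (use F in \<open>auto simp: bnd_def\<close>)
 thus ?thesis by (auto simp: bnd_def)
qed

lemma csum_S: "csum F l ==> l \<in> carrier S"
 using csum_bnd csum_def S_carrier by meson

lemma csum_F_S: "csum F l ==> F j \<in> carrier S"
 unfolding csum_def S_carrier by blast

lemma csum_unique: "csum F l ==> csum F m ==> l = m"
 unfolding csum_def using sums_unique by blast

lemma csum_xi: assumes "csum F l" shows "csum (\<lambda>j. xi (F j)) (xi l)"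
 unfolding csum_def
proof (intro conjI allI)
 obtain \<gamma> where "\<And>j. F j \<in> bnd \<gamma>" using assms unfolding csum_def by blast
 thus "\<exists>\<gamma>. \<forall>j. xi (F j) \<in> bnd \<gamma>" using xi_pow_bnd[of _ \<gamma> 1] by auto
 have h: "hsum (\<lambda>j. F j n) (l n)" for n using assms by (simp add: csum_def)
 have s: "hsum (\<lambda>j. \<sigma> (F j n)) (\<sigma> (l n))" for n
  by (rule sums_amap[OF h \<sigma>_amap, where d = "- C"]) (auto dest: \<sigma>_G)
 have d: "hsum (\<lambda>j. \<delta> (F j n)) (\<delta> (l n))" for n
  by (rule sums_amap[OF h \<delta>_amap, where d = "- C"]) (auto dest: \<delta>_G)
 show "hsum (\<lambda>j. xi (F j) n) (xi l n)" for n
  by (cases n) (auto simp: xi_0 xi_Suc intro: s d sums_add)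
qed

lemma csum_xi_pow: "csum F l ==> csum (\<lambda>j. (xi ^^ i) (F j)) ((xi ^^ i) l)"
 by (induction i) (auto intro: csum_xi)

definition smul :: "'a \<Rightarrow> (nat \<Rightarrow> 'a) \<Rightarrow> nat \<Rightarrow> 'a" where "smul q a = (\<lambda>n. q \<otimes> a n)"

lemma smul_bnd: "q \<in> G d ==> a \<in> bnd c ==> smul q a \<in> bnd (d + c)"
 by (auto simp: smul_def bnd_def intro: G_mult)

lemma smul_S: "q \<in> carrier Q ==> a \<in> carrier S ==> smul q a \<in> carrier S"
 unfolding S_carrier using smul_bnd G_exhaust by metis

lemma csum_pr: assumes "a \<in> carrier S" "b \<in> carrier S"
 shows "csum (\<lambda>i. smul (a i) ((xi ^^ i) b)) (pr a b)"
proof -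
 obtain \<alpha> \<beta> where "a \<in> bnd \<alpha>" "b \<in> bnd \<beta>" using assms S_carrier by auto
 hence "smul (a i) ((xi ^^ i) b) \<in> bnd (\<alpha> + (\<beta> - C))" for i
  by (intro smul_bnd xi_pow_bnd) (auto simp: bnd_def)
 thus ?thesis using pr_hsum[OF assms] unfolding csum_def smul_def by blast
qed

text \<open>Fubini for the terms F_j(i) (x^i s)_n. Those with i \<ge> N1 are small uniformly in j,
  as the F_j share a bound; for each of the finitely many i < N1 they become small as j
  grows.\<close>

lemma csum_pr_left: assumes F: "csum F l" and s: "s \<in> carrier S"
 shows "csum (\<lambda>j. pr (F j) s) (pr l s)"
 unfolding csum_def
proof (intro conjI allI)
 obtain \<gamma> where \<gamma>: "\<And>j. F j \<in> bnd \<gamma>" using F unfolding csum_def by blast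
 obtain \<beta> where \<beta>: "s \<in> bnd \<beta>" using s S_carrier by auto
 show "\<exists>\<gamma>. \<forall>j. pr (F j) s \<in> bnd \<gamma>" using pr_bnd[OF \<gamma> \<beta>] by blast
 have l: "l \<in> carrier S" using csum_S F by auto
 note FS = csum_F_S[OF F]
 fix n
 obtain a where a: "hsum (\<lambda>j. pr (F j) s n) a" "hsum (\<lambda>i. l i \<otimes> (xi ^^ i) s n) a"
 proof (rule fubini[where f = "\<lambda>j i. F j i \<otimes> (xi ^^ i) s n" and r = "\<lambda>j. pr (F j) s n"
    and s = "\<lambda>i. l i \<otimes> (xi ^^ i) s n"])
  show "hsum (\<lambda>i. F j i \<otimes> (xi ^^ i) s n) (pr (F j) s n)" for j by (rule pr_hsum[OF FS s])
  show "hsum (\<lambda>j. F j i \<otimes> (xi ^^ i) s n) (l i \<otimes> (xi ^^ i) s n)" for i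
   using F S_coeff[OF xi_pow_S[OF s]] by (auto intro!: sums_rmult simp: csum_def)
  show "F i j \<otimes> (xi ^^ j) s n \<in> carrier Q" for i j
   using S_coeff[OF FS] S_coeff[OF xi_pow_S[OF s]] by auto
  fix c
  obtain N1 where N1: "\<And>i. i \<ge> N1 ==> (xi ^^ i) s n \<in> G (c - \<gamma>)"
   using xi_pow_null[OF s, of n] unfolding null_def by meson
  have "\<exists>N. \<forall>j\<ge>N. F j i \<in> G (c - (\<beta> - C))" for i
   using F sums_null unfolding csum_def null_def by blast
  hence "\<exists>M. \<forall>i. \<forall>j\<ge>M i. F j i \<in> G (c - (\<beta> - C))" by (intro choice allI)
  then obtain M where M: "\<And>i j. j \<ge> M i ==> F j i \<in> G (c - (\<beta> - C))" by blast
  define N where "N = Max (insert N1 (M ` {..<N1}))"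
  have "F j i \<otimes> (xi ^^ i) s n \<in> G c" if "N \<le> j \<or> N \<le> i" for i j
  proof (cases "N1 \<le> i")
   case True
   thus ?thesis using N1 \<gamma> by (intro G_mult'[of _ \<gamma> _ "c - \<gamma>"]) (auto simp: bnd_def)
  next
   case False
   have "N1 \<le> N" "M i \<le> N" using False by (auto simp: N_def)
   hence "M i \<le> j" using that False by auto
   thus ?thesis using M xi_pow_bnd[OF \<beta>]
    by (intro G_mult'[of _ "c - (\<beta> - C)" _ "\<beta> - C"]) (auto simp: bnd_def)
  qed
  thus "\<exists>N. \<forall>j i. N \<le> j \<or> N \<le> i \<longrightarrow> F j i \<otimes> (xi ^^ i) s n \<in> G c" by blast
 qed
 thus "hsum (\<lambda>j. pr (F j) s n) (pr l s n)" using sums_unique[OF pr_hsum[OF l s] a(2)] a(1) by simp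
qed

text \<open>As for the left factor, but here (x^i F_j)_n must be small for i \<ge> N1 uniformly in
  j. This is why the index in \<open>xi_pow_small\<close> depends on the series only through its
  bound.\<close>

lemma csum_pr_right: assumes F: "csum F l" and s: "s \<in> carrier S"
 shows "csum (\<lambda>j. pr s (F j)) (pr s l)"
 unfolding csum_def
proof (intro conjI allI)
 obtain \<gamma> where \<gamma>: "\<And>j. F j \<in> bnd \<gamma>" using F unfolding csum_def by blast
 obtain \<beta> where \<beta>: "s \<in> bnd \<beta>" using s S_carrier by auto
 show "\<exists>\<gamma>. \<forall>j. pr s (F j) \<in> bnd \<gamma>" using pr_bnd[OF \<beta> \<gamma>] by blast
 have l: "l \<in> carrier S" using csum_S F by auto
 note FS = csum_F_S[OF F]
 fix n
 have x: "hsum (\<lambda>j. (xi ^^ i) (F j) n) ((xi ^^ i) l n)" for i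
  using csum_xi_pow[OF F] by (auto simp: csum_def)
 obtain a where a: "hsum (\<lambda>j. pr s (F j) n) a" "hsum (\<lambda>i. s i \<otimes> (xi ^^ i) l n) a"
 proof (rule fubini[where f = "\<lambda>j i. s i \<otimes> (xi ^^ i) (F j) n" and r = "\<lambda>j. pr s (F j) n"
    and s = "\<lambda>i. s i \<otimes> (xi ^^ i) l n"])
  show "hsum (\<lambda>i. s i \<otimes> (xi ^^ i) (F j) n) (pr s (F j) n)" for j by (rule pr_hsum[OF s FS])
  show "hsum (\<lambda>j. s i \<otimes> (xi ^^ i) (F j) n) (s i \<otimes> (xi ^^ i) l n)" for i
   using x S_coeff[OF s] by (auto intro!: sums_lmult)
  show "s j \<otimes> (xi ^^ j) (F i) n \<in> carrier Q" for i j
   using S_coeff[OF s] S_coeff[OF xi_pow_S[OF FS]] by auto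
  fix c
  define N1 where "N1 = n + tail_index ((c - \<beta>) + C - \<gamma>)"
  have N1: "(xi ^^ i) (F j) n \<in> G (c - \<beta>)" if "i \<ge> N1" for i j
   by (rule xi_pow_small[OF \<gamma>]) (use that in \<open>simp add: N1_def\<close>)
  have "\<exists>N. \<forall>j\<ge>N. (xi ^^ i) (F j) n \<in> G (c - \<beta>)" for i
   using x[of i] sums_null unfolding null_def by blast
  hence "\<exists>M. \<forall>i. \<forall>j\<ge>M i. (xi ^^ i) (F j) n \<in> G (c - \<beta>)" by (intro choice allI)
  then obtain M where M: "\<And>i j. j \<ge> M i ==> (xi ^^ i) (F j) n \<in> G (c - \<beta>)" by blast
  define N where "N = Max (insert N1 (M ` {..<N1}))"
  have "s i \<otimes> (xi ^^ i) (F j) n \<in> G c" if "N \<le> j \<or> N \<le> i" for i j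
  proof -
   have "(xi ^^ i) (F j) n \<in> G (c - \<beta>)"
   proof (cases "N1 \<le> i")
    case False
    have "N1 \<le> N" "M i \<le> N" using False by (auto simp: N_def)
    hence "M i \<le> j" using that False by auto
    thus ?thesis using M by blast
   qed (use N1 in auto)
   thus ?thesis using \<beta> by (intro G_mult'[of _ \<beta> _ "c - \<beta>"]) (auto simp: bnd_def)
  qed
  thus "\<exists>N. \<forall>j i. N \<le> j \<or> N \<le> i \<longrightarrow> s i \<otimes> (xi ^^ i) (F j) n \<in> G c" by blast
 qed
 thus "hsum (\<lambda>j. pr s (F j) n) (pr s l n)" using sums_unique[OF pr_hsum[OF s l] a(2)] a(1) by simp
qed

lemma xi_smul: assumes "q \<in> carrier Q" "\<And>n. c n \<in> carrier Q"
 shows "xi (smul q c) k = \<sigma> q \<otimes> xi c k \<oplus> \<delta> q \<otimes> c k"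
proof (cases k)
 case 0
 thus ?thesis using assms by (simp add: xi_0 smul_def leib a_comm)
next
 case (Suc j)
 have "\<sigma> q \<otimes> \<sigma> (c j) \<oplus> (\<delta> q \<otimes> c k \<oplus> \<sigma> q \<otimes> \<delta> (c k)) =
    (\<sigma> q \<otimes> \<sigma> (c j) \<oplus> \<sigma> q \<otimes> \<delta> (c k)) \<oplus> \<delta> q \<otimes> c k"
  using assms by (simp add: a_ac)
 thus ?thesis using assms Suc by (simp add: xi_Suc smul_def leib \<sigma>_mult r_distr)
qed

lemma map_S: assumes "a \<in> carrier S" shows "(\<lambda>n. \<sigma> (a n)) \<in> carrier S" "(\<lambda>n. \<delta> (a n)) \<in> carrier S"
proof -
 obtain \<alpha> where "a \<in> bnd \<alpha>" using assms S_carrier by auto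
 hence "(\<lambda>n. \<sigma> (a n)) \<in> bnd (\<alpha> - C)" "(\<lambda>n. \<delta> (a n)) \<in> bnd (\<alpha> - C)"
  by (auto simp: bnd_def intro: \<sigma>_G \<delta>_G)
 thus "(\<lambda>n. \<sigma> (a n)) \<in> carrier S" "(\<lambda>n. \<delta> (a n)) \<in> carrier S" by auto
qed

text \<open>Associativity with first factor x. Both sides consist of a \<sigma>-part and a
  \<delta>-part; the \<sigma>-parts differ by a shift of the index.\<close>

lemma pr_xi: assumes a: "a \<in> carrier S" and b: "b \<in> carrier S"
 shows "pr (xi a) b = xi (pr a b)"
proof
 fix k
 note ac = S_coeff[OF a] and bc = S_coeff[OF xi_pow_S[OF b]]
 have "hsum (\<lambda>i. xi (smul (a i) ((xi ^^ i) b)) k) (xi (pr a b) k)"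
  using csum_xi[OF csum_pr[OF a b]] by (simp add: csum_def)
 hence 1: "hsum (\<lambda>i. \<sigma> (a i) \<otimes> (xi ^^ Suc i) b k \<oplus> \<delta> (a i) \<otimes> (xi ^^ i) b k) (xi (pr a b) k)"
  using ac bc by (simp add: xi_smul)
 have n: "null (\<lambda>i. (xi ^^ i) (xi b) k)" by (rule xi_pow_null[OF xi_S[OF b]])
 obtain P where P: "hsum (\<lambda>i. \<sigma> (a i) \<otimes> (xi ^^ i) (xi b) k) P"
  using null_sums[OF null_mult[OF map_S(1)[OF a] n]] .
 obtain R where R: "hsum (\<lambda>i. \<delta> (a i) \<otimes> (xi ^^ i) b k) R"
  using null_sums[OF null_mult[OF map_S(2)[OF a] xi_pow_null[OF b]]] .
 have "hsum (\<lambda>i. \<sigma> (a i) \<otimes> (xi ^^ Suc i) b k \<oplus> \<delta> (a i) \<otimes> (xi ^^ i) b k) (P \<oplus> R)"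
  using sums_add[OF P R] by (simp add: funpow_swap1)
 hence 2: "xi (pr a b) k = P \<oplus> R" using 1 sums_unique by blast
 \<comment> \<open>The \<sigma>-part of (x a)_i comes from a_(i-1); a zero term in front realigns
   the two series.\<close>
 have "hsum (\<lambda>n. case n of 0 \<Rightarrow> \<zero> | Suc i \<Rightarrow> \<sigma> (a i) \<otimes> (xi ^^ i) (xi b) k) (\<zero> \<oplus> P)"
  by (rule sums_shift[OF P]) simp
 from sums_add[OF this R]
 have "hsum (\<lambda>i. (case i of 0 \<Rightarrow> \<zero> | Suc i \<Rightarrow> \<sigma> (a i) \<otimes> (xi ^^ i) (xi b) k) \<oplus> \<delta> (a i) \<otimes> (xi ^^ i) b k) (P \<oplus> R)"
  using sumsD(2)[OF P] by simp
 moreover have "(case i of 0 \<Rightarrow> \<zero> | Suc i \<Rightarrow> \<sigma> (a i) \<otimes> (xi ^^ i) (xi b) k) \<oplus> \<delta> (a i) \<otimes> (xi ^^ i) b k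
    = xi a i \<otimes> (xi ^^ i) b k" for i
 proof (cases i)
  case 0 thus ?thesis using ac bc[of 0 k] by (simp add: xi_0)
 next
  case (Suc j)
  have "(xi ^^ j) (xi b) k = (xi ^^ Suc j) b k" by (simp add: funpow_swap1)
  thus ?thesis using ac bc Suc by (simp add: xi_Suc l_distr del: funpow.simps)
 qed
 ultimately have "hsum (\<lambda>i. xi a i \<otimes> (xi ^^ i) b k) (P \<oplus> R)" by simp
 thus "pr (xi a) b k = xi (pr a b) k"
  using sums_unique[OF pr_hsum[OF xi_S[OF a] b]] 2 by simp
qed

lemma pr_xi_pow: "a \<in> carrier S ==> b \<in> carrier S ==> pr ((xi ^^ i) a) b = (xi ^^ i) (pr a b)"
 by (induction i) (simp_all add: pr_xi xi_pow_S)

lemma pr_smul: assumes "q \<in> carrier Q" "a \<in> carrier S" "b \<in> carrier S"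
 shows "pr (smul q a) b = smul q (pr a b)"
proof
 fix k
 have "hsum (\<lambda>i. q \<otimes> (a i \<otimes> (xi ^^ i) b k)) (q \<otimes> pr a b k)"
  by (rule sums_lmult[OF pr_hsum]) (use assms in auto)
 hence "hsum (\<lambda>i. smul q a i \<otimes> (xi ^^ i) b k) (q \<otimes> pr a b k)"
  using assms S_coeff[OF assms(2)] S_coeff[OF xi_pow_S[OF assms(3)]] by (simp add: smul_def m_assoc)
 thus "pr (smul q a) b k = smul q (pr a b) k"
  using sums_unique[OF pr_hsum[OF smul_S[OF assms(1,2)] assms(3)]] by (simp add: smul_def)
qed

text \<open>For left factors q x^i this is \<open>pr_smul\<close> with \<open>pr_xi_pow\<close>; a
  is the sum of its terms a_i x^i, and multiplication is continuous.\<close>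

lemma pr_assoc: assumes "a \<in> carrier S" "b \<in> carrier S" "c \<in> carrier S"
 shows "pr (pr a b) c = pr a (pr b c)"
proof -
 have "csum (\<lambda>i. pr (smul (a i) ((xi ^^ i) b)) c) (pr (pr a b) c)"
  by (intro csum_pr_left csum_pr assms)
 moreover have "pr (smul (a i) ((xi ^^ i) b)) c = smul (a i) ((xi ^^ i) (pr b c))" for i
  using assms S_coeff[OF assms(1)] by (simp add: pr_smul xi_pow_S pr_xi_pow)
 ultimately show ?thesis
  using csum_unique[OF csum_pr[OF assms(1) pr_closed[OF assms(2,3)]]] by simp
qed

lemma pr_add_left: assumes "a \<in> carrier S" "b \<in> carrier S" "c \<in> carrier S"
 shows "pr (\<lambda>n. a n \<oplus> b n) c = (\<lambda>n. pr a c n \<oplus> pr b c n)"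
proof
 fix k
 have "hsum (\<lambda>i. (a i \<oplus> b i) \<otimes> (xi ^^ i) c k) (pr a c k \<oplus> pr b c k)"
  using sums_add[OF pr_hsum[OF assms(1,3)] pr_hsum[OF assms(2,3)]]
   S_coeff[OF assms(1)] S_coeff[OF assms(2)] S_coeff[OF xi_pow_S[OF assms(3)]] by (simp add: l_distr)
 thus "pr (\<lambda>n. a n \<oplus> b n) c k = pr a c k \<oplus> pr b c k"
  by (rule sums_unique[OF pr_hsum[OF S_add_closed[OF assms(1,2)] assms(3)]])
qed

lemma xi_add: assumes "\<And>n. a n \<in> carrier Q" "\<And>n. b n \<in> carrier Q"
 shows "xi (\<lambda>n. a n \<oplus> b n) = (\<lambda>n. xi a n \<oplus> xi b n)"
proof
 fix n show "xi (\<lambda>n. a n \<oplus> b n) n = xi a n \<oplus> xi b n"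
  using assms by (cases n) (auto simp: xi_0 xi_Suc amap_add[OF \<sigma>_amap] amap_add[OF \<delta>_amap] a_ac)
qed

lemma xi_pow_add: assumes "\<And>n. a n \<in> carrier Q" "\<And>n. b n \<in> carrier Q"
 shows "(xi ^^ i) (\<lambda>n. a n \<oplus> b n) = (\<lambda>n. (xi ^^ i) a n \<oplus> (xi ^^ i) b n)"
 using assms by (induction i) (simp_all add: xi_add xi_pow_closed)

lemma pr_add_right: assumes "a \<in> carrier S" "b \<in> carrier S" "c \<in> carrier S"
 shows "pr c (\<lambda>n. a n \<oplus> b n) = (\<lambda>n. pr c a n \<oplus> pr c b n)"
proof
 fix k
 have "hsum (\<lambda>i. c i \<otimes> (xi ^^ i) (\<lambda>n. a n \<oplus> b n) k) (pr c a k \<oplus> pr c b k)"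
  using sums_add[OF pr_hsum[OF assms(3,1)] pr_hsum[OF assms(3,2)]]
   S_coeff[OF assms(1)] S_coeff[OF assms(2)] S_coeff[OF assms(3)]
   S_coeff[OF xi_pow_S[OF assms(1)]] S_coeff[OF xi_pow_S[OF assms(2)]]
  by (simp add: r_distr xi_pow_add)
 thus "pr c (\<lambda>n. a n \<oplus> b n) k = pr c a k \<oplus> pr c b k"
  by (rule sums_unique[OF pr_hsum[OF assms(3) S_add_closed[OF assms(1,2)]]])
qed

definition mon :: "nat \<Rightarrow> nat \<Rightarrow> 'a" where "mon k = (\<lambda>n. if n = k then \<one> else \<zero>)"

lemma mon_bnd: "mon k \<in> bnd 0" by (auto simp: mon_def bnd_def G_one)

lemma mon_S [simp, intro]: "mon k \<in> carrier S" using mon_bnd by blast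

lemma xi_mon: "xi (mon k) = mon (Suc k)"
proof
 fix n show "xi (mon k) n = mon (Suc k) n"
  by (cases n) (auto simp: xi_0 xi_Suc mon_def)
qed

lemma xi_pow_mon: "(xi ^^ i) (mon k) = mon (i + k)"
 by (induction i) (auto simp: xi_mon)

lemma pr_one_right: assumes "a \<in> carrier S" shows "pr a (mon 0) = a"
proof
 fix k
 have "hsum (\<lambda>i. if i = k then a k else \<zero>) (a k)" by (rule sums_single[OF S_coeff[OF assms]])
 moreover have "a i \<otimes> (xi ^^ i) (mon 0) k = (if i = k then a k else \<zero>)" for i
  using S_coeff[OF assms] by (simp add: xi_pow_mon) (auto simp: mon_def)
 ultimately show "pr a (mon 0) k = a k" using sums_unique[OF pr_hsum[OF assms mon_S[of 0], of k]] by simp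
qed

lemma pr_mon_left: assumes "a \<in> carrier S" shows "pr (mon j) a = (xi ^^ j) a"
proof
 fix k
 have "hsum (\<lambda>i. if i = j then (xi ^^ j) a k else \<zero>) ((xi ^^ j) a k)"
  by (rule sums_single[OF S_coeff[OF xi_pow_S[OF assms]]])
 moreover have "mon j i \<otimes> (xi ^^ i) a k = (if i = j then (xi ^^ j) a k else \<zero>)" for i
  using S_coeff[OF xi_pow_S[OF assms]] by (auto simp: mon_def)
 ultimately show "pr (mon j) a k = (xi ^^ j) a k" using sums_unique[OF pr_hsum[OF mon_S assms, of j k]] by simp
qed

lemma S_one_mon: "\<one>\<^bsub>S\<^esub> = mon 0" by (simp add: S_one mon_def)

lemma neg_S: assumes "a \<in> carrier S" shows "(\<lambda>n. \<ominus> a n) \<in> carrier S"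
 using assms unfolding S_carrier bnd_def by (auto intro: G_neg)

lemma zero_seq_S: "(\<lambda>n. \<zero>) \<in> carrier S" unfolding S_carrier bnd_def by auto

lemma S_ring: "ring S"
proof (rule ringI)
 show "abelian_group S"
 proof (rule abelian_groupI, goal_cases)
  case (6 a)
  hence a: "a \<in> carrier S" by simp
  show ?case
   using S_coeff[OF a] by (intro bexI[OF _ neg_S[OF a]]) (auto simp: S_add S_zero l_neg)
 qed (use S_coeff in \<open>auto simp only: S_add S_zero zero_seq_S S_add_closed intro!: ext a_assoc a_comm l_zero\<close>)
 show "monoid S"
  by (rule monoidI)
    (auto simp: S_mult pr_closed S_one_mon pr_assoc pr_one_right pr_mon_left)
qed (auto simp: S_mult S_add pr_closed pr_add_left pr_add_right S_add_closed)

end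

sublocale skew \<subseteq> S: ring S
 by (rule S_ring)

context skew begin

lemma S_minus: assumes "a \<in> carrier S" shows "\<ominus>\<^bsub>S\<^esub> a = (\<lambda>n. \<ominus> a n)"
 by (rule S.minus_equality) (use assms neg_S S_coeff[OF assms] in \<open>auto simp: S_add S_zero l_neg\<close>)

lemma S_diff: "a \<in> carrier S ==> b \<in> carrier S ==> a \<ominus>\<^bsub>S\<^esub> b = (\<lambda>n. a n \<ominus> b n)"
 by (simp add: S.minus_eq S_minus S_add minus_eq)

lemma S_finsum: assumes "\<And>i. i \<in> A ==> F i \<in> carrier S"
 shows "(\<Oplus>\<^bsub>S\<^esub>i\<in>A. F i) n = (\<Oplus>i\<in>A. F i n)"
 using assms
proof (induction A rule: infinite_finite_induct)
 case (insert x A)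
 hence "F y m \<in> carrier Q" if "y \<in> insert x A" for y m using S_coeff that by blast
 thus ?case using insert by (subst S.finsum_insert) (auto simp: S_add)
qed (auto simp: S_zero)

definition cst :: "'a \<Rightarrow> nat \<Rightarrow> 'a" where "cst = series_const Q"

lemma cst_eq: "cst q = (\<lambda>n. if n = 0 then q else \<zero>)"
 by (simp add: cst_def series_const_def)

lemma cst_bnd: "q \<in> G c ==> cst q \<in> bnd c" by (auto simp: cst_eq bnd_def)

lemma cst_S [simp, intro]: "q \<in> carrier Q ==> cst q \<in> carrier S"
 using G_exhaust cst_bnd by blast

lemma var_eq: "series_var Q = mon 1" by (auto simp: series_var_def mon_def)

lemma cst_mult: assumes "q \<in> carrier Q" "a \<in> carrier S" shows "cst q \<otimes>\<^bsub>S\<^esub> a = smul q a"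
proof -
 have "cst q = smul q (mon 0)" using assms by (auto simp: cst_eq smul_def mon_def)
 thus ?thesis using assms by (simp add: S_mult smul_S pr_smul pr_mon_left)
qed

lemma var_mult: "a \<in> carrier S ==> mon 1 \<otimes>\<^bsub>S\<^esub> a = xi a"
 by (simp add: S_mult pr_mon_left)

lemma mon_pow: "mon 1 [^]\<^bsub>S\<^esub> (k::nat) = mon k"
proof (induction k)
 case (Suc k)
 thus ?case by (simp add: S_mult pr_mon_left xi_pow_mon)
qed (simp add: S_one_mon)

lemma cst_add: "a \<in> carrier Q ==> b \<in> carrier Q ==> cst (a \<oplus> b) = cst a \<oplus>\<^bsub>S\<^esub> cst b"
 by (auto simp: cst_eq S_add)

lemma cst_cst: "a \<in> carrier Q ==> b \<in> carrier Q ==> cst a \<otimes>\<^bsub>S\<^esub> cst b = cst (a \<otimes> b)"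
 by (simp add: cst_mult) (auto simp: cst_eq smul_def)

lemma cst_one: "cst \<one> = \<one>\<^bsub>S\<^esub>" by (simp add: cst_eq S_one)

lemma cst_zero: "cst \<zero> = \<zero>\<^bsub>S\<^esub>" by (auto simp: cst_eq S_zero)

lemma cst_minus: "a \<in> carrier Q ==> cst (\<ominus> a) = \<ominus>\<^bsub>S\<^esub> cst a"
 using S_minus[OF cst_S, of a] by (auto simp: cst_eq)

lemma var_cst: "q \<in> carrier Q ==> mon 1 \<otimes>\<^bsub>S\<^esub> cst q = cst (\<sigma> q) \<otimes>\<^bsub>S\<^esub> mon 1 \<oplus>\<^bsub>S\<^esub> cst (\<delta> q)"
proof -
 assume q: "q \<in> carrier Q"
 have "xi (cst q) n = \<sigma> q \<otimes> mon 1 n \<oplus> cst (\<delta> q) n" for n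
  using q by (cases n) (auto simp: xi_0 xi_Suc cst_eq mon_def)
 thus ?thesis using q var_mult[of "cst q"] by (auto simp: cst_mult smul_def S_add)
qed

end

section \<open>Substitution into a power series\<close>

text \<open>The conditions under which X \<mapsto> z extends to a homomorphism from the power series
  ring of (\<sigma>', \<delta>') to that of (\<sigma>, \<delta>): z obeys the commutation rule of X,
  and its powers are uniformly bounded and tend to zero in each coefficient.\<close>

locale skew_subst = skew Q u \<sigma> \<delta> C N0 + A: skew Q u \<sigma>' \<delta>' C' N0'
 for Q :: "('a, 'm) ring_scheme" (structure) and u \<sigma> \<delta> C N0 \<sigma>' \<delta>' C' N0' +
 fixes z :: "nat \<Rightarrow> 'a"
 assumes z_S [simp, intro]: "z \<in> carrier S"
  and z_cst: "q \<in> carrier Q ==> z \<otimes>\<^bsub>S\<^esub> cst q = cst (\<sigma>' q) \<otimes>\<^bsub>S\<^esub> z \<oplus>\<^bsub>S\<^esub> cst (\<delta>' q)"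
  and z_pow_bnd: "\<exists>\<gamma>. \<forall>k::nat. z [^]\<^bsub>S\<^esub> k \<in> bnd \<gamma>"
  and z_pow_null: "null (\<lambda>k::nat. (z [^]\<^bsub>S\<^esub> k) n)"
begin

lemma AS_carrier: "carrier A.S = carrier S"
 using S_carrier A.S_carrier by blast

definition iota :: "(nat \<Rightarrow> 'a) \<Rightarrow> nat \<Rightarrow> 'a" where
 "iota a = (\<lambda>n. filt_suminf Q u (\<lambda>k. a k \<otimes> (z [^]\<^bsub>S\<^esub> k) n))"

lemma zp_coeff: "(z [^]\<^bsub>S\<^esub> (k::nat)) n \<in> carrier Q"
 by (rule S_coeff) auto

lemma iota_csum: assumes "a \<in> carrier S" shows "csum (\<lambda>k. smul (a k) (z [^]\<^bsub>S\<^esub> k)) (iota a)"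
 unfolding csum_def
proof (intro conjI allI)
 obtain \<gamma> where \<gamma>: "\<And>k::nat. z [^]\<^bsub>S\<^esub> k \<in> bnd \<gamma>" using z_pow_bnd by blast
 obtain \<alpha> where \<alpha>: "a \<in> bnd \<alpha>" using assms S_carrier by auto
 have "smul (a k) (z [^]\<^bsub>S\<^esub> k) \<in> bnd (\<alpha> + \<gamma>)" for k
  by (rule smul_bnd[OF _ \<gamma>]) (use \<alpha> in \<open>auto simp: bnd_def\<close>)
 thus "\<exists>\<gamma>. \<forall>k. smul (a k) (z [^]\<^bsub>S\<^esub> k) \<in> bnd \<gamma>" by blast
 fix n
 obtain l where l: "hsum (\<lambda>k. a k \<otimes> (z [^]\<^bsub>S\<^esub> k) n) l"
  using null_sums[OF null_mult[OF assms z_pow_null]] .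
 thus "hsum (\<lambda>k. smul (a k) (z [^]\<^bsub>S\<^esub> k) n) (iota a n)"
  using filt_suminf_eq[OF l] by (simp add: iota_def smul_def)
qed

lemma iota_hsum: "a \<in> carrier S ==> hsum (\<lambda>k. a k \<otimes> (z [^]\<^bsub>S\<^esub> k) n) (iota a n)"
 using iota_csum[of a] by (simp add: csum_def smul_def)

lemma iota_S [simp, intro]: "a \<in> carrier S ==> iota a \<in> carrier S"
 by (rule csum_S[OF iota_csum])

lemma iota_add: assumes "a \<in> carrier S" "b \<in> carrier S"
 shows "iota (a \<oplus>\<^bsub>S\<^esub> b) = iota a \<oplus>\<^bsub>S\<^esub> iota b"
proof
 fix n
 have "hsum (\<lambda>k. (a \<oplus>\<^bsub>S\<^esub> b) k \<otimes> (z [^]\<^bsub>S\<^esub> k) n) (iota a n \<oplus> iota b n)"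
  using sums_add[OF iota_hsum[OF assms(1)] iota_hsum[OF assms(2)], of n n]
   S_coeff[OF assms(1)] S_coeff[OF assms(2)] zp_coeff by (simp add: S_add l_distr)
 thus "iota (a \<oplus>\<^bsub>S\<^esub> b) n = (iota a \<oplus>\<^bsub>S\<^esub> iota b) n"
  using sums_unique[OF iota_hsum[of "a \<oplus>\<^bsub>S\<^esub> b" n]] assms by (simp add: S_add[of "iota a"])
qed

lemma iota_smul_mon: assumes "q \<in> carrier Q" shows "iota (smul q (mon k)) = smul q (z [^]\<^bsub>S\<^esub> k)"
proof
 fix n
 have "smul q (mon k) \<in> carrier S" using assms by (auto intro: smul_S)
 from iota_hsum[OF this, of n]
 have "hsum (\<lambda>j. smul q (mon k) j \<otimes> (z [^]\<^bsub>S\<^esub> j) n) (iota (smul q (mon k)) n)" .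
 moreover have "(\<lambda>j. smul q (mon k) j \<otimes> (z [^]\<^bsub>S\<^esub> j) n) = (\<lambda>j. if j = k then q \<otimes> (z [^]\<^bsub>S\<^esub> k) n else \<zero>)"
  using assms zp_coeff by (auto simp: smul_def mon_def fun_eq_iff)
 ultimately have "hsum (\<lambda>j. if j = k then q \<otimes> (z [^]\<^bsub>S\<^esub> k) n else \<zero>) (iota (smul q (mon k)) n)" by simp
 thus "iota (smul q (mon k)) n = smul q (z [^]\<^bsub>S\<^esub> k) n"
  using sums_unique[OF _ sums_single[of "q \<otimes> (z [^]\<^bsub>S\<^esub> k) n" k]] assms zp_coeff by (simp add: smul_def)
qed

lemma smul_one: "a \<in> carrier S ==> smul \<one> a = a"
 using S_coeff[of a] by (auto simp: smul_def)

lemma iota_mon: "iota (mon k) = z [^]\<^bsub>S\<^esub> k"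
 using iota_smul_mon[of \<one> k] by (simp add: smul_one)

lemma iota_cst: assumes "q \<in> carrier Q" shows "iota (cst q) = cst q"
proof -
 have "cst q = smul q (mon 0)" using assms by (auto simp: cst_eq smul_def mon_def)
 thus ?thesis using iota_smul_mon[OF assms, of 0] by (simp add: S_one_mon)
qed

lemma z_smul: assumes "q \<in> carrier Q" "f \<in> carrier S"
 shows "z \<otimes>\<^bsub>S\<^esub> smul q f = smul (\<sigma>' q) (z \<otimes>\<^bsub>S\<^esub> f) \<oplus>\<^bsub>S\<^esub> smul (\<delta>' q) f"
proof -
 have "z \<otimes>\<^bsub>S\<^esub> smul q f = (z \<otimes>\<^bsub>S\<^esub> cst q) \<otimes>\<^bsub>S\<^esub> f"
  using assms by (simp add: cst_mult[symmetric] S.m_assoc)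
 also have "\<dots> = (cst (\<sigma>' q) \<otimes>\<^bsub>S\<^esub> z \<oplus>\<^bsub>S\<^esub> cst (\<delta>' q)) \<otimes>\<^bsub>S\<^esub> f"
  using assms by (simp only: z_cst)
 also have "\<dots> = cst (\<sigma>' q) \<otimes>\<^bsub>S\<^esub> (z \<otimes>\<^bsub>S\<^esub> f) \<oplus>\<^bsub>S\<^esub> cst (\<delta>' q) \<otimes>\<^bsub>S\<^esub> f"
  using assms by (simp only: S.l_distr S.m_assoc cst_S z_S A.\<sigma>_closed A.\<delta>_closed S.m_closed)
 finally show ?thesis using assms by (simp add: cst_mult)
qed

text \<open>Multiplicativity with first factor X. Moving z past the coefficients produces a
  \<sigma>'-part with exponents raised by one and a \<delta>'-part; after realignment they are the
  coefficients of X b.\<close>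

lemma iota_z: assumes b: "b \<in> carrier S" shows "z \<otimes>\<^bsub>S\<^esub> iota b = iota (A.xi b)"
proof
 fix n
 note bc = S_coeff[OF b]
 have "csum (\<lambda>k. pr z (smul (b k) (z [^]\<^bsub>S\<^esub> k))) (pr z (iota b))"
  by (rule csum_pr_right[OF iota_csum[OF b] z_S])
 moreover have "pr z (smul (b k) (z [^]\<^bsub>S\<^esub> k)) =
   smul (\<sigma>' (b k)) (z [^]\<^bsub>S\<^esub> Suc k) \<oplus>\<^bsub>S\<^esub> smul (\<delta>' (b k)) (z [^]\<^bsub>S\<^esub> k)" for k
  using z_smul[of "b k" "z [^]\<^bsub>S\<^esub> k"] bc S.nat_pow_Suc2[OF z_S, of k]
  by (simp add: S_mult[OF z_S smul_S, symmetric] del: S.nat_pow_Suc)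
 ultimately have 1: "hsum (\<lambda>k. \<sigma>' (b k) \<otimes> (z [^]\<^bsub>S\<^esub> Suc k) n \<oplus> \<delta>' (b k) \<otimes> (z [^]\<^bsub>S\<^esub> k) n)
   ((z \<otimes>\<^bsub>S\<^esub> iota b) n)"
  using S_mult[OF z_S iota_S[OF b]] by (simp add: csum_def S_add smul_def del: S.nat_pow_Suc)
 have "null (\<lambda>k. (z [^]\<^bsub>S\<^esub> Suc k) n)"
 proof -
  have "\<exists>N. \<forall>k\<ge>N. (z [^]\<^bsub>S\<^esub> Suc k) n \<in> G c" for c
  proof -
   obtain N where "\<forall>k::nat\<ge>N. (z [^]\<^bsub>S\<^esub> k) n \<in> G c" using z_pow_null[of n] unfolding null_def by blast
   hence "\<forall>k\<ge>N. (z [^]\<^bsub>S\<^esub> Suc k) n \<in> G c" using le_SucI by blast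
   thus ?thesis by blast
  qed
  thus ?thesis unfolding null_def using zp_coeff by blast
 qed
 from null_sums[OF null_mult[OF A.map_S(1)[unfolded AS_carrier, OF b] this]] obtain P
  where P: "hsum (\<lambda>k. \<sigma>' (b k) \<otimes> (z [^]\<^bsub>S\<^esub> Suc k) n) P" .
 from null_sums[OF null_mult[OF A.map_S(2)[unfolded AS_carrier, OF b] z_pow_null]] obtain R
  where R: "hsum (\<lambda>k. \<delta>' (b k) \<otimes> (z [^]\<^bsub>S\<^esub> k) n) R" .
 have 2: "(z \<otimes>\<^bsub>S\<^esub> iota b) n = P \<oplus> R" by (rule sums_unique[OF 1 sums_add[OF P R]])
 have "hsum (\<lambda>k. case k of 0 \<Rightarrow> \<zero> | Suc i \<Rightarrow> \<sigma>' (b i) \<otimes> (z [^]\<^bsub>S\<^esub> Suc i) n) (\<zero> \<oplus> P)"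
  by (rule sums_shift[OF P]) simp
 from sums_add[OF this R]
 have "hsum (\<lambda>k. (case k of 0 \<Rightarrow> \<zero> | Suc i \<Rightarrow> \<sigma>' (b i) \<otimes> (z [^]\<^bsub>S\<^esub> Suc i) n)
    \<oplus> \<delta>' (b k) \<otimes> (z [^]\<^bsub>S\<^esub> k) n) (P \<oplus> R)"
  using sumsD(2)[OF P] by simp
 moreover have "(case k of 0 \<Rightarrow> \<zero> | Suc i \<Rightarrow> \<sigma>' (b i) \<otimes> (z [^]\<^bsub>S\<^esub> Suc i) n)
    \<oplus> \<delta>' (b k) \<otimes> (z [^]\<^bsub>S\<^esub> k) n = A.xi b k \<otimes> (z [^]\<^bsub>S\<^esub> k) n" for k
 proof -
  have "(case k of 0 \<Rightarrow> \<zero> | Suc i \<Rightarrow> \<sigma>' (b i) \<otimes> w (Suc i)) \<oplus> \<delta>' (b k) \<otimes> w k = A.xi b k \<otimes> w k"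
   if "\<And>k. w k \<in> carrier Q" for w
   using bc that by (cases k) (auto simp: A.xi_0 A.xi_Suc l_distr)
  from this[of "\<lambda>k. (z [^]\<^bsub>S\<^esub> k) n", OF zp_coeff] show ?thesis .
 qed
 ultimately have "hsum (\<lambda>k. A.xi b k \<otimes> (z [^]\<^bsub>S\<^esub> k) n) (P \<oplus> R)" by simp
 thus "(z \<otimes>\<^bsub>S\<^esub> iota b) n = iota (A.xi b) n"
  using sums_unique[OF iota_hsum[OF A.xi_S[unfolded AS_carrier, OF b]]] 2 by simp
qed

lemma iota_z_pow: "b \<in> carrier S ==> z [^]\<^bsub>S\<^esub> (i::nat) \<otimes>\<^bsub>S\<^esub> iota b = iota ((A.xi ^^ i) b)"
proof (induction i)
 case (Suc i)
 have "z [^]\<^bsub>S\<^esub> Suc i \<otimes>\<^bsub>S\<^esub> iota b = z \<otimes>\<^bsub>S\<^esub> (z [^]\<^bsub>S\<^esub> i \<otimes>\<^bsub>S\<^esub> iota b)"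
  using Suc.prems S.nat_pow_Suc2[OF z_S, of i] S.m_assoc[of z "z [^]\<^bsub>S\<^esub> i" "iota b"]
  by (simp del: S.nat_pow_Suc)
 thus ?case using Suc A.xi_pow_S[unfolded AS_carrier, OF Suc.prems, of i] by (simp add: iota_z)
qed simp

text \<open>\<open>iota_z_pow\<close> gives the claim for left factors X^i. In general both sides
  are iterated sums of a_i (X^i b)_k z^k, and Fubini identifies them.\<close>

lemma iota_mult: assumes a: "a \<in> carrier S" and b: "b \<in> carrier S"
 shows "iota (a \<otimes>\<^bsub>A.S\<^esub> b) = iota a \<otimes>\<^bsub>S\<^esub> iota b"
proof
 fix n
 note a' = a[folded AS_carrier] and b' = b[folded AS_carrier]
 note xb = A.xi_pow_S[unfolded AS_carrier, OF b]
 have m: "a \<otimes>\<^bsub>A.S\<^esub> b = A.pr a b" by (rule A.S_mult[OF a' b'])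
 have ms: "A.pr a b \<in> carrier S" using A.pr_closed[OF a' b'] AS_carrier by simp
 obtain \<gamma> where \<gamma>: "\<And>k::nat. z [^]\<^bsub>S\<^esub> k \<in> bnd \<gamma>" using z_pow_bnd by blast
 obtain \<alpha> where \<alpha>: "a \<in> bnd \<alpha>" using a S_carrier by auto
 obtain \<beta> where \<beta>: "b \<in> bnd \<beta>" using b S_carrier by auto
 have "csum (\<lambda>i. pr (smul (a i) (z [^]\<^bsub>S\<^esub> i)) (iota b)) (pr (iota a) (iota b))"
  by (rule csum_pr_left[OF iota_csum[OF a] iota_S[OF b]])
 moreover have "pr (smul (a i) (z [^]\<^bsub>S\<^esub> i)) (iota b) = smul (a i) (iota ((A.xi ^^ i) b))" for i
  using iota_z_pow[OF b, of i] S_mult[OF _ iota_S[OF b], of "z [^]\<^bsub>S\<^esub> i"] S_coeff[OF a] b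
  by (simp add: pr_smul)
 ultimately have 1: "hsum (\<lambda>i. a i \<otimes> iota ((A.xi ^^ i) b) n) ((iota a \<otimes>\<^bsub>S\<^esub> iota b) n)"
  using S_mult[OF iota_S[OF a] iota_S[OF b]] by (simp add: csum_def smul_def)
 obtain l where l: "hsum (\<lambda>i. a i \<otimes> iota ((A.xi ^^ i) b) n) l"
   "hsum (\<lambda>k. A.pr a b k \<otimes> (z [^]\<^bsub>S\<^esub> k) n) l"
 proof (rule fubini[where f = "\<lambda>i k. a i \<otimes> ((A.xi ^^ i) b k \<otimes> (z [^]\<^bsub>S\<^esub> k) n)"
    and r = "\<lambda>i. a i \<otimes> iota ((A.xi ^^ i) b) n" and s = "\<lambda>k. A.pr a b k \<otimes> (z [^]\<^bsub>S\<^esub> k) n"])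
  show "a i \<otimes> ((A.xi ^^ i) b k \<otimes> (z [^]\<^bsub>S\<^esub> k) n) \<in> carrier Q" for i k
   using S_coeff[OF a] S_coeff[OF xb] zp_coeff by auto
  show "hsum (\<lambda>k. a i \<otimes> ((A.xi ^^ i) b k \<otimes> (z [^]\<^bsub>S\<^esub> k) n)) (a i \<otimes> iota ((A.xi ^^ i) b) n)" for i
   by (rule sums_lmult[OF iota_hsum[OF xb] S_coeff[OF a]])
  show "hsum (\<lambda>i. a i \<otimes> ((A.xi ^^ i) b k \<otimes> (z [^]\<^bsub>S\<^esub> k) n)) (A.pr a b k \<otimes> (z [^]\<^bsub>S\<^esub> k) n)" for k
   using sums_rmult[OF A.pr_hsum[OF a' b'] zp_coeff, of k k n] S_coeff[OF a] S_coeff[OF xb] zp_coeff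
   by (simp add: m_assoc)
  fix c
  obtain N1 where N1: "\<And>k::nat. k \<ge> N1 ==> (z [^]\<^bsub>S\<^esub> k) n \<in> G (c - \<alpha> - (\<beta> - C'))"
   using z_pow_null[of n] unfolding null_def by meson
  \<comment> \<open>For k \<ge> N1 the power z^k is small. For k < N1 it is (X^i b)_k that is small,
    once i exceeds k by the tail index; hence the sum.\<close>
  define N where "N = N1 + A.tail_index (c - \<alpha> - \<gamma> + C' - \<beta>)"
  have ai: "a i \<in> G \<alpha>" and xi: "(A.xi ^^ i) b k \<in> G (\<beta> - C')" and zi: "(z [^]\<^bsub>S\<^esub> k) n \<in> G \<gamma>" for i k
   using \<alpha> A.xi_pow_bnd[OF \<beta>] \<gamma> by (auto simp: bnd_def)
  have "a i \<otimes> ((A.xi ^^ i) b k \<otimes> (z [^]\<^bsub>S\<^esub> k) n) \<in> G c" if "N \<le> i \<or> N \<le> k" for i k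
  proof (rule G_mult'[OF ai, of _ "c - \<alpha>"])
   show "(A.xi ^^ i) b k \<otimes> (z [^]\<^bsub>S\<^esub> k) n \<in> G (c - \<alpha>)"
   proof (cases "N1 \<le> k")
    case True
    thus ?thesis by (intro G_mult'[OF xi N1]) auto
   next
    case False
    hence "N \<le> i" using that by (auto simp: N_def)
    hence "(A.xi ^^ i) b k \<in> G (c - \<alpha> - \<gamma>)"
     using False by (intro A.xi_pow_small[OF \<beta>]) (simp add: N_def)
    thus ?thesis by (rule G_mult'[OF _ zi]) auto
   qed
  qed auto
  thus "\<exists>N. \<forall>i k. N \<le> i \<or> N \<le> k \<longrightarrow> a i \<otimes> ((A.xi ^^ i) b k \<otimes> (z [^]\<^bsub>S\<^esub> k) n) \<in> G c" by blast
 qed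
 show "iota (a \<otimes>\<^bsub>A.S\<^esub> b) n = (iota a \<otimes>\<^bsub>S\<^esub> iota b) n"
  unfolding m using sums_unique[OF l(2) iota_hsum[OF ms]] sums_unique[OF l(1) 1] by simp
qed

lemma iota_hom: "iota \<in> ring_hom A.S S"
proof (rule ring_hom_memI)
 show "iota \<one>\<^bsub>A.S\<^esub> = \<one>\<^bsub>S\<^esub>" using iota_mon[of 0] by (simp add: A.S_one_mon)
qed (auto simp: AS_carrier iota_mult, use iota_add in \<open>simp add: S_add A.S_add\<close>)

end

lemma (in abelian_group) finsum_diff:
 assumes "\<And>l. l \<in> A ==> x l \<in> carrier G" "\<And>l. l \<in> A ==> y l \<in> carrier G"
 shows "(\<Oplus>l\<in>A. x l) \<ominus> (\<Oplus>l\<in>A. y l) = (\<Oplus>l\<in>A. x l \<ominus> y l)"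
 using assms
proof (induction A rule: infinite_finite_induct)
 case (insert a A)
 thus ?case by (auto simp: minus_eq minus_add a_ac)
qed (auto simp: minus_eq r_neg)

lemma (in ring) diff_telescope:
 assumes "x \<in> carrier R" "y \<in> carrier R" "z \<in> carrier R" "d \<in> carrier R"
 shows "(x \<ominus> y) \<oplus> (y \<ominus> z) \<oplus> d = (x \<oplus> d) \<ominus> z"
proof -
 have "(x \<ominus> y) \<oplus> (y \<ominus> z) = x \<ominus> z" using assms by (simp add: minus_eq a_assoc r_neg1)
 thus ?thesis using assms by (simp add: minus_eq a_ac)
qed

lemma (in ring) add_diff_cancel_left: "a \<in> carrier R ==> b \<in> carrier R ==> a \<oplus> b \<ominus> a = b"
 by (simp add: minus_eq a_comm[of a b] a_assoc r_neg)

section \<open>Neumann series\<close>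

context skew begin

text \<open>\<open>\<mu> w k\<close> is the level that weight w demands of coefficient k, so that a
  weight can combine the filtration with the degree in x.\<close>

definition wt_set :: "(nat \<Rightarrow> nat \<Rightarrow> int) \<Rightarrow> nat \<Rightarrow> (nat \<Rightarrow> 'a) set" where
 "wt_set \<mu> w = {h. \<forall>k. h k \<in> G (\<mu> w k)}"

text \<open>Solvability of \<open>h + E h = g\<close> by the Neumann series \<open>\<Sum>\<^sub>n (-E)\<^sup>n g\<close>, for an operator
 \<open>E\<close> raising the weights.\<close>

lemma neumann:
 assumes lim: "\<And>k c. \<exists>w. c \<le> \<mu> w k" and mono: "\<And>w w' k. w \<le> w' ==> \<mu> w k \<le> \<mu> w' k"
  and E: "\<And>w h. h \<in> wt_set \<mu> w ==> E h \<in> wt_set \<mu> (Suc w)"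
  and E_add: "\<And>a b. a \<in> wt_set \<mu> 0 ==> b \<in> wt_set \<mu> 0 ==>
    E (\<lambda>k. a k \<oplus> b k) = (\<lambda>k. E a k \<oplus> E b k)"
  and g: "g \<in> wt_set \<mu> 0"
 obtains h where "h \<in> wt_set \<mu> 0" "(\<lambda>k. h k \<oplus> E h k) = g"
proof -
 define D where "D = rec_nat g (\<lambda>_ d k. \<ominus> E d k)"
 have D0: "D 0 = g" and DS: "\<And>n. D (Suc n) = (\<lambda>k. \<ominus> E (D n) k)" by (auto simp: D_def)
 have Dw: "D n \<in> wt_set \<mu> n" for n
 proof (induction n)
  case (Suc n)
  from E[OF this] show ?case by (auto simp: DS wt_set_def intro: G_neg)
 qed (simp add: D0 g)
 have DG: "D i k \<in> G (\<mu> n k)" if "n \<le> i" for i n k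
  using Dw[of i] G_mono[OF _ mono[OF that]] by (auto simp: wt_set_def)
 have Dc: "D i k \<in> carrier Q" for i k using DG by blast
 have wc: "a k \<in> carrier Q" if "a \<in> wt_set \<mu> w" for a w k using that by (auto simp: wt_set_def)
 have "null (\<lambda>n. D n k)" for k
  unfolding null_def
 proof (intro conjI allI)
  fix c obtain w where "c \<le> \<mu> w k" using lim by blast
  hence "D n k \<in> G c" if "w \<le> n" for n using DG[OF that, of k] G_mono by blast
  thus "\<exists>N. \<forall>n\<ge>N. D n k \<in> G c" by blast
 qed (rule Dc)
 hence "\<exists>l. hsum (\<lambda>n. D n k) l" for k by (meson null_sums)
 hence "\<exists>h. \<forall>k. hsum (\<lambda>n. D n k) (h k)" by (intro choice allI)
 then obtain h where h: "\<And>k. hsum (\<lambda>n. D n k) (h k)" by blast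
 have hc: "h k \<in> carrier Q" for k using sumsD(2)[OF h] .
 have h0: "h \<in> wt_set \<mu> 0" unfolding wt_set_def using sums_G[OF h DG] by auto
 define s where "s n = (\<lambda>k. \<Oplus>i\<in>{..<n}. D i k)" for n
 have s0: "s n \<in> wt_set \<mu> 0" for n
  unfolding wt_set_def s_def by (auto intro!: G_finsum DG)
 have sc: "s n k \<in> carrier Q" for n k using wc[OF s0] .
 have sS: "s (Suc n) = (\<lambda>k. s n k \<oplus> D n k)" for n
  unfolding s_def by (simp add: finsum_lessThan_Suc Dc)
 have D0': "D n \<in> wt_set \<mu> 0" for n using DG[of 0 n] by (auto simp: wt_set_def)
 have z0: "(\<lambda>k. \<zero>) \<in> wt_set \<mu> 0" by (auto simp: wt_set_def)
 have Ec: "E a k \<in> carrier Q" if "a \<in> wt_set \<mu> w" for a w k using wc[OF E[OF that]] .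
 have Ez: "E (\<lambda>k. \<zero>) k = \<zero>" for k
 proof -
  have "E (\<lambda>k. \<zero>) k \<oplus> E (\<lambda>k. \<zero>) k = E (\<lambda>k. \<zero>) k"
   using fun_cong[OF E_add[OF z0 z0], of k] by simp
  thus ?thesis using Ec[OF z0, of k] by (metis add.r_cancel_one)
 qed
 \<comment> \<open>Telescoping: applying 1 + E to a partial sum of the Neumann series yields g minus
   the first omitted term.\<close>
 have part: "s n k \<oplus> E (s n) k = g k \<ominus> D n k" for n k
 proof (induction n)
  case 0
  show ?case using wc[OF g] by (simp add: s_def Ez D0 r_neg minus_eq)
 next
  case (Suc n)
  have "s (Suc n) k \<oplus> E (s (Suc n)) k = (s n k \<oplus> D n k) \<oplus> (E (s n) k \<oplus> E (D n) k)"
   unfolding sS using E_add[OF s0 D0'] by simp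
  also have "\<dots> = (s n k \<oplus> E (s n) k) \<oplus> (D n k \<oplus> E (D n) k)"
   using sc Dc Ec[OF s0] Ec[OF D0'] by (simp add: a_ac)
  also have "\<dots> = g k \<oplus> E (D n) k"
   unfolding Suc using Dc Ec[OF D0'] wc[OF g] by (simp add: minus_eq a_assoc r_neg1)
  finally show ?case unfolding DS using Ec[OF D0'] by (simp add: minus_eq)
 qed
 have "h k \<oplus> E h k = g k" for k
 proof (rule G_eq)
  fix c
  obtain n where n: "c \<le> \<mu> n k" using lim by blast
  \<comment> \<open>The remainder r has weight n, and E does not lower it. This is how E is carried
    past the infinite sum.\<close>
  define r where "r = (\<lambda>k. h k \<ominus> s n k)"
  have r: "r \<in> wt_set \<mu> n" unfolding r_def s_def wt_set_def using sums_tail[OF h DG] by auto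
  have r0: "r \<in> wt_set \<mu> 0" unfolding r_def wt_set_def using h0 s0[of n]
   by (auto simp: wt_set_def intro: G_diff)
  have hr: "h = (\<lambda>k. s n k \<oplus> r k)" unfolding r_def using hc sc by (auto simp: minus_eq a_ac r_neg r_neg1 r_neg2)
  have "h k \<oplus> E h k = (s n k \<oplus> r k) \<oplus> (E (s n) k \<oplus> E r k)"
   unfolding hr using E_add[OF s0 r0] by simp
  also have "\<dots> = (s n k \<oplus> E (s n) k) \<oplus> (r k \<oplus> E r k)"
   using sc wc[OF r0] Ec[OF s0] Ec[OF r0] by (simp add: a_ac)
  finally have "h k \<oplus> E h k = g k \<oplus> (r k \<oplus> E r k \<ominus> D n k)"
   unfolding part using Dc wc[OF g] wc[OF r0] Ec[OF r0] by (simp add: minus_eq a_ac)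
  hence "h k \<oplus> E h k \<ominus> g k = r k \<oplus> E r k \<ominus> D n k"
   using Dc wc[OF g] wc[OF r0] Ec[OF r0] by (simp add: add_diff_cancel_left)
  moreover have "r k \<in> G (\<mu> n k)" "E r k \<in> G (\<mu> n k)" "D n k \<in> G (\<mu> n k)"
   using r E[OF r] DG mono[of n "Suc n" k] by (auto simp: wt_set_def intro: G_mono)
  ultimately have "h k \<oplus> E h k \<ominus> g k \<in> G (\<mu> n k)" by (auto intro: G_add G_diff)
  thus "h k \<oplus> E h k \<ominus> g k \<in> G c" using n by (rule G_mono)
 qed (use hc Ec[OF h0] wc[OF g] in auto)
 thus ?thesis using that h0 by blast
qed

lemma pr_mon_right: assumes "a \<in> carrier S"
 shows "pr a (mon j) = (\<lambda>k. if k < j then \<zero> else a (k - j))"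
proof
 fix k
 note ac = S_coeff[OF assms]
 have *: "a i \<otimes> (xi ^^ i) (mon j) k = (if i = k - j then (if k < j then \<zero> else a (k - j)) else \<zero>)" for i
  using ac by (simp add: xi_pow_mon) (auto simp: mon_def)
 show "pr a (mon j) k = (if k < j then \<zero> else a (k - j))"
  by (rule sums_unique[OF pr_hsum[OF assms mon_S]], subst *) (rule sums_single, use ac in auto)
qed

end

section \<open>Ideals of power series rings over a standard filtered artinian ring\<close>

text \<open>Simplicity of Q with control of the filtration: the factors around c cost no more than
  the value v of c. This allows leading coefficients to be normalised to 1 within bounds.\<close>

locale std_ring = filtered_ring +
 assumes std: "[| c \<in> G v; c \<notin> G (v + 1) |] ==>
   \<exists>(s::nat) a b. (\<forall>l. a l \<in> G 0 \<and> b l \<in> G (- v)) \<and> (\<Oplus>l\<in>{..<s}. a l \<otimes> c \<otimes> b l) = \<one>"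
begin

lemma G_top: assumes "c \<in> carrier Q" "c \<noteq> \<zero>"
 obtains v where "c \<in> G v" "c \<notin> G (v + 1)"
proof -
 obtain c0 where c0: "c \<in> G c0" using G_exhaust assms by blast
 have "\<exists>m::nat. c \<notin> G (c0 + int m)"
 proof (rule ccontr)
  assume "\<not> ?thesis"
  hence m: "c \<in> G (c0 + int m)" for m by blast
  have "c \<in> G d" if "d \<ge> c0" for d using m[of "nat (d - c0)"] that by simp
  thus False using G_sep'[OF assms(1)] assms(2) by blast
 qed
 then obtain m where m: "c \<notin> G (c0 + int m)" "\<And>k. k < m ==> c \<in> G (c0 + int k)"
  using exists_least_iff[of "\<lambda>m. c \<notin> G (c0 + int m)"] by auto
 have "m \<noteq> 0" using m c0 by (metis add.right_neutral of_nat_0)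
 then obtain k where "m = Suc k" by (cases m) auto
 thus ?thesis using m(1) m(2)[of k] that[of "c0 + int k"] by (simp add: algebra_simps)
qed

lemma simple_sum: assumes "c \<in> carrier Q" "c \<noteq> \<zero>"
 obtains s :: nat and a b where "\<And>l. a l \<in> carrier Q" "\<And>l. b l \<in> carrier Q"
  "(\<Oplus>l\<in>{..<s}. a l \<otimes> c \<otimes> b l) = \<one>"
proof -
 obtain v where "c \<in> G v" "c \<notin> G (v + 1)" by (rule G_top[OF assms])
 then obtain s :: nat and a b where "\<forall>l. a l \<in> G 0 \<and> b l \<in> G (- v)" "(\<Oplus>l\<in>{..<s}. a l \<otimes> c \<otimes> b l) = \<one>"
  using std by blast
 thus ?thesis using that G_carrier by blast
qed

text \<open>In a relation \<Sum> a_l c b_l = 1 the element c can be moved to the right end, which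
  gives a left inverse, and to the left end, which gives a right inverse; the latter uses
  \<tau>^-1.\<close>

lemma semicentral_unit:
 assumes c: "c \<in> carrier Q" "c \<noteq> \<zero>" and \<tau>: "bij_betw \<tau> (carrier Q) (carrier Q)"
  and comm: "\<And>r. r \<in> carrier Q ==> c \<otimes> r = \<tau> r \<otimes> c"
 shows "c \<in> Units Q"
proof -
 obtain s :: nat and a b where ab: "\<And>l. a l \<in> carrier Q" "\<And>l. b l \<in> carrier Q"
  "(\<Oplus>l\<in>{..<s}. a l \<otimes> c \<otimes> b l) = \<one>" by (rule simple_sum[OF c]) (rule that)
 have \<tau>c: "r \<in> carrier Q ==> \<tau> r \<in> carrier Q" for r using bij_betwE[OF \<tau>] by blast
 define a' where "a' l = inv_into (carrier Q) \<tau> (a l)" for l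
 have im: "a l \<in> \<tau> ` carrier Q" for l using bij_betw_imp_surj_on[OF \<tau>] ab(1) by blast
 have a': "a' l \<in> carrier Q" "\<tau> (a' l) = a l" for l
  unfolding a'_def by (rule inv_into_into[OF im], rule f_inv_into_f[OF im])
 have 1: "a l \<otimes> c \<otimes> b l = (a l \<otimes> \<tau> (b l)) \<otimes> c" for l
  by (simp only: m_assoc[OF ab(1) c(1) ab(2)] comm[OF ab(2)] m_assoc[OF ab(1) \<tau>c[OF ab(2)] c(1)])
 have 2: "a l \<otimes> c \<otimes> b l = c \<otimes> (a' l \<otimes> b l)" for l
  by (simp only: m_assoc[OF c(1) a'(1) ab(2), symmetric] comm[OF a'(1)] a'(2))
 let ?g = "\<Oplus>l\<in>{..<s}. a l \<otimes> \<tau> (b l)" and ?h = "\<Oplus>l\<in>{..<s}. a' l \<otimes> b l"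
 have c1: "a l \<otimes> \<tau> (b l) \<in> carrier Q" "a' l \<otimes> b l \<in> carrier Q" for l
  by (intro m_closed ab(1) ab(2) a'(1) \<tau>c)+
 have g: "?g \<otimes> c = \<one>"
  using finsum_ldistr[of "{..<s}" c "\<lambda>l. a l \<otimes> \<tau> (b l)", OF _ c(1)] c1(1) ab(3)[unfolded 1] by fastforce
 have h: "c \<otimes> ?h = \<one>"
  using finsum_rdistr[of "{..<s}" c "\<lambda>l. a' l \<otimes> b l", OF _ c(1)] c1(2) ab(3)[unfolded 2] by fastforce
 have gh: "?g \<in> carrier Q" "?h \<in> carrier Q" using c1 by (auto intro!: finsum_closed)
 have "?g = ?h" by (rule inv_unique[OF g h c(1) gh])
 hence "?h \<otimes> c = \<one>" using g by (simp only:)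
 thus ?thesis using h gh(2) c(1) unfolding Units_def by blast
qed

end

text \<open>C = 0 and N0 = 1 are the constants of a compatible pair: \<sigma> keeps every level and
  \<delta> raises it by one.\<close>

locale compat = skew Q u \<sigma> \<delta> 0 1 + std_ring Q u
 for Q :: "('a, 'm) ring_scheme" (structure) and u \<sigma> \<delta> +
 assumes \<sigma>_near: "r \<in> G n ==> \<sigma> r \<ominus> r \<in> G (n + 1)" and \<delta>_near: "r \<in> G n ==> \<delta> r \<in> G (n + 1)"
begin

text \<open>Modulo one level more, \<sigma> is the identity and \<delta> is zero, so x becomes
  central and x^i only shifts.\<close>

lemma xi_pow_near: assumes "b \<in> bnd \<beta>"
 shows "(xi ^^ i) b k \<ominus> (if k < i then \<zero> else b (k - i)) \<in> G (\<beta> + 1)"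
proof (induction i arbitrary: k)
 case 0
 have "b k \<in> carrier Q" using assms by (auto simp: bnd_def)
 thus ?case by (simp add: r_neg minus_eq)
next
 case (Suc i)
 have xb: "(xi ^^ i) b n \<in> G \<beta>" for n using xi_pow_bnd[OF assms] by (auto simp: bnd_def)
 have bb: "b n \<in> carrier Q" for n using assms by (auto simp: bnd_def)
 show ?case
 proof (cases k)
  case 0
  thus ?thesis using \<delta>_near[OF xb[of 0]] by (simp add: xi_0 minus_eq)
 next
  case (Suc j)
  let ?y = "if j < i then \<zero> else b (j - i)"
  have "(xi ^^ Suc i) b k \<ominus> (if k < Suc i then \<zero> else b (k - Suc i)) =
    (\<sigma> ((xi ^^ i) b j) \<ominus> (xi ^^ i) b j) \<oplus> ((xi ^^ i) b j \<ominus> ?y) \<oplus> \<delta> ((xi ^^ i) b (Suc j))"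
   by (subst diff_telescope) (use G_carrier[OF xb] bb Suc in \<open>auto simp: xi_Suc\<close>)
  moreover have "\<sigma> ((xi ^^ i) b j) \<ominus> (xi ^^ i) b j \<in> G (\<beta> + 1)" by (rule \<sigma>_near[OF xb])
  moreover have "(xi ^^ i) b j \<ominus> ?y \<in> G (\<beta> + 1)" by (rule Suc.IH)
  moreover have "\<delta> ((xi ^^ i) b (Suc j)) \<in> G (\<beta> + 1)" by (rule \<delta>_near[OF xb])
  ultimately show ?thesis by (simp only:) (intro G_add)
 qed
qed

text \<open>As x is central modulo one level more, only the term i = k of the product survives
  there.\<close>

lemma pr_cst_near: assumes a: "a \<in> bnd \<alpha>" and b: "b \<in> G \<beta>"
 shows "pr a (cst b) k \<ominus> a k \<otimes> b \<in> G (\<alpha> + \<beta> + 1)"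
proof -
 have aS: "a \<in> carrier S" and bS: "cst b \<in> carrier S" using a b by auto
 have ak: "a i \<in> G \<alpha>" for i using a by (simp add: bnd_def)
 have xb: "(xi ^^ i) (cst b) n \<in> carrier Q" for i n using S_coeff[OF xi_pow_S[OF bS]] .
 let ?y = "\<lambda>i. if k < i then \<zero> else cst b (k - i)"
 have yc: "?y i \<in> carrier Q" for i using b by (auto simp: cst_eq)
 have "hsum (\<lambda>i. if i = k then a k \<otimes> b else \<zero>) (a k \<otimes> b)" using G_carrier[OF ak] b by (auto intro!: sums_single)
 moreover have "a i \<otimes> ?y i = (if i = k then a k \<otimes> b else \<zero>)" for i
  using G_carrier[OF ak] b by (auto simp: cst_eq)
 ultimately have "hsum (\<lambda>i. a i \<otimes> ?y i) (a k \<otimes> b)" by simp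
 from sums_add[OF pr_hsum[OF aS bS, of k] sums_neg[OF this]]
 have "hsum (\<lambda>i. a i \<otimes> (xi ^^ i) (cst b) k \<oplus> \<ominus> (a i \<otimes> ?y i)) (pr a (cst b) k \<ominus> a k \<otimes> b)"
  by (simp add: minus_eq)
 moreover have "a i \<otimes> (xi ^^ i) (cst b) k \<oplus> \<ominus> (a i \<otimes> ?y i) = a i \<otimes> ((xi ^^ i) (cst b) k \<ominus> ?y i)" for i
  using G_carrier[OF ak] xb yc by (simp only: minus_eq r_distr r_minus a_inv_closed)
 ultimately have h: "hsum (\<lambda>i. a i \<otimes> ((xi ^^ i) (cst b) k \<ominus> ?y i)) (pr a (cst b) k \<ominus> a k \<otimes> b)" by simp
 show ?thesis
  by (rule sums_G[OF h], rule G_mult'[OF ak xi_pow_near[OF cst_bnd[OF b]]]) auto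
qed

text \<open>Let v be the largest level with f in \<open>bnd v\<close>, and j the first index with f
  j outside \<open>G (v + 1)\<close>; this is the Weierstrass degree. The relation \<Sum> a (f j) b
  = 1 from \<open>std\<close>, applied to the whole of f, acts coefficientwise modulo
  \<open>G 1\<close>.\<close>

lemma normalised_in_ideal:
 assumes I: "ideal I S" and f: "f \<in> I" "f \<noteq> \<zero>\<^bsub>S\<^esub>"
 obtains f' j where "f' \<in> I" "f' \<in> bnd 0" "\<And>k. k < j ==> f' k \<in> G 1" "f' j \<ominus> \<one> \<in> G 1"
proof -
 interpret I: ideal I S by (rule I)
 have fS: "f \<in> carrier S" using f I.Icarr by auto
 obtain c0 where c0: "f \<in> bnd c0" using fS S_carrier by auto
 obtain n where n: "f n \<noteq> \<zero>" using f(2) by (auto simp: S_zero)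
 obtain v1 where v1: "f n \<in> G v1" "f n \<notin> G (v1 + 1)" using G_top[OF S_coeff[OF fS] n] .
 \<comment> \<open>Some coefficient is nonzero, so the levels v with f in \<open>bnd v\<close> are
   bounded above and a largest one exists.\<close>
 have "f \<notin> bnd (c0 + int (nat (v1 + 1 - c0)))"
 proof
  assume "f \<in> bnd (c0 + int (nat (v1 + 1 - c0)))"
  hence "f n \<in> G (c0 + int (nat (v1 + 1 - c0)))" by (simp add: bnd_def)
  thus False using v1(2) G_mono[of "f n" "c0 + int (nat (v1 + 1 - c0))" "v1 + 1"] by auto
 qed
 hence "\<exists>m::nat. f \<notin> bnd (c0 + int m)" by blast
 then obtain m where m: "f \<notin> bnd (c0 + int m)" "\<And>k. k < m ==> f \<in> bnd (c0 + int k)"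
  using exists_least_iff[of "\<lambda>m. f \<notin> bnd (c0 + int m)"] by auto
 have "m \<noteq> 0" using m c0 by (metis add.right_neutral of_nat_0)
 then obtain m' where "m = Suc m'" by (cases m) auto
 then obtain v where v: "f \<in> bnd v" "f \<notin> bnd (v + 1)" using m(1) m(2)[of m']
  by (metis add.assoc add.commute lessI of_nat_Suc)
 then obtain j where j: "f j \<notin> G (v + 1)" "\<And>k. k < j ==> f k \<in> G (v + 1)"
  using exists_least_iff[of "\<lambda>k. f k \<notin> G (v + 1)"] by (auto simp: bnd_def)
 have fv: "f k \<in> G v" for k using v by (simp add: bnd_def)
 obtain s :: nat and a b where ab: "\<And>l. a l \<in> G 0" "\<And>l. b l \<in> G (- v)"
  "(\<Oplus>l\<in>{..<s}. a l \<otimes> f j \<otimes> b l) = \<one>" using std[OF fv j(1)] by blast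
 define f' where "f' = (\<Oplus>\<^bsub>S\<^esub>l\<in>{..<s}. cst (a l) \<otimes>\<^bsub>S\<^esub> (f \<otimes>\<^bsub>S\<^esub> cst (b l)))"
 have tI: "cst (a l) \<otimes>\<^bsub>S\<^esub> (f \<otimes>\<^bsub>S\<^esub> cst (b l)) \<in> I" for l
  by (intro I.I_l_closed I.I_r_closed f cst_S G_carrier[OF ab(1)] G_carrier[OF ab(2)])
 have f'I: "f' \<in> I" unfolding f'_def
 proof (induction s)
  case (Suc s)
  thus ?case using tI I.Icarr by (subst S.finsum_lessThan_Suc) (auto intro!: I.a_closed)
 qed auto
 have tk: "(cst (a l) \<otimes>\<^bsub>S\<^esub> (f \<otimes>\<^bsub>S\<^esub> cst (b l))) k = a l \<otimes> pr f (cst (b l)) k" for l k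
  using G_carrier[OF ab(1)] G_carrier[OF ab(2)] fS
  by (simp add: S_mult[OF fS cst_S] cst_mult pr_closed smul_def)
 have pc: "pr f (cst (b l)) k \<in> carrier Q" for l k
  using S_coeff[OF pr_closed[OF fS cst_S[OF G_carrier[OF ab(2)]]]] .
 have f'k: "f' k = (\<Oplus>l\<in>{..<s}. a l \<otimes> pr f (cst (b l)) k)" for k
  unfolding f'_def using tI I.Icarr by (subst S_finsum) (auto simp: tk)
 \<comment> \<open>Modulo \<open>G 1\<close> the constants b l pass through the powers of x.\<close>
 have near: "f' k \<ominus> (\<Oplus>l\<in>{..<s}. a l \<otimes> f k \<otimes> b l) \<in> G 1" for k
 proof -
  have "f' k \<ominus> (\<Oplus>l\<in>{..<s}. a l \<otimes> f k \<otimes> b l) =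
    (\<Oplus>l\<in>{..<s}. a l \<otimes> (pr f (cst (b l)) k \<ominus> f k \<otimes> b l))"
  proof -
   have e: "a l \<otimes> (pr f (cst (b l)) k \<ominus> f k \<otimes> b l) = a l \<otimes> pr f (cst (b l)) k \<ominus> a l \<otimes> f k \<otimes> b l" for l
    using ab pc fv[of k] G_carrier[OF ab(1)] G_carrier[OF ab(2)]
    by (simp add: minus_eq r_distr r_minus m_assoc)
   show ?thesis unfolding f'k e
    by (rule finsum_diff) (use G_carrier[OF ab(1)] G_carrier[OF ab(2)] pc G_carrier[OF fv] in auto)
  qed
  also have "\<dots> \<in> G 1"
   using pr_cst_near[OF v(1) ab(2)] ab(1) by (auto intro!: G_finsum G_mult')
  finally show ?thesis .
 qed
 have sc: "(\<Oplus>l\<in>{..<s}. a l \<otimes> f k \<otimes> b l) \<in> G c" if "f k \<in> G (c + v)" for k c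
  using ab by (intro G_finsum G_mult'[of _ "c + v" _ "- v"] G_mult'[of _ 0 _ "c + v"] that) auto
 have f'c: "f' k \<in> carrier Q" for k using f'I I.Icarr S_coeff by blast
 show ?thesis
 proof (rule that[OF f'I])
  have "f' k \<in> G 0" for k
   by (rule G_diff_cancel[OF G_mono[OF near] sc[of k 0] f'c]) (use fv in auto)
  thus "f' \<in> bnd 0" by (simp add: bnd_def)
  show "f' k \<in> G 1" if "k < j" for k
   by (rule G_diff_cancel[OF near sc[of k 1] f'c]) (use j(2)[OF that] in \<open>simp add: add.commute\<close>)
  show "f' j \<ominus> \<one> \<in> G 1" using near[of j] ab(3) by simp
 qed
qed

text \<open>The ceiling of x / M: the least level whose weight M c reaches x.\<close>

definition cdiv :: "int \<Rightarrow> int \<Rightarrow> int" where "cdiv M x = - ((- x) div M)"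

lemma cdiv_le: "0 < M ==> cdiv M x \<le> c \<longleftrightarrow> x \<le> M * c"
proof -
 assume M: "0 < M"
 define q r where "q = (- x) div M" and "r = (- x) mod M"
 have qr: "- x = q * M + r" "0 \<le> r" "r < M" using M by (auto simp: q_def r_def)
 have "- c \<le> q \<longleftrightarrow> - c * M \<le> - x"
 proof
  assume "- c \<le> q"
  hence "- c * M \<le> q * M" using M by (intro mult_right_mono) auto
  thus "- c * M \<le> - x" using qr by linarith
 next
  assume *: "- c * M \<le> - x"
  show "- c \<le> q"
  proof (rule ccontr)
   assume "\<not> - c \<le> q"
   hence "(q + 1) * M \<le> - c * M" using M by (intro mult_right_mono) auto
   thus False using * qr by (simp add: algebra_simps)
  qed
 qed
 thus ?thesis by (auto simp: cdiv_def q_def[symmetric] mult.commute)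
qed

end

section \<open>Weierstrass division\<close>

context compat begin

lemma G_cdiv_mult: assumes "0 < M" "a \<in> G (cdiv M x)" "b \<in> G (cdiv M y)" "z \<le> x + y"
 shows "a \<otimes> b \<in> G (cdiv M z)"
proof (rule G_mult'[OF assms(2,3)])
 have "x \<le> M * cdiv M x" "y \<le> M * cdiv M y" using cdiv_le[OF assms(1)] by blast+
 hence "z \<le> M * (cdiv M x + cdiv M y)" using assms(4) by (simp add: distrib_left)
 thus "cdiv M z \<le> cdiv M x + cdiv M y" using cdiv_le[OF assms(1)] by blast
qed

text \<open>Series of weight at least \<open>w\<close>, where \<open>x\<close> has weight 1 and \<open>G c\<close> has weight \<open>M c\<close>.\<close>

definition heavy :: "int \<Rightarrow> int \<Rightarrow> (nat \<Rightarrow> 'a) set" where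
 "heavy M w = {b. \<forall>k. b k \<in> G 0 \<and> b k \<in> G (cdiv M (w - int k))}"

text \<open>The \<sigma>-part gains 1 from the extra x; the \<delta>-part gains a level of the
  filtration, worth M \<ge> 1.\<close>

lemma xi_heavy: assumes M: "0 < M" and b: "b \<in> heavy M w" shows "xi b \<in> heavy M (w + 1)"
proof -
 have b0: "b k \<in> G 0" and bw: "b k \<in> G (cdiv M (w - int k))" for k using b by (auto simp: heavy_def)
 have sG: "\<sigma> q \<in> G c" if "q \<in> G c" for q c using \<sigma>_G[OF that] by simp
 have dG: "\<delta> (b k) \<in> G (cdiv M (w + 1 - int k))" for k
 proof (rule G_mono[OF \<delta>_near[OF bw]])
  have "w - int k \<le> M * cdiv M (w - int k)" using cdiv_le[OF M] by blast
  hence "w + 1 - int k \<le> M * (cdiv M (w - int k) + 1)" using M by (simp add: distrib_left)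
  thus "cdiv M (w + 1 - int k) \<le> cdiv M (w - int k) + 1" using cdiv_le[OF M] by blast
 qed
 have d0: "\<delta> (b k) \<in> G 0" for k using \<delta>_G[OF b0[of k]] by simp
 have "xi b k \<in> G 0 \<and> xi b k \<in> G (cdiv M (w + 1 - int k))" for k
 proof (cases k)
  case 0
  thus ?thesis using d0 dG[of 0] by (simp add: xi_0)
 next
  case (Suc j)
  have "\<sigma> (b j) \<in> G (cdiv M (w + 1 - int (Suc j)))" using sG[OF bw[of j]] by simp
  thus ?thesis unfolding Suc xi_Suc using d0 dG[of "Suc j"] sG[OF b0[of j]] by (auto intro!: G_add)
 qed
 thus ?thesis by (auto simp: heavy_def)
qed

lemma xi_pow_heavy: "0 < M ==> b \<in> heavy M w ==> (xi ^^ i) b \<in> heavy M (w + int i)"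
proof (induction i)
 case (Suc i)
 from xi_heavy[OF Suc.prems(1) Suc.IH[OF Suc.prems]] show ?case by (simp add: ac_simps)
qed simp

lemma G_max: "a \<in> G (max c d) \<longleftrightarrow> a \<in> G c \<and> a \<in> G d"
 by (auto simp: max_def intro: G_mono)

text \<open>Put d = f - x^j and write the unknowns as one series h = g x^j + r. The equation g f + r
  = x^j becomes h + g d = x^j, where g is h shifted down by j; a Neumann series solves it.\<close>

lemma weierstrass:
 assumes f: "f \<in> bnd 0" "\<And>k. k < j ==> f k \<in> G 1" "f j \<ominus> \<one> \<in> G 1"
 obtains g r where "g \<in> carrier S" "\<And>k. r k \<in> carrier Q"
  "(\<lambda>k. (g \<otimes>\<^bsub>S\<^esub> f) k \<oplus> (if k < j then r k else \<zero>)) = mon j"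
proof -
 \<comment> \<open>With this M all of d has weight at least M: its coefficients up to index j lie in
   \<open>G 1\<close>, and above j the power of x alone contributes j + 1.\<close>
 define M where "M = int j + 1"
 have M: "0 < M" by (simp add: M_def)
 define d where "d = f \<ominus>\<^bsub>S\<^esub> mon j"
 have fS: "f \<in> carrier S" using f by auto
 have dS: "d \<in> carrier S" using fS by (simp add: d_def)
 have fk: "f k \<in> G 0" for k using f(1) by (simp add: bnd_def)
 have dk: "d k = f k \<ominus> mon j k" for k using fS by (simp add: d_def S_diff)
 have dh: "d \<in> heavy M M"
 proof -
  have d0: "d k \<in> G 0" for k unfolding dk using fk mon_bnd[of j] by (auto simp: bnd_def intro: G_diff)
  have "d k \<in> G (cdiv M (M - int k))" for k
  proof (cases "k \<le> j")
   case True
   have "d k \<in> G 1" using True f(2)[of k] f(3) unfolding dk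
    by (cases "k = j") (auto simp: mon_def minus_eq)
   moreover have "cdiv M (M - int k) \<le> 1" using M cdiv_le[OF M] by simp
   ultimately show ?thesis by (rule G_mono)
  next
   case False
   hence "cdiv M (M - int k) \<le> 0" using M cdiv_le[OF M] by (simp add: M_def)
   thus ?thesis by (rule G_mono[OF d0])
  qed
  thus ?thesis using d0 by (simp add: heavy_def)
 qed
 \<comment> \<open>The maximum with 0 keeps the coefficients in \<open>G 0\<close>, hence the series
   in \<open>S\<close>.\<close>
 define \<mu> where "\<mu> w k = max 0 (cdiv M (int w - int k))" for w k :: nat
 define E where "E h = pr (\<lambda>k. h (k + j)) d" for h
 have wt: "h \<in> wt_set \<mu> w \<longleftrightarrow> h \<in> heavy M (int w)" for h w
  by (auto simp: wt_set_def \<mu>_def heavy_def G_max)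
 have hS: "h \<in> carrier S" if "h \<in> heavy M w" for h w
  using that by (auto simp: heavy_def bnd_def intro!: bnd_S[of h 0])
 have tS: "(\<lambda>k. h (k + j)) \<in> carrier S" if "h \<in> heavy M w" for h w
  using that by (auto simp: heavy_def bnd_def intro!: bnd_S[of _ 0])
 have cm: "cdiv M x \<le> cdiv M y" if "x \<le> y" for x y
 proof -
  have "y \<le> M * cdiv M y" using cdiv_le[OF M] by blast
  thus ?thesis using that cdiv_le[OF M] by (meson order.trans)
 qed
 have "\<exists>h\<in>wt_set \<mu> 0. (\<lambda>k. h k \<oplus> E h k) = mon j"
 proof -
  have "c \<le> \<mu> (nat (M * c) + k) k" for c k
  proof -
   have "\<not> cdiv M (M * c) \<le> c - 1" unfolding cdiv_le[OF M] using M by (simp add: algebra_simps)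
   hence "c \<le> cdiv M (M * c)" by linarith
   moreover have "cdiv M (M * c) \<le> cdiv M (int (nat (M * c) + k) - int k)" by (rule cm) auto
   ultimately show ?thesis unfolding \<mu>_def by linarith
  qed
  hence lim: "\<exists>w. c \<le> \<mu> w k" for c k by blast
  have mono: "\<mu> w k \<le> \<mu> w' k" if "w \<le> w'" for w w' k
   using cm[of "int w - int k" "int w' - int k"] that by (auto simp: \<mu>_def max_def)
  \<comment> \<open>Shifting down by j loses weight j and the factor d brings M = j + 1, so E gains
    1.\<close>
  have step: "E h \<in> wt_set \<mu> (Suc w)" if "h \<in> wt_set \<mu> w" for w h
  proof -
   have hh: "h \<in> heavy M (int w)" using that wt by blast
   have xd: "(xi ^^ i) d \<in> heavy M (M + int i)" for i by (rule xi_pow_heavy[OF M dh])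
   have "E h k \<in> G 0 \<and> E h k \<in> G (cdiv M (int (Suc w) - int k))" for k
   proof -
    have hs: "hsum (\<lambda>i. h (i + j) \<otimes> (xi ^^ i) d k) (E h k)"
     unfolding E_def by (rule pr_hsum[OF tS[OF hh] dS])
    have t0: "h (i + j) \<otimes> (xi ^^ i) d k \<in> G 0" for i
     by (rule G_mult'[of _ 0 _ 0]) (use hh xd[of i] in \<open>auto simp: heavy_def\<close>)
    have "h (i + j) \<otimes> (xi ^^ i) d k \<in> G (cdiv M (int (Suc w) - int k))" for i
    proof (rule G_cdiv_mult[OF M])
     show "h (i + j) \<in> G (cdiv M (int w - int (i + j)))" using hh unfolding heavy_def by blast
     show "(xi ^^ i) d k \<in> G (cdiv M (M + int i - int k))" using xd[of i] by (simp add: heavy_def)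
    qed (simp add: M_def)
    thus ?thesis using sums_G[OF hs] t0 by blast
   qed
   thus ?thesis by (simp only: wt heavy_def mem_Collect_eq) blast
  qed
  have add: "E (\<lambda>k. a k \<oplus> b k) = (\<lambda>k. E a k \<oplus> E b k)"
   if "a \<in> wt_set \<mu> 0" "b \<in> wt_set \<mu> 0" for a b
   unfolding E_def using that tS dS unfolding wt by (intro pr_add_left) auto
  have "mon j \<in> wt_set \<mu> 0" unfolding wt heavy_def mem_Collect_eq
  proof
   fix k
   have 0: "mon j k \<in> G 0" using mon_bnd[of j] by (simp add: bnd_def)
   have "cdiv M (int 0 - int k) \<le> 0" by (simp add: cdiv_le[OF M])
   thus "mon j k \<in> G 0 \<and> mon j k \<in> G (cdiv M (int 0 - int k))" using 0 G_mono by blast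
  qed
  from neumann[of \<mu> E "mon j", OF lim mono step add this] show ?thesis by blast
 qed
 then obtain h where h: "h \<in> wt_set \<mu> 0" "(\<lambda>k. h k \<oplus> E h k) = mon j" by blast
 have hh: "h \<in> heavy M 0" using h(1) wt[of h 0] by simp
 let ?g = "\<lambda>k. h (k + j)"
 have hc: "h k \<in> carrier Q" for k using hh by (auto simp: heavy_def)
 have gS: "?g \<in> carrier S" by (rule tS[OF hh])
 have "f = d \<oplus>\<^bsub>S\<^esub> mon j" unfolding d_def using fS by (simp add: S.minus_eq S.a_assoc S.l_neg)
 hence "?g \<otimes>\<^bsub>S\<^esub> f = ?g \<otimes>\<^bsub>S\<^esub> d \<oplus>\<^bsub>S\<^esub> ?g \<otimes>\<^bsub>S\<^esub> mon j" using gS dS by (simp add: S.r_distr)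
 also have "\<dots> = (\<lambda>k. E h k \<oplus> (if k < j then \<zero> else h k))"
  using gS dS by (simp add: S_add S_mult pr_mon_right E_def fun_eq_iff)
 finally have gf: "?g \<otimes>\<^bsub>S\<^esub> f = (\<lambda>k. E h k \<oplus> (if k < j then \<zero> else h k))" .
 have Ec: "E h k \<in> carrier Q" for k unfolding E_def by (rule S_coeff[OF pr_closed[OF gS dS]])
 have "(?g \<otimes>\<^bsub>S\<^esub> f) k \<oplus> (if k < j then h k else \<zero>) = mon j k" for k
  using fun_cong[OF h(2), of k] hc[of k] Ec[of k] S_coeff[OF mon_S, of j k] by (simp add: gf a_comm)
 thus ?thesis by (intro that[of ?g h] gS hc ext)
qed

end

section \<open>Inner derivations and polynomials in y = x - t\<close>

locale skew_inner = skew Q u \<sigma> \<delta> C N0 for Q :: "('a, 'm) ring_scheme" (structure) and u \<sigma> \<delta> C N0 +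
 fixes t :: 'a
 assumes t_closed [simp, intro]: "t \<in> carrier Q" and \<sigma>_t [simp]: "\<sigma> t = t"
  and \<delta>_eq: "q \<in> carrier Q ==> \<delta> q = t \<otimes> q \<ominus> \<sigma> q \<otimes> t"
begin

definition y :: "nat \<Rightarrow> 'a" where "y = mon 1 \<ominus>\<^bsub>S\<^esub> cst t"

lemma y_S [simp, intro]: "y \<in> carrier S" by (simp add: y_def)

lemma \<delta>_t [simp]: "\<delta> t = \<zero>" by (simp add: \<delta>_eq minus_eq r_neg)

text \<open>As \<delta> is inner by t, subtracting t from x cancels the derivation and leaves pure
  skew commutation.\<close>

lemma y_cst: assumes q: "q \<in> carrier Q" shows "y \<otimes>\<^bsub>S\<^esub> cst q = cst (\<sigma> q) \<otimes>\<^bsub>S\<^esub> y"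
proof -
 have "cst (\<delta> q) = cst t \<otimes>\<^bsub>S\<^esub> cst q \<ominus>\<^bsub>S\<^esub> cst (\<sigma> q) \<otimes>\<^bsub>S\<^esub> cst t"
  using q by (simp add: \<delta>_eq cst_cst minus_eq S.minus_eq cst_add cst_minus)
 hence "mon 1 \<otimes>\<^bsub>S\<^esub> cst q = cst (\<sigma> q) \<otimes>\<^bsub>S\<^esub> mon 1 \<oplus>\<^bsub>S\<^esub> (cst t \<otimes>\<^bsub>S\<^esub> cst q \<ominus>\<^bsub>S\<^esub> cst (\<sigma> q) \<otimes>\<^bsub>S\<^esub> cst t)"
  using var_cst[OF q] by simp
 hence "y \<otimes>\<^bsub>S\<^esub> cst q = cst (\<sigma> q) \<otimes>\<^bsub>S\<^esub> mon 1 \<oplus>\<^bsub>S\<^esub> (cst t \<otimes>\<^bsub>S\<^esub> cst q \<ominus>\<^bsub>S\<^esub> cst (\<sigma> q) \<otimes>\<^bsub>S\<^esub> cst t)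
   \<ominus>\<^bsub>S\<^esub> cst t \<otimes>\<^bsub>S\<^esub> cst q"
  unfolding y_def using q by (simp only: S.minus_eq S.l_distr S.l_minus mon_S cst_S t_closed S.a_inv_closed S.m_closed)
 also have "\<dots> = cst (\<sigma> q) \<otimes>\<^bsub>S\<^esub> mon 1 \<ominus>\<^bsub>S\<^esub> cst (\<sigma> q) \<otimes>\<^bsub>S\<^esub> cst t"
 proof -
  have "a \<oplus>\<^bsub>S\<^esub> (b \<ominus>\<^bsub>S\<^esub> c) \<ominus>\<^bsub>S\<^esub> b = a \<ominus>\<^bsub>S\<^esub> c" if "a \<in> carrier S" "b \<in> carrier S" "c \<in> carrier S" for a b c
   using that S.add_diff_cancel_left[of b "a \<ominus>\<^bsub>S\<^esub> c"] by (simp add: S.minus_eq S.a_ac)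
  thus ?thesis using q by simp
 qed
 also have "\<dots> = cst (\<sigma> q) \<otimes>\<^bsub>S\<^esub> y"
  unfolding y_def using q by (simp only: S.minus_eq S.r_distr S.r_minus mon_S cst_S t_closed S.a_inv_closed S.m_closed \<sigma>_closed)
 finally show ?thesis .
qed

lemma y_pow_cst: "q \<in> carrier Q ==> y [^]\<^bsub>S\<^esub> (n::nat) \<otimes>\<^bsub>S\<^esub> cst q = cst ((\<sigma> ^^ n) q) \<otimes>\<^bsub>S\<^esub> y [^]\<^bsub>S\<^esub> n"
proof (induction n arbitrary: q)
 case (Suc n)
 have "y [^]\<^bsub>S\<^esub> Suc n \<otimes>\<^bsub>S\<^esub> cst q = y [^]\<^bsub>S\<^esub> n \<otimes>\<^bsub>S\<^esub> (y \<otimes>\<^bsub>S\<^esub> cst q)"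
  using Suc.prems by (simp add: S.m_assoc)
 also have "\<dots> = (y [^]\<^bsub>S\<^esub> n \<otimes>\<^bsub>S\<^esub> cst (\<sigma> q)) \<otimes>\<^bsub>S\<^esub> y"
  using Suc.prems by (simp add: y_cst S.m_assoc)
 also have "\<dots> = cst ((\<sigma> ^^ Suc n) q) \<otimes>\<^bsub>S\<^esub> y [^]\<^bsub>S\<^esub> Suc n"
  using Suc.IH[of "\<sigma> q"] Suc.prems by (simp add: S.m_assoc funpow_swap1)
 finally show ?case .
qed simp

lemma var_y: "mon 1 = y \<oplus>\<^bsub>S\<^esub> cst t"
 by (simp add: y_def S.minus_eq S.a_assoc S.l_neg)

text \<open>Left polynomials in y of degree below n. In y, unlike in x, right multiplication by a
  constant acts on each monomial separately.\<close>

definition span :: "nat \<Rightarrow> (nat \<Rightarrow> 'a) set" where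
 "span n = {\<Oplus>\<^bsub>S\<^esub>i\<in>{..<n}. cst (c i) \<otimes>\<^bsub>S\<^esub> y [^]\<^bsub>S\<^esub> i | c. \<forall>i. c i \<in> carrier Q}"

lemma span_S: "p \<in> span n ==> p \<in> carrier S"
 unfolding span_def by (auto intro!: S.finsum_closed)

lemma span_zero: "\<zero>\<^bsub>S\<^esub> \<in> span n"
 unfolding span_def by (auto intro!: exI[of _ "\<lambda>_. \<zero>"] simp: cst_zero S.finsum_zero)

lemma span_add: assumes "p \<in> span n" "p' \<in> span n" shows "p \<oplus>\<^bsub>S\<^esub> p' \<in> span n"
proof -
 obtain c c' where c: "\<And>i. c i \<in> carrier Q" "\<And>i. c' i \<in> carrier Q"
  "p = (\<Oplus>\<^bsub>S\<^esub>i\<in>{..<n}. cst (c i) \<otimes>\<^bsub>S\<^esub> y [^]\<^bsub>S\<^esub> i)" "p' = (\<Oplus>\<^bsub>S\<^esub>i\<in>{..<n}. cst (c' i) \<otimes>\<^bsub>S\<^esub> y [^]\<^bsub>S\<^esub> i)"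
  using assms unfolding span_def by blast
 have "p \<oplus>\<^bsub>S\<^esub> p' = (\<Oplus>\<^bsub>S\<^esub>i\<in>{..<n}. cst (c i) \<otimes>\<^bsub>S\<^esub> y [^]\<^bsub>S\<^esub> i \<oplus>\<^bsub>S\<^esub> cst (c' i) \<otimes>\<^bsub>S\<^esub> y [^]\<^bsub>S\<^esub> i)"
  unfolding c(3,4) using c(1,2) by (intro S.finsum_addf[symmetric]) auto
 also have "\<dots> = (\<Oplus>\<^bsub>S\<^esub>i\<in>{..<n}. cst (c i \<oplus> c' i) \<otimes>\<^bsub>S\<^esub> y [^]\<^bsub>S\<^esub> i)"
  using c(1,2) by (simp add: cst_add S.l_distr)
 finally show ?thesis unfolding span_def using c(1,2)
  by (intro CollectI exI[of _ "\<lambda>i. c i \<oplus> c' i"]) auto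
qed

lemma span_Suc: "p \<in> span (Suc n) \<longleftrightarrow> (\<exists>p'\<in>span n. \<exists>q\<in>carrier Q. p = p' \<oplus>\<^bsub>S\<^esub> cst q \<otimes>\<^bsub>S\<^esub> y [^]\<^bsub>S\<^esub> n)"
proof
 assume "p \<in> span (Suc n)"
 then obtain c where c: "\<And>i. c i \<in> carrier Q"
  "p = (\<Oplus>\<^bsub>S\<^esub>i\<in>{..<Suc n}. cst (c i) \<otimes>\<^bsub>S\<^esub> y [^]\<^bsub>S\<^esub> i)" unfolding span_def by blast
 have "p = (\<Oplus>\<^bsub>S\<^esub>i\<in>{..<n}. cst (c i) \<otimes>\<^bsub>S\<^esub> y [^]\<^bsub>S\<^esub> i) \<oplus>\<^bsub>S\<^esub> cst (c n) \<otimes>\<^bsub>S\<^esub> y [^]\<^bsub>S\<^esub> n"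
  unfolding c(2) using c(1) by (intro S.finsum_lessThan_Suc) auto
 thus "\<exists>p'\<in>span n. \<exists>q\<in>carrier Q. p = p' \<oplus>\<^bsub>S\<^esub> cst q \<otimes>\<^bsub>S\<^esub> y [^]\<^bsub>S\<^esub> n"
  using c(1) unfolding span_def by blast
next
 assume "\<exists>p'\<in>span n. \<exists>q\<in>carrier Q. p = p' \<oplus>\<^bsub>S\<^esub> cst q \<otimes>\<^bsub>S\<^esub> y [^]\<^bsub>S\<^esub> n"
 then obtain c q where c: "\<And>i. c i \<in> carrier Q" "q \<in> carrier Q"
  "p = (\<Oplus>\<^bsub>S\<^esub>i\<in>{..<n}. cst (c i) \<otimes>\<^bsub>S\<^esub> y [^]\<^bsub>S\<^esub> i) \<oplus>\<^bsub>S\<^esub> cst q \<otimes>\<^bsub>S\<^esub> y [^]\<^bsub>S\<^esub> n"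
  unfolding span_def by blast
 let ?c = "c(n := q)"
 have "(\<Oplus>\<^bsub>S\<^esub>i\<in>{..<Suc n}. cst (?c i) \<otimes>\<^bsub>S\<^esub> y [^]\<^bsub>S\<^esub> i) =
   (\<Oplus>\<^bsub>S\<^esub>i\<in>{..<n}. cst (?c i) \<otimes>\<^bsub>S\<^esub> y [^]\<^bsub>S\<^esub> i) \<oplus>\<^bsub>S\<^esub> cst (?c n) \<otimes>\<^bsub>S\<^esub> y [^]\<^bsub>S\<^esub> n"
  using c(1,2) by (intro S.finsum_lessThan_Suc) auto
 also have "(\<Oplus>\<^bsub>S\<^esub>i\<in>{..<n}. cst (?c i) \<otimes>\<^bsub>S\<^esub> y [^]\<^bsub>S\<^esub> i) = (\<Oplus>\<^bsub>S\<^esub>i\<in>{..<n}. cst (c i) \<otimes>\<^bsub>S\<^esub> y [^]\<^bsub>S\<^esub> i)"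
  using c(1) by (intro S.finsum_cong') auto
 finally have "p = (\<Oplus>\<^bsub>S\<^esub>i\<in>{..<Suc n}. cst (?c i) \<otimes>\<^bsub>S\<^esub> y [^]\<^bsub>S\<^esub> i)" using c(3) by simp
 thus "p \<in> span (Suc n)" unfolding span_def using c(1,2) by (intro CollectI exI[of _ ?c]) auto
qed

lemma span_0: "p \<in> span 0 \<longleftrightarrow> p = \<zero>\<^bsub>S\<^esub>" unfolding span_def by auto

lemma span_mono1: assumes "p \<in> span n" shows "p \<in> span (Suc n)"
proof -
 have "p = p \<oplus>\<^bsub>S\<^esub> cst \<zero> \<otimes>\<^bsub>S\<^esub> y [^]\<^bsub>S\<^esub> n" using span_S[OF assms] by (simp add: cst_zero)
 thus ?thesis unfolding span_Suc using assms by blast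
qed

lemma span_cst: "p \<in> span n ==> q \<in> carrier Q ==> cst q \<otimes>\<^bsub>S\<^esub> p \<in> span n"
proof (induction n arbitrary: p)
 case (Suc n)
 then obtain p' r where p': "p' \<in> span n" "r \<in> carrier Q" "p = p' \<oplus>\<^bsub>S\<^esub> cst r \<otimes>\<^bsub>S\<^esub> y [^]\<^bsub>S\<^esub> n"
  unfolding span_Suc by blast
 have "cst q \<otimes>\<^bsub>S\<^esub> p = cst q \<otimes>\<^bsub>S\<^esub> p' \<oplus>\<^bsub>S\<^esub> cst (q \<otimes> r) \<otimes>\<^bsub>S\<^esub> y [^]\<^bsub>S\<^esub> n"
  using p' Suc.prems span_S[OF p'(1)] by (simp add: S.r_distr S.m_assoc[symmetric] cst_cst)
 thus ?case unfolding span_Suc using Suc.IH[OF p'(1) Suc.prems(2)] p'(2) Suc.prems(2) by blast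
qed (simp add: span_0)

lemma span_rcst: "p \<in> span n ==> q \<in> carrier Q ==> p \<otimes>\<^bsub>S\<^esub> cst q \<in> span n"
proof (induction n arbitrary: p)
 case (Suc n)
 then obtain p' r where p': "p' \<in> span n" "r \<in> carrier Q" "p = p' \<oplus>\<^bsub>S\<^esub> cst r \<otimes>\<^bsub>S\<^esub> y [^]\<^bsub>S\<^esub> n"
  unfolding span_Suc by blast
 have "p \<otimes>\<^bsub>S\<^esub> cst q = p' \<otimes>\<^bsub>S\<^esub> cst q \<oplus>\<^bsub>S\<^esub> cst r \<otimes>\<^bsub>S\<^esub> (y [^]\<^bsub>S\<^esub> n \<otimes>\<^bsub>S\<^esub> cst q)"
  using p' Suc.prems span_S[OF p'(1)] by (simp add: S.l_distr S.m_assoc)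
 also have "\<dots> = p' \<otimes>\<^bsub>S\<^esub> cst q \<oplus>\<^bsub>S\<^esub> cst (r \<otimes> (\<sigma> ^^ n) q) \<otimes>\<^bsub>S\<^esub> y [^]\<^bsub>S\<^esub> n"
  using p'(2) Suc.prems(2) by (simp add: y_pow_cst S.m_assoc[symmetric] cst_cst)
 finally show ?case unfolding span_Suc using Suc.IH[OF p'(1) Suc.prems(2)] p'(2) Suc.prems(2) by blast
qed (simp add: span_0)

lemma span_y: "p \<in> span n ==> p \<otimes>\<^bsub>S\<^esub> y \<in> span (Suc n)"
proof (induction n arbitrary: p)
 case (Suc n)
 then obtain p' r where p': "p' \<in> span n" "r \<in> carrier Q" "p = p' \<oplus>\<^bsub>S\<^esub> cst r \<otimes>\<^bsub>S\<^esub> y [^]\<^bsub>S\<^esub> n"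
  unfolding span_Suc by blast
 have "p \<otimes>\<^bsub>S\<^esub> y = p' \<otimes>\<^bsub>S\<^esub> y \<oplus>\<^bsub>S\<^esub> cst r \<otimes>\<^bsub>S\<^esub> y [^]\<^bsub>S\<^esub> Suc n"
  using p' span_S[OF p'(1)] by (simp add: S.l_distr S.m_assoc)
 thus ?case unfolding span_Suc[of _ "Suc n"] using Suc.IH[OF p'(1)] p'(2) by blast
next
 case 0
 thus ?case using span_zero by (simp add: span_0)
qed

text \<open>Expand (y + t)^k; t commutes with y because \<sigma> t = t.\<close>

lemma mon_monic: "\<exists>p\<in>span k. mon k = y [^]\<^bsub>S\<^esub> k \<oplus>\<^bsub>S\<^esub> p"
proof (induction k)
 case 0
 show ?case using S_one_mon by (intro bexI[of _ "\<zero>\<^bsub>S\<^esub>"]) (auto simp: span_zero)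
next
 case (Suc k)
 then obtain p where p: "p \<in> span k" "mon k = y [^]\<^bsub>S\<^esub> k \<oplus>\<^bsub>S\<^esub> p" by blast
 note pS = span_S[OF p(1)]
 have "mon (Suc k) = mon k \<otimes>\<^bsub>S\<^esub> mon 1" using mon_pow[of k] mon_pow[of "Suc k"] by simp
 also have "\<dots> = (y [^]\<^bsub>S\<^esub> k \<oplus>\<^bsub>S\<^esub> p) \<otimes>\<^bsub>S\<^esub> (y \<oplus>\<^bsub>S\<^esub> cst t)" unfolding p(2) var_y ..
 also have "\<dots> = y [^]\<^bsub>S\<^esub> Suc k \<oplus>\<^bsub>S\<^esub> (y [^]\<^bsub>S\<^esub> k \<otimes>\<^bsub>S\<^esub> cst t \<oplus>\<^bsub>S\<^esub> (p \<otimes>\<^bsub>S\<^esub> y \<oplus>\<^bsub>S\<^esub> p \<otimes>\<^bsub>S\<^esub> cst t))"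
  using pS by (simp add: S.l_distr S.r_distr S.a_ac)
 finally have e: "mon (Suc k) = \<dots>" .
 have 1: "y [^]\<^bsub>S\<^esub> k \<otimes>\<^bsub>S\<^esub> cst t \<in> span (Suc k)"
 proof -
  have "(\<sigma> ^^ k) t = t" by (induction k) auto
  hence "y [^]\<^bsub>S\<^esub> k \<otimes>\<^bsub>S\<^esub> cst t = \<zero>\<^bsub>S\<^esub> \<oplus>\<^bsub>S\<^esub> cst t \<otimes>\<^bsub>S\<^esub> y [^]\<^bsub>S\<^esub> k" by (simp add: y_pow_cst)
  thus ?thesis unfolding span_Suc using span_zero t_closed by blast
 qed
 have 2: "p \<otimes>\<^bsub>S\<^esub> y \<oplus>\<^bsub>S\<^esub> p \<otimes>\<^bsub>S\<^esub> cst t \<in> span (Suc k)"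
  by (intro span_add span_y span_mono1 span_rcst p t_closed)
 show ?case using e span_add[OF 1 2] by blast
qed

lemma poly_span: assumes "\<And>k. r k \<in> carrier Q"
 shows "(\<lambda>k. if k < j then r k else \<zero>) \<in> span j"
proof (induction j)
 case 0
 show ?case by (simp add: span_0 S_zero)
next
 case (Suc j)
 obtain p where p: "p \<in> span j" "mon j = y [^]\<^bsub>S\<^esub> j \<oplus>\<^bsub>S\<^esub> p" using mon_monic by blast
 have "mon j \<in> span (Suc j)"
 proof -
  have "mon j = p \<oplus>\<^bsub>S\<^esub> cst \<one> \<otimes>\<^bsub>S\<^esub> y [^]\<^bsub>S\<^esub> j" using p span_S[OF p(1)] by (simp add: cst_one S.a_comm)
  thus ?thesis unfolding span_Suc using p(1) by blast
 qed
 hence "cst (r j) \<otimes>\<^bsub>S\<^esub> mon j \<in> span (Suc j)" using assms by (rule span_cst)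
 from span_add[OF span_mono1[OF Suc] this]
 have "(\<lambda>k. if k < j then r k else \<zero>) \<oplus>\<^bsub>S\<^esub> cst (r j) \<otimes>\<^bsub>S\<^esub> mon j \<in> span (Suc j)" .
 moreover have "(\<lambda>k. if k < j then r k else \<zero>) \<oplus>\<^bsub>S\<^esub> cst (r j) \<otimes>\<^bsub>S\<^esub> mon j = (\<lambda>k. if k < Suc j then r k else \<zero>)"
  using assms cst_mult[OF assms mon_S] less_Suc_eq by (auto simp: S_add smul_def mon_def fun_eq_iff)
 ultimately show ?case by simp
qed

end

text \<open>\<open>outer\<close> is the form in which outerness is used: by
  \<open>semicentral_unit\<close> a nonzero c with c r = \<sigma>^n(r) c would be a unit, and
  \<sigma>^n would be conjugation by it.\<close>

locale compat_outer = compat Q u \<sigma> \<delta> + skew_inner Q u \<sigma> \<delta> 0 1 t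
 for Q :: "('a, 'm) ring_scheme" (structure) and u \<sigma> \<delta> t +
 assumes outer: "[| 0 < n; c \<in> carrier Q; \<And>r. r \<in> carrier Q ==> c \<otimes> r = (\<sigma> ^^ n) r \<otimes> c |] ==> c = \<zero>"
begin

lemma \<sigma>_pow_surj: "b \<in> carrier Q ==> \<exists>b'\<in>carrier Q. (\<sigma> ^^ i) b' = b"
proof (induction i arbitrary: b)
 case (Suc i)
 obtain b1 where "b1 \<in> carrier Q" "\<sigma> b1 = b"
  using \<sigma>_bij Suc.prems unfolding bij_betw_def by (metis imageE)
 moreover then obtain b2 where "b2 \<in> carrier Q" "(\<sigma> ^^ i) b2 = b1" using Suc.IH by blast
 ultimately show ?case by auto
qed auto

text \<open>Simplicity of \<open>Q\<close> turns the leading coefficient into 1.\<close>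

lemma make_monic:
 assumes I: "ideal I S" and p: "p \<in> span i" and e: "e \<in> carrier Q" "e \<noteq> \<zero>"
  and h: "p \<oplus>\<^bsub>S\<^esub> cst e \<otimes>\<^bsub>S\<^esub> y [^]\<^bsub>S\<^esub> i \<in> I"
 shows "\<exists>p'\<in>span i. y [^]\<^bsub>S\<^esub> i \<oplus>\<^bsub>S\<^esub> p' \<in> I"
proof -
 interpret I: ideal I S by (rule I)
 obtain s :: nat and a b where ab: "\<And>l. a l \<in> carrier Q" "\<And>l. b l \<in> carrier Q"
  "(\<Oplus>l\<in>{..<s}. a l \<otimes> e \<otimes> b l) = \<one>" by (rule simple_sum[OF e]) (rule that)
 \<comment> \<open>The right factors are pulled back along \<sigma>^i, since \<sigma>^i is applied
   to them on their way past y^i.\<close>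
 have "\<exists>b'. \<forall>l. b' l \<in> carrier Q \<and> (\<sigma> ^^ i) (b' l) = b l"
  using \<sigma>_pow_surj[OF ab(2)] by (intro choice allI) blast
 then obtain b' where b': "\<And>l. b' l \<in> carrier Q" "\<And>l. (\<sigma> ^^ i) (b' l) = b l" by blast
 note pS = span_S[OF p]
 let ?h = "p \<oplus>\<^bsub>S\<^esub> cst e \<otimes>\<^bsub>S\<^esub> y [^]\<^bsub>S\<^esub> i"
 have "\<exists>q\<in>span i. q \<oplus>\<^bsub>S\<^esub> cst (\<Oplus>l\<in>{..<n}. a l \<otimes> e \<otimes> b l) \<otimes>\<^bsub>S\<^esub> y [^]\<^bsub>S\<^esub> i \<in> I" for n :: nat
 proof (induction n)
  case 0
  show ?case using span_zero I.zero_closed by (intro bexI[of _ "\<zero>\<^bsub>S\<^esub>"]) (auto simp: cst_zero)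
 next
  case (Suc n)
  then obtain q where q: "q \<in> span i" "q \<oplus>\<^bsub>S\<^esub> cst (\<Oplus>l\<in>{..<n}. a l \<otimes> e \<otimes> b l) \<otimes>\<^bsub>S\<^esub> y [^]\<^bsub>S\<^esub> i \<in> I" by blast
  let ?A = "\<Oplus>l\<in>{..<n}. a l \<otimes> e \<otimes> b l"
  have Ac: "?A \<in> carrier Q" using ab e by (intro finsum_closed) auto
  define p1 where "p1 = cst (a n) \<otimes>\<^bsub>S\<^esub> p \<otimes>\<^bsub>S\<^esub> cst (b' n)"
  have p1: "p1 \<in> span i" unfolding p1_def by (intro span_cst span_rcst p ab b')
  have "cst (a n) \<otimes>\<^bsub>S\<^esub> ?h \<otimes>\<^bsub>S\<^esub> cst (b' n) \<in> I"
   by (intro I.I_l_closed I.I_r_closed h cst_S ab b')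
  also have "cst (a n) \<otimes>\<^bsub>S\<^esub> ?h \<otimes>\<^bsub>S\<^esub> cst (b' n) =
    p1 \<oplus>\<^bsub>S\<^esub> cst (a n) \<otimes>\<^bsub>S\<^esub> cst e \<otimes>\<^bsub>S\<^esub> (y [^]\<^bsub>S\<^esub> i \<otimes>\<^bsub>S\<^esub> cst (b' n))"
   using pS ab(1)[of n] b'(1)[of n] e(1) unfolding p1_def by (simp add: S.l_distr S.r_distr S.m_assoc)
  also have "\<dots> = p1 \<oplus>\<^bsub>S\<^esub> cst (a n \<otimes> e \<otimes> b n) \<otimes>\<^bsub>S\<^esub> y [^]\<^bsub>S\<^esub> i"
   using ab(1)[of n] ab(2)[of n] b'(1)[of n] b'(2)[of n] e(1)
   by (simp add: y_pow_cst S.m_assoc[symmetric] cst_cst)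
  finally have 1: "p1 \<oplus>\<^bsub>S\<^esub> cst (a n \<otimes> e \<otimes> b n) \<otimes>\<^bsub>S\<^esub> y [^]\<^bsub>S\<^esub> i \<in> I" .
  have "(\<Oplus>l\<in>{..<Suc n}. a l \<otimes> e \<otimes> b l) = ?A \<oplus> a n \<otimes> e \<otimes> b n"
   using ab e by (intro finsum_lessThan_Suc) auto
  hence "(q \<oplus>\<^bsub>S\<^esub> p1) \<oplus>\<^bsub>S\<^esub> cst (\<Oplus>l\<in>{..<Suc n}. a l \<otimes> e \<otimes> b l) \<otimes>\<^bsub>S\<^esub> y [^]\<^bsub>S\<^esub> i =
    (q \<oplus>\<^bsub>S\<^esub> cst ?A \<otimes>\<^bsub>S\<^esub> y [^]\<^bsub>S\<^esub> i) \<oplus>\<^bsub>S\<^esub> (p1 \<oplus>\<^bsub>S\<^esub> cst (a n \<otimes> e \<otimes> b n) \<otimes>\<^bsub>S\<^esub> y [^]\<^bsub>S\<^esub> i)"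
   using Ac ab(1)[of n] ab(2)[of n] e(1) span_S[OF q(1)] span_S[OF p1]
   by (simp add: cst_add S.l_distr S.a_ac)
  also have "\<dots> \<in> I" by (intro I.a_closed q 1)
  finally show ?case using span_add[OF q(1) p1] by blast
 qed
 from this[of s] obtain q where "q \<in> span i" "q \<oplus>\<^bsub>S\<^esub> y [^]\<^bsub>S\<^esub> i \<in> I"
  unfolding ab(3) by (auto simp: cst_one)
 thus ?thesis using span_S by (intro bexI[of _ q]) (auto simp: S.a_comm)
qed

text \<open>In a monic polynomial h in I of least degree n, the difference \<sigma>^n(q) h - h q
  loses its leading term, so its coefficients vanish by minimality. They express c_i r =
  \<sigma>^(n-i)(r) c_i, and outerness kills each c_i.\<close>

theorem y_pow_in_ideal:
 assumes I: "ideal I S" and ne: "I \<noteq> {\<zero>\<^bsub>S\<^esub>}"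
 shows "\<exists>n::nat. y [^]\<^bsub>S\<^esub> n \<in> I"
proof -
 interpret I: ideal I S by (rule I)
 obtain f where f: "f \<in> I" "f \<noteq> \<zero>\<^bsub>S\<^esub>" using ne I.zero_closed by auto
 obtain f' j where f': "f' \<in> I" "f' \<in> bnd 0" "\<And>k. k < j ==> f' k \<in> G 1" "f' j \<ominus> \<one> \<in> G 1"
  by (rule normalised_in_ideal[OF I f]) (rule that)
 obtain g r where g: "g \<in> carrier S" "\<And>k. r k \<in> carrier Q"
  "(\<lambda>k. (g \<otimes>\<^bsub>S\<^esub> f') k \<oplus> (if k < j then r k else \<zero>)) = mon j"
  by (rule weierstrass[OF f'(2,3,4)]) (assumption, rule that)
 have gfI: "g \<otimes>\<^bsub>S\<^esub> f' \<in> I" by (intro I.I_l_closed f' g)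
 obtain p where p: "p \<in> span j" "mon j = y [^]\<^bsub>S\<^esub> j \<oplus>\<^bsub>S\<^esub> p" using mon_monic by blast
 let ?l = "\<lambda>k. if k < j then r k else \<zero>"
 have l: "(\<lambda>k. \<ominus> (?l k)) \<in> span j"
 proof -
  have "(\<lambda>k. \<ominus> (?l k)) = (\<lambda>k. if k < j then \<ominus> r k else \<zero>)" by auto
  thus ?thesis using poly_span[of "\<lambda>k. \<ominus> r k" j] g(2) by simp
 qed
 have "g \<otimes>\<^bsub>S\<^esub> f' = mon j \<oplus>\<^bsub>S\<^esub> (\<lambda>k. \<ominus> (?l k))"
 proof
  fix k
  have "mon j k = (g \<otimes>\<^bsub>S\<^esub> f') k \<oplus> ?l k" using fun_cong[OF g(3), of k] by simp
  moreover have "(g \<otimes>\<^bsub>S\<^esub> f') k \<in> carrier Q" using S_coeff[OF I.Icarr[OF gfI]] .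
  ultimately show "(g \<otimes>\<^bsub>S\<^esub> f') k = (mon j \<oplus>\<^bsub>S\<^esub> (\<lambda>k. \<ominus> (?l k))) k"
   using g(2)[of k] by (simp add: S_add a_assoc r_neg)
 qed
 hence "y [^]\<^bsub>S\<^esub> j \<oplus>\<^bsub>S\<^esub> (p \<oplus>\<^bsub>S\<^esub> (\<lambda>k. \<ominus> (?l k))) \<in> I"
  using gfI p span_S[OF p(1)] span_S[OF l] by (simp add: S.a_assoc)
 hence ex: "\<exists>n. \<exists>p\<in>span n. y [^]\<^bsub>S\<^esub> n \<oplus>\<^bsub>S\<^esub> p \<in> I" using span_add[OF p(1) l] by blast
 define n where "n = (LEAST n. \<exists>p\<in>span n. y [^]\<^bsub>S\<^esub> n \<oplus>\<^bsub>S\<^esub> p \<in> I)"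
 have nI: "\<exists>p\<in>span n. y [^]\<^bsub>S\<^esub> n \<oplus>\<^bsub>S\<^esub> p \<in> I" unfolding n_def by (rule LeastI_ex[OF ex])
 have least: "\<not> (\<exists>p\<in>span i. y [^]\<^bsub>S\<^esub> i \<oplus>\<^bsub>S\<^esub> p \<in> I)" if "i < n" for i
  using not_less_Least[OF that[unfolded n_def]] .
 \<comment> \<open>By minimality of n, a polynomial of degree below n in I has zero coefficients: a
   nonzero top coefficient could be made 1.\<close>
 have low: "c i = \<zero>" if "\<And>i. c i \<in> carrier Q" "(\<Oplus>\<^bsub>S\<^esub>i\<in>{..<m}. cst (c i) \<otimes>\<^bsub>S\<^esub> y [^]\<^bsub>S\<^esub> i) \<in> I" "m \<le> n" "i < m" for c m i
  using that(2-4)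
 proof (induction m)
  case (Suc m)
  let ?p = "\<Oplus>\<^bsub>S\<^esub>i\<in>{..<m}. cst (c i) \<otimes>\<^bsub>S\<^esub> y [^]\<^bsub>S\<^esub> i"
  have sp: "?p \<in> span m" unfolding span_def using that(1) by blast
  have e: "(\<Oplus>\<^bsub>S\<^esub>i\<in>{..<Suc m}. cst (c i) \<otimes>\<^bsub>S\<^esub> y [^]\<^bsub>S\<^esub> i) = ?p \<oplus>\<^bsub>S\<^esub> cst (c m) \<otimes>\<^bsub>S\<^esub> y [^]\<^bsub>S\<^esub> m"
   using that(1) by (intro S.finsum_lessThan_Suc) auto
  have "c m = \<zero>"
  proof (rule ccontr)
   assume "c m \<noteq> \<zero>"
   hence "\<exists>p'\<in>span m. y [^]\<^bsub>S\<^esub> m \<oplus>\<^bsub>S\<^esub> p' \<in> I"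
    using make_monic[OF I sp that(1)] Suc.prems(1) unfolding e by blast
   thus False using least[of m] Suc.prems(2) by simp
  qed
  moreover from this have "?p \<in> I" using Suc.prems(1) span_S[OF sp] unfolding e by (simp add: cst_zero)
  ultimately show ?case using Suc by (cases "i = m") auto
 qed simp
 obtain c where c: "\<And>i. c i \<in> carrier Q" "y [^]\<^bsub>S\<^esub> n \<oplus>\<^bsub>S\<^esub> (\<Oplus>\<^bsub>S\<^esub>i\<in>{..<n}. cst (c i) \<otimes>\<^bsub>S\<^esub> y [^]\<^bsub>S\<^esub> i) \<in> I"
  using nI unfolding span_def by blast
 let ?p = "\<Oplus>\<^bsub>S\<^esub>i\<in>{..<n}. cst (c i) \<otimes>\<^bsub>S\<^esub> y [^]\<^bsub>S\<^esub> i"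
 have pS: "?p \<in> carrier S" using c(1) by (intro S.finsum_closed) auto
 have cz: "c i = \<zero>" if i: "i < n" for i
 proof (rule outer[of "n - i"])
  fix r assume r: "r \<in> carrier Q"
  \<comment> \<open>The difference is formed with q = \<sigma>^-i(r), because c_i sees q only after
    it has passed y^i.\<close>
  obtain q where q: "q \<in> carrier Q" "(\<sigma> ^^ i) q = r" using \<sigma>_pow_surj[OF r] by blast
  let ?e = "\<lambda>j. (\<sigma> ^^ n) q \<otimes> c j \<ominus> c j \<otimes> (\<sigma> ^^ j) q"
  have "cst ((\<sigma> ^^ n) q) \<otimes>\<^bsub>S\<^esub> (y [^]\<^bsub>S\<^esub> n \<oplus>\<^bsub>S\<^esub> ?p) \<ominus>\<^bsub>S\<^esub> (y [^]\<^bsub>S\<^esub> n \<oplus>\<^bsub>S\<^esub> ?p) \<otimes>\<^bsub>S\<^esub> cst q \<in> I"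
   unfolding S.minus_eq by (intro I.a_closed I.a_inv_closed I.I_l_closed I.I_r_closed c cst_S \<sigma>_pow_closed q)
  also have "cst ((\<sigma> ^^ n) q) \<otimes>\<^bsub>S\<^esub> (y [^]\<^bsub>S\<^esub> n \<oplus>\<^bsub>S\<^esub> ?p) \<ominus>\<^bsub>S\<^esub> (y [^]\<^bsub>S\<^esub> n \<oplus>\<^bsub>S\<^esub> ?p) \<otimes>\<^bsub>S\<^esub> cst q
    = cst ((\<sigma> ^^ n) q) \<otimes>\<^bsub>S\<^esub> ?p \<ominus>\<^bsub>S\<^esub> ?p \<otimes>\<^bsub>S\<^esub> cst q"
  proof -
   have "a \<oplus>\<^bsub>S\<^esub> b \<ominus>\<^bsub>S\<^esub> (a \<oplus>\<^bsub>S\<^esub> d) = b \<ominus>\<^bsub>S\<^esub> d" if "a \<in> carrier S" "b \<in> carrier S" "d \<in> carrier S" for a b d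
    using that S.add_diff_cancel_left[of a "b \<ominus>\<^bsub>S\<^esub> d"] by (simp add: S.minus_eq S.minus_add S.a_ac)
   thus ?thesis using pS q(1) by (simp add: S.r_distr S.l_distr y_pow_cst)
  qed
  also have "\<dots> = (\<Oplus>\<^bsub>S\<^esub>j\<in>{..<n}. cst (?e j) \<otimes>\<^bsub>S\<^esub> y [^]\<^bsub>S\<^esub> j)"
  proof -
   have 1: "cst ((\<sigma> ^^ n) q) \<otimes>\<^bsub>S\<^esub> ?p = (\<Oplus>\<^bsub>S\<^esub>j\<in>{..<n}. cst ((\<sigma> ^^ n) q \<otimes> c j) \<otimes>\<^bsub>S\<^esub> y [^]\<^bsub>S\<^esub> j)"
    using c(1) q(1) by (subst S.finsum_rdistr) (auto simp: S.m_assoc[symmetric] cst_cst)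
   have "?p \<otimes>\<^bsub>S\<^esub> cst q = (\<Oplus>\<^bsub>S\<^esub>j\<in>{..<n}. cst (c j) \<otimes>\<^bsub>S\<^esub> y [^]\<^bsub>S\<^esub> j \<otimes>\<^bsub>S\<^esub> cst q)"
    using c(1) q(1) by (subst S.finsum_ldistr) auto
   also have "\<dots> = (\<Oplus>\<^bsub>S\<^esub>j\<in>{..<n}. cst (c j \<otimes> (\<sigma> ^^ j) q) \<otimes>\<^bsub>S\<^esub> y [^]\<^bsub>S\<^esub> j)"
   proof (rule S.finsum_cong')
    fix j
    have "cst (c j) \<otimes>\<^bsub>S\<^esub> y [^]\<^bsub>S\<^esub> j \<otimes>\<^bsub>S\<^esub> cst q = cst (c j) \<otimes>\<^bsub>S\<^esub> (y [^]\<^bsub>S\<^esub> j \<otimes>\<^bsub>S\<^esub> cst q)"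
     using c(1) q(1) by (simp add: S.m_assoc)
    thus "cst (c j) \<otimes>\<^bsub>S\<^esub> y [^]\<^bsub>S\<^esub> j \<otimes>\<^bsub>S\<^esub> cst q = cst (c j \<otimes> (\<sigma> ^^ j) q) \<otimes>\<^bsub>S\<^esub> y [^]\<^bsub>S\<^esub> j"
     using c(1) q(1) by (simp add: y_pow_cst S.m_assoc[symmetric] cst_cst)
   qed (use c(1) q(1) in auto)
   finally have 2: "?p \<otimes>\<^bsub>S\<^esub> cst q = (\<Oplus>\<^bsub>S\<^esub>j\<in>{..<n}. cst (c j \<otimes> (\<sigma> ^^ j) q) \<otimes>\<^bsub>S\<^esub> y [^]\<^bsub>S\<^esub> j)" .
   have 3: "cst (?e j) \<otimes>\<^bsub>S\<^esub> y [^]\<^bsub>S\<^esub> j = cst ((\<sigma> ^^ n) q \<otimes> c j) \<otimes>\<^bsub>S\<^esub> y [^]\<^bsub>S\<^esub> j \<ominus>\<^bsub>S\<^esub> cst (c j \<otimes> (\<sigma> ^^ j) q) \<otimes>\<^bsub>S\<^esub> y [^]\<^bsub>S\<^esub> j" for j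
    using c(1) q(1) by (simp add: minus_eq S.minus_eq cst_add cst_minus S.l_distr S.l_minus)
   show ?thesis unfolding 1 2 3 using c(1) q(1) by (intro S.finsum_diff) auto
  qed
  finally have I': "(\<Oplus>\<^bsub>S\<^esub>j\<in>{..<n}. cst (?e j) \<otimes>\<^bsub>S\<^esub> y [^]\<^bsub>S\<^esub> j) \<in> I" .
  have "?e i = \<zero>" by (rule low[OF _ I' order_refl i]) (use c(1) q(1) in auto)
  hence "(\<sigma> ^^ n) q \<otimes> c i = c i \<otimes> r" using c(1) q r by simp
  moreover have "(\<sigma> ^^ (n - i)) r = (\<sigma> ^^ n) q"
   unfolding q(2)[symmetric] using i funpow_add[of "n - i" i \<sigma>] by simp
  ultimately show "c i \<otimes> r = (\<sigma> ^^ (n - i)) r \<otimes> c i" by simp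
 qed (use i c(1) in auto)
 have "?p = \<zero>\<^bsub>S\<^esub>"
 proof -
  have "?p = (\<Oplus>\<^bsub>S\<^esub>i\<in>{..<n}. \<zero>\<^bsub>S\<^esub>)" by (rule S.finsum_cong') (auto simp: cz cst_zero)
  thus ?thesis by simp
 qed
 thus ?thesis using c(2) by auto
qed

end

section \<open>Rings graded by a cyclic group\<close>

text \<open>An ideal contains a nonzero central element, and the centre is finite-dimensional over the
 field of its elements lying in \<open>B\<close>; so if the centre is a domain, it is a field.\<close>

locale cyclic_graded = ring L for L :: "('a, 'm) ring_scheme" (structure) +
 fixes B and y and N :: nat
 assumes B: "subring B L" and y: "y \<in> Units L"
  and conj: "b \<in> B ==> y \<otimes> b \<otimes> inv y \<in> B" and conj': "b \<in> B ==> inv y \<otimes> b \<otimes> y \<in> B"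
  and gen: "l \<in> carrier L ==> \<exists>b. (\<forall>i. b i \<in> B) \<and> l = (\<Oplus>i\<in>{..<N}. b i \<otimes> y [^] i)"
  and indep: "[| \<And>i. v i \<in> B; (\<Oplus>i\<in>{..<N}. v i \<otimes> y [^] i) = \<zero>; j < N |] ==> v j = \<zero>"
  and B_simple: "[| J \<subseteq> B; \<And>a b. a \<in> J ==> b \<in> J ==> a \<oplus> b \<in> J;
    \<And>a r. a \<in> J ==> r \<in> B ==> a \<otimes> r \<in> J; \<And>a r. a \<in> J ==> r \<in> B ==> r \<otimes> a \<in> J;
    b \<in> J; b \<noteq> \<zero> |] ==> \<one> \<in> J"
  and centre_domain: "[| f \<in> carrier L; g \<in> carrier L; \<And>r. r \<in> carrier L ==> f \<otimes> r = r \<otimes> f;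
    \<And>r. r \<in> carrier L ==> g \<otimes> r = r \<otimes> g; f \<otimes> g = \<zero> |] ==> f = \<zero> \<or> g = \<zero>"
  and nontrivial: "\<one> \<noteq> \<zero>"
begin

lemma B_carrier: "b \<in> B ==> b \<in> carrier L" using subringE(1)[OF B] by auto
lemmas B_zero = subringE(2)[OF B] and B_one = subringE(3)[OF B] and B_neg = subringE(5)[OF B]
 and B_mult = subringE(6)[OF B] and B_add = subringE(7)[OF B]

lemma yc [simp, intro]: "y \<in> carrier L" "y [^] (i::nat) \<in> carrier L" using y by auto

lemma yU: "y [^] (i::nat) \<in> Units L" using y by (rule Units_pow_closed)

definition yi :: "nat \<Rightarrow> 'a" where "yi i = inv (y [^] i)"

lemma yi_c [simp, intro]: "yi i \<in> carrier L" using yU by (simp add: yi_def)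
lemma y_yi: "y [^] i \<otimes> yi i = \<one>" "yi i \<otimes> y [^] i = \<one>" using yU by (auto simp: yi_def)

lemma cancel_yi: "a \<in> carrier L ==> a \<otimes> y [^] i \<otimes> yi i = a" "a \<in> carrier L ==> a \<otimes> yi i \<otimes> y [^] i = a"
 "a \<in> carrier L ==> y [^] i \<otimes> (yi i \<otimes> a) = a" "a \<in> carrier L ==> yi i \<otimes> (y [^] i \<otimes> a) = a"
 by (auto simp: m_assoc y_yi) (auto simp: m_assoc[symmetric] y_yi)

lemma yi_Suc: "yi (Suc i) = inv y \<otimes> yi i"
proof (rule inv_unique'[unfolded yi_def[symmetric], symmetric, of "y [^] Suc i", folded yi_def])
 have iy: "inv y \<in> carrier L" using y by auto
 have "y [^] Suc i \<otimes> (inv y \<otimes> yi i) = y [^] i \<otimes> (y \<otimes> inv y) \<otimes> yi i"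
  using iy by (simp only: nat_pow_Suc m_assoc m_closed yc yi_c)
 thus "y [^] Suc i \<otimes> (inv y \<otimes> yi i) = \<one>" using y by (simp add: y_yi)
 have "inv y \<otimes> yi i \<otimes> y [^] Suc i = inv y \<otimes> (yi i \<otimes> y [^] i) \<otimes> y" using y by (simp add: m_assoc)
 thus "inv y \<otimes> yi i \<otimes> y [^] Suc i = \<one>" using y by (simp add: y_yi)
qed (use y in auto)

definition cj :: "nat \<Rightarrow> 'a \<Rightarrow> 'a" where "cj i r = y [^] i \<otimes> r \<otimes> yi i"
definition ci :: "nat \<Rightarrow> 'a \<Rightarrow> 'a" where "ci i r = yi i \<otimes> r \<otimes> y [^] i"

lemma cj_B: "r \<in> B ==> cj i r \<in> B"
proof (induction i arbitrary: r)
 case 0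
 thus ?case using B_carrier by (simp add: cj_def yi_def)
next
 case (Suc i)
 have "cj (Suc i) r = y [^] i \<otimes> (y \<otimes> r \<otimes> inv y) \<otimes> yi i"
  using B_carrier[OF Suc.prems] y by (simp add: cj_def yi_Suc m_assoc)
 thus ?case using Suc.IH[OF conj[OF Suc.prems]] by (simp add: cj_def)
qed

lemma ci_B: "r \<in> B ==> ci i r \<in> B"
proof (induction i arbitrary: r)
 case 0
 thus ?case using B_carrier by (simp add: ci_def yi_def)
next
 case (Suc i)
 have "ci (Suc i) r = inv y \<otimes> ci i r \<otimes> y"
  using B_carrier[OF Suc.prems] y by (simp add: ci_def yi_Suc m_assoc)
 thus ?case using conj'[OF Suc.IH[OF Suc.prems]] by simp
qed

lemma y_cj: "r \<in> carrier L ==> cj i r \<otimes> y [^] i = y [^] i \<otimes> r"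
 unfolding cj_def by (simp add: cancel_yi)

lemma cj_ci: "r \<in> carrier L ==> cj i (ci i r) = r"
 unfolding cj_def ci_def by (simp add: m_assoc cancel_yi y_yi)

definition comb :: "(nat \<Rightarrow> 'a) \<Rightarrow> 'a" where "comb b = (\<Oplus>i\<in>{..<N}. b i \<otimes> y [^] i)"

text \<open>Coordinates in the basis of powers of y, unique by \<open>indep\<close>. They are
  continued by 0 beyond N, so that conditions on all high coordinates need no reference to
  N.\<close>

definition cf :: "'a \<Rightarrow> nat \<Rightarrow> 'a" where
 "cf v i = (if i < N then (SOME b. (\<forall>i. b i \<in> B) \<and> v = comb b) i else \<zero>)"

lemma comb_cong: "(\<And>i. i < N ==> b i = b' i) ==> (\<And>i. b' i \<in> B) ==> comb b = comb b'"
 unfolding comb_def by (rule finsum_cong') (auto simp: B_carrier)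

lemma comb_c: "(\<And>i. b i \<in> B) ==> comb b \<in> carrier L"
 unfolding comb_def by (auto intro!: finsum_closed simp: B_carrier)

lemma cf_B: assumes "v \<in> carrier L" shows "cf v i \<in> B"
proof -
 have "\<exists>b. (\<forall>i. b i \<in> B) \<and> v = comb b" using gen[OF assms] by (simp add: comb_def)
 from someI_ex[OF this] B_zero show ?thesis by (simp add: cf_def)
qed

lemma cf_c: "v \<in> carrier L ==> cf v i \<in> carrier L" using cf_B B_carrier by blast

lemma comb_cf: assumes "v \<in> carrier L" shows "comb (cf v) = v"
proof -
 have "\<exists>b. (\<forall>i. b i \<in> B) \<and> v = comb b" using gen[OF assms] by (simp add: comb_def)
 from someI_ex[OF this] have *: "\<forall>i. (SOME b. (\<forall>i. b i \<in> B) \<and> v = comb b) i \<in> B"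
  "v = comb (SOME b. (\<forall>i. b i \<in> B) \<and> v = comb b)" by blast+
 have "comb (cf v) = comb (SOME b. (\<forall>i. b i \<in> B) \<and> v = comb b)"
  by (rule comb_cong) (use *(1) B_zero in \<open>auto simp: cf_def\<close>)
 thus ?thesis using *(2) by simp
qed

lemma comb_diff: assumes "\<And>i. b i \<in> B" "\<And>i. b' i \<in> B"
 shows "comb b \<ominus> comb b' = comb (\<lambda>i. b i \<ominus> b' i)"
 unfolding comb_def using assms[THEN B_carrier]
 by (subst finsum_diff) (auto simp: minus_eq l_distr l_minus)

lemma comb_add: assumes "\<And>i. b i \<in> B" "\<And>i. b' i \<in> B"
 shows "comb b \<oplus> comb b' = comb (\<lambda>i. b i \<oplus> b' i)"
 unfolding comb_def using assms[THEN B_carrier] by (simp add: l_distr finsum_addf)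

lemma cf_unique: assumes "\<And>i. b i \<in> B" "v = comb b" "i < N" shows "cf v i = b i"
proof -
 have v: "v \<in> carrier L" unfolding assms(2) using assms(1) by (rule comb_c)
 have "comb (\<lambda>i. cf v i \<ominus> b i) = comb (cf v) \<ominus> comb b"
  by (rule comb_diff[symmetric, OF cf_B[OF v] assms(1)])
 also have "\<dots> = \<zero>" unfolding comb_cf[OF v] assms(2)[symmetric] using v by (simp add: minus_eq r_neg)
 finally have 0: "(\<Oplus>i\<in>{..<N}. (cf v i \<ominus> b i) \<otimes> y [^] i) = \<zero>" by (simp add: comb_def)
 have "cf v j \<ominus> b j \<in> B" for j unfolding minus_eq by (intro B_add B_neg cf_B v assms(1))
 from indep[of "\<lambda>i. cf v i \<ominus> b i", OF this 0 assms(3)]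
 have "cf v i \<ominus> b i = \<zero>" .
 thus ?thesis using cf_c[OF v] B_carrier[OF assms(1)] by simp
qed

lemma cf_eq: assumes "\<And>i. b i \<in> B" "v = comb b" "\<And>i. \<not> i < N ==> b i = \<zero>" shows "cf v i = b i"
 using cf_unique[OF assms(1,2)] assms(3) by (cases "i < N") (auto simp: cf_def)

lemma cf_high: "\<not> i < N ==> cf v i = \<zero>" by (simp add: cf_def)

lemma cf_add: assumes "v \<in> carrier L" "w \<in> carrier L" shows "cf (v \<oplus> w) i = cf v i \<oplus> cf w i"
proof (rule cf_eq)
 show "v \<oplus> w = comb (\<lambda>i. cf v i \<oplus> cf w i)"
  using comb_add[of "cf v" "cf w", OF cf_B[OF assms(1)] cf_B[OF assms(2)]] by (simp only: comb_cf assms)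
qed (use cf_B[OF assms(1)] cf_B[OF assms(2)] B_add in \<open>auto simp: cf_high\<close>)

lemma cf_diff: assumes "v \<in> carrier L" "w \<in> carrier L" shows "cf (v \<ominus> w) i = cf v i \<ominus> cf w i"
proof (rule cf_eq)
 show "v \<ominus> w = comb (\<lambda>i. cf v i \<ominus> cf w i)"
  using comb_diff[of "cf v" "cf w", OF cf_B[OF assms(1)] cf_B[OF assms(2)]] by (simp only: comb_cf assms)
qed (use cf_B[OF assms(1)] cf_B[OF assms(2)] B_add B_neg in \<open>auto simp: cf_high minus_eq\<close>)

lemma cf_lmult: assumes "r \<in> B" "v \<in> carrier L" shows "cf (r \<otimes> v) i = r \<otimes> cf v i"
proof (rule cf_eq)
 have "r \<otimes> comb (cf v) = comb (\<lambda>i. r \<otimes> cf v i)" unfolding comb_def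
  using B_carrier[OF assms(1)] cf_c[OF assms(2)] by (subst finsum_rdistr) (auto simp: m_assoc)
 thus "r \<otimes> v = comb (\<lambda>i. r \<otimes> cf v i)" by (simp add: comb_cf assms)
qed (use B_mult[OF assms(1) cf_B[OF assms(2)]] B_carrier[OF assms(1)] in \<open>auto simp: cf_high\<close>)

lemma cf_rmult: assumes "r \<in> B" "v \<in> carrier L" shows "cf (v \<otimes> r) i = cf v i \<otimes> cj i r"
proof (rule cf_eq)
 note r = B_carrier[OF assms(1)]
 have "comb (cf v) \<otimes> r = (\<Oplus>i\<in>{..<N}. cf v i \<otimes> y [^] i \<otimes> r)" unfolding comb_def
  using r cf_c[OF assms(2)] by (subst finsum_ldistr) auto
 also have "\<dots> = comb (\<lambda>i. cf v i \<otimes> cj i r)" unfolding comb_def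
  using r cf_c[OF assms(2)] B_carrier[OF cj_B[OF assms(1)]]
  by (intro finsum_cong') (auto simp: m_assoc y_cj)
 finally show "v \<otimes> r = comb (\<lambda>i. cf v i \<otimes> cj i r)" by (simp add: comb_cf assms)
qed (use B_mult[OF cf_B[OF assms(2)] cj_B[OF assms(1)]] B_carrier[OF cj_B[OF assms(1)]] in \<open>auto simp: cf_high\<close>)

lemma cf_conj: assumes "v \<in> carrier L" shows "cf (y \<otimes> v \<otimes> inv y) i = y \<otimes> cf v i \<otimes> inv y"
proof (rule cf_eq)
 have iy: "inv y \<in> carrier L" using y by auto
 have "y \<otimes> comb (cf v) \<otimes> inv y = (\<Oplus>i\<in>{..<N}. y \<otimes> (cf v i \<otimes> y [^] i)) \<otimes> inv y" unfolding comb_def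
  using cf_c[OF assms] by (subst finsum_rdistr) auto
 also have "\<dots> = (\<Oplus>i\<in>{..<N}. y \<otimes> (cf v i \<otimes> y [^] i) \<otimes> inv y)"
  using cf_c[OF assms] iy by (subst finsum_ldistr) auto
 also have "\<dots> = comb (\<lambda>i. y \<otimes> cf v i \<otimes> inv y)" unfolding comb_def
 proof (rule finsum_cong')
  fix i :: nat
  have "y [^] i \<otimes> inv y = inv y \<otimes> y [^] i"
  proof -
   have "y \<otimes> y [^] i = y [^] i \<otimes> y" using nat_pow_Suc2[of y i] by simp
   hence "inv y \<otimes> (y \<otimes> y [^] i) \<otimes> inv y = inv y \<otimes> (y [^] i \<otimes> y) \<otimes> inv y" by simp
   moreover have "inv y \<otimes> (y \<otimes> y [^] i) = y [^] i"
    using y iy by (simp add: m_assoc[symmetric] del: m_assoc)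
   moreover have "inv y \<otimes> (y [^] i \<otimes> y) \<otimes> inv y = inv y \<otimes> y [^] i"
    using y iy by (simp add: m_assoc)
   ultimately show ?thesis by simp
  qed
  thus "y \<otimes> (cf v i \<otimes> y [^] i) \<otimes> inv y = y \<otimes> cf v i \<otimes> inv y \<otimes> y [^] i"
   using cf_c[OF assms] iy by (simp add: m_assoc)
 qed (use cf_c[OF assms] iy in auto)
 finally show "y \<otimes> v \<otimes> inv y = comb (\<lambda>i. y \<otimes> cf v i \<otimes> inv y)" by (simp add: comb_cf assms)
qed (use conj[OF cf_B[OF assms]] y in \<open>auto simp: cf_high\<close>)

lemma cf_zero: assumes "v \<in> carrier L" "\<And>i. cf v i = \<zero>" shows "v = \<zero>"
proof -
 have "comb (cf v) = (\<Oplus>i\<in>{..<N}. \<zero>)" unfolding comb_def by (rule finsum_cong') (auto simp: assms(2))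
 thus ?thesis using comb_cf[OF assms(1)] by simp
qed

definition Z where "Z = {f \<in> carrier L. \<forall>r\<in>carrier L. f \<otimes> r = r \<otimes> f}"

lemma Z_c: "f \<in> Z ==> f \<in> carrier L" and Z_comm: "f \<in> Z ==> r \<in> carrier L ==> f \<otimes> r = r \<otimes> f"
 by (auto simp: Z_def)

lemma Z_I: assumes f: "f \<in> carrier L" and b: "\<And>b. b \<in> B ==> f \<otimes> b = b \<otimes> f" and fy: "f \<otimes> y = y \<otimes> f"
 shows "f \<in> Z"
proof -
 have p: "f \<otimes> y [^] i = y [^] i \<otimes> f" for i :: nat
 proof (induction i)
  case (Suc i)
  have "f \<otimes> y [^] Suc i = y [^] i \<otimes> (f \<otimes> y)" using f Suc by (simp add: m_assoc[symmetric])
  thus ?case using f by (simp add: fy m_assoc)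
 qed (use f in simp)
 have "f \<otimes> r = r \<otimes> f" if r: "r \<in> carrier L" for r
 proof -
  have "f \<otimes> comb (cf r) = (\<Oplus>i\<in>{..<N}. f \<otimes> (cf r i \<otimes> y [^] i))" unfolding comb_def
   using cf_c[OF r] f by (subst finsum_rdistr) auto
  also have "\<dots> = (\<Oplus>i\<in>{..<N}. cf r i \<otimes> y [^] i \<otimes> f)"
  proof (rule finsum_cong')
   fix i
   have "f \<otimes> (cf r i \<otimes> y [^] i) = cf r i \<otimes> (f \<otimes> y [^] i)"
    using b[OF cf_B[OF r]] cf_c[OF r] f by (simp add: m_assoc[symmetric])
   thus "f \<otimes> (cf r i \<otimes> y [^] i) = cf r i \<otimes> y [^] i \<otimes> f" using p f cf_c[OF r] by (simp add: m_assoc)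
  qed (use cf_c[OF r] f in auto)
  also have "\<dots> = comb (cf r) \<otimes> f" unfolding comb_def
   using cf_c[OF r] f by (subst finsum_ldistr) auto
  finally show ?thesis by (simp add: comb_cf r)
 qed
 thus ?thesis using f by (simp add: Z_def)
qed

lemma Z_mult: assumes "f \<in> Z" "g \<in> Z" shows "f \<otimes> g \<in> Z"
proof -
 note c = Z_c[OF assms(1)] Z_c[OF assms(2)]
 have "f \<otimes> g \<otimes> r = r \<otimes> (f \<otimes> g)" if "r \<in> carrier L" for r
 proof -
  have "f \<otimes> g \<otimes> r = f \<otimes> (r \<otimes> g)" using c that Z_comm[OF assms(2) that] by (simp add: m_assoc)
  also have "\<dots> = (r \<otimes> f) \<otimes> g" using c that Z_comm[OF assms(1) that] by (simp add: m_assoc[symmetric])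
  finally show ?thesis using c that by (simp add: m_assoc)
 qed
 thus ?thesis using c by (simp add: Z_def)
qed

lemma Z_diff: "f \<in> Z ==> g \<in> Z ==> f \<ominus> g \<in> Z"
 unfolding Z_def by (auto simp: minus_eq l_distr r_distr l_minus r_minus)

lemma Z_add: "f \<in> Z ==> g \<in> Z ==> f \<oplus> g \<in> Z"
 unfolding Z_def by (auto simp: l_distr r_distr)

lemma Z_one: "\<one> \<in> Z" by (simp add: Z_def)

lemma Z_pow: "f \<in> Z ==> f [^] (n::nat) \<in> Z"
 by (induction n) (auto simp: Z_one Z_mult)

lemma Z_pow_ne: assumes "f \<in> Z" "f \<noteq> \<zero>" shows "f [^] (n::nat) \<noteq> \<zero>"
proof (induction n)
 case (Suc n)
 have p: "f [^] n \<in> Z" by (rule Z_pow[OF assms(1)])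
 have "f [^] n \<otimes> f \<noteq> \<zero>"
  using centre_domain[OF Z_c[OF p] Z_c[OF assms(1)] Z_comm[OF p] Z_comm[OF assms(1)]] Suc assms(2) by blast
 thus ?case by simp
qed (simp add: nontrivial)

lemma Z_inv: assumes c: "c \<in> Z" and U: "c \<in> Units L" shows "inv c \<in> Z"
proof -
 have ic: "inv c \<in> carrier L" using U by auto
 have "inv c \<otimes> r = r \<otimes> inv c" if r: "r \<in> carrier L" for r
 proof -
  have "inv c \<otimes> r = inv c \<otimes> r \<otimes> (c \<otimes> inv c)" using U r ic by simp
  also have "\<dots> = inv c \<otimes> (r \<otimes> c) \<otimes> inv c" using Z_c[OF c] r ic by (simp add: m_assoc)
  also have "\<dots> = inv c \<otimes> (c \<otimes> r) \<otimes> inv c" using Z_comm[OF c r] by simp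
  also have "\<dots> = (inv c \<otimes> c) \<otimes> r \<otimes> inv c" using Z_c[OF c] r ic by (simp only: m_assoc m_closed)
  finally show ?thesis using U r ic by simp
 qed
 thus ?thesis using ic by (simp add: Z_def)
qed

lemma conj_eq: assumes "a \<in> carrier L" shows "y \<otimes> a \<otimes> inv y = a \<longleftrightarrow> a \<otimes> y = y \<otimes> a"
proof
 have iy: "inv y \<in> carrier L" using y by auto
 assume "y \<otimes> a \<otimes> inv y = a"
 hence "a \<otimes> y = y \<otimes> a \<otimes> inv y \<otimes> y" by simp
 thus "a \<otimes> y = y \<otimes> a" using assms y iy by (simp add: m_assoc)
next
 have iy: "inv y \<in> carrier L" using y by auto
 assume "a \<otimes> y = y \<otimes> a"
 hence "y \<otimes> a \<otimes> inv y = a \<otimes> y \<otimes> inv y" by simp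
 thus "y \<otimes> a \<otimes> inv y = a" using assms y iy by (simp add: m_assoc)
qed

text \<open>Compare coordinates: r f = f r for r in B gives the twisted commutation of each
  coordinate with B, and y f y^-1 = f gives its commutation with y.\<close>

lemma Z_component: assumes f: "f \<in> Z" and i: "i < N"
 shows "cf f i \<otimes> y [^] i \<in> Z" "r \<in> B ==> r \<otimes> cf f i = cf f i \<otimes> cj i r"
proof -
 note fc = Z_c[OF f]
 have 1: "r \<otimes> cf f i = cf f i \<otimes> cj i r" if "r \<in> B" for r
  using cf_lmult[OF that fc, of i] cf_rmult[OF that fc, of i] Z_comm[OF f B_carrier[OF that]] by simp
 have "y \<otimes> cf f i \<otimes> inv y = cf f i"
  using cf_conj[OF fc, of i] conj_eq[OF fc] Z_comm[OF f yc(1)] by simp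
 hence 2: "cf f i \<otimes> y = y \<otimes> cf f i" using conj_eq[OF cf_c[OF fc]] by simp
 show "r \<in> B ==> r \<otimes> cf f i = cf f i \<otimes> cj i r" by (rule 1)
 show "cf f i \<otimes> y [^] i \<in> Z"
 proof (rule Z_I)
  fix b assume b: "b \<in> B"
  have "b \<otimes> (cf f i \<otimes> y [^] i) = cf f i \<otimes> (cj i b \<otimes> y [^] i)"
   using 1[OF b] B_carrier[OF b] B_carrier[OF cj_B[OF b]] cf_c[OF fc] by (simp add: m_assoc[symmetric])
  thus "cf f i \<otimes> y [^] i \<otimes> b = b \<otimes> (cf f i \<otimes> y [^] i)"
   using B_carrier[OF b] cf_c[OF fc] by (simp add: y_cj m_assoc)
 next
  have "y \<otimes> (cf f i \<otimes> y [^] i) = cf f i \<otimes> (y \<otimes> y [^] i)"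
   using 2 cf_c[OF fc] by (simp add: m_assoc[symmetric])
  thus "cf f i \<otimes> y [^] i \<otimes> y = y \<otimes> (cf f i \<otimes> y [^] i)"
   using cf_c[OF fc] nat_pow_Suc2[of y i] by (simp add: m_assoc)
 qed (use cf_c[OF fc] in auto)
qed

text \<open>By the twisted commutation b B = B b is a two-sided ideal of the simple ring B. It
  contains 1, which yields a right inverse from b B and a left inverse from B b.\<close>

lemma semicentral_unit_B:
 assumes b: "b \<in> B" "b \<noteq> \<zero>" and comm: "\<And>r. r \<in> B ==> r \<otimes> b = b \<otimes> cj i r"
 shows "\<exists>x\<in>B. b \<otimes> x = \<one> \<and> x \<otimes> b = \<one>"
proof -
 note bc = B_carrier[OF b(1)]
 have comm': "b \<otimes> r = ci i r \<otimes> b" if "r \<in> B" for r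
  using comm[OF ci_B[OF that, of i]] B_carrier[OF that] by (simp add: cj_ci)
 have "\<one> \<in> {b \<otimes> x | x. x \<in> B}"
 proof (rule B_simple[where b = b])
  fix a r assume "a \<in> {b \<otimes> x | x. x \<in> B}" "r \<in> B"
  then obtain x where x: "a = b \<otimes> x" "x \<in> B" by blast
  have "r \<otimes> a = b \<otimes> (cj i r \<otimes> x)"
   using x bc comm[OF \<open>r \<in> B\<close>] B_carrier[OF x(2)] B_carrier[OF \<open>r \<in> B\<close>] B_carrier[OF cj_B[OF \<open>r \<in> B\<close>]]
   by (simp add: m_assoc[symmetric])
  thus "r \<otimes> a \<in> {b \<otimes> x | x. x \<in> B}" using B_mult[OF cj_B[OF \<open>r \<in> B\<close>] x(2)] by blast
  have "a \<otimes> r = b \<otimes> (x \<otimes> r)" using x bc B_carrier[OF x(2)] B_carrier[OF \<open>r \<in> B\<close>] by (simp add: m_assoc)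
  thus "a \<otimes> r \<in> {b \<otimes> x | x. x \<in> B}" using B_mult[OF x(2) \<open>r \<in> B\<close>] by blast
 next
  fix a c assume "a \<in> {b \<otimes> x | x. x \<in> B}" "c \<in> {b \<otimes> x | x. x \<in> B}"
  then obtain x x' where x: "a = b \<otimes> x" "x \<in> B" "c = b \<otimes> x'" "x' \<in> B" by blast
  hence "a \<oplus> c = b \<otimes> (x \<oplus> x')" using bc B_carrier by (simp add: r_distr)
  thus "a \<oplus> c \<in> {b \<otimes> x | x. x \<in> B}" using x B_add by blast
 next
  have "b = b \<otimes> \<one>" using bc by simp
  thus "b \<in> {b \<otimes> x | x. x \<in> B}" using B_one by blast
 qed (use b B_mult in auto)
 then obtain x where x: "x \<in> B" "b \<otimes> x = \<one>" by auto
 have "\<one> \<in> {x \<otimes> b | x. x \<in> B}"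
 proof (rule B_simple[where b = b])
  fix a r assume "a \<in> {x \<otimes> b | x. x \<in> B}" "r \<in> B"
  then obtain x where x: "a = x \<otimes> b" "x \<in> B" by blast
  have "a \<otimes> r = (x \<otimes> ci i r) \<otimes> b"
   using x bc comm'[OF \<open>r \<in> B\<close>] B_carrier[OF x(2)] B_carrier[OF \<open>r \<in> B\<close>] B_carrier[OF ci_B[OF \<open>r \<in> B\<close>]]
   by (simp add: m_assoc)
  thus "a \<otimes> r \<in> {x \<otimes> b | x. x \<in> B}" using B_mult[OF x(2) ci_B[OF \<open>r \<in> B\<close>]] by blast
  have "r \<otimes> a = (r \<otimes> x) \<otimes> b" using x bc B_carrier[OF x(2)] B_carrier[OF \<open>r \<in> B\<close>] by (simp add: m_assoc)
  thus "r \<otimes> a \<in> {x \<otimes> b | x. x \<in> B}" using B_mult[OF \<open>r \<in> B\<close> x(2)] by blast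
 next
  fix a c assume "a \<in> {x \<otimes> b | x. x \<in> B}" "c \<in> {x \<otimes> b | x. x \<in> B}"
  then obtain x x' where x: "a = x \<otimes> b" "x \<in> B" "c = x' \<otimes> b" "x' \<in> B" by blast
  hence "a \<oplus> c = (x \<oplus> x') \<otimes> b" using bc B_carrier by (simp add: l_distr)
  thus "a \<oplus> c \<in> {x \<otimes> b | x. x \<in> B}" using x B_add by blast
 next
  have "b = \<one> \<otimes> b" using bc by simp
  thus "b \<in> {x \<otimes> b | x. x \<in> B}" using B_one by blast
 qed (use b B_mult in auto)
 then obtain x' where x': "x' \<in> B" "x' \<otimes> b = \<one>" by auto
 have "x' = x" by (rule inv_unique[OF x'(2) x(2) bc B_carrier[OF x'(1)] B_carrier[OF x(1)]])
 thus ?thesis using x x' by blast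
qed

text \<open>Among the nonzero elements of I consider those of least length k. One of them has
  leading coefficient 1; its twisted commutators with B and with y are shorter elements of I, hence
  zero.\<close>

lemma central_in_ideal:
 assumes I: "ideal I L" and ne: "I \<noteq> {\<zero>}"
 shows "\<exists>g\<in>I \<inter> Z. g \<noteq> \<zero>"
proof -
 interpret I: ideal I L by (rule I)
 define P where "P k f \<longleftrightarrow> f \<in> I \<and> (\<forall>i\<ge>k. cf f i = \<zero>)" for k :: nat and f
 obtain f0 where f0: "f0 \<in> I" "f0 \<noteq> \<zero>" using ne I.zero_closed by auto
 have "P N f0" unfolding P_def using f0(1) cf_high[of _ f0] by auto
 hence ex: "\<exists>k f. f \<noteq> \<zero> \<and> P k f" using f0(2) by blast
 define k where "k = (LEAST k. \<exists>f. f \<noteq> \<zero> \<and> P k f)"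
 obtain f where f: "f \<noteq> \<zero>" "P k f" using LeastI_ex[OF ex] unfolding k_def by blast
 have least: "g = \<zero>" if "P i g" "i < k" for g i
  using not_less_Least[OF that(2)[unfolded k_def]] that(1) by blast
 have PI: "P j g ==> g \<in> carrier L" for j g unfolding P_def using I.Icarr by blast
 have "k \<noteq> 0"
 proof
  assume "k = 0"
  hence "cf f i = \<zero>" for i using f(2) by (simp add: P_def)
  thus False using cf_zero[OF PI[OF f(2)]] f(1) by blast
 qed
 then obtain d where d: "k = Suc d" by (cases k) auto
 have fd: "cf f d \<noteq> \<zero>"
 proof
  assume "cf f d = \<zero>"
  hence "cf f i = \<zero>" if "d \<le> i" for i using f(2) that unfolding P_def d by (cases "i = d") auto
  hence "P d f" using f(2) unfolding P_def by blast
  thus False using least[of d f] f(1) d by simp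
 qed
 have dN: "d < N" using fd cf_high by blast
 \<comment> \<open>The leading coefficients of elements of length at most k form an ideal of B. For
   right multiples r is replaced by \<open>ci d r\<close>, since r is conjugated on its way past
   y^d.\<close>
 have "\<one> \<in> {cf h d | h. P k h}"
 proof (rule B_simple)
  show "{cf h d | h. P k h} \<subseteq> B" using cf_B PI by blast
  show "cf f d \<in> {cf h d | h. P k h}" using f by blast
 next
  fix a b assume "a \<in> {cf h d | h. P k h}" "b \<in> {cf h d | h. P k h}"
  then obtain h h' where h: "a = cf h d" "P k h" "b = cf h' d" "P k h'" by blast
  have "P k (h \<oplus> h')" using h(2,4) PI[OF h(2)] PI[OF h(4)] unfolding P_def by (auto simp: cf_add I.a_closed)
  thus "a \<oplus> b \<in> {cf h d | h. P k h}" using h cf_add[OF PI[OF h(2)] PI[OF h(4)], of d] by force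
 next
  fix a r assume "a \<in> {cf h d | h. P k h}" and r: "r \<in> B"
  then obtain h where h: "a = cf h d" "P k h" by blast
  have "P k (r \<otimes> h)" using h(2) PI[OF h(2)] B_carrier[OF r] unfolding P_def
   by (auto simp: cf_lmult[OF r] I.I_l_closed)
  thus "r \<otimes> a \<in> {cf h d | h. P k h}" using h cf_lmult[OF r PI[OF h(2)], of d] by force
  have "P k (h \<otimes> ci d r)" using h(2) PI[OF h(2)] B_carrier[OF ci_B[OF r]] B_carrier[OF cj_B[OF ci_B[OF r]]] unfolding P_def
   by (auto simp: cf_rmult[OF ci_B[OF r]] I.I_r_closed)
  thus "a \<otimes> r \<in> {cf h d | h. P k h}"
   using h cf_rmult[OF ci_B[OF r] PI[OF h(2)], of d d] cj_ci[OF B_carrier[OF r]] by force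
 qed (use fd in auto)
 then obtain h where h: "P k h" "cf h d = \<one>" by force
 note hc = PI[OF h(1)]
 have hI: "h \<in> I" using h by (simp add: P_def)
 have hh: "cf h i = \<zero>" if "i > d" for i using h(1) that by (simp add: P_def d)
 have 1: "cj d r \<otimes> h = h \<otimes> r" if r: "r \<in> B" for r
 proof -
  note rc = B_carrier[OF r] and jc = B_carrier[OF cj_B[OF r]]
  have "P d (cj d r \<otimes> h \<ominus> h \<otimes> r)" unfolding P_def
  proof (intro conjI allI impI)
   show "cj d r \<otimes> h \<ominus> h \<otimes> r \<in> I" unfolding minus_eq
    by (intro I.a_closed I.a_inv_closed I.I_l_closed I.I_r_closed hI rc jc)
   fix i assume "d \<le> i"
   have "cf (cj d r \<otimes> h \<ominus> h \<otimes> r) i = cj d r \<otimes> cf h i \<ominus> cf h i \<otimes> cj i r"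
    using hc rc jc by (simp add: cf_diff cf_lmult cf_rmult cj_B r)
   thus "cf (cj d r \<otimes> h \<ominus> h \<otimes> r) i = \<zero>"
    using \<open>d \<le> i\<close> hh[of i] h(2) jc B_carrier[OF cj_B[OF r, of i]] by (cases "i = d") (auto simp: minus_eq r_neg)
  qed
  from least[OF this] show ?thesis using d hc rc jc by simp
 qed
 have 2: "h \<otimes> y = y \<otimes> h"
 proof -
  have iy: "inv y \<in> carrier L" using y by auto
  have "P d (y \<otimes> h \<otimes> inv y \<ominus> h)" unfolding P_def
  proof (intro conjI allI impI)
   show "y \<otimes> h \<otimes> inv y \<ominus> h \<in> I" unfolding minus_eq
    by (intro I.a_closed I.a_inv_closed I.I_l_closed I.I_r_closed hI yc iy)
   fix i assume "d \<le> i"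
   have "cf (y \<otimes> h \<otimes> inv y \<ominus> h) i = y \<otimes> cf h i \<otimes> inv y \<ominus> cf h i"
    using hc iy by (simp add: cf_diff cf_conj)
   thus "cf (y \<otimes> h \<otimes> inv y \<ominus> h) i = \<zero>"
    using \<open>d \<le> i\<close> hh[of i] h(2) iy y by (cases "i = d") (auto simp: minus_eq r_neg)
  qed
  from least[OF this] show ?thesis using d hc iy conj_eq[OF hc] by simp
 qed
 \<comment> \<open>The factor y^-d undoes the twist \<open>cj d\<close> and turns h into a central
   element.\<close>
 have "h \<otimes> yi d \<in> Z"
 proof (rule Z_I)
  fix b assume b: "b \<in> B"
  note bc = B_carrier[OF b] and cic = B_carrier[OF ci_B[OF b]]
  have "b \<otimes> (h \<otimes> yi d) = (cj d (ci d b) \<otimes> h) \<otimes> yi d" using cj_ci[OF bc] hc bc by (simp add: m_assoc)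
  also have "\<dots> = h \<otimes> (ci d b \<otimes> yi d)" using 1[OF ci_B[OF b]] hc cic by (simp add: m_assoc)
  also have "ci d b \<otimes> yi d = yi d \<otimes> b" unfolding ci_def using bc by (simp add: cancel_yi)
  finally show "h \<otimes> yi d \<otimes> b = b \<otimes> (h \<otimes> yi d)" using hc bc by (simp add: m_assoc)
 next
  have "yi d \<otimes> y = y \<otimes> yi d"
  proof -
   have "y [^] d \<otimes> y = y \<otimes> y [^] d" using nat_pow_Suc2[of y d] by simp
   hence "yi d \<otimes> (y [^] d \<otimes> y) \<otimes> yi d = yi d \<otimes> (y \<otimes> y [^] d) \<otimes> yi d" by simp
   thus ?thesis by (simp add: m_assoc y_yi) (simp add: m_assoc[symmetric] y_yi)
  qed
  hence "h \<otimes> yi d \<otimes> y = (h \<otimes> y) \<otimes> yi d" using hc by (simp add: m_assoc)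
  thus "h \<otimes> yi d \<otimes> y = y \<otimes> (h \<otimes> yi d)" using 2 hc by (simp add: m_assoc)
 qed (use hc in auto)
 moreover have "h \<otimes> yi d \<in> I" by (intro I.I_r_closed hI yi_c)
 moreover have "h \<otimes> yi d \<noteq> \<zero>"
 proof
  assume "h \<otimes> yi d = \<zero>"
  hence "h = \<zero>" using cancel_yi(2)[OF hc, of d] by simp
  hence "cf h d = \<zero>" using cf_diff[OF hc hc, of d] cf_c[OF hc] by (simp add: minus_eq r_neg)
  thus False using h(2) nontrivial by simp
 qed
 ultimately show ?thesis by blast
qed

text \<open>The leading components b y^k of v and b' y^k of w are central, and the second is a unit.
  Their quotient b b'^-1 is therefore central and lies in B, so it can serve as the multiplier in an
  elimination.\<close>

lemma central_eliminate:
 assumes v: "v \<in> Z" and w: "w \<in> Z" and kN: "k < N" and wk: "cf w k \<noteq> \<zero>"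
  and hi: "\<And>j. k < j ==> cf v j = \<zero>" "\<And>j. k < j ==> cf w j = \<zero>"
 shows "\<exists>\<zeta>\<in>Z. \<forall>j\<ge>k. cf (v \<ominus> \<zeta> \<otimes> w) j = \<zero>"
proof -
 note vc = Z_c[OF v] and wc = Z_c[OF w]
 define b b' where "b = cf v k" and "b' = cf w k"
 have bc: "b \<in> carrier L" and bc': "b' \<in> carrier L" unfolding b_def b'_def using vc wc by (auto intro: cf_c)
 obtain x where x: "x \<in> B" "b' \<otimes> x = \<one>" "x \<otimes> b' = \<one>"
  using semicentral_unit_B[OF cf_B[OF wc] wk Z_component(2)[OF w kN]] unfolding b'_def by blast
 note xc = B_carrier[OF x(1)]
 define \<zeta> where "\<zeta> = b \<otimes> x"
 have \<zeta>B: "\<zeta> \<in> B" unfolding \<zeta>_def b_def using cf_B[OF vc] x(1) by (rule B_mult)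
 note \<zeta>c = B_carrier[OF \<zeta>B]
 have cZ: "b \<otimes> y [^] k \<in> Z" "b' \<otimes> y [^] k \<in> Z" unfolding b_def b'_def
  by (rule Z_component(1)[OF v kN], rule Z_component(1)[OF w kN])
 define c where "c = b' \<otimes> y [^] k"
 have cc: "c \<in> carrier L" "yi k \<otimes> x \<in> carrier L" unfolding c_def using bc' xc by auto
 have i1: "c \<otimes> (yi k \<otimes> x) = \<one>" unfolding c_def using bc' xc x(2) by (simp add: m_assoc cancel_yi)
 have "(yi k \<otimes> x) \<otimes> c = yi k \<otimes> (x \<otimes> b') \<otimes> y [^] k"
  unfolding c_def using bc' xc by (simp only: m_assoc m_closed yi_c yc)
 hence i2: "(yi k \<otimes> x) \<otimes> c = \<one>" using x(3) by (simp add: y_yi)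
 have U: "c \<in> Units L" unfolding Units_def using cc i1 i2 by blast
 have "inv c = yi k \<otimes> x" by (rule inv_unique'[OF cc i1 i2, symmetric])
 hence "b \<otimes> y [^] k \<otimes> inv c = \<zeta>" unfolding \<zeta>_def using bc xc by (simp add: m_assoc cancel_yi)
 moreover have "b \<otimes> y [^] k \<otimes> inv c \<in> Z"
  by (rule Z_mult[OF cZ(1) Z_inv[OF cZ(2)[folded c_def] U]])
 ultimately have \<zeta>Z: "\<zeta> \<in> Z" by simp
 have "cf (v \<ominus> \<zeta> \<otimes> w) j = \<zero>" if "k \<le> j" for j
 proof -
  have 1: "cf (v \<ominus> \<zeta> \<otimes> w) j = cf v j \<ominus> \<zeta> \<otimes> cf w j"
   using vc wc \<zeta>c by (simp add: cf_diff cf_lmult[OF \<zeta>B])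
  show ?thesis
  proof (cases "j = k")
   case True
   have "\<zeta> \<otimes> b' = b" unfolding \<zeta>_def using bc bc' xc x(3) by (simp add: m_assoc)
   hence "b \<ominus> \<zeta> \<otimes> b' = \<zero>" using bc by (simp add: minus_eq r_neg)
   thus ?thesis using 1 True unfolding b_def b'_def by simp
  next
   case False
   thus ?thesis unfolding 1 using hi[of j] that \<zeta>c by (simp add: minus_eq)
  qed
 qed
 thus ?thesis using \<zeta>Z by blast
qed

text \<open>If F' Z lies in F Z and every leading degree of F Z occurs in F' Z, then elimination
  from the top downwards shows that the two coincide.\<close>

lemma central_descend:
 assumes F: "F \<in> Z" and F': "F' \<in> Z" and sub: "\<And>z. z \<in> Z ==> \<exists>z'\<in>Z. F' \<otimes> z = F \<otimes> z'"
  and lead: "\<And>z k. [| z \<in> Z; k < N; cf (F \<otimes> z) k \<noteq> \<zero>; \<forall>j>k. cf (F \<otimes> z) j = \<zero> |] ==>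
    \<exists>z'\<in>Z. cf (F' \<otimes> z') k \<noteq> \<zero> \<and> (\<forall>j>k. cf (F' \<otimes> z') j = \<zero>)"
 shows "[| z \<in> Z; \<forall>j\<ge>k. cf (F \<otimes> z) j = \<zero> |] ==> \<exists>w\<in>Z. F \<otimes> z = F' \<otimes> w"
proof (induction k arbitrary: z)
 case 0
 have "F \<otimes> z = \<zero>"
 proof (rule cf_zero)
  show "F \<otimes> z \<in> carrier L" using Z_c[OF F] Z_c[OF 0(1)] by simp
  show "cf (F \<otimes> z) i = \<zero>" for i using 0(2) by simp
 qed
 moreover have "F' \<otimes> \<zero> = \<zero>" using Z_c[OF F'] by simp
 moreover have "\<zero> \<in> Z" by (simp add: Z_def)
 ultimately show ?case by metis
next
 case (Suc k)
 note z = Suc.prems(1)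
 define v where "v = F \<otimes> z"
 have v: "v \<in> Z" unfolding v_def by (rule Z_mult[OF F z])
 have hv: "cf v j = \<zero>" if "k < j" for j using Suc.prems(2) that unfolding v_def by auto
 show ?case
 proof (cases "cf v k = \<zero>")
  case True
  hence "cf v j = \<zero>" if "k \<le> j" for j using hv[of j] that by (cases "j = k") auto
  thus ?thesis using Suc.IH[OF z] unfolding v_def by blast
 next
  case False
  hence kN: "k < N" using cf_high by blast
  obtain z' where z': "z' \<in> Z" "cf (F' \<otimes> z') k \<noteq> \<zero>" "\<forall>j>k. cf (F' \<otimes> z') j = \<zero>"
   using lead[OF z kN] False hv unfolding v_def by blast
  define w where "w = F' \<otimes> z'"
  have w: "w \<in> Z" unfolding w_def by (rule Z_mult[OF F' z'(1)])
  obtain \<zeta> where \<zeta>: "\<zeta> \<in> Z" "\<forall>j\<ge>k. cf (v \<ominus> \<zeta> \<otimes> w) j = \<zero>"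
   using central_eliminate[OF v w kN] z'(2,3) hv unfolding w_def by blast
  obtain z2 where z2: "z2 \<in> Z" "w = F \<otimes> z2" using sub[OF z'(1)] unfolding w_def by blast
  note cs = Z_c[OF F] Z_c[OF F'] Z_c[OF z] Z_c[OF z'(1)] Z_c[OF z2(1)] Z_c[OF \<zeta>(1)]
  have sw: "\<zeta> \<otimes> (a \<otimes> b) = a \<otimes> (\<zeta> \<otimes> b)" if "a \<in> carrier L" "b \<in> carrier L" for a b
   using Z_comm[OF \<zeta>(1) that(1)] that cs(6) m_assoc[of \<zeta> a b] m_assoc[of a \<zeta> b] by simp
  have e: "F \<otimes> (z \<ominus> \<zeta> \<otimes> z2) = v \<ominus> \<zeta> \<otimes> w"
   unfolding z2(2) v_def sw[OF cs(1) cs(5)] using cs by (simp add: minus_eq r_distr r_minus)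
  have zz: "z \<ominus> \<zeta> \<otimes> z2 \<in> Z" by (rule Z_diff[OF z Z_mult[OF \<zeta>(1) z2(1)]])
  obtain w1 where w1: "w1 \<in> Z" "v \<ominus> \<zeta> \<otimes> w = F' \<otimes> w1"
   using Suc.IH[OF zz] \<zeta>(2) unfolding e by blast
  have vw: "v \<in> carrier L" "\<zeta> \<otimes> w \<in> carrier L" using Z_c[OF v] Z_c[OF w] cs by auto
  have "v = (v \<ominus> \<zeta> \<otimes> w) \<oplus> \<zeta> \<otimes> w" using vw by (simp add: minus_eq a_assoc l_neg)
  also have "\<dots> = F' \<otimes> w1 \<oplus> F' \<otimes> (\<zeta> \<otimes> z')"
   unfolding w1(2) unfolding w_def sw[OF cs(2) cs(4)] ..
  also have "\<dots> = F' \<otimes> (w1 \<oplus> \<zeta> \<otimes> z')" using cs Z_c[OF w1(1)] by (simp add: r_distr)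
  finally show ?thesis using Z_add[OF w1(1) Z_mult[OF \<zeta>(1) z'(1)]] unfolding v_def by blast
 qed
qed

text \<open>Choose n such that f^n Z has the fewest leading degrees. Then f^n Z = f^(n+1) Z by
  \<open>central_descend\<close>, so f^n = f^(n+1) w for some central w, and f^n cancels because Z
  is a domain.\<close>

lemma central_unit: assumes f: "f \<in> Z" "f \<noteq> \<zero>" shows "\<exists>w\<in>Z. f \<otimes> w = \<one>"
proof -
 define Ld where "Ld F = {i. i < N \<and> (\<exists>z\<in>Z. cf (F \<otimes> z) i \<noteq> \<zero> \<and> (\<forall>j>i. cf (F \<otimes> z) j = \<zero>))}" for F
 have fin: "finite (Ld F)" for F by (rule finite_subset[of _ "{..<N}"]) (auto simp only: Ld_def lessThan_iff mem_Collect_eq finite_lessThan)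
 have "\<exists>n::nat. True \<and> (\<forall>m::nat. True \<longrightarrow> card (Ld (f [^] n)) \<le> card (Ld (f [^] m)))"
  by (rule ex_has_least_nat[where P = "\<lambda>_. True"]) (rule TrueI)
 then obtain n :: nat where n: "\<And>m::nat. card (Ld (f [^] n)) \<le> card (Ld (f [^] m))"
  by blast
 define F F' where "F = f [^] n" and "F' = f [^] Suc n"
 have "card (Ld F) \<le> card (Ld F')" unfolding F_def F'_def by (rule n)
 note fc = Z_c[OF f(1)]
 have F: "F \<in> Z" and F': "F' \<in> Z" unfolding F_def F'_def by (rule Z_pow[OF f(1)])+
 have F'F: "F' = F \<otimes> f" unfolding F_def F'_def by simp
 have sub: "\<exists>z'\<in>Z. F' \<otimes> z = F \<otimes> z'" if "z \<in> Z" for z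
  unfolding F'F by (rule bexI[of _ "f \<otimes> z"], rule m_assoc[OF Z_c[OF F] fc Z_c[OF that]], rule Z_mult[OF f(1) that])
 have "Ld F' \<subseteq> Ld F"
 proof
  fix i assume "i \<in> Ld F'"
  then obtain z where z: "i < N" "z \<in> Z" "cf (F' \<otimes> z) i \<noteq> \<zero>" "\<forall>j>i. cf (F' \<otimes> z) j = \<zero>"
   unfolding Ld_def by blast
  obtain z' where z': "z' \<in> Z" "F' \<otimes> z = F \<otimes> z'" using sub[OF z(2)] by blast
  show "i \<in> Ld F" unfolding Ld_def using z(1,3,4) z'(1) unfolding z'(2) by blast
 qed
 hence Ld: "Ld F' = Ld F" using \<open>card (Ld F) \<le> card (Ld F')\<close>
  by (rule card_seteq[OF fin])
 have lead: "\<exists>z'\<in>Z. cf (F' \<otimes> z') k \<noteq> \<zero> \<and> (\<forall>j>k. cf (F' \<otimes> z') j = \<zero>)"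
  if "z \<in> Z" "k < N" "cf (F \<otimes> z) k \<noteq> \<zero>" "\<forall>j>k. cf (F \<otimes> z) j = \<zero>" for z k
 proof -
  have "k \<in> Ld F'" unfolding Ld unfolding Ld_def using that by blast
  thus ?thesis unfolding Ld_def by blast
 qed
 have "\<exists>w\<in>Z. F \<otimes> \<one> = F' \<otimes> w"
 proof (rule central_descend[where k = N])
  show "\<forall>j\<ge>N. cf (F \<otimes> \<one>) j = \<zero>" by (intro allI impI cf_high) simp
  show "\<exists>z'\<in>Z. F' \<otimes> z = F \<otimes> z'" if "z \<in> Z" for z by (rule sub[OF that])
  show "\<exists>z'\<in>Z. cf (F' \<otimes> z') k \<noteq> \<zero> \<and> (\<forall>j>k. cf (F' \<otimes> z') j = \<zero>)"
   if "z \<in> Z" "k < N" "cf (F \<otimes> z) k \<noteq> \<zero>" "\<forall>j>k. cf (F \<otimes> z) j = \<zero>" for z k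
   by (rule lead[OF that])
 qed (rule F F' Z_one)+
 then obtain w where w: "w \<in> Z" "F \<otimes> \<one> = F' \<otimes> w" by (elim bexE)
 define d where "d = \<one> \<ominus> f \<otimes> w"
 note cs = Z_c[OF F] fc Z_c[OF w(1)]
 have fw: "f \<otimes> w \<in> carrier L" using cs by simp
 have "F \<otimes> d = F \<otimes> \<one> \<ominus> F \<otimes> (f \<otimes> w)"
  unfolding d_def minus_eq using cs(1) fw by (simp only: r_distr r_minus one_closed a_inv_closed)
 also have "F \<otimes> (f \<otimes> w) = F \<otimes> \<one>" unfolding w(2) F'F by (rule m_assoc[symmetric, OF cs])
 finally have d: "F \<otimes> d = \<zero>" using cs(1) by (simp add: minus_eq r_neg)
 have dZ: "d \<in> Z" unfolding d_def by (rule Z_diff[OF Z_one Z_mult[OF f(1) w(1)]])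
 have "F \<noteq> \<zero>" unfolding F_def by (rule Z_pow_ne[OF f])
 hence "d = \<zero>" using centre_domain[OF Z_c[OF F] Z_c[OF dZ] Z_comm[OF F] Z_comm[OF dZ] d] by simp
 hence "\<one> = f \<otimes> w" unfolding d_def by (rule iffD1[OF r_right_minus_eq[OF one_closed fw]])
 thus ?thesis by (intro bexI[OF _ w(1)]) (rule sym)
qed

theorem graded_simple: "simple_ring L"
 unfolding simple_ring_def
proof (intro conjI allI impI)
 show "ring L" by (rule ring_axioms)
 show "\<one> \<noteq> \<zero>" by (rule nontrivial)
 fix I assume I: "ideal I L"
 show "I = {\<zero>} \<or> I = carrier L"
 proof (cases "I = {\<zero>}")
  case False
  interpret I: ideal I L by (rule I)
  obtain g where g: "g \<in> I" "g \<in> Z" "g \<noteq> \<zero>" using central_in_ideal[OF I False] by blast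
  obtain w where w: "w \<in> Z" "g \<otimes> w = \<one>" using central_unit[OF g(2,3)] by blast
  have "\<one> \<in> I" using I.I_r_closed[OF g(1) Z_c[OF w(1)]] w(2) by simp
  thus ?thesis using I.one_imp_carrier by blast
 qed simp
qed

end

lemma (in monoid) inv_mult_units:
 assumes x: "x \<in> Units G" and y: "y \<in> Units G" shows "inv (x \<otimes> y) = inv y \<otimes> inv x"
proof (rule inv_unique'[symmetric])
 have c: "x \<in> carrier G" "y \<in> carrier G" "inv x \<in> carrier G" "inv y \<in> carrier G" using x y by auto
 show "x \<otimes> y \<in> carrier G" "inv y \<otimes> inv x \<in> carrier G" using c by auto
 have "x \<otimes> y \<otimes> (inv y \<otimes> inv x) = x \<otimes> (y \<otimes> inv y) \<otimes> inv x" using c by (simp only: m_assoc m_closed)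
 thus "x \<otimes> y \<otimes> (inv y \<otimes> inv x) = \<one>" using c x y by simp
 have "inv y \<otimes> inv x \<otimes> (x \<otimes> y) = inv y \<otimes> (inv x \<otimes> x) \<otimes> y" using c by (simp only: m_assoc m_closed)
 thus "inv y \<otimes> inv x \<otimes> (x \<otimes> y) = \<one>" using c x y by simp
qed

section \<open>Matrices over a discrete valuation ring\<close>

locale dvr = ring F for F :: "('a, 'm) ring_scheme" (structure) +
 fixes D and \<pi>
 assumes dvr: "discrete_valuation_ring D F" and unif: "is_uniformiser D F \<pi>"
begin

abbreviation "v \<equiv> induced_val D F \<pi>"
abbreviation "R \<equiv> F\<lparr>carrier := D\<rparr>"

lemma D: "subring D F" and div: "is_division_ring F" and noeth: "is_noetherian R"
 and not_div: "\<not> is_division_ring R"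
 and total: "x \<in> carrier F ==> x \<noteq> \<zero> ==> x \<in> D \<or> inv x \<in> D"
 using dvr unfolding discrete_valuation_ring_def division_ring_of_fractions_def by auto

lemma one_ne: "\<one> \<noteq> \<zero>" using div by (simp add: is_division_ring_def)

lemma unit: "x \<in> carrier F ==> x \<noteq> \<zero> ==> x \<in> Units F"
 using div by (auto simp: is_division_ring_def)

lemma Dc: "x \<in> D ==> x \<in> carrier F" using subringE(1)[OF D] by auto
lemmas D0 = subringE(2)[OF D] and D1 = subringE(3)[OF D] and Dneg = subringE(5)[OF D]
 and Dmult = subringE(6)[OF D] and Dadd = subringE(7)[OF D]

lemma R_ring: "ring R" by (rule subring_is_ring[OF D])

lemma R_neg: assumes "a \<in> D" shows "\<ominus>\<^bsub>R\<^esub> a = \<ominus> a"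
proof -
 interpret R: ring R by (rule R_ring)
 show ?thesis by (rule R.minus_equality) (use assms Dneg[OF assms] Dc[OF assms] in \<open>auto simp: l_neg\<close>)
qed

lemma R_minus: "a \<in> D ==> b \<in> D ==> a \<ominus>\<^bsub>R\<^esub> b = a \<ominus> b"
 using R_neg by (simp add: a_minus_def)

lemma add_subgroupI:
 assumes "I \<subseteq> D" "\<zero> \<in> I" "\<And>a b. a \<in> I ==> b \<in> I ==> a \<oplus> b \<in> I" "\<And>a. a \<in> I ==> \<ominus> a \<in> I"
 shows "additive_subgroup I R"
proof (rule additive_subgroup.intro)
 interpret R: ring R by (rule R_ring)
 show "subgroup I (add_monoid R)"
 proof (rule R.add.subgroupI)
  show "\<ominus>\<^bsub>R\<^esub> a \<in> I" if "a \<in> I" for a using R_neg assms(1,4) that by auto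
 qed (use assms in auto)
qed

lemma add_subgroupD: assumes "additive_subgroup I R"
 shows "I \<subseteq> D" "\<zero> \<in> I" "\<And>a b. a \<in> I ==> b \<in> I ==> a \<oplus> b \<in> I"
 using additive_subgroup.a_subset[OF assms] additive_subgroup.zero_closed[OF assms]
  additive_subgroup.a_closed[OF assms] by auto

text \<open>The nonunits of D, shown below to form the unique maximal right ideal and hence
  J(D).\<close>

definition mm where "mm = {e \<in> D. e = \<zero> \<or> inv e \<notin> D}"

lemma mm_mult: assumes a: "a \<in> mm" and r: "r \<in> D" shows "a \<otimes> r \<in> mm"
proof (cases "a \<otimes> r = \<zero>")
 case False
 have aD: "a \<in> D" "a \<in> carrier F" "r \<in> carrier F" using a r Dc by (auto simp: mm_def)
 have "a \<noteq> \<zero>" using False aD by auto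
 have "inv (a \<otimes> r) \<notin> D"
 proof
  assume i: "inv (a \<otimes> r) \<in> D"
  have "a \<otimes> (r \<otimes> inv (a \<otimes> r)) = \<one>"
   using aD unit[OF _ False] Dc[OF i] by (simp add: m_assoc[symmetric])
  hence "inv a = r \<otimes> inv (a \<otimes> r)"
   using unit[OF aD(2) \<open>a \<noteq> \<zero>\<close>] aD Dc[OF i] inv_unique[of "inv a" a "r \<otimes> inv (a \<otimes> r)"] by simp
  hence "inv a \<in> D" using Dmult[OF r i] by simp
  thus False using a \<open>a \<noteq> \<zero>\<close> by (simp add: mm_def)
 qed
 thus ?thesis using Dmult[OF aD(1) r] by (simp add: mm_def)
qed (simp add: mm_def D0)

lemma mm_add_aux: assumes a: "a \<in> mm" "a \<noteq> \<zero>" and b: "b \<in> D" and ab: "inv a \<otimes> b \<in> D"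
 shows "a \<oplus> b \<in> mm"
proof -
 have aD: "a \<in> carrier F" using a Dc by (auto simp: mm_def)
 note U = unit[OF aD a(2)]
 have "a \<otimes> (\<one> \<oplus> inv a \<otimes> b) = a \<oplus> b"
  using aD U Dc[OF b] Dc[OF ab] by (simp add: r_distr m_assoc[symmetric])
 thus ?thesis using mm_mult[OF a(1) Dadd[OF D1 ab]] by simp
qed

text \<open>One of a^-1 b and b^-1 a lies in D, so the sum is a right multiple of a or of b.\<close>

lemma mm_add: assumes a: "a \<in> mm" and b: "b \<in> mm" shows "a \<oplus> b \<in> mm"
proof (cases "a = \<zero> \<or> b = \<zero>")
 case True
 thus ?thesis using a b Dc by (auto simp: mm_def)
next
 case False
 have c: "a \<in> D" "b \<in> D" "a \<in> carrier F" "b \<in> carrier F" using a b Dc by (auto simp: mm_def)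
 have U: "a \<in> Units F" "b \<in> Units F" using unit c False by auto
 have "inv a \<otimes> b \<in> Units F" using U by auto
 hence "inv a \<otimes> b \<noteq> \<zero>" using one_ne by (metis Units_l_inv_ex r_null)
 hence "inv a \<otimes> b \<in> D \<or> inv (inv a \<otimes> b) \<in> D" using U by (intro total) auto
 moreover have "inv (inv a \<otimes> b) = inv b \<otimes> a" using U by (simp add: inv_mult_units)
 ultimately show ?thesis
  using mm_add_aux[OF a _ c(2)] mm_add_aux[OF b _ c(1)] False a_comm[OF c(3,4)] by auto
qed

lemma mm_right: "right_ideal mm R"
proof -
 have "\<ominus> a \<in> mm" if "a \<in> mm" for a
 proof -
  have "a \<otimes> \<ominus> \<one> = \<ominus> a" using that Dc by (simp add: mm_def r_minus)
  thus ?thesis using mm_mult[OF that Dneg[OF D1]] by simp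
 qed
 moreover have "mm \<subseteq> D" "\<zero> \<in> mm" using D0 by (auto simp: mm_def)
 ultimately have "additive_subgroup mm R" using mm_add by (intro add_subgroupI)
 thus ?thesis unfolding right_ideal_def using mm_mult by simp
qed

lemma proper_right: assumes I: "right_ideal I R" "I \<noteq> D" shows "I \<subseteq> mm"
proof
 fix e assume e: "e \<in> I"
 have sub: "I \<subseteq> D" and m: "\<And>r a. r \<in> D ==> a \<in> I ==> a \<otimes> r \<in> I"
  using I(1) add_subgroupD(1) by (auto simp: right_ideal_def)
 show "e \<in> mm"
 proof (rule ccontr)
  assume "e \<notin> mm"
  hence i: "e \<noteq> \<zero>" "inv e \<in> D" using e sub by (auto simp: mm_def)
  have ec: "e \<in> carrier F" using e sub Dc by auto
  have "\<one> \<in> I" using m[OF i(2) e] unit[OF ec i(1)] by simp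
  hence "d \<in> I" if "d \<in> D" for d using m[OF that] Dc[OF that] by fastforce
  thus False using I(2) sub by blast
 qed
qed

lemma one_mm: "\<one> \<notin> mm" using one_ne D1 by (simp add: mm_def)

lemma jacobson: "jacobson_radical R = mm"
proof -
 have mx: "maximal_right_ideal mm R"
  unfolding maximal_right_ideal_def using mm_right proper_right one_mm D1 by auto
 have "M = mm" if "maximal_right_ideal M R" for M
  using that mm_right proper_right[of M] one_mm D1 unfolding maximal_right_ideal_def by auto
 hence "{M. maximal_right_ideal M R} = {mm}" using mx by blast
 moreover have "mm \<subseteq> D" by (auto simp: mm_def)
 ultimately show ?thesis unfolding jacobson_radical_def by (simp only: Inter_insert Inter_empty) auto
qed

lemma \<pi>D: "\<pi> \<in> D" and mm_eq: "mm = \<pi> <#\<^bsub>F\<^esub> D" and normal: "\<pi> <#\<^bsub>F\<^esub> D = D #>\<^bsub>F\<^esub> \<pi>"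
 using unif jacobson by (auto simp: is_uniformiser_def)

lemma \<pi>c: "\<pi> \<in> carrier F" using Dc \<pi>D .

lemma \<pi>_ne: "\<pi> \<noteq> \<zero>"
proof
 assume "\<pi> = \<zero>"
 hence "mm \<subseteq> {\<zero>}" unfolding mm_eq l_coset_def using Dc by auto
 hence i: "inv e \<in> D" if "e \<in> D" "e \<noteq> \<zero>" for e using that by (auto simp: mm_def)
 have "e \<in> Units R" if e: "e \<in> D" "e \<noteq> \<zero>" for e
 proof -
  have "e \<otimes> inv e = \<one>" "inv e \<otimes> e = \<one>" using unit[OF Dc[OF e(1)] e(2)] by auto
  thus ?thesis using i[OF e] e(1) unfolding Units_def by auto
 qed
 hence "is_division_ring R" unfolding is_division_ring_def using R_ring one_ne by auto
 thus False using not_div by simp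
qed

lemma \<pi>U: "\<pi> \<in> Units F" using unit \<pi>c \<pi>_ne by auto

lemma \<pi>_mm: "\<pi> \<in> mm"
proof -
 have "\<pi> \<otimes> \<one> \<in> mm" unfolding mm_eq l_coset_def using D1 by blast
 thus ?thesis using \<pi>c by simp
qed

lemma inv_\<pi>: "inv \<pi> \<notin> D" using \<pi>_mm \<pi>_ne by (simp add: mm_def)

definition pw :: "int \<Rightarrow> 'a" where "pw k = \<pi> [^] k"

text \<open>F is not a group under multiplication, so the laws of integer powers are taken from its
  group of units.\<close>

lemma pw_units: "pw k = \<pi> [^]\<^bsub>units_of F\<^esub> k" (is ?A) and pw_U: "pw k \<in> Units F" (is ?B)
proof -
 have n: "\<pi> [^] (n::nat) = \<pi> [^]\<^bsub>units_of F\<^esub> n" for n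
  using \<pi>U by (simp add: units_of_pow)
 have U: "\<pi> [^] (n::nat) \<in> Units F" for n using \<pi>U by (rule Units_pow_closed)
 show ?A unfolding pw_def int_pow_def2 n[symmetric] units_of_inv[OF U] ..
 show ?B unfolding pw_def int_pow_def2
  by (cases "k < 0") (simp_all only: if_True if_False U Units_inv_Units)
qed

lemma pw_add: "pw (k + l) = pw k \<otimes> pw l"
proof -
 interpret U: group "units_of F" by (rule units_group)
 show ?thesis unfolding pw_units using U.int_pow_mult[of \<pi> k l] \<pi>U
  by (simp add: units_of_carrier units_of_mult)
qed

lemma pw_0: "pw 0 = \<one>" and pw_1: "pw 1 = \<pi>" and pw_m1: "pw (- 1) = inv \<pi>"
 using \<pi>c by (auto simp: pw_def int_pow_def2)

lemma pwc [simp]: "pw k \<in> carrier F" using pw_U by auto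

lemma pw_cancel: "x \<in> carrier F ==> pw k \<otimes> (pw l \<otimes> x) = pw (k + l) \<otimes> x"
 by (simp add: pw_add m_assoc)

lemma conj1: assumes "d \<in> D" shows "\<pi> \<otimes> d \<otimes> inv \<pi> \<in> D" "inv \<pi> \<otimes> d \<otimes> \<pi> \<in> D"
proof -
 have "\<pi> \<otimes> d \<in> D #>\<^bsub>F\<^esub> \<pi>" using assms normal unfolding l_coset_def by blast
 then obtain d' where d': "d' \<in> D" "\<pi> \<otimes> d = d' \<otimes> \<pi>" unfolding r_coset_def by blast
 have ic: "inv \<pi> \<in> carrier F" using \<pi>U by simp
 have "\<pi> \<otimes> d \<otimes> inv \<pi> = d'" unfolding d'(2) using \<pi>U \<pi>c ic Dc[OF d'(1)] by (simp add: m_assoc)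
 thus "\<pi> \<otimes> d \<otimes> inv \<pi> \<in> D" using d'(1) by simp
 have "d \<otimes> \<pi> \<in> \<pi> <#\<^bsub>F\<^esub> D" using assms normal unfolding r_coset_def by blast
 then obtain d'' where d'': "d'' \<in> D" "d \<otimes> \<pi> = \<pi> \<otimes> d''" unfolding l_coset_def by blast
 have "inv \<pi> \<otimes> d \<otimes> \<pi> = inv \<pi> \<otimes> (d \<otimes> \<pi>)" using \<pi>U \<pi>c ic Dc[OF assms] by (simp add: m_assoc)
 also have "\<dots> = d''" unfolding d''(2) using \<pi>U \<pi>c ic Dc[OF d''(1)] by (simp add: m_assoc[symmetric])
 finally show "inv \<pi> \<otimes> d \<otimes> \<pi> \<in> D" using d''(1) by simp
qed

text \<open>Normality of \<pi>, iterated in both directions; it allows powers of \<pi> to change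
  sides in tests of membership in D.\<close>

lemma pw_conj: assumes "d \<in> D" shows "pw k \<otimes> d \<otimes> pw (- k) \<in> D"
proof -
 have dc: "d \<in> carrier F" using Dc assms .
 have "pw (int n) \<otimes> d \<otimes> pw (- int n) \<in> D \<and> pw (- int n) \<otimes> d \<otimes> pw (int n) \<in> D" for n
 proof (induction n)
  case 0
  thus ?case using assms dc by (simp add: pw_0)
 next
  case (Suc n)
  have ic: "inv \<pi> \<in> carrier F" using \<pi>U by simp
  have e: "int (Suc n) = 1 + int n" "int (Suc n) = int n + 1"
   "- int (Suc n) = - int n + (- 1)" "- int (Suc n) = - 1 + (- int n)" by auto
  have p: "pw (int (Suc n)) = \<pi> \<otimes> pw (int n)" "pw (int (Suc n)) = pw (int n) \<otimes> \<pi>"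
   "pw (- int (Suc n)) = pw (- int n) \<otimes> inv \<pi>" "pw (- int (Suc n)) = inv \<pi> \<otimes> pw (- int n)"
   by (subst e(1), simp only: pw_add pw_1, subst e(2), simp only: pw_add pw_1,
     subst e(3), simp only: pw_add pw_m1, subst e(4), simp only: pw_add pw_m1)
  have "pw (int (Suc n)) \<otimes> d \<otimes> pw (- int (Suc n)) = \<pi> \<otimes> (pw (int n) \<otimes> d \<otimes> pw (- int n)) \<otimes> inv \<pi>"
   unfolding p(1,3) using dc \<pi>c ic by (simp only: m_assoc m_closed pwc)
  moreover have "pw (- int (Suc n)) \<otimes> d \<otimes> pw (int (Suc n)) = inv \<pi> \<otimes> (pw (- int n) \<otimes> d \<otimes> pw (int n)) \<otimes> \<pi>"
   unfolding p(2,4) using dc \<pi>c ic by (simp only: m_assoc m_closed pwc)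
  ultimately show ?case using conj1 Suc by simp
 qed
 from this[of "nat k"] this[of "nat (- k)"] show ?thesis by (cases "0 \<le> k") auto
qed

lemma pw_D: assumes "0 \<le> k" shows "pw k \<in> D"
proof -
 have "\<pi> [^] (n::nat) \<in> D" for n by (induction n) (auto simp: D1 Dmult \<pi>D)
 from this[of "nat k"] show ?thesis
  unfolding pw_def int_pow_def2 if_not_P[OF assms[unfolded not_less[symmetric]]] .
qed

lemma down: assumes "x \<in> carrier F" "pw (- n) \<otimes> x \<in> D" "k \<le> n" shows "pw (- k) \<otimes> x \<in> D"
proof -
 have "pw (- k) \<otimes> x = pw (n - k) \<otimes> (pw (- n) \<otimes> x)" using assms(1) by (simp add: pw_cancel)
 thus ?thesis using Dmult[OF pw_D assms(2)] assms(3) by simp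
qed

text \<open>If \<pi>^-n x were in D for every n, the left ideals generated by these elements would
  form a strictly ascending chain in the Noetherian ring D.\<close>

lemma bounded_D: assumes x: "x \<in> D" "x \<noteq> \<zero>" shows "\<exists>n::nat. pw (- int n) \<otimes> x \<notin> D"
proof (rule ccontr)
 assume "\<not> ?thesis"
 hence dD: "pw (- int n) \<otimes> x \<in> D" for n by blast
 note xc = Dc[OF x(1)]
 define d where "d n = pw (- int n) \<otimes> x" for n
 have dc: "d n \<in> carrier F" for n using dD Dc by (simp add: d_def)
 have dS: "d n = \<pi> \<otimes> d (Suc n)" for n
  unfolding d_def using pw_cancel[OF xc, of 1 "- int (Suc n)"] by (simp add: pw_1)
 have dne: "d n \<noteq> \<zero>" for n
 proof
  assume "d n = \<zero>"
  hence "pw (int n) \<otimes> d n = \<zero>" by simp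
  thus False using x(2) xc by (simp add: d_def pw_cancel pw_0)
 qed
 define I where "I n = {r \<otimes> d n | r. r \<in> D}" for n
 have "left_ideal (I n) R" for n
  unfolding left_ideal_def
 proof
  show "additive_subgroup (I n) R"
  proof (rule add_subgroupI)
   show "I n \<subseteq> D" using dD Dmult by (auto simp: I_def d_def)
   have "\<zero> = \<zero> \<otimes> d n" using dc by simp
   thus "\<zero> \<in> I n" using D0 unfolding I_def by blast
   fix a assume "a \<in> I n"
   then obtain r where r: "a = r \<otimes> d n" "r \<in> D" by (auto simp: I_def)
   have "\<ominus> a = (\<ominus> r) \<otimes> d n" using r dc Dc[OF r(2)] by (simp add: l_minus)
   thus "\<ominus> a \<in> I n" unfolding I_def using Dneg[OF r(2)] by blast
   fix b assume "b \<in> I n"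
   then obtain r' where r': "b = r' \<otimes> d n" "r' \<in> D" by (auto simp: I_def)
   have "a \<oplus> b = (r \<oplus> r') \<otimes> d n" using r r' dc Dc[OF r(2)] Dc[OF r'(2)] by (simp add: l_distr)
   thus "a \<oplus> b \<in> I n" unfolding I_def using Dadd[OF r(2) r'(2)] by blast
  qed
  show "\<forall>r\<in>carrier R. \<forall>a\<in>I n. r \<otimes>\<^bsub>R\<^esub> a \<in> I n"
  proof (intro ballI)
   fix r a assume r: "r \<in> carrier R" and "a \<in> I n"
   then obtain r' where r': "a = r' \<otimes> d n" "r' \<in> D" by (auto simp: I_def)
   have "r \<otimes> a = (r \<otimes> r') \<otimes> d n" using r r' dc Dc by (simp add: m_assoc)
   thus "r \<otimes>\<^bsub>R\<^esub> a \<in> I n" unfolding I_def using Dmult[OF _ r'(2)] r by auto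
  qed
 qed
 moreover have "I n \<subset> I (Suc n)" for n
 proof
  show "I n \<subseteq> I (Suc n)"
  proof
   fix a assume "a \<in> I n"
   then obtain r where r: "a = r \<otimes> d n" "r \<in> D" by (auto simp: I_def)
   have "a = (r \<otimes> \<pi>) \<otimes> d (Suc n)" unfolding r(1) dS[of n] using dc Dc[OF r(2)] \<pi>c by (simp add: m_assoc)
   thus "a \<in> I (Suc n)" unfolding I_def using Dmult[OF r(2) \<pi>D] by blast
  qed
  have "d (Suc n) \<notin> I n"
  proof
   assume "d (Suc n) \<in> I n"
   then obtain r where r: "d (Suc n) = r \<otimes> d n" "r \<in> D" by (auto simp: I_def)
   have U: "d (Suc n) \<in> Units F" using unit dc dne by blast
   have "\<one> \<otimes> d (Suc n) = (r \<otimes> \<pi>) \<otimes> d (Suc n)"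
    using r(1) dS[of n] dc[of "Suc n"] Dc[OF r(2)] \<pi>c by (simp add: m_assoc)
   hence "r \<otimes> \<pi> = \<one>" using U Dc[OF r(2)] \<pi>c by (metis Units_r_inv m_assoc m_closed one_closed r_one Units_inv_closed dc)
   hence "r = inv \<pi>" using \<pi>U Dc[OF r(2)] by (metis Units_r_inv Units_inv_closed \<pi>c inv_unique)
   thus False using r(2) inv_\<pi> by simp
  qed
  moreover have "d (Suc n) \<in> I (Suc n)" unfolding I_def using D1 dc[of "Suc n"] by (auto intro!: exI[of _ \<one>])
  ultimately show "I n \<noteq> I (Suc n)" by blast
 qed
 ultimately show False using noeth unfolding is_noetherian_def by blast
qed

text \<open>\<open>induced_val\<close> is a GREATEST, so a maximum must be exhibited: the exponents
  n with x in \<pi>^n D are closed downwards, nonempty, and bounded above by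
  \<open>bounded_D\<close>.\<close>

lemma val_ge_iff: assumes x: "x \<in> carrier F" shows "Fin c \<le> v x \<longleftrightarrow> pw (- c) \<otimes> x \<in> D"
proof (cases "x = \<zero>")
 case True
 thus ?thesis using D0 by (simp add: induced_val_def)
next
 case False
 have mem: "x \<in> (\<pi> [^] n) <#\<^bsub>F\<^esub> D \<longleftrightarrow> pw (- n) \<otimes> x \<in> D" for n :: int
 proof
  assume "x \<in> (\<pi> [^] n) <#\<^bsub>F\<^esub> D"
  then obtain d where d: "d \<in> D" "x = pw n \<otimes> d" unfolding l_coset_def pw_def by blast
  thus "pw (- n) \<otimes> x \<in> D" using pw_cancel[OF Dc[OF d(1)]] Dc[OF d(1)] by (simp add: pw_0)
 next
  assume d: "pw (- n) \<otimes> x \<in> D"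
  have "x = pw n \<otimes> (pw (- n) \<otimes> x)" using pw_cancel[OF x] x by (simp add: pw_0)
  thus "x \<in> (\<pi> [^] n) <#\<^bsub>F\<^esub> D" unfolding l_coset_def using d by (auto simp: pw_def)
 qed
 define A where "A = {n::int. pw (- n) \<otimes> x \<in> D}"
 have dn: "k \<in> A" if "n \<in> A" "k \<le> n" for n k using down[OF x _ that(2)] that(1) by (simp add: A_def)
 have "\<exists>a. a \<in> A"
 proof (cases "x \<in> D")
  case True
  thus ?thesis using x by (intro exI[of _ 0]) (simp add: A_def pw_0)
 next
  case nD: False
  let ?i = "inv x"
  have U: "x \<in> Units F" using unit x False .
  have i: "?i \<in> D" "?i \<noteq> \<zero>" using total[OF x False] nD U one_ne by (auto, metis Units_r_inv r_null x)
  \<comment> \<open>If \<pi>^-n x^-1 is not in D, then its inverse x \<pi>^n is, by the valuation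
    property.\<close>
  obtain n where n: "pw (- int n) \<otimes> ?i \<notin> D" using bounded_D[OF i] by blast
  let ?e = "pw (- int n) \<otimes> ?i"
  have eU: "?e \<in> Units F" using pw_U U by auto
  hence "?e \<noteq> \<zero>" using one_ne by (metis Units_l_inv_ex r_null)
  hence "inv ?e \<in> D" using total[of ?e] n eU by auto
  moreover have "inv ?e = x \<otimes> pw (int n)"
  proof -
   have "inv (pw (- int n)) = pw (int n)"
    by (rule inv_unique'[symmetric]) (auto simp: pw_add[symmetric] pw_0)
   thus ?thesis using U pw_U by (simp add: inv_mult_units)
  qed
  ultimately have "x \<otimes> pw (int n) \<in> D" by simp
  \<comment> \<open>The power of \<pi> stands on the right; conjugation moves it to the
    left.\<close>
  from pw_conj[OF this, of "int n"] have "pw (int n) \<otimes> x \<in> D"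
  proof -
   have "pw (int n) \<otimes> (x \<otimes> pw (int n)) \<otimes> pw (- int n) = pw (int n) \<otimes> x \<otimes> (pw (int n) \<otimes> pw (- int n))"
    using x by (simp only: m_assoc m_closed pwc)
   also have "\<dots> = pw (int n) \<otimes> x" using x by (simp add: pw_add[symmetric] pw_0)
   finally show "pw (int n) \<otimes> (x \<otimes> pw (int n)) \<otimes> pw (- int n) \<in> D ==> pw (int n) \<otimes> x \<in> D" by simp
  qed
  thus ?thesis by (intro exI[of _ "- int n"]) (simp add: A_def)
 qed
 then obtain a where a: "a \<in> A" by blast
 let ?d = "pw (- a) \<otimes> x"
 have dD: "?d \<in> D" using a by (simp add: A_def)
 have "?d \<noteq> \<zero>"
 proof
  assume "?d = \<zero>"
  hence "pw a \<otimes> ?d = \<zero>" by simp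
  thus False using False x by (simp add: pw_cancel pw_0)
 qed
 from bounded_D[OF dD this] obtain n where "pw (- int n) \<otimes> ?d \<notin> D" by blast
 moreover have "- int n + - a = - (a + int n)" by simp
 ultimately have nb: "a + int n \<notin> A" unfolding A_def pw_cancel[OF x] by (simp only: mem_Collect_eq not_False_eq_True)
 have fin: "finite (A \<inter> {a..a + int n})" by simp
 have ne: "A \<inter> {a..a + int n} \<noteq> {}" using a by auto
 define g where "g = Max (A \<inter> {a..a + int n})"
 have gA: "g \<in> A" "a \<le> g" using Max_in[OF fin ne] by (auto simp: g_def)
 have gmax: "k \<le> g" if "k \<in> A" for k
 proof (cases "a \<le> k")
  case True
  have "k \<le> a + int n" using dn[OF that, of "a + int n"] nb by linarith
  thus ?thesis unfolding g_def using True that fin by (intro Max_ge) auto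
 qed (use gA in linarith)
 have "(GREATEST n::int. x \<in> (\<pi> [^] n) <#\<^bsub>F\<^esub> D) = g"
  by (rule Greatest_equality) (use gA gmax in \<open>auto simp: mem A_def\<close>)
 hence "v x = Fin g" using False by (simp add: induced_val_def)
 moreover have "c \<le> g \<longleftrightarrow> c \<in> A" using dn[OF gA(1)] gmax by blast
 ultimately show ?thesis by (simp add: A_def)
qed

text \<open>\<pi>^-c x lies in D but not in \<pi> D, the set of nonunits, so it is a unit of
  D.\<close>

lemma val_inv: assumes x: "x \<in> carrier F" and c: "Fin c \<le> v x" "\<not> Fin (c + 1) \<le> v x"
 shows "x \<in> Units F" "Fin (- c) \<le> v (inv x)"
proof -
 have "x \<noteq> \<zero>" using c(2) by (auto simp: induced_val_def)
 thus U: "x \<in> Units F" using unit x by blast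
 define e where "e = pw (- c) \<otimes> x"
 have e: "e \<in> D" using c(1) val_ge_iff[OF x] by (simp add: e_def)
 have "- 1 + - c = - (c + 1)" by simp
 hence "inv \<pi> \<otimes> e = pw (- (c + 1)) \<otimes> x" using pw_cancel[OF x, of "- 1" "- c"] by (simp only: e_def pw_m1)
 hence "inv \<pi> \<otimes> e \<notin> D" using c(2) val_ge_iff[OF x, of "c + 1"] by (simp only: not_False_eq_True)
 moreover have "inv \<pi> \<otimes> e \<in> D" if "e \<in> mm"
 proof -
  obtain d where d: "d \<in> D" "e = \<pi> \<otimes> d" using \<open>e \<in> mm\<close> unfolding mm_eq l_coset_def by blast
  have "inv \<pi> \<otimes> e = d" unfolding d(2)
   using \<pi>U \<pi>c Dc[OF d(1)] m_assoc[of "inv \<pi>" \<pi> d] by simp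
  thus ?thesis using d(1) by simp
 qed
 ultimately have ie: "inv e \<in> D" "e \<noteq> \<zero>" using e by (auto simp: mm_def)
 have "inv e = inv x \<otimes> inv (pw (- c))" unfolding e_def using U pw_U by (simp add: inv_mult_units)
 also have "inv (pw (- c)) = pw c"
  by (rule inv_unique'[symmetric]) (auto simp: pw_add[symmetric] pw_0)
 finally have "inv x \<otimes> pw c \<in> D" using ie by simp
 from pw_conj[OF this, of c]
 have "pw c \<otimes> inv x \<otimes> (pw c \<otimes> pw (- c)) \<in> D" using U by (simp add: m_assoc)
 hence "pw c \<otimes> inv x \<in> D" using U by (simp add: pw_add[symmetric] pw_0)
 thus "Fin (- c) \<le> v (inv x)" using val_ge_iff[of "inv x" "- c"] U by simp
qed

lemma val_zero: "v \<zero> = \<infinity>" by (simp add: induced_val_def)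

lemma val_one: "0 \<le> v \<one>" and val_minus_one: "0 \<le> v (\<ominus> \<one>)"
 using val_ge_iff[of \<one> 0] val_ge_iff[of "\<ominus> \<one>" 0] D1 Dneg[OF D1] by (auto simp: pw_0 zero_extended_def)

end

locale matrix_over_dvr = ring Q + F: dvr F D \<pi>
 for Q :: "('a, 'm) ring_scheme" (structure) and F :: "('b, 'n) ring_scheme" and D \<pi> +
 fixes s :: nat and \<phi> and u :: "'a \<Rightarrow> int extended"
 assumes s_pos: "1 \<le> s" and D_complete: "filt_complete (F\<lparr>carrier := D\<rparr>) (induced_val D F \<pi>)"
  and \<phi>: "\<phi> \<in> ring_iso Q (matrix_ring s F)"
  and u_eq: "x \<in> carrier Q ==> u x = Min ((\<lambda>ij. induced_val D F \<pi> (\<phi> x ij)) ` ({..<s} \<times> {..<s}))"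
  and filt: "filtration Q u"
begin

lemma \<phi>_carrier: "x \<in> carrier Q ==> \<phi> x \<in> {..<s} \<times> {..<s} \<rightarrow>\<^sub>E carrier F"
 using ring_iso_memE(1)[OF \<phi>] by (simp add: matrix_ring_def)

lemma en_c: "x \<in> carrier Q ==> i < s ==> j < s ==> \<phi> x (i, j) \<in> carrier F"
 using \<phi>_carrier by (auto simp: PiE_iff)

lemma en_add: "x \<in> carrier Q ==> y \<in> carrier Q ==> i < s ==> j < s ==>
  \<phi> (x \<oplus> y) (i, j) = \<phi> x (i, j) \<oplus>\<^bsub>F\<^esub> \<phi> y (i, j)"
 using ring_iso_memE(3)[OF \<phi>] by (simp add: matrix_ring_def)

lemma en_mult: "x \<in> carrier Q ==> y \<in> carrier Q ==> i < s ==> j < s ==>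
  \<phi> (x \<otimes> y) (i, j) = (\<Oplus>\<^bsub>F\<^esub>k\<in>{..<s}. \<phi> x (i, k) \<otimes>\<^bsub>F\<^esub> \<phi> y (k, j))"
 using ring_iso_memE(2)[OF \<phi>] by (simp add: matrix_ring_def)

lemma en_one: "i < s ==> j < s ==> \<phi> \<one> (i, j) = (if i = j then \<one>\<^bsub>F\<^esub> else \<zero>\<^bsub>F\<^esub>)"
 using ring_iso_memE(4)[OF \<phi>] by (simp add: matrix_ring_def)

lemma en_ext: assumes "x \<in> carrier Q" "y \<in> carrier Q" "\<And>i j. i < s ==> j < s ==> \<phi> x (i, j) = \<phi> y (i, j)"
 shows "x = y"
proof -
 have "\<phi> x = \<phi> y" using \<phi>_carrier[OF assms(1)] \<phi>_carrier[OF assms(2)] assms(3)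
  by (intro PiE_ext) auto
 moreover have "inj_on \<phi> (carrier Q)" using ring_iso_memE(5)[OF \<phi>] by (simp add: bij_betw_def)
 ultimately show ?thesis using assms by (simp add: inj_on_def)
qed

lemma en_surj: assumes "\<And>i j. i < s ==> j < s ==> h i j \<in> carrier F"
 obtains x where "x \<in> carrier Q" "\<And>i j. i < s ==> j < s ==> \<phi> x (i, j) = h i j"
proof -
 let ?h = "\<lambda>(i, j)\<in>{..<s} \<times> {..<s}. h i j"
 have "?h \<in> carrier (matrix_ring s F)" using assms by (auto simp: matrix_ring_def)
 hence "?h \<in> \<phi> ` carrier Q" using ring_iso_memE(5)[OF \<phi>] by (simp add: bij_betw_def)
 then obtain x where "x \<in> carrier Q" "\<phi> x = ?h" by auto
 thus ?thesis using that by simp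
qed

definition mk :: "(nat \<Rightarrow> nat \<Rightarrow> 'b) \<Rightarrow> 'a" where
 "mk h = (SOME x. x \<in> carrier Q \<and> (\<forall>i j. i < s \<longrightarrow> j < s \<longrightarrow> \<phi> x (i, j) = h i j))"

lemma mk: assumes "\<And>i j. i < s ==> j < s ==> h i j \<in> carrier F"
 shows "mk h \<in> carrier Q" "i < s ==> j < s ==> \<phi> (mk h) (i, j) = h i j"
proof -
 have "\<exists>x. x \<in> carrier Q \<and> (\<forall>i j. i < s \<longrightarrow> j < s \<longrightarrow> \<phi> x (i, j) = h i j)"
  using en_surj[of h, OF assms] by metis
 from someI_ex[OF this] show "mk h \<in> carrier Q" "i < s ==> j < s ==> \<phi> (mk h) (i, j) = h i j"
  by (auto simp: mk_def)
qed

lemma en_zero: assumes "i < s" "j < s" shows "\<phi> \<zero> (i, j) = \<zero>\<^bsub>F\<^esub>"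
proof -
 have "\<phi> \<zero> (i, j) \<oplus>\<^bsub>F\<^esub> \<phi> \<zero> (i, j) = \<phi> \<zero> (i, j)" using en_add[of \<zero> \<zero> i j] assms by simp
 thus ?thesis using en_c[of \<zero> i j] assms by (metis F.add.r_cancel_one zero_closed)
qed

lemma en_neg: assumes "x \<in> carrier Q" "i < s" "j < s" shows "\<phi> (\<ominus> x) (i, j) = \<ominus>\<^bsub>F\<^esub> \<phi> x (i, j)"
proof -
 have "\<phi> (\<ominus> x) (i, j) \<oplus>\<^bsub>F\<^esub> \<phi> x (i, j) = \<zero>\<^bsub>F\<^esub>"
  using en_add[of "\<ominus> x" x i j] assms by (simp add: l_neg en_zero)
 thus ?thesis using F.minus_equality en_c assms by (metis a_inv_closed)
qed

lemma en_minus: "x \<in> carrier Q ==> y \<in> carrier Q ==> i < s ==> j < s ==>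
  \<phi> (x \<ominus> y) (i, j) = \<phi> x (i, j) \<ominus>\<^bsub>F\<^esub> \<phi> y (i, j)"
 by (simp add: minus_eq F.minus_eq en_add en_neg)

lemma en_finsum: assumes "\<And>l. x l \<in> carrier Q" "i < s" "j < s"
 shows "\<phi> (\<Oplus>l\<in>{..<n::nat}. x l) (i, j) = (\<Oplus>\<^bsub>F\<^esub>l\<in>{..<n}. \<phi> (x l) (i, j))"
proof (induction n)
 case (Suc n)
 have xc: "(\<Oplus>l\<in>{..<n}. x l) \<in> carrier Q" using assms by auto
 have "\<phi> (\<Oplus>l\<in>{..<Suc n}. x l) (i, j) = \<phi> (\<Oplus>l\<in>{..<n}. x l) (i, j) \<oplus>\<^bsub>F\<^esub> \<phi> (x n) (i, j)"
  using en_add[OF xc assms(1)] assms by (simp add: finsum_lessThan_Suc)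
 also have "\<dots> = (\<Oplus>\<^bsub>F\<^esub>l\<in>{..<Suc n}. \<phi> (x l) (i, j))"
  unfolding Suc using en_c[OF assms(1)] assms by (simp add: F.finsum_lessThan_Suc)
 finally show ?case .
qed (simp add: en_zero assms)

lemma u_ge_iff: assumes "x \<in> carrier Q"
 shows "Fin c \<le> u x \<longleftrightarrow> (\<forall>i<s. \<forall>j<s. Fin c \<le> F.v (\<phi> x (i, j)))"
proof -
 have "(0, 0) \<in> {..<s} \<times> {..<s}" using s_pos by auto
 hence "{..<s} \<times> {..<s} \<noteq> {}" by blast
 thus ?thesis unfolding u_eq[OF assms] by (subst Min_ge_iff) auto
qed

lemma F_single: assumes "i < s" "z \<in> carrier F"
 shows "(\<Oplus>\<^bsub>F\<^esub>k\<in>{..<s}. if k = i then z else \<zero>\<^bsub>F\<^esub>) = z"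
proof -
 have "(\<Oplus>\<^bsub>F\<^esub>k\<in>{..<s}. if k = i then z else \<zero>\<^bsub>F\<^esub>) = (\<Oplus>\<^bsub>F\<^esub>k\<in>{..<s}. if i = k then z else \<zero>\<^bsub>F\<^esub>)"
  by (rule F.finsum_cong') (use assms in auto)
 also have "\<dots> = z" using F.add.finprod_singleton[of i "{..<s}" "\<lambda>_. z"] assms by (simp add: finsum_def)
 finally show ?thesis .
qed

lemma scalar_en: assumes f: "f \<in> carrier F" and x: "x \<in> carrier Q" and ij: "i < s" "j < s"
 shows "\<phi> (mk (\<lambda>i j. if i = j then f else \<zero>\<^bsub>F\<^esub>) \<otimes> x) (i, j) = f \<otimes>\<^bsub>F\<^esub> \<phi> x (i, j)"
proof -
 let ?m = "mk (\<lambda>i j. if i = j then f else \<zero>\<^bsub>F\<^esub>)"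
 have m: "?m \<in> carrier Q" "\<And>i j. i < s ==> j < s ==> \<phi> ?m (i, j) = (if i = j then f else \<zero>\<^bsub>F\<^esub>)"
  using f mk[of "\<lambda>i j. if i = j then f else \<zero>\<^bsub>F\<^esub>"] by auto
 have "\<phi> (?m \<otimes> x) (i, j) = (\<Oplus>\<^bsub>F\<^esub>k\<in>{..<s}. if k = i then f \<otimes>\<^bsub>F\<^esub> \<phi> x (i, j) else \<zero>\<^bsub>F\<^esub>)"
  unfolding en_mult[OF m(1) x ij] by (rule F.finsum_cong') (use ij m(2) f en_c[OF x] in auto)
 thus ?thesis using F_single ij f en_c[OF x ij] by simp
qed

sublocale filtered_ring Q u
proof
 show "filtration Q u" by (rule filt)
 show "0 \<le> u (\<ominus> \<one>)"
 proof -
  have "Fin 0 \<le> F.v (\<phi> (\<ominus> \<one>) (i, j))" if "i < s" "j < s" for i j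
   using that F.val_minus_one F.val_zero by (auto simp: en_neg en_one zero_extended_def)
  thus ?thesis using u_ge_iff[of "\<ominus> \<one>" 0] by (simp add: zero_extended_def)
 qed
 show "filt_complete Q u" unfolding filt_complete_def
 proof (intro allI impI, elim conjE)
  fix f :: "nat \<Rightarrow> 'a"
  assume f: "\<forall>n. f n \<in> carrier Q" and cau: "\<forall>c. \<exists>N. \<forall>m\<ge>N. \<forall>n\<ge>N. Fin c \<le> u (f m \<ominus> f n)"
  have fc: "f n \<in> carrier Q" for n using f by blast
  have ent: "Fin c \<le> F.v (\<phi> (f m) (i, j) \<ominus>\<^bsub>F\<^esub> \<phi> (f n) (i, j))" if "Fin c \<le> u (f m \<ominus> f n)" "i < s" "j < s" for c m n i j
   using that(1) u_ge_iff[of "f m \<ominus> f n" c] fc that(2,3) by (simp add: en_minus)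
  obtain N0 where N0: "\<And>m n. m \<ge> N0 ==> n \<ge> N0 ==> Fin 0 \<le> u (f m \<ominus> f n)" using cau by meson
  have "\<exists>L. L \<in> carrier F \<and> (\<forall>c. \<exists>N. \<forall>n\<ge>N. Fin c \<le> F.v (\<phi> (f n) (i, j) \<ominus>\<^bsub>F\<^esub> L))" if ij: "i < s" "j < s" for i j
  proof -
   define g where "g n = \<phi> (f n) (i, j)" for n
   have gc: "g n \<in> carrier F" for n using en_c[OF fc ij] by (simp add: g_def)
   \<comment> \<open>Completeness is given for D, while the entries lie in F. From N0 on they differ
     by elements of D, so the differences from the N0-th term form a Cauchy sequence in D.\<close>
   define h where "h n = g (N0 + n) \<ominus>\<^bsub>F\<^esub> g N0" for n
   have hD: "h n \<in> D" for n
   proof -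
    have "Fin 0 \<le> F.v (h n)" unfolding h_def g_def by (rule ent[OF N0 ij]) auto
    moreover have hc: "h n \<in> carrier F" using gc by (simp add: h_def)
    ultimately show ?thesis using F.val_ge_iff[OF hc, of 0] by (simp add: F.pw_0)
   qed
   have can: "(a \<ominus>\<^bsub>F\<^esub> b) \<ominus>\<^bsub>F\<^esub> (c \<ominus>\<^bsub>F\<^esub> b) = a \<ominus>\<^bsub>F\<^esub> c" if "a \<in> carrier F" "b \<in> carrier F" "c \<in> carrier F" for a b c
   proof -
    have "(a \<ominus>\<^bsub>F\<^esub> b) \<ominus>\<^bsub>F\<^esub> (c \<ominus>\<^bsub>F\<^esub> b) = \<ominus>\<^bsub>F\<^esub> b \<oplus>\<^bsub>F\<^esub> (a \<ominus>\<^bsub>F\<^esub> c) \<ominus>\<^bsub>F\<^esub> (\<ominus>\<^bsub>F\<^esub> b)"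
     using that by (simp add: F.minus_eq F.minus_add F.a_ac)
    thus ?thesis using that F.add_diff_cancel_left[of "\<ominus>\<^bsub>F\<^esub> b" "a \<ominus>\<^bsub>F\<^esub> c"] by simp
   qed
   have "\<exists>l\<in>carrier F.R. \<forall>c. \<exists>N. \<forall>n\<ge>N. Fin c \<le> F.v (h n \<ominus>\<^bsub>F.R\<^esub> l)"
   proof (rule D_complete[unfolded filt_complete_def, rule_format], intro conjI allI)
    show "h n \<in> carrier F.R" for n using hD by simp
    fix c
    obtain N where N: "\<And>m n. m \<ge> N ==> n \<ge> N ==> Fin c \<le> u (f m \<ominus> f n)" using cau by meson
    have "Fin c \<le> F.v (h m \<ominus>\<^bsub>F.R\<^esub> h n)" if "m \<ge> N" "n \<ge> N" for m n
    proof -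
     have "h m \<ominus>\<^bsub>F.R\<^esub> h n = g (N0 + m) \<ominus>\<^bsub>F\<^esub> g (N0 + n)"
      unfolding F.R_minus[OF hD hD] unfolding h_def by (rule can[OF gc gc gc])
     thus ?thesis unfolding g_def using ent[OF N ij] that by simp
    qed
    thus "\<exists>N. \<forall>m\<ge>N. \<forall>n\<ge>N. Fin c \<le> F.v (h m \<ominus>\<^bsub>F.R\<^esub> h n)" by blast
   qed
   then obtain l where l: "l \<in> D" "\<And>c. \<exists>N. \<forall>n\<ge>N. Fin c \<le> F.v (h n \<ominus>\<^bsub>F.R\<^esub> l)" by auto
   have lc: "l \<in> carrier F" using F.Dc l(1) .
   have "\<exists>N. \<forall>n\<ge>N. Fin c \<le> F.v (g n \<ominus>\<^bsub>F\<^esub> (l \<oplus>\<^bsub>F\<^esub> g N0))" for c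
   proof -
    obtain N where N: "\<And>n. n \<ge> N ==> Fin c \<le> F.v (h n \<ominus>\<^bsub>F.R\<^esub> l)" using l(2) by meson
    have "Fin c \<le> F.v (g n \<ominus>\<^bsub>F\<^esub> (l \<oplus>\<^bsub>F\<^esub> g N0))" if "n \<ge> N0 + N" for n
    proof -
     have "h (n - N0) \<ominus>\<^bsub>F.R\<^esub> l = g n \<ominus>\<^bsub>F\<^esub> (l \<oplus>\<^bsub>F\<^esub> g N0)"
      unfolding F.R_minus[OF hD l(1)] unfolding h_def using gc lc that
      by (simp add: F.minus_eq F.minus_add F.a_ac)
     thus ?thesis using N[of "n - N0"] that by simp
    qed
    thus ?thesis by blast
   qed
   moreover have "l \<oplus>\<^bsub>F\<^esub> g N0 \<in> carrier F" using lc gc by simp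
   ultimately show ?thesis unfolding g_def by blast
  qed
  then obtain L where L: "\<And>i j. i < s ==> j < s ==> L i j \<in> carrier F"
   "\<And>i j c. i < s ==> j < s ==> \<exists>N. \<forall>n\<ge>N. Fin c \<le> F.v (\<phi> (f n) (i, j) \<ominus>\<^bsub>F\<^esub> L i j)" by metis
  note l = mk[of L, OF L(1)]
  have "\<exists>N. \<forall>n\<ge>N. Fin c \<le> u (f n \<ominus> mk L)" for c
  proof -
   \<comment> \<open>There are finitely many entries, so one index N serves all of them.\<close>
   have "\<forall>ij\<in>{..<s} \<times> {..<s}. eventually (\<lambda>n. Fin c \<le> F.v (\<phi> (f n) ij \<ominus>\<^bsub>F\<^esub> L (fst ij) (snd ij))) sequentially"
    using L(2) by (auto simp: eventually_sequentially)
   hence "eventually (\<lambda>n. \<forall>ij\<in>{..<s} \<times> {..<s}. Fin c \<le> F.v (\<phi> (f n) ij \<ominus>\<^bsub>F\<^esub> L (fst ij) (snd ij))) sequentially"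
    by (intro eventually_ball_finite) auto
   then obtain N where "\<And>n ij. n \<ge> N ==> ij \<in> {..<s} \<times> {..<s} ==> Fin c \<le> F.v (\<phi> (f n) ij \<ominus>\<^bsub>F\<^esub> L (fst ij) (snd ij))"
    unfolding eventually_sequentially by blast
   hence "Fin c \<le> u (f n \<ominus> mk L)" if "n \<ge> N" for n
    using that fc l u_ge_iff[of "f n \<ominus> mk L" c] by (auto simp: en_minus)
   thus ?thesis by blast
  qed
  thus "\<exists>l\<in>carrier Q. \<forall>c. \<exists>N. \<forall>n\<ge>N. Fin c \<le> u (f n \<ominus> l)" using l(1) by blast
 qed
qed

text \<open>Let p be an entry of c of least value w, at position (a0, b0). With the matrix units,
  e_(l,a0) c (p^-1 e_(b0,l)) = e_(l,l), and these add up to 1; p^-1 has value at least -w.\<close>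

lemma std_matrix:
 assumes c: "c \<in> G w" "c \<notin> G (w + 1)"
 shows "\<exists>(s::nat) a b. (\<forall>l. a l \<in> G 0 \<and> b l \<in> G (- w)) \<and> (\<Oplus>l\<in>{..<s}. a l \<otimes> c \<otimes> b l) = \<one>"
proof -
 have cc: "c \<in> carrier Q" using c(1) by blast
 have cw: "Fin w \<le> F.v (\<phi> c (i, j))" if "i < s" "j < s" for i j
  using c(1) u_ge_iff[OF cc] that by (simp add: G_iff)
 obtain a0 b0 where ab: "a0 < s" "b0 < s" "\<not> Fin (w + 1) \<le> F.v (\<phi> c (a0, b0))"
  using c(2) cc u_ge_iff[OF cc] by (auto simp: G_iff)
 define p where "p = \<phi> c (a0, b0)"
 have pc: "p \<in> carrier F" unfolding p_def by (rule en_c[OF cc ab(1,2)])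
 have pU: "p \<in> Units F" "Fin (- w) \<le> F.v (inv\<^bsub>F\<^esub> p)"
  using F.val_inv[OF pc] cw[OF ab(1,2)] ab(3) by (auto simp: p_def)
 have ipc: "inv\<^bsub>F\<^esub> p \<in> carrier F" using pU(1) by simp
 define ea eb where "ea l = (\<lambda>i j. if i = l \<and> j = a0 then \<one>\<^bsub>F\<^esub> else \<zero>\<^bsub>F\<^esub>)"
  and "eb l = (\<lambda>i j. if i = b0 \<and> j = l then inv\<^bsub>F\<^esub> p else \<zero>\<^bsub>F\<^esub>)" for l :: nat
 have ec: "ea l i j \<in> carrier F" "eb l i j \<in> carrier F" for l i j using ipc by (auto simp: ea_def eb_def)
 define a b where "a l = mk (ea l)" and "b l = mk (eb l)" for l
 have am: "a l \<in> carrier Q" "i < s ==> j < s ==> \<phi> (a l) (i, j) = ea l i j" for l i j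
  using mk[of "ea l"] ec by (auto simp: a_def)
 have bm: "b l \<in> carrier Q" "i < s ==> j < s ==> \<phi> (b l) (i, j) = eb l i j" for l i j
  using mk[of "eb l"] ec by (auto simp: b_def)
 have aG: "a l \<in> G 0" for l
  using am(1) F.val_one unfolding G_iff u_ge_iff[OF am(1)]
  by (auto simp: am(2) ea_def F.val_zero zero_extended_def)
 have bG: "b l \<in> G (- w)" for l
  using bm(1) pU(2) unfolding G_iff u_ge_iff[OF bm(1)]
  by (auto simp: bm(2) eb_def F.val_zero)
 have ac: "\<phi> (a l \<otimes> c) (i, j) = (if i = l then \<phi> c (a0, j) else \<zero>\<^bsub>F\<^esub>)" if ij: "i < s" "j < s" for l i j
 proof -
  have "\<phi> (a l \<otimes> c) (i, j) = (\<Oplus>\<^bsub>F\<^esub>k\<in>{..<s}. if k = a0 then (if i = l then \<phi> c (a0, j) else \<zero>\<^bsub>F\<^esub>) else \<zero>\<^bsub>F\<^esub>)"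
   unfolding en_mult[OF am(1) cc ij]
   by (rule F.finsum_cong') (use ij ab(1) en_c[OF cc] in \<open>auto simp: am(2) ea_def\<close>)
  thus ?thesis using F_single[OF ab(1), of "if i = l then \<phi> c (a0, j) else \<zero>\<^bsub>F\<^esub>"] en_c[OF cc ab(1) ij(2)] by simp
 qed
 have acb: "\<phi> (a l \<otimes> c \<otimes> b l) (i, j) = (if i = l then (if j = l then \<one>\<^bsub>F\<^esub> else \<zero>\<^bsub>F\<^esub>) else \<zero>\<^bsub>F\<^esub>)" if ij: "i < s" "j < s" for l i j
 proof -
  have acc: "a l \<otimes> c \<in> carrier Q" using am(1) cc by simp
  let ?z = "if i = l then (if j = l then \<one>\<^bsub>F\<^esub> else \<zero>\<^bsub>F\<^esub>) else \<zero>\<^bsub>F\<^esub>"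
  have pp: "p \<otimes>\<^bsub>F\<^esub> inv\<^bsub>F\<^esub> p = \<one>\<^bsub>F\<^esub>" using pU(1) by simp
  have "\<phi> (a l \<otimes> c \<otimes> b l) (i, j) = (\<Oplus>\<^bsub>F\<^esub>k\<in>{..<s}. if k = b0 then ?z else \<zero>\<^bsub>F\<^esub>)"
   unfolding en_mult[OF acc bm(1) ij]
   by (rule F.finsum_cong') (use ij ab en_c[OF cc ab(1)] pp pc ipc in \<open>auto simp: ac bm(2) eb_def p_def[symmetric]\<close>)
  thus ?thesis using F_single[OF ab(2), of ?z] by simp
 qed
 have "(\<Oplus>l\<in>{..<s}. a l \<otimes> c \<otimes> b l) = \<one>"
 proof (rule en_ext)
  have abc: "a l \<otimes> c \<otimes> b l \<in> carrier Q" for l using am(1) bm(1) cc by simp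
  thus "(\<Oplus>l\<in>{..<s}. a l \<otimes> c \<otimes> b l) \<in> carrier Q" by simp
  fix i j assume ij: "i < s" "j < s"
  have "\<phi> (\<Oplus>l\<in>{..<s}. a l \<otimes> c \<otimes> b l) (i, j) =
    (\<Oplus>\<^bsub>F\<^esub>l\<in>{..<s}. if l = i then (if j = i then \<one>\<^bsub>F\<^esub> else \<zero>\<^bsub>F\<^esub>) else \<zero>\<^bsub>F\<^esub>)"
   unfolding en_finsum[of "\<lambda>l. a l \<otimes> c \<otimes> b l", OF abc ij] acb[OF ij]
   by (rule F.finsum_cong') auto
  also have "\<dots> = (if j = i then \<one>\<^bsub>F\<^esub> else \<zero>\<^bsub>F\<^esub>)" using ij by (intro F_single) auto
  finally show "\<phi> (\<Oplus>l\<in>{..<s}. a l \<otimes> c \<otimes> b l) (i, j) = \<phi> \<one> (i, j)" using ij by (simp add: en_one)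
 qed simp
 thus ?thesis using aG bG by blast
qed

sublocale std_ring Q u
 by unfold_locales (rule std_matrix)

text \<open>Q is a left vector space of dimension s^2 over F, and each Q r is a subspace. With the
  entries in a linear order, \<open>Ld r\<close> is the set of leading positions in Q r. A member of
  P with fewest of them is minimal, by elimination from the top.\<close>

lemma left_dcc:
 assumes P: "P \<subseteq> carrier Q" "P \<noteq> {}"
 shows "\<exists>r\<in>P. \<forall>r'\<in>P. (\<exists>q\<in>carrier Q. r' = q \<otimes> r) \<longrightarrow> (\<exists>q\<in>carrier Q. r = q \<otimes> r')"
proof -
 define cx where "cx x n = \<phi> x (n div s, n mod s)" for x n
 define K where "K = s * s"
 have nd: "n div s < s" "n mod s < s" if "n < K" for n
  using that s_pos by (auto simp: K_def less_mult_imp_div_less)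
 have cxc: "cx x n \<in> carrier F" if "x \<in> carrier Q" "n < K" for x n
  unfolding cx_def using en_c[OF that(1)] nd[OF that(2)] by simp
 have cx_ext: "x = y" if "x \<in> carrier Q" "y \<in> carrier Q" "\<And>n. n < K ==> cx x n = cx y n" for x y
 proof (rule en_ext[OF that(1,2)])
  fix i j assume ij: "i < s" "j < s"
  have "i * s + j < K"
  proof -
   have "(i + 1) * s \<le> s * s" using ij(1) by (intro mult_right_mono) auto
   thus ?thesis using ij(2) by (simp add: K_def)
  qed
  from that(3)[OF this] show "\<phi> x (i, j) = \<phi> y (i, j)" using ij by (simp add: cx_def)
 qed
 define Ld where "Ld r = {n. n < K \<and> (\<exists>q\<in>carrier Q. cx (q \<otimes> r) n \<noteq> \<zero>\<^bsub>F\<^esub> \<and> (\<forall>m. n < m \<and> m < K \<longrightarrow> cx (q \<otimes> r) m = \<zero>\<^bsub>F\<^esub>))}" for r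
 have fin: "finite (Ld r)" for r by (rule finite_subset[of _ "{..<K}"]) (auto simp: Ld_def)
 obtain r where r: "r \<in> P" "\<forall>r'. r' \<in> P \<longrightarrow> card (Ld r) \<le> card (Ld r')"
  using P(2) ex_has_least_nat[of "\<lambda>r. r \<in> P" _ "\<lambda>r. card (Ld r)"] by blast
 have rc: "r \<in> carrier Q" using r(1) P(1) by blast
 show ?thesis
 proof (intro bexI[OF _ r(1)] ballI impI, elim bexE)
  fix r' q0 assume r': "r' \<in> P" and q0: "q0 \<in> carrier Q" "r' = q0 \<otimes> r"
  have r'c: "r' \<in> carrier Q" using r' P(1) by blast
  have "Ld r' \<subseteq> Ld r"
  proof
   fix n assume "n \<in> Ld r'"
   then obtain q where q: "n < K" "q \<in> carrier Q" "cx (q \<otimes> r') n \<noteq> \<zero>\<^bsub>F\<^esub>"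
     "\<forall>m. n < m \<and> m < K \<longrightarrow> cx (q \<otimes> r') m = \<zero>\<^bsub>F\<^esub>" unfolding Ld_def by blast
   have e: "q \<otimes> r' = (q \<otimes> q0) \<otimes> r" using q(2) q0 rc by (simp add: m_assoc)
   have "q \<otimes> q0 \<in> carrier Q" using q(2) q0(1) by simp
   thus "n \<in> Ld r" unfolding Ld_def using q(1,3,4) unfolding e by blast
  qed
  hence Ld: "Ld r' = Ld r" using r(2) r' by (intro card_seteq[OF fin]) auto
  have main: "\<exists>q'\<in>carrier Q. q \<otimes> r = q' \<otimes> r'" if "q \<in> carrier Q" "\<forall>m. k \<le> m \<and> m < K \<longrightarrow> cx (q \<otimes> r) m = \<zero>\<^bsub>F\<^esub>" "k \<le> K" for k q
   using that
  proof (induction k arbitrary: q)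
   case 0
   have "q \<otimes> r = \<zero>"
   proof (rule cx_ext)
    fix n assume n: "n < K"
    have "cx \<zero> n = \<zero>\<^bsub>F\<^esub>" unfolding cx_def by (rule en_zero[OF nd[OF n]])
    thus "cx (q \<otimes> r) n = cx \<zero> n" using 0(2) n by simp
   qed (use 0(1) rc in auto)
   thus ?case using r'c by (intro bexI[of _ \<zero>]) auto
  next
   case (Suc k)
   have k: "k < K" using Suc.prems(3) by simp
   note qc = Suc.prems(1)
   show ?case
   proof (cases "cx (q \<otimes> r) k = \<zero>\<^bsub>F\<^esub>")
    case True
    hence "\<forall>m. k \<le> m \<and> m < K \<longrightarrow> cx (q \<otimes> r) m = \<zero>\<^bsub>F\<^esub>"
     using Suc.prems(2) by (metis Suc_leI le_neq_implies_less)
    thus ?thesis using Suc.IH[OF qc] k by simp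
   next
    case False
    have "k \<in> Ld r" unfolding Ld_def using k False qc Suc.prems(2) by (auto simp: Suc_le_eq)
    hence "k \<in> Ld r'" unfolding Ld .
    then obtain q1 where q1: "q1 \<in> carrier Q" "cx (q1 \<otimes> r') k \<noteq> \<zero>\<^bsub>F\<^esub>"
     "\<forall>m. k < m \<and> m < K \<longrightarrow> cx (q1 \<otimes> r') m = \<zero>\<^bsub>F\<^esub>" unfolding Ld_def by blast
    define a b where "a = cx (q \<otimes> r) k" and "b = cx (q1 \<otimes> r') k"
    have ab: "a \<in> carrier F" "b \<in> carrier F" unfolding a_def b_def using cxc k qc rc q1(1) r'c by auto
    have bU: "b \<in> Units F" using F.unit ab(2) q1(2) by (simp add: b_def)
    define f where "f = a \<otimes>\<^bsub>F\<^esub> inv\<^bsub>F\<^esub> b"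
    have fc: "f \<in> carrier F" using ab bU by (simp add: f_def)
    have fb: "f \<otimes>\<^bsub>F\<^esub> b = a" using ab bU by (simp add: f_def F.m_assoc)
    \<comment> \<open>A scalar matrix on the left multiplies every coordinate by f on the left, so a
      leading coordinate can be cancelled.\<close>
    define z where "z = mk (\<lambda>i j. if i = j then f else \<zero>\<^bsub>F\<^esub>)"
    have zc: "z \<in> carrier Q" unfolding z_def by (rule mk(1)) (use fc in auto)
    have zx: "cx (z \<otimes> x) m = f \<otimes>\<^bsub>F\<^esub> cx x m" if "x \<in> carrier Q" "m < K" for x m
     unfolding cx_def z_def by (rule scalar_en[OF fc that(1) nd[OF that(2)]])
    define q2 where "q2 = q \<ominus> z \<otimes> q1 \<otimes> q0"
    have q2c: "q2 \<in> carrier Q" using qc zc q1(1) q0(1) by (simp add: q2_def)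
    have e: "q2 \<otimes> r = q \<otimes> r \<ominus> z \<otimes> (q1 \<otimes> r')"
     unfolding q2_def q0(2) using qc zc q1(1) q0(1) rc by (simp add: minus_eq l_distr l_minus m_assoc)
    have c1: "q \<otimes> r \<in> carrier Q" "q1 \<otimes> r' \<in> carrier Q" using qc rc q1(1) r'c by auto
    have "cx (q2 \<otimes> r) m = \<zero>\<^bsub>F\<^esub>" if m: "k \<le> m" "m < K" for m
    proof -
     have "cx (q2 \<otimes> r) m = cx (q \<otimes> r) m \<ominus>\<^bsub>F\<^esub> f \<otimes>\<^bsub>F\<^esub> cx (q1 \<otimes> r') m"
      unfolding e zx[OF c1(2) m(2), symmetric] using en_minus[OF c1(1) _ nd[OF m(2)]] zc c1(2) by (simp add: cx_def)
     moreover have "cx (q \<otimes> r) m = \<zero>\<^bsub>F\<^esub>" "cx (q1 \<otimes> r') m = \<zero>\<^bsub>F\<^esub>" if "m \<noteq> k"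
      using Suc.prems(2) q1(3) m that by auto
     ultimately show ?thesis using fb fc ab(1) unfolding a_def b_def
      by (cases "m = k") (auto simp: F.minus_eq F.r_neg)
    qed
    from Suc.IH[OF q2c] this k obtain q3 where q3: "q3 \<in> carrier Q" "q2 \<otimes> r = q3 \<otimes> r'" by auto
    have "q \<otimes> r = (q \<otimes> r \<ominus> z \<otimes> (q1 \<otimes> r')) \<oplus> z \<otimes> (q1 \<otimes> r')"
     using c1 zc by (simp add: minus_eq a_assoc l_neg)
    also have "\<dots> = q3 \<otimes> r' \<oplus> z \<otimes> (q1 \<otimes> r')" using q3(2) e by simp
    also have "\<dots> = (q3 \<oplus> z \<otimes> q1) \<otimes> r'" using q3(1) zc q1(1) r'c by (simp add: l_distr m_assoc)
    finally show ?thesis using q3(1) zc q1(1) by (intro bexI[of _ "q3 \<oplus> z \<otimes> q1"]) auto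
   qed
  qed
  have "\<exists>q'\<in>carrier Q. \<one> \<otimes> r = q' \<otimes> r'" by (rule main[of _ K]) auto
  thus "\<exists>q\<in>carrier Q. r = q \<otimes> r'" using rc by simp
 qed
qed

end

lemma standard_matrix_over_dvr:
 assumes "filtration Q u" "standard_filtered_artinian Q u"
 obtains s F D \<pi> \<phi> where "matrix_over_dvr Q (F :: 'a ring) D \<pi> s \<phi> (u :: 'a \<Rightarrow> int extended)"
proof -
 obtain s and F :: "'a ring" and D \<pi> \<phi> where *: "s \<ge> 1" "discrete_valuation_ring D F" "is_uniformiser D F \<pi>"
  "filt_complete (F\<lparr>carrier := D\<rparr>) (induced_val D F \<pi>)" "\<phi> \<in> ring_iso Q (matrix_ring s F)"
  "\<forall>x\<in>carrier Q. u x = Min ((\<lambda>ij. induced_val D F \<pi> (\<phi> x ij)) ` ({..<s} \<times> {..<s}))"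
  using assms(2) unfolding standard_filtered_artinian_def by blast
 have r: "ring Q" using assms(2) by (simp add: standard_filtered_artinian_def)
 have "ring F" using *(2) by (simp add: discrete_valuation_ring_def division_ring_of_fractions_def is_division_ring_def)
 hence "dvr F D \<pi>" using *(2,3) by (simp add: dvr_def dvr_axioms_def)
 hence "matrix_over_dvr Q F D \<pi> s \<phi> u"
  using *(1,4,5,6) r assms(1) by (simp add: matrix_over_dvr_def matrix_over_dvr_axioms_def)
 thus ?thesis by (rule that)
qed

section \<open>Localisation at a normal element\<close>

text \<open>The localisation described up to isomorphism. Simplicity and the comparison of
  localisations are proved from this description, without recourse to classes of pairs.\<close>

locale is_localisation = S: ring S + L: ring L
 for S :: "('a, 'm) ring_scheme" and L :: "('b, 'n) ring_scheme" +
 fixes y :: 'a and \<kappa> :: "'a \<Rightarrow> 'b"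
 assumes y: "y \<in> carrier S"
  and normal: "s \<in> carrier S ==> \<exists>s'\<in>carrier S. y [^]\<^bsub>S\<^esub> (n::nat) \<otimes>\<^bsub>S\<^esub> s = s' \<otimes>\<^bsub>S\<^esub> y [^]\<^bsub>S\<^esub> n"
  and \<kappa>: "\<kappa> \<in> ring_hom S L" and \<kappa>_inj: "inj_on \<kappa> (carrier S)"
  and \<kappa>_y: "\<kappa> y \<in> Units L"
  and frac: "l \<in> carrier L ==> \<exists>(n::nat). \<exists>s\<in>carrier S. \<kappa> y [^]\<^bsub>L\<^esub> n \<otimes>\<^bsub>L\<^esub> l = \<kappa> s"
begin

lemma \<kappa>_c [simp, intro]: "s \<in> carrier S ==> \<kappa> s \<in> carrier L"
 and \<kappa>_add: "s \<in> carrier S ==> t \<in> carrier S ==> \<kappa> (s \<oplus>\<^bsub>S\<^esub> t) = \<kappa> s \<oplus>\<^bsub>L\<^esub> \<kappa> t"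
 and \<kappa>_mult: "s \<in> carrier S ==> t \<in> carrier S ==> \<kappa> (s \<otimes>\<^bsub>S\<^esub> t) = \<kappa> s \<otimes>\<^bsub>L\<^esub> \<kappa> t"
 and \<kappa>_one: "\<kappa> \<one>\<^bsub>S\<^esub> = \<one>\<^bsub>L\<^esub>"
 using \<kappa> by (auto simp: ring_hom_def)

lemma \<kappa>_eq: "s \<in> carrier S ==> t \<in> carrier S ==> \<kappa> s = \<kappa> t \<longleftrightarrow> s = t"
 using \<kappa>_inj by (auto simp: inj_on_def)

lemma \<kappa>_zero: "\<kappa> \<zero>\<^bsub>S\<^esub> = \<zero>\<^bsub>L\<^esub>"
proof -
 have "\<kappa> \<zero>\<^bsub>S\<^esub> \<oplus>\<^bsub>L\<^esub> \<kappa> \<zero>\<^bsub>S\<^esub> = \<kappa> \<zero>\<^bsub>S\<^esub>" using \<kappa>_add[of "\<zero>\<^bsub>S\<^esub>" "\<zero>\<^bsub>S\<^esub>"] by simp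
 thus ?thesis using L.add.r_cancel_one[of "\<kappa> \<zero>\<^bsub>S\<^esub>" "\<kappa> \<zero>\<^bsub>S\<^esub>"] by simp
qed

lemma \<kappa>_eq_zero: "s \<in> carrier S ==> \<kappa> s = \<zero>\<^bsub>L\<^esub> \<longleftrightarrow> s = \<zero>\<^bsub>S\<^esub>"
 using \<kappa>_eq[of s "\<zero>\<^bsub>S\<^esub>"] by (simp add: \<kappa>_zero)

lemma \<kappa>_pow: "s \<in> carrier S ==> \<kappa> (s [^]\<^bsub>S\<^esub> (n::nat)) = \<kappa> s [^]\<^bsub>L\<^esub> n"
 by (induction n) (auto simp: \<kappa>_one \<kappa>_mult)

abbreviation "Yp (n::nat) \<equiv> \<kappa> y [^]\<^bsub>L\<^esub> n"

lemma Yp_U: "Yp n \<in> Units L" using \<kappa>_y by (rule L.Units_pow_closed)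
lemma Yp_c [simp, intro]: "Yp n \<in> carrier L" using y by simp
lemma yp_c [simp, intro]: "y [^]\<^bsub>S\<^esub> (n::nat) \<in> carrier S" using y by simp

lemma Yp_cancel: assumes "Yp n \<otimes>\<^bsub>L\<^esub> a = Yp n \<otimes>\<^bsub>L\<^esub> b" "a \<in> carrier L" "b \<in> carrier L" shows "a = b"
proof -
 have i: "inv\<^bsub>L\<^esub> (Yp n) \<in> carrier L" using Yp_U by simp
 have "inv\<^bsub>L\<^esub> (Yp n) \<otimes>\<^bsub>L\<^esub> (Yp n \<otimes>\<^bsub>L\<^esub> a) = inv\<^bsub>L\<^esub> (Yp n) \<otimes>\<^bsub>L\<^esub> (Yp n \<otimes>\<^bsub>L\<^esub> b)" using assms(1) by simp
 thus ?thesis using assms(2,3) i Yp_U L.m_assoc[OF i Yp_c assms(2), of n, symmetric]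
   L.m_assoc[OF i Yp_c assms(3), of n, symmetric] by simp
qed

lemma Yp_comm: "Yp m \<otimes>\<^bsub>L\<^esub> Yp n = Yp n \<otimes>\<^bsub>L\<^esub> Yp m"
 using y by (simp add: L.nat_pow_mult add.commute)

lemma frac_raise: assumes "Yp n \<otimes>\<^bsub>L\<^esub> l = \<kappa> s" "l \<in> carrier L" "s \<in> carrier S"
 shows "Yp (m + n) \<otimes>\<^bsub>L\<^esub> l = \<kappa> (y [^]\<^bsub>S\<^esub> m \<otimes>\<^bsub>S\<^esub> s)"
proof -
 have "Yp (m + n) \<otimes>\<^bsub>L\<^esub> l = Yp m \<otimes>\<^bsub>L\<^esub> (Yp n \<otimes>\<^bsub>L\<^esub> l)"
  using assms(2) y by (simp add: L.nat_pow_mult[symmetric] L.m_assoc)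
 thus ?thesis using assms y by (simp add: \<kappa>_mult \<kappa>_pow)
qed

lemma frac_add: assumes "Yp n \<otimes>\<^bsub>L\<^esub> l = \<kappa> s" "l \<in> carrier L" "s \<in> carrier S"
  "Yp m \<otimes>\<^bsub>L\<^esub> l' = \<kappa> s'" "l' \<in> carrier L" "s' \<in> carrier S"
 shows "Yp (m + n) \<otimes>\<^bsub>L\<^esub> (l \<oplus>\<^bsub>L\<^esub> l') = \<kappa> (y [^]\<^bsub>S\<^esub> m \<otimes>\<^bsub>S\<^esub> s \<oplus>\<^bsub>S\<^esub> y [^]\<^bsub>S\<^esub> n \<otimes>\<^bsub>S\<^esub> s')"
 using frac_raise[OF assms(1,2,3), of m] frac_raise[OF assms(4,5,6), of n] assms(2,3,5,6)
 by (simp add: L.r_distr \<kappa>_add add.commute)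

text \<open>The numerator s is moved past the second denominator, which replaces it by s1; normality
  supplies such an s1 in S.\<close>

lemma frac_mult: assumes "Yp n \<otimes>\<^bsub>L\<^esub> l = \<kappa> s" "l \<in> carrier L" "s \<in> carrier S"
  "Yp m \<otimes>\<^bsub>L\<^esub> l' = \<kappa> s'" "l' \<in> carrier L" "s' \<in> carrier S"
  and s1: "s1 \<in> carrier S" "y [^]\<^bsub>S\<^esub> m \<otimes>\<^bsub>S\<^esub> s = s1 \<otimes>\<^bsub>S\<^esub> y [^]\<^bsub>S\<^esub> m"
 shows "Yp (m + n) \<otimes>\<^bsub>L\<^esub> (l \<otimes>\<^bsub>L\<^esub> l') = \<kappa> (s1 \<otimes>\<^bsub>S\<^esub> s')"
proof -
 have "Yp (m + n) \<otimes>\<^bsub>L\<^esub> (l \<otimes>\<^bsub>L\<^esub> l') = Yp (m + n) \<otimes>\<^bsub>L\<^esub> l \<otimes>\<^bsub>L\<^esub> l'"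
  using assms(2,5) y by (simp add: L.m_assoc)
 also have "\<dots> = \<kappa> s1 \<otimes>\<^bsub>L\<^esub> Yp m \<otimes>\<^bsub>L\<^esub> l'"
  using frac_raise[OF assms(1-3), of m] s1 y by (simp add: \<kappa>_mult \<kappa>_pow)
 also have "\<dots> = \<kappa> s1 \<otimes>\<^bsub>L\<^esub> \<kappa> s'" using s1(1) assms(4,5) y by (simp add: L.m_assoc)
 finally show ?thesis using s1 assms(6) by (simp add: \<kappa>_mult)
qed

end

text \<open>Elements with the same numerator over the same power of y correspond. Any two fractions
  can be raised to a common denominator, which makes this relation the graph of a bijection
  compatible with the operations.\<close>

lemma localisations_isomorphic:
 assumes 1: "is_localisation S L y \<kappa>" and 2: "is_localisation S L' y \<kappa>'"
 shows "\<exists>\<psi>. \<psi> \<in> ring_iso L L'"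
proof -
 interpret A: is_localisation S L y \<kappa> by (rule 1)
 interpret B: is_localisation S L' y \<kappa>' by (rule 2)
 define rel where "rel l l' \<longleftrightarrow> l \<in> carrier L \<and> l' \<in> carrier L' \<and>
   (\<exists>(n::nat) s. s \<in> carrier S \<and> A.Yp n \<otimes>\<^bsub>L\<^esub> l = \<kappa> s \<and> B.Yp n \<otimes>\<^bsub>L'\<^esub> l' = \<kappa>' s)" for l l'
 have total: "\<exists>l'. rel l l'" if l: "l \<in> carrier L" for l
 proof -
  obtain n :: nat and s where s: "s \<in> carrier S" "A.Yp n \<otimes>\<^bsub>L\<^esub> l = \<kappa> s" using A.frac[OF l] by blast
  have i: "inv\<^bsub>L'\<^esub> (B.Yp n) \<in> carrier L'" using B.Yp_U by simp
  have "B.Yp n \<otimes>\<^bsub>L'\<^esub> (inv\<^bsub>L'\<^esub> (B.Yp n) \<otimes>\<^bsub>L'\<^esub> \<kappa>' s) = \<kappa>' s"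
   using B.Yp_U i s(1) B.L.m_assoc[OF B.Yp_c i, of "\<kappa>' s" n, symmetric] by simp
  thus ?thesis unfolding rel_def using l s i by (intro exI conjI) auto
 qed
 have total': "\<exists>l. rel l l'" if l: "l' \<in> carrier L'" for l'
 proof -
  obtain n :: nat and s where s: "s \<in> carrier S" "B.Yp n \<otimes>\<^bsub>L'\<^esub> l' = \<kappa>' s" using B.frac[OF l] by blast
  have i: "inv\<^bsub>L\<^esub> (A.Yp n) \<in> carrier L" using A.Yp_U by simp
  have "A.Yp n \<otimes>\<^bsub>L\<^esub> (inv\<^bsub>L\<^esub> (A.Yp n) \<otimes>\<^bsub>L\<^esub> \<kappa> s) = \<kappa> s"
   using A.Yp_U i s(1) A.L.m_assoc[OF A.Yp_c i, of "\<kappa> s" n, symmetric] by simp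
  thus ?thesis unfolding rel_def using l s i by (intro exI conjI) auto
 qed
 have uniq: "l1 = l2 \<longleftrightarrow> l1' = l2'" if r: "rel l1 l1'" "rel l2 l2'" for l1 l1' l2 l2'
 proof -
  obtain n :: nat and s where s: "s \<in> carrier S" "A.Yp n \<otimes>\<^bsub>L\<^esub> l1 = \<kappa> s" "B.Yp n \<otimes>\<^bsub>L'\<^esub> l1' = \<kappa>' s"
   using r(1) unfolding rel_def by blast
  obtain m :: nat and t where t: "t \<in> carrier S" "A.Yp m \<otimes>\<^bsub>L\<^esub> l2 = \<kappa> t" "B.Yp m \<otimes>\<^bsub>L'\<^esub> l2' = \<kappa>' t"
   using r(2) unfolding rel_def by blast
  have c: "l1 \<in> carrier L" "l2 \<in> carrier L" "l1' \<in> carrier L'" "l2' \<in> carrier L'" using r by (auto simp: rel_def)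
  let ?a = "y [^]\<^bsub>S\<^esub> m \<otimes>\<^bsub>S\<^esub> s" and ?b = "y [^]\<^bsub>S\<^esub> n \<otimes>\<^bsub>S\<^esub> t"
  have ab: "?a \<in> carrier S" "?b \<in> carrier S" using s(1) t(1) by auto
  have e: "A.Yp (m + n) \<otimes>\<^bsub>L\<^esub> l1 = \<kappa> ?a" "A.Yp (m + n) \<otimes>\<^bsub>L\<^esub> l2 = \<kappa> ?b"
   "B.Yp (m + n) \<otimes>\<^bsub>L'\<^esub> l1' = \<kappa>' ?a" "B.Yp (m + n) \<otimes>\<^bsub>L'\<^esub> l2' = \<kappa>' ?b"
   using A.frac_raise[OF s(2) c(1) s(1), of m] A.frac_raise[OF t(2) c(2) t(1), of n]
    B.frac_raise[OF s(3) c(3) s(1), of m] B.frac_raise[OF t(3) c(4) t(1), of n] by (simp_all add: add.commute)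
  have "l1 = l2 \<longleftrightarrow> ?a = ?b" using e(1,2) A.\<kappa>_eq[OF ab] A.Yp_cancel[OF _ c(1,2), of "m + n"] by auto
  moreover have "l1' = l2' \<longleftrightarrow> ?a = ?b" using e(3,4) B.\<kappa>_eq[OF ab] B.Yp_cancel[OF _ c(3,4), of "m + n"] by auto
  ultimately show ?thesis by simp
 qed
 define \<psi> where "\<psi> l = (SOME l'. rel l l')" for l
 have \<psi>: "rel l (\<psi> l)" if "l \<in> carrier L" for l unfolding \<psi>_def using someI_ex[OF total[OF that]] .
 have \<psi>c: "\<psi> l \<in> carrier L'" if "l \<in> carrier L" for l using \<psi>[OF that] by (simp add: rel_def)
 have rel_add: "rel (l1 \<oplus>\<^bsub>L\<^esub> l2) (l1' \<oplus>\<^bsub>L'\<^esub> l2')" if r: "rel l1 l1'" "rel l2 l2'" for l1 l1' l2 l2'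
 proof -
  obtain n :: nat and s where s: "s \<in> carrier S" "A.Yp n \<otimes>\<^bsub>L\<^esub> l1 = \<kappa> s" "B.Yp n \<otimes>\<^bsub>L'\<^esub> l1' = \<kappa>' s"
   using r(1) unfolding rel_def by blast
  obtain m :: nat and t where t: "t \<in> carrier S" "A.Yp m \<otimes>\<^bsub>L\<^esub> l2 = \<kappa> t" "B.Yp m \<otimes>\<^bsub>L'\<^esub> l2' = \<kappa>' t"
   using r(2) unfolding rel_def by blast
  have c: "l1 \<in> carrier L" "l2 \<in> carrier L" "l1' \<in> carrier L'" "l2' \<in> carrier L'" using r by (auto simp: rel_def)
  note A.frac_add[OF s(2) c(1) s(1) t(2) c(2) t(1)] B.frac_add[OF s(3) c(3) s(1) t(3) c(4) t(1)]
  moreover have "y [^]\<^bsub>S\<^esub> m \<otimes>\<^bsub>S\<^esub> s \<oplus>\<^bsub>S\<^esub> y [^]\<^bsub>S\<^esub> n \<otimes>\<^bsub>S\<^esub> t \<in> carrier S" using s(1) t(1) by auto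
  ultimately show ?thesis unfolding rel_def using c by blast
 qed
 have rel_mult: "rel (l1 \<otimes>\<^bsub>L\<^esub> l2) (l1' \<otimes>\<^bsub>L'\<^esub> l2')" if r: "rel l1 l1'" "rel l2 l2'" for l1 l1' l2 l2'
 proof -
  obtain n :: nat and s where s: "s \<in> carrier S" "A.Yp n \<otimes>\<^bsub>L\<^esub> l1 = \<kappa> s" "B.Yp n \<otimes>\<^bsub>L'\<^esub> l1' = \<kappa>' s"
   using r(1) unfolding rel_def by blast
  obtain m :: nat and t where t: "t \<in> carrier S" "A.Yp m \<otimes>\<^bsub>L\<^esub> l2 = \<kappa> t" "B.Yp m \<otimes>\<^bsub>L'\<^esub> l2' = \<kappa>' t"
   using r(2) unfolding rel_def by blast
  have c: "l1 \<in> carrier L" "l2 \<in> carrier L" "l1' \<in> carrier L'" "l2' \<in> carrier L'" using r by (auto simp: rel_def)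
  obtain s1 where s1: "s1 \<in> carrier S" "y [^]\<^bsub>S\<^esub> m \<otimes>\<^bsub>S\<^esub> s = s1 \<otimes>\<^bsub>S\<^esub> y [^]\<^bsub>S\<^esub> m"
   using A.normal[OF s(1), of m] by blast
  note A.frac_mult[OF s(2) c(1) s(1) t(2) c(2) t(1) s1] B.frac_mult[OF s(3) c(3) s(1) t(3) c(4) t(1) s1]
  moreover have "s1 \<otimes>\<^bsub>S\<^esub> t \<in> carrier S" using s1(1) t(1) by auto
  ultimately show ?thesis unfolding rel_def using c by blast
 qed
 have rel_one: "rel \<one>\<^bsub>L\<^esub> \<one>\<^bsub>L'\<^esub>"
  unfolding rel_def using A.\<kappa>_one B.\<kappa>_one by (auto intro!: exI[of _ "0::nat"] exI[of _ "\<one>\<^bsub>S\<^esub>"])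
 have "\<psi> \<in> ring_hom L L'"
 proof (rule ring_hom_memI)
  fix a b assume ab: "a \<in> carrier L" "b \<in> carrier L"
  show "\<psi> (a \<otimes>\<^bsub>L\<^esub> b) = \<psi> a \<otimes>\<^bsub>L'\<^esub> \<psi> b"
   using uniq[OF \<psi>[OF A.L.m_closed[OF ab]] rel_mult[OF \<psi>[OF ab(1)] \<psi>[OF ab(2)]]] by simp
  show "\<psi> (a \<oplus>\<^bsub>L\<^esub> b) = \<psi> a \<oplus>\<^bsub>L'\<^esub> \<psi> b"
   using uniq[OF \<psi>[OF A.L.a_closed[OF ab]] rel_add[OF \<psi>[OF ab(1)] \<psi>[OF ab(2)]]] by simp
 next
  show "\<psi> \<one>\<^bsub>L\<^esub> = \<one>\<^bsub>L'\<^esub>" using uniq[OF \<psi>[OF A.L.one_closed] rel_one] by simp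
 qed (rule \<psi>c)
 moreover have "bij_betw \<psi> (carrier L) (carrier L')"
 proof (rule bij_betw_imageI)
  show "inj_on \<psi> (carrier L)"
  proof (rule inj_onI)
   fix a b assume ab: "a \<in> carrier L" "b \<in> carrier L" and e: "\<psi> a = \<psi> b"
   show "a = b" using uniq[OF \<psi>[OF ab(1)] \<psi>[OF ab(2)]] e by simp
  qed
  show "\<psi> ` carrier L = carrier L'"
  proof
   show "carrier L' \<subseteq> \<psi> ` carrier L"
   proof
    fix l' assume "l' \<in> carrier L'"
    then obtain l where l: "rel l l'" using total' by blast
    hence lc: "l \<in> carrier L" by (simp add: rel_def)
    have "\<psi> l = l'" using uniq[OF \<psi>[OF lc] l] by simp
    thus "l' \<in> \<psi> ` carrier L" using lc by blast
   qed
  qed (use \<psi>c in auto)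
 qed
 ultimately show ?thesis unfolding ring_iso_def by blast
qed

locale normal_element = ring S for S :: "('a, 'm) ring_scheme" (structure) +
 fixes y :: 'a
 assumes y: "y \<in> carrier S"
  and reg_left: "a \<in> carrier S ==> y \<otimes> a = \<zero> ==> a = \<zero>"
  and reg_right: "a \<in> carrier S ==> a \<otimes> y = \<zero> ==> a = \<zero>"
  and normal: "s \<in> carrier S ==> \<exists>s'\<in>carrier S. y \<otimes> s = s' \<otimes> y"
begin

abbreviation "Y (n::nat) \<equiv> y [^] n"

lemma Yc [simp, intro]: "Y n \<in> carrier S" using y by simp

lemma Y_comm: "Y m \<otimes> Y n = Y n \<otimes> Y m" using y by (simp add: nat_pow_mult add.commute)

lemma reg_left_pow: "a \<in> carrier S ==> Y n \<otimes> a = \<zero> ==> a = \<zero>"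
proof (induction n arbitrary: a)
 case (Suc n)
 have "Y n \<otimes> (y \<otimes> a) = \<zero>" using Suc.prems y by (simp add: m_assoc)
 hence "y \<otimes> a = \<zero>" using Suc.IH[of "y \<otimes> a"] Suc.prems(1) y by simp
 thus ?case using reg_left Suc.prems(1) by blast
qed simp

lemma reg_right_pow: "a \<in> carrier S ==> a \<otimes> Y n = \<zero> ==> a = \<zero>"
proof (induction n arbitrary: a)
 case (Suc n)
 have "(a \<otimes> Y n) \<otimes> y = \<zero>" using Suc.prems y by (simp add: m_assoc)
 hence "a \<otimes> Y n = \<zero>" using reg_right[of "a \<otimes> Y n"] Suc.prems(1) by simp
 thus ?case by (rule Suc.IH[OF Suc.prems(1)])
qed simp

lemma lcancel: assumes "Y n \<otimes> a = Y n \<otimes> b" "a \<in> carrier S" "b \<in> carrier S" shows "a = b"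
proof -
 have "Y n \<otimes> (a \<ominus> b) = \<zero>" using assms by (simp add: minus_eq r_distr r_minus r_neg)
 hence "a \<ominus> b = \<zero>" by (intro reg_left_pow[of "a \<ominus> b" n]) (simp_all add: assms(2,3))
 thus ?thesis using assms(2,3) by simp
qed

lemma rcancel: assumes "a \<otimes> Y n = b \<otimes> Y n" "a \<in> carrier S" "b \<in> carrier S" shows "a = b"
proof -
 have "(a \<ominus> b) \<otimes> Y n = \<zero>" using assms by (simp add: minus_eq l_distr l_minus r_neg)
 hence "a \<ominus> b = \<zero>" by (intro reg_right_pow[of "a \<ominus> b" n]) (simp_all add: assms(2,3))
 thus ?thesis using assms(2,3) by simp
qed

lemma normal_pow: "s \<in> carrier S ==> \<exists>s'\<in>carrier S. Y n \<otimes> s = s' \<otimes> Y n"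
proof (induction n arbitrary: s)
 case (Suc n)
 obtain s1 where s1: "s1 \<in> carrier S" "y \<otimes> s = s1 \<otimes> y" using normal[OF Suc.prems] by blast
 obtain s2 where s2: "s2 \<in> carrier S" "Y n \<otimes> s1 = s2 \<otimes> Y n" using Suc.IH[OF s1(1)] by blast
 have "Y (Suc n) \<otimes> s = Y n \<otimes> s1 \<otimes> y" using y Suc.prems s1 by (simp add: m_assoc)
 also have "\<dots> = s2 \<otimes> Y (Suc n)" using y s2 by (simp add: m_assoc)
 finally show ?case using s2(1) by blast
next
 case 0
 thus ?case by (intro bexI[of _ s]) simp_all
qed

abbreviation "mp \<equiv> move_past S y"

lemma mp: assumes "s \<in> carrier S" shows "mp q s \<in> carrier S" "mp q s \<otimes> Y q = Y q \<otimes> s"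
proof -
 obtain s' where s': "s' \<in> carrier S" "Y q \<otimes> s = s' \<otimes> Y q" using normal_pow[OF assms] by blast
 have "mp q s = s'" unfolding move_past_def
 proof (rule the_equality)
  show "s' \<in> carrier S \<and> s' \<otimes> Y q = Y q \<otimes> s" using s' by simp
  fix t assume "t \<in> carrier S \<and> t \<otimes> Y q = Y q \<otimes> s"
  thus "t = s'" using rcancel[of t q s'] s' by simp
 qed
 thus "mp q s \<in> carrier S" "mp q s \<otimes> Y q = Y q \<otimes> s" using s' by auto
qed

lemma mp_eqI: "s \<in> carrier S ==> t \<in> carrier S ==> t \<otimes> Y q = Y q \<otimes> s ==> mp q s = t"
 using rcancel[of "mp q s" q t] mp[of s q] by simp

lemma mp_0: "s \<in> carrier S ==> mp 0 s = s" by (rule mp_eqI) auto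

lemma mp_one: "mp q \<one> = \<one>" by (rule mp_eqI) auto

lemma mp_Y: "mp q (Y k) = Y k" by (rule mp_eqI) (auto simp: Y_comm)

lemma mp_mult: assumes "a \<in> carrier S" "b \<in> carrier S" shows "mp q (a \<otimes> b) = mp q a \<otimes> mp q b"
proof (rule mp_eqI)
 have "mp q a \<otimes> mp q b \<otimes> Y q = mp q a \<otimes> (Y q \<otimes> b)"
  using mp(1)[OF assms(1)] mp[OF assms(2)] by (simp add: m_assoc)
 also have "\<dots> = (mp q a \<otimes> Y q) \<otimes> b" using mp(1)[OF assms(1)] assms by (simp only: m_assoc Yc)
 also have "\<dots> = Y q \<otimes> (a \<otimes> b)" unfolding mp(2)[OF assms(1)] using assms by (simp add: m_assoc)
 finally show "mp q a \<otimes> mp q b \<otimes> Y q = Y q \<otimes> (a \<otimes> b)" .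
qed (use assms mp in auto)

lemma mp_add: "a \<in> carrier S ==> b \<in> carrier S ==> mp q (a \<oplus> b) = mp q a \<oplus> mp q b"
 by (rule mp_eqI) (auto simp: mp l_distr r_distr)

lemma mp_mp: assumes "a \<in> carrier S" shows "mp k (mp q a) = mp (q + k) a"
proof (rule mp_eqI[symmetric])
 note m = mp[OF assms, of q] and m' = mp[OF mp(1)[OF assms, of q], of k]
 have "mp k (mp q a) \<otimes> Y (q + k) = mp k (mp q a) \<otimes> Y k \<otimes> Y q"
  using m'(1) y by (simp add: nat_pow_mult[symmetric] Y_comm[of q k] m_assoc)
 also have "\<dots> = Y k \<otimes> (mp q a \<otimes> Y q)" unfolding m'(2) using m(1) by (simp add: m_assoc)
 also have "\<dots> = Y (q + k) \<otimes> a" unfolding m(2)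
  using assms y by (simp add: nat_pow_mult[symmetric] Y_comm[of q k] m_assoc)
 finally show "mp k (mp q a) \<otimes> Y (q + k) = Y (q + k) \<otimes> a" .
qed (use assms mp in auto)

definition cls :: "nat \<Rightarrow> 'a \<Rightarrow> (nat \<times> 'a) set" where "cls r s = frac_rel S y `` {(r, s)}"

lemma frac_iff: "((r, s), (q, t)) \<in> frac_rel S y \<longleftrightarrow> s \<in> carrier S \<and> t \<in> carrier S \<and> Y q \<otimes> s = Y r \<otimes> t"
 by (simp add: frac_rel_def)

lemma Y_swap: "a \<in> carrier S ==> Y m \<otimes> (Y n \<otimes> a) = Y n \<otimes> (Y m \<otimes> a)"
 by (simp add: m_assoc[symmetric] Y_comm)

lemma equiv: "equiv (UNIV \<times> carrier S) (frac_rel S y)"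
proof (rule equivI)
 show "frac_rel S y \<subseteq> (UNIV \<times> carrier S) \<times> (UNIV \<times> carrier S)" by (auto simp: frac_rel_def)
 show "refl_on (UNIV \<times> carrier S) (frac_rel S y)" unfolding refl_on_def by (auto simp: frac_rel_def)
 show "sym (frac_rel S y)" unfolding sym_def by (auto simp: frac_rel_def)
 show "trans (frac_rel S y)" unfolding trans_def
 proof (intro allI impI)
  fix a b c assume "(a, b) \<in> frac_rel S y" "(b, c) \<in> frac_rel S y"
  then obtain r s q t k w where abc: "a = (r, s)" "b = (q, t)" "c = (k, w)"
   and h: "s \<in> carrier S" "t \<in> carrier S" "w \<in> carrier S" "Y q \<otimes> s = Y r \<otimes> t" "Y k \<otimes> t = Y q \<otimes> w"
   by (cases a; cases b; cases c) (auto simp: frac_iff)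
  have "Y q \<otimes> (Y k \<otimes> s) = Y k \<otimes> (Y r \<otimes> t)" using h(1,4) Y_swap[of s q k] by simp
  also have "\<dots> = Y r \<otimes> (Y q \<otimes> w)" using h(2,5) Y_swap[of t k r] by simp
  also have "\<dots> = Y q \<otimes> (Y r \<otimes> w)" using h(3) Y_swap[of w r q] by simp
  finally have "Y k \<otimes> s = Y r \<otimes> w" by (rule lcancel) (use h in auto)
  thus "(a, c) \<in> frac_rel S y" unfolding abc frac_iff using h by blast
 qed
qed

lemma cls_eq: "s \<in> carrier S ==> t \<in> carrier S ==> cls r s = cls q t \<longleftrightarrow> Y q \<otimes> s = Y r \<otimes> t"
 unfolding cls_def using eq_equiv_class_iff[OF equiv, of "(r, s)" "(q, t)"] by (simp add: frac_iff)

lemma mem_cls: "s \<in> carrier S ==> (q, t) \<in> cls r s \<longleftrightarrow> t \<in> carrier S \<and> cls q t = cls r s"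
 using cls_eq[of s t r q] unfolding cls_def by (auto simp: frac_iff)

abbreviation "L \<equiv> localisation S y"

lemma L_carrier: "W \<in> carrier L \<longleftrightarrow> (\<exists>r. \<exists>s\<in>carrier S. W = cls r s)"
 by (auto simp: localisation_def quotient_def cls_def)

lemma cls_c [simp, intro]: "s \<in> carrier S ==> cls r s \<in> carrier L"
 using L_carrier by blast

lemma cls_raise: "s \<in> carrier S ==> cls (r + k) (Y k \<otimes> s) = cls r s"
 using y by (subst cls_eq) (auto simp: nat_pow_mult[symmetric] m_assoc)

text \<open>The operations of \<open>localisation\<close> are unions over all representatives.
  \<open>wd\<close> shows that all of them give the same class, which collapses the union.\<close>

lemma L_add: assumes s: "s \<in> carrier S" and t: "t \<in> carrier S"
 shows "cls r s \<oplus>\<^bsub>L\<^esub> cls q t = cls (r + q) (Y q \<otimes> s \<oplus> Y r \<otimes> t)"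
proof -
 have wd: "cls (r' + q') (Y q' \<otimes> s' \<oplus> Y r' \<otimes> t') = cls (r + q) (Y q \<otimes> s \<oplus> Y r \<otimes> t)"
  if "(r', s') \<in> cls r s" "(q', t') \<in> cls q t" for r' s' q' t'
 proof -
  have c: "s' \<in> carrier S" "t' \<in> carrier S" using that mem_cls s t by auto
  have e: "Y r \<otimes> s' = Y r' \<otimes> s" "Y q \<otimes> t' = Y q' \<otimes> t"
   using that c s t by (simp_all add: mem_cls cls_eq)
  have p: "Y (a + b) \<otimes> z = Y a \<otimes> (Y b \<otimes> z)" if "z \<in> carrier S" for a b z
   using that y by (simp add: nat_pow_mult[symmetric] m_assoc)
  have "Y (r + q) \<otimes> (Y q' \<otimes> s') = Y (r' + q') \<otimes> (Y q \<otimes> s)"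
  proof -
   have "Y (r + q) \<otimes> (Y q' \<otimes> s') = Y q \<otimes> (Y q' \<otimes> (Y r \<otimes> s'))"
    using c(1) by (simp add: p add.commute[of r q] Y_swap[of s' r q'])
   also have "\<dots> = Y (r' + q') \<otimes> (Y q \<otimes> s)"
    unfolding e(1) using s
    by (simp add: p Y_swap[of "Y r' \<otimes> s" q q'] Y_swap[of s q r'] Y_swap[of "Y q \<otimes> s" q' r'])
   finally show ?thesis .
  qed
  moreover have "Y (r + q) \<otimes> (Y r' \<otimes> t') = Y (r' + q') \<otimes> (Y r \<otimes> t)"
  proof -
   have "Y (r + q) \<otimes> (Y r' \<otimes> t') = Y r \<otimes> (Y r' \<otimes> (Y q \<otimes> t'))"
    using c(2) by (simp add: p Y_swap[of t' q r'])
   also have "\<dots> = Y (r' + q') \<otimes> (Y r \<otimes> t)"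
    unfolding e(2) using t by (simp add: p Y_swap[of "Y q' \<otimes> t" r r'] Y_swap[of t r q'])
   finally show ?thesis .
  qed
  ultimately show ?thesis using c s t by (subst cls_eq) (auto simp: r_distr)
 qed
 have ne: "(r, s) \<in> cls r s" "(q, t) \<in> cls q t" using s t by (auto simp: mem_cls)
 have "cls r s \<oplus>\<^bsub>L\<^esub> cls q t = (\<Union>(r', s')\<in>cls r s. \<Union>(q', t')\<in>cls q t. cls (r' + q') (Y q' \<otimes> s' \<oplus> Y r' \<otimes> t'))"
  by (simp add: localisation_def cls_def)
 also have "\<dots> = cls (r + q) (Y q \<otimes> s \<oplus> Y r \<otimes> t)" using wd ne by fast
 finally show ?thesis .
qed

lemma L_mult: assumes s: "s \<in> carrier S" and t: "t \<in> carrier S"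
 shows "cls r s \<otimes>\<^bsub>L\<^esub> cls q t = cls (r + q) (mp q s \<otimes> t)"
proof -
 have p: "Y (a + b) \<otimes> z = Y a \<otimes> (Y b \<otimes> z)" if "z \<in> carrier S" for a b z
  using that y by (simp add: nat_pow_mult[symmetric] m_assoc)
 have wd: "cls (r' + q') (mp q' s' \<otimes> t') = cls (r + q) (mp q s \<otimes> t)"
  if "(r', s') \<in> cls r s" "(q', t') \<in> cls q t" for r' s' q' t'
 proof -
  have c: "s' \<in> carrier S" "t' \<in> carrier S" using that mem_cls s t by auto
  have e: "Y r \<otimes> s' = Y r' \<otimes> s" "Y q \<otimes> t' = Y q' \<otimes> t"
   using that c s t by (simp_all add: mem_cls cls_eq)
  note mc = mp(1)[OF s] mp(1)[OF c(1)] mp(1)[OF mp(1)[OF s]] mp(1)[OF mp(1)[OF c(1)]]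
  \<comment> \<open>\<open>mp q'\<close> is multiplicative and fixes the powers of y, so the
    relation between s and s' can be pushed through it.\<close>
  have m1: "Y r \<otimes> mp q' s' = Y r' \<otimes> mp q' s"
   using arg_cong[OF e(1), of "mp q'"] c(1) s by (simp add: mp_mult mp_Y)
  have "Y (r + q) \<otimes> (mp q' s' \<otimes> t') = Y q \<otimes> ((Y r \<otimes> mp q' s') \<otimes> t')"
   using mc c(2) by (simp add: p add.commute[of r q] m_assoc)
  also have "\<dots> = Y q \<otimes> ((Y r' \<otimes> mp q' s) \<otimes> t')" unfolding m1 ..
  also have "\<dots> = Y r' \<otimes> (Y q \<otimes> mp q' s) \<otimes> t'"
   using mc c(2) by (simp add: m_assoc Y_swap[of "mp q' s \<otimes> t'" q r'])
  also have "\<dots> = Y r' \<otimes> (mp (q' + q) s \<otimes> Y q) \<otimes> t'"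
   using mp(2)[OF mp(1)[OF s, of q'], of q] by (simp add: mp_mp[OF s])
  also have "\<dots> = Y r' \<otimes> mp (q' + q) s \<otimes> (Y q \<otimes> t')"
   using mc(1) c(2) by (simp add: m_assoc)
  also have "\<dots> = Y r' \<otimes> (mp (q + q') s \<otimes> Y q') \<otimes> t"
   unfolding e(2) using mc t by (simp add: m_assoc add.commute)
  also have "\<dots> = Y r' \<otimes> (Y q' \<otimes> mp q s) \<otimes> t"
   using mp(2)[OF mp(1)[OF s, of q], of q'] by (simp add: mp_mp[OF s])
  also have "\<dots> = Y (r' + q') \<otimes> (mp q s \<otimes> t)"
   using mc t by (simp add: p m_assoc)
  finally show ?thesis using c s t mc by (subst cls_eq) auto
 qed
 have ne: "(r, s) \<in> cls r s" "(q, t) \<in> cls q t" using s t by (auto simp: mem_cls)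
 have "cls r s \<otimes>\<^bsub>L\<^esub> cls q t = (\<Union>(r', s')\<in>cls r s. \<Union>(q', t')\<in>cls q t. cls (r' + q') (mp q' s' \<otimes> t'))"
  by (simp add: localisation_def cls_def)
 also have "\<dots> = cls (r + q) (mp q s \<otimes> t)" using wd ne by fast
 finally show ?thesis .
qed

lemma L_one: "\<one>\<^bsub>L\<^esub> = cls 0 \<one>" and L_zero: "\<zero>\<^bsub>L\<^esub> = cls 0 \<zero>"
 by (simp_all add: localisation_def cls_def)

lemma cls_zero: "cls r \<zero> = cls 0 \<zero>" by (subst cls_eq) auto

lemma L_add_same: assumes "s \<in> carrier S" "t \<in> carrier S" shows "cls r s \<oplus>\<^bsub>L\<^esub> cls r t = cls r (s \<oplus> t)"
proof -
 have "cls r s \<oplus>\<^bsub>L\<^esub> cls r t = cls (r + r) (Y r \<otimes> (s \<oplus> t))" using assms by (simp add: L_add r_distr)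
 thus ?thesis using cls_raise[of "s \<oplus> t" r r] assms by simp
qed

lemma common: assumes "A \<in> carrier L" "B \<in> carrier L"
 obtains r s t where "s \<in> carrier S" "t \<in> carrier S" "A = cls r s" "B = cls r t"
proof -
 obtain r s q t where st: "s \<in> carrier S" "A = cls r s" "t \<in> carrier S" "B = cls q t"
  using assms L_carrier by auto
 have "A = cls (r + q) (Y q \<otimes> s)" "B = cls (r + q) (Y r \<otimes> t)"
  using st cls_raise[of s r q] cls_raise[of t q r] by (simp_all add: add.commute)
 thus ?thesis using that[of "Y q \<otimes> s" "Y r \<otimes> t" "r + q"] st by simp
qed

lemma L_ring: "ring L"
proof (rule ringI)
 show "abelian_group L"
 proof (rule abelian_groupI)
  fix A B assume AB: "A \<in> carrier L" "B \<in> carrier L"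
  obtain r s t where c: "s \<in> carrier S" "t \<in> carrier S" "A = cls r s" "B = cls r t" by (rule common[OF AB])
  show "A \<oplus>\<^bsub>L\<^esub> B \<in> carrier L" using c by (simp add: L_add_same)
  show "A \<oplus>\<^bsub>L\<^esub> B = B \<oplus>\<^bsub>L\<^esub> A" using c by (simp add: L_add_same a_comm)
  fix C assume C: "C \<in> carrier L"
  obtain q w where w: "w \<in> carrier S" "C = cls q w" using C L_carrier by auto
  have e: "A = cls (r + q) (Y q \<otimes> s)" "B = cls (r + q) (Y q \<otimes> t)" "C = cls (r + q) (Y r \<otimes> w)"
   using c w cls_raise[of s r q] cls_raise[of t r q] cls_raise[of w q r] by (simp_all add: add.commute)
  show "A \<oplus>\<^bsub>L\<^esub> B \<oplus>\<^bsub>L\<^esub> C = A \<oplus>\<^bsub>L\<^esub> (B \<oplus>\<^bsub>L\<^esub> C)"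
   unfolding e using c(1,2) w(1) by (simp add: L_add_same a_assoc)
 next
  show "\<zero>\<^bsub>L\<^esub> \<in> carrier L" by (simp add: L_zero)
  fix A assume "A \<in> carrier L"
  then obtain r s where s: "s \<in> carrier S" "A = cls r s" using L_carrier by auto
  show "\<zero>\<^bsub>L\<^esub> \<oplus>\<^bsub>L\<^esub> A = A" unfolding s(2) L_zero cls_zero[of r, symmetric] using s(1) by (simp add: L_add_same)
  have "cls r (\<ominus> s) \<oplus>\<^bsub>L\<^esub> A = \<zero>\<^bsub>L\<^esub>" unfolding s(2) L_zero using s(1) by (simp add: L_add_same l_neg cls_zero[of r])
  thus "\<exists>B\<in>carrier L. B \<oplus>\<^bsub>L\<^esub> A = \<zero>\<^bsub>L\<^esub>" using s(1) by (intro bexI[of _ "cls r (\<ominus> s)"]) auto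
 qed
 show "monoid L"
 proof (rule monoidI)
  show "\<one>\<^bsub>L\<^esub> \<in> carrier L" by (simp add: L_one)
  fix A assume "A \<in> carrier L"
  then obtain r s where s: "s \<in> carrier S" "A = cls r s" using L_carrier by auto
  show "\<one>\<^bsub>L\<^esub> \<otimes>\<^bsub>L\<^esub> A = A" unfolding s(2) L_one using s(1) by (simp add: L_mult mp_one)
  show "A \<otimes>\<^bsub>L\<^esub> \<one>\<^bsub>L\<^esub> = A" unfolding s(2) L_one using s(1) by (simp add: L_mult mp_0)
  fix B assume "B \<in> carrier L"
  then obtain q t where t: "t \<in> carrier S" "B = cls q t" using L_carrier by auto
  show "A \<otimes>\<^bsub>L\<^esub> B \<in> carrier L" unfolding s(2) t(2) using s(1) t(1) mp(1) by (simp add: L_mult)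
  fix C assume "C \<in> carrier L"
  then obtain k w where w: "w \<in> carrier S" "C = cls k w" using L_carrier by auto
  show "A \<otimes>\<^bsub>L\<^esub> B \<otimes>\<^bsub>L\<^esub> C = A \<otimes>\<^bsub>L\<^esub> (B \<otimes>\<^bsub>L\<^esub> C)"
   unfolding s(2) t(2) w(2) using s(1) t(1) w(1) mp(1)[OF s(1)] mp(1)[OF t(1)] mp(1)[OF mp(1)[OF s(1)]]
   by (simp add: L_mult mp_mult mp_mp m_assoc add.assoc)
 qed
 fix A B C assume AB: "A \<in> carrier L" "B \<in> carrier L" and C: "C \<in> carrier L"
 obtain r s t where c: "s \<in> carrier S" "t \<in> carrier S" "A = cls r s" "B = cls r t" by (rule common[OF AB])
 obtain q w where w: "w \<in> carrier S" "C = cls q w" using C L_carrier by auto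
 show "(A \<oplus>\<^bsub>L\<^esub> B) \<otimes>\<^bsub>L\<^esub> C = A \<otimes>\<^bsub>L\<^esub> C \<oplus>\<^bsub>L\<^esub> B \<otimes>\<^bsub>L\<^esub> C"
  unfolding c(3,4) w(2) using c(1,2) w(1) mp(1)[OF c(1)] mp(1)[OF c(2)]
  by (simp add: L_mult L_add_same mp_add l_distr)
 show "C \<otimes>\<^bsub>L\<^esub> (A \<oplus>\<^bsub>L\<^esub> B) = C \<otimes>\<^bsub>L\<^esub> A \<oplus>\<^bsub>L\<^esub> C \<otimes>\<^bsub>L\<^esub> B"
  unfolding c(3,4) w(2) using c(1,2) w(1) mp(1)[OF w(1)]
  by (simp add: L_mult L_add_same r_distr)
qed

theorem localisation_is_localisation: "is_localisation S L y (cls 0)"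
proof -
 interpret L: ring L by (rule L_ring)
 have hom: "cls 0 \<in> ring_hom S L"
  by (rule ring_hom_memI) (auto simp: L_mult mp_0 L_add_same L_one)
 have pow: "cls 0 y [^]\<^bsub>L\<^esub> (n::nat) = cls 0 (Y n)" for n
  by (induction n) (simp_all add: L_one L_mult mp_0 y)
 have inv1: "cls 0 (Y n) \<otimes>\<^bsub>L\<^esub> cls n s = cls 0 s" if "s \<in> carrier S" for n s
  using that mp(1)[OF Yc[of n], of n] cls_raise[OF that, of 0 n] by (simp add: L_mult mp_Y)
 show ?thesis
 proof (rule is_localisation.intro[OF ring_axioms L_ring is_localisation_axioms.intro])
  show "y \<in> carrier S" by (rule y)
  show "\<exists>s'\<in>carrier S. Y n \<otimes> s = s' \<otimes> Y n" if "s \<in> carrier S" for n s by (rule normal_pow[OF that])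
  show "cls 0 \<in> ring_hom S L" by (rule hom)
  show "inj_on (cls 0) (carrier S)" by (rule inj_onI) (simp add: cls_eq)
  show "cls 0 y \<in> Units L"
  proof -
   have "cls 0 y \<otimes>\<^bsub>L\<^esub> cls 1 \<one> = \<one>\<^bsub>L\<^esub>" using inv1[of \<one> 1] y by (simp add: L_one)
   moreover have "cls 1 \<one> \<otimes>\<^bsub>L\<^esub> cls 0 y = \<one>\<^bsub>L\<^esub>"
    using y by (simp add: L_mult mp_0 L_one cls_eq)
   ultimately show ?thesis unfolding Units_def using y by (auto intro!: bexI[of _ "cls 1 \<one>"])
  qed
  fix l assume "l \<in> carrier L"
  then obtain r s where s: "s \<in> carrier S" "l = cls r s" using L_carrier by auto
  have "cls 0 y [^]\<^bsub>L\<^esub> r \<otimes>\<^bsub>L\<^esub> l = cls 0 s" unfolding s(2) pow by (rule inv1[OF s(1)])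
  thus "\<exists>(n::nat). \<exists>s\<in>carrier S. cls 0 y [^]\<^bsub>L\<^esub> n \<otimes>\<^bsub>L\<^esub> l = cls 0 s" using s(1) by blast
 qed
qed

end

section \<open>Series whose coefficients are fixed by \<sigma> and killed by \<delta>\<close>

context skew begin

text \<open>Such a series commutes with x, so right multiplication by it follows the Cauchy formula
  with finite sums. The powers of y and of z are of this kind, and so are the numerators of central
  fractions.\<close>

definition fixed :: "(nat \<Rightarrow> 'a) \<Rightarrow> bool" where
 "fixed f \<longleftrightarrow> f \<in> carrier S \<and> (\<forall>n. \<sigma> (f n) = f n \<and> \<delta> (f n) = \<zero>)"

lemma fixed_S: "fixed f ==> f \<in> carrier S" and fixed_\<sigma>: "fixed f ==> \<sigma> (f n) = f n"
 and fixed_\<delta>: "fixed f ==> \<delta> (f n) = \<zero>" by (auto simp: fixed_def)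

lemma xi_pow_fixed: assumes f: "fixed f"
 shows "(xi ^^ i) f = (\<lambda>k. if k < i then \<zero> else f (k - i))"
proof (induction i)
 case (Suc i)
 show ?case
 proof
  fix k
  have c: "f j \<in> carrier Q" for j by (rule S_coeff[OF fixed_S[OF f]])
  show "(xi ^^ Suc i) f k = (if k < Suc i then \<zero> else f (k - Suc i))"
  proof (cases k)
   case 0
   thus ?thesis by (simp add: Suc xi_0 fixed_\<delta>[OF f])
  next
   case (Suc k')
   thus ?thesis
    using c[of "k' - i"] by (simp add: \<open>(xi ^^ i) f = _\<close> xi_Suc fixed_\<delta>[OF f] fixed_\<sigma>[OF f])
  qed
 qed
qed simp

lemma mult_fixed: assumes a: "a \<in> carrier S" and f: "fixed f"
 shows "(a \<otimes>\<^bsub>S\<^esub> f) n = (\<Oplus>i\<in>{..<Suc n}. a i \<otimes> f (n - i))"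
proof -
 have ac: "a i \<in> carrier Q" for i by (rule S_coeff[OF a])
 have fc: "f i \<in> carrier Q" for i by (rule S_coeff[OF fixed_S[OF f]])
 have h: "hsum (\<lambda>i. a i \<otimes> (xi ^^ i) f n) (pr a f n)" by (rule pr_hsum[OF a fixed_S[OF f]])
 have "hsum (\<lambda>i. a i \<otimes> (xi ^^ i) f n) (\<Oplus>i\<in>{..<Suc n}. a i \<otimes> (xi ^^ i) f n)"
  by (rule sums_finite) (use ac fc in \<open>simp_all add: xi_pow_fixed[OF f]\<close>)
 hence "pr a f n = (\<Oplus>i\<in>{..<Suc n}. a i \<otimes> (xi ^^ i) f n)" by (rule sums_unique[OF h])
 also have "\<dots> = (\<Oplus>i\<in>{..<Suc n}. a i \<otimes> f (n - i))"
  by (rule finsum_cong') (use ac fc in \<open>simp_all add: xi_pow_fixed[OF f]\<close>)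
 finally show ?thesis by (simp only: S_mult[OF a fixed_S[OF f]])
qed

lemma fixed_mult: assumes a: "fixed a" and f: "fixed f" shows "fixed (a \<otimes>\<^bsub>S\<^esub> f)"
proof -
 have ac: "a i \<in> carrier Q" for i by (rule S_coeff[OF fixed_S[OF a]])
 have fc: "f i \<in> carrier Q" for i by (rule S_coeff[OF fixed_S[OF f]])
 note m = mult_fixed[OF fixed_S[OF a] f]
 have "\<sigma> ((a \<otimes>\<^bsub>S\<^esub> f) n) = (\<Oplus>i\<in>{..<Suc n}. \<sigma> (a i \<otimes> f (n - i)))" for n
  unfolding m by (rule amap_finsum[OF \<sigma>_amap]) (use ac fc in simp)
 moreover have "\<delta> ((a \<otimes>\<^bsub>S\<^esub> f) n) = (\<Oplus>i\<in>{..<Suc n}. \<delta> (a i \<otimes> f (n - i)))" for n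
  unfolding m by (rule amap_finsum[OF \<delta>_amap]) (use ac fc in simp)
 moreover have "\<sigma> (a i \<otimes> f j) = a i \<otimes> f j" "\<delta> (a i \<otimes> f j) = \<zero>" for i j
  using ac fc by (simp_all add: \<sigma>_mult leib fixed_\<sigma>[OF a] fixed_\<sigma>[OF f] fixed_\<delta>[OF a] fixed_\<delta>[OF f])
 ultimately show ?thesis unfolding fixed_def using fixed_S[OF a] fixed_S[OF f] by (simp add: m)
qed

lemma mon_fixed: "fixed (mon k)" by (simp add: fixed_def mon_def[of k]) (simp add: mon_def[symmetric])

lemma cst_fixed: "q \<in> carrier Q ==> \<sigma> q = q ==> \<delta> q = \<zero> ==> fixed (cst q)"
 unfolding fixed_def by (simp add: cst_eq) (simp add: cst_eq[symmetric])

lemma mult_cst: assumes a: "a \<in> carrier S" and q: "q \<in> carrier Q" "\<sigma> q = q" "\<delta> q = \<zero>"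
 shows "(a \<otimes>\<^bsub>S\<^esub> cst q) k = a k \<otimes> q"
proof -
 have ac: "a i \<in> carrier Q" for i by (rule S_coeff[OF a])
 have "(a \<otimes>\<^bsub>S\<^esub> cst q) k = (\<Oplus>i\<in>{..<Suc k}. a i \<otimes> cst q (k - i))"
  by (rule mult_fixed[OF a cst_fixed[OF q]])
 also have "\<dots> = (\<Oplus>i\<in>{..<k}. a i \<otimes> cst q (k - i)) \<oplus> a k \<otimes> cst q (k - k)"
  by (rule finsum_lessThan_Suc) (use ac q in \<open>simp add: cst_eq\<close>)
 also have "(\<Oplus>i\<in>{..<k}. a i \<otimes> cst q (k - i)) = (\<Oplus>i\<in>{..<k}. \<zero>)"
  by (rule finsum_cong') (use ac in \<open>simp_all add: cst_eq\<close>)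
 finally show ?thesis using ac q by (simp add: cst_eq)
qed

lemma fixed_add: assumes "fixed a" "fixed b" shows "fixed (a \<oplus>\<^bsub>S\<^esub> b)"
 unfolding fixed_def S_add[of a b] using assms S_coeff[OF fixed_S[OF assms(1)]] S_coeff[OF fixed_S[OF assms(2)]]
 S_add_closed[OF fixed_S[OF assms(1)] fixed_S[OF assms(2)]]
 by (simp add: \<sigma>_simps \<delta>_simps fixed_\<sigma> fixed_\<delta>)

lemma fixed_neg: assumes "fixed a" shows "fixed (\<ominus>\<^bsub>S\<^esub> a)"
 unfolding fixed_def S_minus[OF fixed_S[OF assms]]
 using neg_S[OF fixed_S[OF assms]] S_coeff[OF fixed_S[OF assms]]
 by (simp add: \<sigma>_simps \<delta>_simps fixed_\<sigma>[OF assms] fixed_\<delta>[OF assms])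

lemma fixed_pow: "fixed a ==> fixed (a [^]\<^bsub>S\<^esub> (n::nat))"
proof (induction n)
 case 0
 thus ?case using mon_fixed[of 0] by (simp add: S_one_mon)
next
 case (Suc n)
 thus ?case using fixed_mult by simp
qed

lemma mult_linear: assumes a: "a \<in> carrier S" and q: "q \<in> carrier Q" "\<sigma> q = q" "\<delta> q = \<zero>"
 shows "(a \<otimes>\<^bsub>S\<^esub> (mon 1 \<oplus>\<^bsub>S\<^esub> cst q)) k = (if k = 0 then \<zero> else a (k - 1)) \<oplus> a k \<otimes> q"
proof -
 have "a \<otimes>\<^bsub>S\<^esub> (mon 1 \<oplus>\<^bsub>S\<^esub> cst q) = a \<otimes>\<^bsub>S\<^esub> mon 1 \<oplus>\<^bsub>S\<^esub> a \<otimes>\<^bsub>S\<^esub> cst q" using a q(1) by (simp add: S.r_distr)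
 hence "(a \<otimes>\<^bsub>S\<^esub> (mon 1 \<oplus>\<^bsub>S\<^esub> cst q)) k = (a \<otimes>\<^bsub>S\<^esub> mon 1) k \<oplus> (a \<otimes>\<^bsub>S\<^esub> cst q) k"
  using fun_cong[OF S_add[of "a \<otimes>\<^bsub>S\<^esub> mon 1" "a \<otimes>\<^bsub>S\<^esub> cst q"], of k] by simp
 also have "(a \<otimes>\<^bsub>S\<^esub> mon 1) k = (if k = 0 then \<zero> else a (k - 1))"
  unfolding S_mult[OF a mon_S] pr_mon_right[OF a] by simp
 finally show ?thesis unfolding mult_cst[OF a q] .
qed

text \<open>x commutes with q, so this is the binomial theorem.\<close>

lemma linear_pow_coeff: assumes q: "q \<in> carrier Q" "\<sigma> q = q" "\<delta> q = \<zero>"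
 shows "((mon 1 \<oplus>\<^bsub>S\<^esub> cst q) [^]\<^bsub>S\<^esub> (n::nat)) k = add_pow Q (n choose k) (q [^] (n - k))"
proof (induction n arbitrary: k)
 case 0
 show ?case by (simp add: S_one binomial_eq_0)
next
 case (Suc n)
 let ?z = "mon 1 \<oplus>\<^bsub>S\<^esub> cst q"
 have zS: "?z \<in> carrier S" using q(1) by (intro S.a_closed) simp_all
 have e: "(?z [^]\<^bsub>S\<^esub> Suc n) k = (if k = 0 then \<zero> else (?z [^]\<^bsub>S\<^esub> n) (k - 1)) \<oplus> (?z [^]\<^bsub>S\<^esub> n) k \<otimes> q"
  unfolding S.nat_pow_Suc by (rule mult_linear[OF S.nat_pow_closed[OF zS] q])
 have m: "add_pow Q (n choose k) (q [^] (n - k)) \<otimes> q = add_pow Q (n choose k) (q [^] (Suc n - k))"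
 proof (cases "k \<le> n")
  case True
  thus ?thesis using q(1) by (simp add: add_pow_ldistr Suc_diff_le)
 next
  case False
  thus ?thesis using q(1) by (simp add: binomial_eq_0 not_le)
 qed
 show ?case
 proof (cases k)
  case 0
  thus ?thesis unfolding e Suc m unfolding 0 using q(1) by simp
 next
  case (Suc j)
  have "(?z [^]\<^bsub>S\<^esub> Suc n) k = add_pow Q (n choose j) (q [^] (n - j)) \<oplus> add_pow Q (n choose k) (q [^] (Suc n - k))"
   unfolding e Suc.IH m by (simp add: \<open>k = Suc j\<close>)
  thus ?thesis using \<open>k = Suc j\<close> q(1) by (simp add: add.nat_pow_mult)
 qed
qed

text \<open>Descent without end: from one bound of a the hypothesis produces arbitrarily high ones,
  and the filtration is separated.\<close>

lemma bnd_iter: assumes a: "a \<in> carrier S" and st: "\<And>c. a \<in> bnd c ==> a \<in> bnd (c + 1)" shows "a = \<zero>\<^bsub>S\<^esub>"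
proof -
 obtain c0 where c0: "a \<in> bnd c0" using a S_carrier by blast
 have n: "a \<in> bnd (c0 + int n)" for n
 proof (induction n)
  case (Suc n)
  show ?case using st[OF Suc] by (simp add: ac_simps)
 qed (simp add: c0)
 have "a k = \<zero>" for k
 proof (rule G_sep[OF S_coeff[OF a]])
  fix c
  have "a k \<in> G (c0 + int (nat (c - c0)))" using n[of "nat (c - c0)"] unfolding bnd_def by blast
  thus "a k \<in> G c" by (rule G_mono) simp
 qed
 thus ?thesis by (auto simp: S_zero)
qed

lemma \<sigma>_pow_bij: "bij_betw (\<sigma> ^^ n) (carrier Q) (carrier Q)"
proof (induction n)
 case (Suc n)
 show ?case using bij_betw_trans[OF Suc \<sigma>_bij] by (simp add: comp_def)
qed (simp add: bij_betw_def)

lemma \<sigma>_map_inj: assumes "a \<in> carrier S" "(\<lambda>k. \<sigma> (a k)) = (\<lambda>k. \<zero>)" shows "a = \<zero>\<^bsub>S\<^esub>"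
proof
 fix k
 have "\<sigma> (a k) = \<sigma> \<zero>" using fun_cong[OF assms(2), of k] by simp
 thus "a k = \<zero>\<^bsub>S\<^esub> k"
  using \<sigma>_bij S_coeff[OF assms(1), of k] by (simp add: S_zero bij_betw_def inj_on_def)
qed

lemma \<sigma>_funpow_map_S: "a \<in> carrier S ==> (\<lambda>k. (\<sigma> ^^ n) (a k)) \<in> carrier S"
proof (induction n)
 case (Suc n)
 show ?case using map_S(1)[OF Suc.IH[OF Suc.prems]] by simp
qed simp

end

context skew_inner begin

lemma fixed_y: "fixed y"
proof -
 have "fixed (mon 1 \<oplus>\<^bsub>S\<^esub> (\<ominus>\<^bsub>S\<^esub> cst t))"
  by (intro fixed_add fixed_neg mon_fixed cst_fixed) simp_all
 thus ?thesis by (simp add: y_def a_minus_def)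
qed

text \<open>The term t s of \<delta>(s) = t s - \<sigma>(s) t cancels; comparison with
  \<open>y_mult_right\<close> then gives y s = \<sigma>(s) y.\<close>

lemma y_mult_left: assumes s: "s \<in> carrier S"
 shows "(y \<otimes>\<^bsub>S\<^esub> s) k = (if k = 0 then \<zero> else \<sigma> (s (k - 1))) \<ominus> \<sigma> (s k) \<otimes> t"
proof -
 have sc: "s i \<in> carrier Q" for i by (rule S_coeff[OF s])
 have "y \<otimes>\<^bsub>S\<^esub> s = mon 1 \<otimes>\<^bsub>S\<^esub> s \<ominus>\<^bsub>S\<^esub> cst t \<otimes>\<^bsub>S\<^esub> s"
  unfolding y_def a_minus_def using s by (simp add: S.l_distr S.l_minus)
 also have "\<dots> = (\<lambda>n. xi s n \<ominus> t \<otimes> s n)"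
  unfolding var_mult[OF s] cst_mult[OF t_closed s] S_diff[OF xi_S[OF s] smul_S[OF t_closed s]]
  by (simp add: smul_def)
 finally have e: "(y \<otimes>\<^bsub>S\<^esub> s) k = xi s k \<ominus> t \<otimes> s k" by simp
 show ?thesis
 proof (cases k)
  case 0
  have "t \<otimes> s 0 \<ominus> \<sigma> (s 0) \<otimes> t \<ominus> t \<otimes> s 0 = \<ominus> (\<sigma> (s 0) \<otimes> t)"
   using sc by (simp add: minus_eq a_ac r_neg2 r_neg1)
  thus ?thesis unfolding e unfolding 0 using sc by (simp add: xi_0 \<delta>_eq minus_eq)
 next
  case (Suc j)
  have "\<sigma> (s j) \<oplus> (t \<otimes> s (Suc j) \<ominus> \<sigma> (s (Suc j)) \<otimes> t) \<ominus> t \<otimes> s (Suc j) = \<sigma> (s j) \<ominus> \<sigma> (s (Suc j)) \<otimes> t"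
   using sc by (simp add: minus_eq a_ac r_neg2 r_neg1)
  thus ?thesis unfolding e unfolding Suc using sc by (simp add: xi_Suc \<delta>_eq)
 qed
qed

lemma y_linear: "y = mon 1 \<oplus>\<^bsub>S\<^esub> cst (\<ominus> t)" by (simp add: y_def a_minus_def cst_minus)

lemma y_mult_right: assumes a: "a \<in> carrier S"
 shows "(a \<otimes>\<^bsub>S\<^esub> y) k = (if k = 0 then \<zero> else a (k - 1)) \<ominus> a k \<otimes> t"
 unfolding y_linear using mult_linear[OF a, of "\<ominus> t" k] S_coeff[OF a, of k]
 by (simp add: \<sigma>_simps \<delta>_simps r_minus minus_eq)

lemma y_map: assumes s: "s \<in> carrier S" shows "y \<otimes>\<^bsub>S\<^esub> s = (\<lambda>k. \<sigma> (s k)) \<otimes>\<^bsub>S\<^esub> y"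
 by (rule ext) (simp only: y_mult_left[OF s] y_mult_right[OF map_S(1)[OF s]])

lemma y_pow_map: assumes s: "s \<in> carrier S"
 shows "y [^]\<^bsub>S\<^esub> (n::nat) \<otimes>\<^bsub>S\<^esub> s = (\<lambda>k. (\<sigma> ^^ n) (s k)) \<otimes>\<^bsub>S\<^esub> y [^]\<^bsub>S\<^esub> n"
proof (induction n)
 case (Suc n)
 note c = \<sigma>_funpow_map_S[OF s, of n] \<sigma>_funpow_map_S[OF s, of "Suc n"]
 have "y [^]\<^bsub>S\<^esub> Suc n \<otimes>\<^bsub>S\<^esub> s = y \<otimes>\<^bsub>S\<^esub> (y [^]\<^bsub>S\<^esub> n \<otimes>\<^bsub>S\<^esub> s)"
  unfolding S.nat_pow_Suc2[OF y_S] by (rule S.m_assoc) (use s in simp_all)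
 also have "\<dots> = (y \<otimes>\<^bsub>S\<^esub> (\<lambda>k. (\<sigma> ^^ n) (s k))) \<otimes>\<^bsub>S\<^esub> y [^]\<^bsub>S\<^esub> n"
  unfolding Suc by (rule S.m_assoc[symmetric]) (use c in simp_all)
 also have "\<dots> = (\<lambda>k. (\<sigma> ^^ Suc n) (s k)) \<otimes>\<^bsub>S\<^esub> (y \<otimes>\<^bsub>S\<^esub> y [^]\<^bsub>S\<^esub> n)"
  unfolding y_map[OF c(1)] using c by (simp add: S.m_assoc)
 finally show ?case by (simp only: S.nat_pow_Suc2[OF y_S])
qed (use s in simp)

lemma t_pow_fixed: "\<sigma> ((\<ominus> t) [^] (n::nat)) = (\<ominus> t) [^] n" "\<delta> ((\<ominus> t) [^] (n::nat)) = \<zero>"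
proof -
 show s: "\<sigma> ((\<ominus> t) [^] (n::nat)) = (\<ominus> t) [^] n" for n
  by (induction n) (simp_all add: \<sigma>_mult \<sigma>_simps)
 have "t \<otimes> (\<ominus> t) [^] n = (\<ominus> t) [^] n \<otimes> t"
  using group_commutes_pow[of "\<ominus> t" t n] by (simp add: l_minus r_minus)
 thus "\<delta> ((\<ominus> t) [^] (n::nat)) = \<zero>" by (simp add: \<delta>_eq s minus_eq r_neg)
qed

lemma y_pow_coeff: "(y [^]\<^bsub>S\<^esub> (n::nat)) k = add_pow Q (n choose k) ((\<ominus> t) [^] (n - k))"
 unfolding y_linear by (rule linear_pow_coeff) (simp_all add: \<sigma>_simps \<delta>_simps)

end

context skew_subst begin

abbreviation "zp (k::nat) \<equiv> z [^]\<^bsub>S\<^esub> k"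

context
 fixes N :: nat
 assumes near: "\<And>k n. zp k n \<ominus> mon (N * k) n \<in> G 1" and N: "0 < N"
begin

text \<open>z^k is x^(N k) modulo \<open>G 1\<close>, so up to one level more the substitution
  spreads the coefficients of a over the multiples of N.\<close>

lemma iota_near: assumes a: "a \<in> bnd w"
 shows "iota a n \<ominus> (if N dvd n then a (n div N) else \<zero>) \<in> G (w + 1)"
proof -
 have aS: "a \<in> carrier S" using a by (rule bnd_S)
 have ac: "a k \<in> carrier Q" for k by (rule S_coeff[OF aS])
 have aG: "a k \<in> G w" for k using a by (simp add: bnd_def)
 define v where "v = (if N dvd n then a (n div N) else \<zero>)"
 have vc: "v \<in> carrier Q" using ac by (simp add: v_def)
 have "hsum (\<lambda>k. a k \<otimes> zp k n \<oplus> \<ominus> (if k = n div N then v else \<zero>)) (iota a n \<oplus> \<ominus> v)"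
  by (rule sums_add[OF iota_hsum[OF aS] sums_neg[OF sums_single[OF vc]]])
 moreover have "a k \<otimes> zp k n \<oplus> \<ominus> (if k = n div N then v else \<zero>) \<in> G (w + 1)" for k
 proof -
  have "(if k = n div N then v else \<zero>) = a k \<otimes> mon (N * k) n"
   using ac[of k] N by (auto simp: v_def mon_def)
  hence "a k \<otimes> zp k n \<oplus> \<ominus> (if k = n div N then v else \<zero>) = a k \<otimes> (zp k n \<ominus> mon (N * k) n)"
   using ac[of k] zp_coeff[of k n] S_coeff[OF mon_S, of "N * k" n] by (simp add: r_distr r_minus minus_eq)
  thus ?thesis using G_mult[OF aG near] by simp
 qed
 ultimately show ?thesis unfolding v_def[symmetric] minus_eq by (rule sums_G)
qed

lemma iota_kernel: assumes a: "a \<in> carrier S" "iota a = \<zero>\<^bsub>S\<^esub>" shows "a = \<zero>\<^bsub>S\<^esub>"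
proof (rule bnd_iter[OF a(1)])
 fix w assume aw: "a \<in> bnd w"
 have "a k \<in> G (w + 1)" for k
 proof -
  have "\<zero> \<ominus> a k \<in> G (w + 1)" using iota_near[OF aw, of "N * k"] a(2) N by (simp add: S_zero)
  hence "\<ominus> (\<zero> \<ominus> a k) \<in> G (w + 1)" by (rule G_neg)
  thus ?thesis using S_coeff[OF a(1), of k] by (simp add: minus_eq)
 qed
 thus "a \<in> bnd (w + 1)" by (simp add: bnd_def)
qed

lemma iota_inj: "inj_on iota (carrier S)"
proof (rule inj_onI)
 fix a b assume ab: "a \<in> carrier S" "b \<in> carrier S" "iota a = iota b"
 have d: "a \<ominus>\<^bsub>S\<^esub> b \<in> carrier S" using ab by simp
 have "iota (a \<ominus>\<^bsub>S\<^esub> b) \<oplus>\<^bsub>S\<^esub> iota b = iota a"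
  using iota_add[OF d ab(2)] ab by (simp add: S.minus_eq S.a_assoc S.l_neg)
 hence "iota (a \<ominus>\<^bsub>S\<^esub> b) = \<zero>\<^bsub>S\<^esub>" using ab d by (simp add: S.add.r_cancel_one)
 hence "a \<ominus>\<^bsub>S\<^esub> b = \<zero>\<^bsub>S\<^esub>" by (rule iota_kernel[OF d])
 thus "a = b" using ab by simp
qed

end

end

lemma (in filtered_ring) G_iter: assumes "\<And>c. a \<in> G c ==> a \<in> G (c + 1)" "a \<in> carrier Q" shows "a = \<zero>"
proof -
 obtain c0 where c0: "a \<in> G c0" by (rule G_exhaust[OF assms(2)])
 have st: "a \<in> G (c0 + int n)" for n
 proof (induction n)
  case (Suc n)
  have "c0 + int (Suc n) = c0 + int n + 1" by simp
  thus ?case using assms(1)[OF Suc] by (simp only:)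
 qed (simp add: c0)
 show ?thesis
 proof (rule G_sep[OF assms(2)])
  fix c show "a \<in> G c" by (rule G_mono[OF st[of "nat (c - c0)"]]) simp
 qed
qed

text \<open>By absorption p^m divides k times the binomial coefficient; if the latter were prime to
  p, then p^m would divide k.\<close>

lemma prime_dvd_choose_prime_power: assumes p: "Factorial_Ring.prime (p::nat)" and k: "0 < k" "k < p ^ m"
 shows "p dvd (p ^ m choose k)"
proof (rule ccontr)
 assume n: "\<not> p dvd (p ^ m choose k)"
 have "k * (p ^ m choose k) = p ^ m * ((p ^ m - 1) choose (k - 1))"
  using k binomial_absorption[of "k - 1" "p ^ m"] by simp
 hence "p ^ m dvd k * (p ^ m choose k)" by simp
 moreover have "coprime (p ^ m) (p ^ m choose k)" using p n by (simp add: prime_imp_coprime)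
 ultimately have "p ^ m dvd k" by (simp add: coprime_dvd_mult_left_iff)
 thus False using k by (auto dest: dvd_imp_le)
qed

section \<open>The tower of power series rings\<close>

text \<open>\<open>p_small\<close> is the common consequence of the two cases of the theorem. T
  appears as -(-t)^N, minus the constant coefficient of y^N. \<open>\<sigma>_inv\<close> bounds the
  loss of filtration under \<sigma>^-1, which keeps preimages of series bounded.\<close>

locale skew_tower = skew_inner Q u \<sigma> \<delta> C N0 t + std_ring Q u
 for Q :: "('a, 'm) ring_scheme" (structure) and u \<sigma> \<delta> C N0 t +
 fixes p m :: nat
 assumes p_prime: "Factorial_Ring.prime p"
  and \<sigma>_inv: "[| q \<in> carrier Q; \<sigma> q \<in> G n |] ==> q \<in> G (n - C)"
  and p_small: "p dvd b ==> add_pow Q b ((\<ominus> t) [^] (i::nat)) \<in> G 1"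
  and \<Sigma>_near: "r \<in> G n ==> (\<sigma> ^^ (p ^ m)) r \<ominus> r \<in> G (n + 1)"
  and \<Delta>_near: "r \<in> G n ==> \<ominus> ((\<ominus> t) [^] (p ^ m)) \<otimes> r \<ominus> (\<sigma> ^^ (p ^ m)) r \<otimes> \<ominus> ((\<ominus> t) [^] (p ^ m)) \<in> G (n + 1)"
  and not_inner: "[| 0 < k; c \<in> carrier Q; \<And>r. r \<in> carrier Q ==> c \<otimes> r = (\<sigma> ^^ k) r \<otimes> c |] ==> c = \<zero>"
  and dcc: "[| P \<subseteq> carrier Q; P \<noteq> {} |] ==> \<exists>r\<in>P. \<forall>r'\<in>P. (\<exists>q\<in>carrier Q. r' = q \<otimes> r) \<longrightarrow> (\<exists>q\<in>carrier Q. r = q \<otimes> r')"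
begin

definition N where "N = p ^ m"
definition T where "T = \<ominus> ((\<ominus> t) [^] N)"
definition Sg where "Sg = \<sigma> ^^ N"
definition Dl where "Dl q = T \<otimes> q \<ominus> Sg q \<otimes> T"

lemma N_pos: "0 < N" using p_prime by (simp add: N_def prime_gt_0_nat)
lemma T_c [simp, intro]: "T \<in> carrier Q" by (simp add: T_def)
lemma \<sigma>_T: "\<sigma> T = T" and \<delta>_T: "\<delta> T = \<zero>"
 using t_pow_fixed by (simp_all add: T_def \<sigma>_simps \<delta>_simps)
lemma Sg_c [simp, intro]: "r \<in> carrier Q ==> Sg r \<in> carrier Q" by (simp add: Sg_def)
lemma Dl_c [simp, intro]: "r \<in> carrier Q ==> Dl r \<in> carrier Q" by (simp add: Dl_def)
lemma Sg_near: "r \<in> G n ==> Sg r \<ominus> r \<in> G (n + 1)" using \<Sigma>_near by (simp add: Sg_def N_def)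
lemma Dl_near: "r \<in> G n ==> Dl r \<in> G (n + 1)" using \<Delta>_near by (simp add: Dl_def Sg_def T_def N_def)

lemma Sg_amap: "amap Sg" unfolding Sg_def by (rule amap_funpow[OF \<sigma>_amap])
lemma Sg_mult: "a \<in> carrier Q ==> b \<in> carrier Q ==> (\<sigma> ^^ n) (a \<otimes> b) = (\<sigma> ^^ n) a \<otimes> (\<sigma> ^^ n) b"
 by (induction n) (simp_all add: \<sigma>_mult)
lemma Sg_T: "Sg T = T"
proof -
 have "(\<sigma> ^^ n) T = T" for n by (induction n) (simp_all add: \<sigma>_T)
 thus ?thesis by (simp add: Sg_def)
qed

lemma Sg_G: assumes "r \<in> G n" shows "Sg r \<in> G n"
 by (rule G_diff_cancel[of _ r]) (use assms G_mono[OF Sg_near[OF assms], of n] in auto)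

lemma A_skew: "skew Q u Sg Dl 0 1"
proof
 show "amap Sg" by (rule Sg_amap)
 have "amap (\<lambda>q. T \<otimes> q \<ominus> Sg q \<otimes> T)"
  unfolding amap_def using amap_closed[OF Sg_amap] amap_add[OF Sg_amap]
  by (auto simp: r_distr l_distr minus_eq minus_add a_ac)
 thus "amap Dl" by (simp add: Dl_def[abs_def])
 show mult: "Sg (r \<otimes> s) = Sg r \<otimes> Sg s" if "r \<in> carrier Q" "s \<in> carrier Q" for r s
  unfolding Sg_def by (rule Sg_mult[OF that])
 have "(\<sigma> ^^ n) \<one> = \<one>" for n by (induction n) simp_all
 thus "Sg \<one> = \<one>" by (simp add: Sg_def)
 show "bij_betw Sg (carrier Q) (carrier Q)" unfolding Sg_def by (rule \<sigma>_pow_bij)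
 show "Dl (r \<otimes> s) = Dl r \<otimes> s \<oplus> Sg r \<otimes> Dl s" if rs: "r \<in> carrier Q" "s \<in> carrier Q" for r s
  using rs by (simp add: Dl_def mult l_distr r_distr minus_eq l_minus r_minus m_assoc a_ac r_neg1 r_neg2)
 show "Sg (Dl r) = Dl (Sg r)" if r: "r \<in> carrier Q" for r
  using r by (simp add: Dl_def amap_diff[OF Sg_amap] mult Sg_T)
 have Sgn: "(Sg ^^ i) r \<in> G n" if "r \<in> G n" for i r n
  by (induction i) (use that Sg_G in auto)
 have Dln: "(Dl ^^ j) r \<in> G (n + int j)" if "r \<in> G n" for j r n
 proof (induction j)
  case (Suc j)
  show ?case using Dl_near[OF Suc] by (simp add: ac_simps)
 qed (use that in simp)
 show "(Sg ^^ i) ((Dl ^^ j) q) \<in> G (n + int (j div 1) - 0)" if "q \<in> G n" for q n i j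
  using Sgn[OF Dln[OF that]] by simp
qed simp_all

sublocale A: compat_outer Q u Sg Dl T
proof (intro compat_outer.intro compat.intro skew_inner.intro A_skew std_ring_axioms)
 show "compat_axioms Q u Sg Dl"
  by (rule compat_axioms.intro) (use Sg_near Dl_near in auto)
 show "skew_inner_axioms Q Sg Dl T"
  by (rule skew_inner_axioms.intro) (auto simp: Sg_T Dl_def)
 show "compat_outer_axioms Q Sg"
 proof (rule compat_outer_axioms.intro)
  fix n :: nat and c assume n: "0 < n" "c \<in> carrier Q" and h: "\<And>r. r \<in> carrier Q ==> c \<otimes> r = (Sg ^^ n) r \<otimes> c"
  have e: "Sg ^^ n = \<sigma> ^^ (N * n)" by (simp add: Sg_def funpow_mult mult.commute)
  show "c = \<zero>" by (rule not_inner[of "N * n"]) (use n N_pos h e in auto)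
 qed
qed

text \<open>T is central up to higher terms: T f - f T = \<Delta>(f) + (\<Sigma>(f) - f) T lies
  above the level v \<le> 0 of T. So b T = 0 makes every b f T small, and \<Sum> f T g = 1 lifts b
  by one level, again and again.\<close>

lemma T_dichotomy: assumes nT: "T \<notin> G 1" and b: "b \<in> carrier Q" "b \<otimes> T = \<zero>" shows "b = \<zero>"
proof (rule G_iter[OF _ b(1)])
 fix c assume bc: "b \<in> G c"
 have "T \<noteq> \<zero>" using nT G_zero[of 1] by auto
 then obtain v where v: "T \<in> G v" "T \<notin> G (v + 1)" by (rule G_top[OF T_c])
 have v0: "v \<le> 0" using v(1) nT G_mono[OF v(1), of 1] by (cases "v \<le> 0") auto
 obtain s :: nat and f g where fg: "\<And>l. f l \<in> G 0" "\<And>l. g l \<in> G (- v)" "(\<Oplus>l\<in>{..<s}. f l \<otimes> T \<otimes> g l) = \<one>"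
  using std[OF v] by blast
 note c = G_carrier[OF fg(1)] G_carrier[OF fg(2)]
 have k: "T \<otimes> f l \<ominus> f l \<otimes> T \<in> G (v + 1)" for l
 proof -
  have 1: "Dl (f l) \<in> G (v + 1)" by (rule G_mono[OF Dl_near[OF fg(1)[of l]]]) (use v0 in simp)
  have 2: "(Sg (f l) \<ominus> f l) \<otimes> T \<in> G (v + 1)" by (rule G_mult'[OF Sg_near[OF fg(1)[of l]] v(1)]) simp
  have "T \<otimes> f l \<ominus> f l \<otimes> T = Dl (f l) \<oplus> (Sg (f l) \<ominus> f l) \<otimes> T"
   using c(1)[of l] by (simp add: Dl_def minus_eq l_distr l_minus a_ac r_neg r_neg1 r_neg2)
  thus ?thesis using G_add[OF 1 2] by simp
 qed
 have tm: "b \<otimes> (f l \<otimes> T \<otimes> g l) \<in> G (c + 1)" for l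
 proof -
  have kc: "T \<otimes> f l \<ominus> f l \<otimes> T \<in> carrier Q" using c(1)[of l] by simp
  have "b \<otimes> (T \<otimes> f l \<ominus> f l \<otimes> T) = b \<otimes> T \<otimes> f l \<ominus> b \<otimes> (f l \<otimes> T)"
   using b(1) c(1)[of l] by (simp add: minus_eq r_distr r_minus m_assoc)
  also have "\<dots> = \<ominus> (b \<otimes> (f l \<otimes> T))" using b c(1)[of l] by (simp add: minus_eq)
  finally have "b \<otimes> (f l \<otimes> T) = \<ominus> (b \<otimes> (T \<otimes> f l \<ominus> f l \<otimes> T))" using b(1) c(1)[of l] by simp
  hence "b \<otimes> (f l \<otimes> T \<otimes> g l) = \<ominus> (b \<otimes> (T \<otimes> f l \<ominus> f l \<otimes> T)) \<otimes> g l"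
   using b(1) c(1)[of l] c(2)[of l] by (simp add: m_assoc[symmetric])
  moreover have "\<ominus> (b \<otimes> (T \<otimes> f l \<ominus> f l \<otimes> T)) \<otimes> g l \<in> G (c + 1)"
   by (rule G_mult'[OF G_neg[OF G_mult[OF bc k]] fg(2)]) simp
  ultimately show ?thesis by simp
 qed
 have "b = b \<otimes> (\<Oplus>l\<in>{..<s}. f l \<otimes> T \<otimes> g l)" unfolding fg(3) using b(1) by simp
 also have "\<dots> = (\<Oplus>l\<in>{..<s}. b \<otimes> (f l \<otimes> T \<otimes> g l))"
  by (rule finsum_rdistr) (use b(1) c in auto)
 also have "\<dots> \<in> G (c + 1)" by (rule G_finsum) (rule tm)
 finally show "b \<in> G (c + 1)" .
qed

text \<open>The equations say b y = 0. If T lies in \<open>G 1\<close>, then b k = b (k + N) t^N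
  raises the level of b indefinitely; otherwise T, and with it t, can be cancelled on the right by
  \<open>T_dichotomy\<close>.\<close>

lemma t_chain: assumes b: "b \<in> carrier S" and h0: "b 0 \<otimes> t = \<zero>" and h: "\<And>k. b k = b (Suc k) \<otimes> t"
 shows "b = \<zero>\<^bsub>S\<^esub>"
proof -
 have bc: "b i \<in> carrier Q" for i by (rule S_coeff[OF b])
 have tp: "b k = b (k + n) \<otimes> t [^] n" for k n
 proof (induction n)
  case (Suc n)
  have "b (k + n) \<otimes> t [^] n = b (k + Suc n) \<otimes> (t \<otimes> t [^] n)" using h[of "k + n"] bc by (simp add: m_assoc)
  also have "t \<otimes> t [^] n = t [^] Suc n" by (simp only: nat_pow_Suc2[OF t_closed])
  finally show ?case using Suc by simp
 qed (use bc in simp)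
 have tN: "t [^] n = (\<ominus> t) [^] n \<or> t [^] n = \<ominus> ((\<ominus> t) [^] n)" for n :: nat
  by (induction n) (auto simp: l_minus r_minus)
 have TN: "t [^] N = T \<or> t [^] N = \<ominus> T" using tN[of N] by (auto simp: T_def)
 show ?thesis
 proof (cases "T \<in> G 1")
  case True
  have tg: "t [^] N \<in> G 1" using TN True G_neg by auto
  show ?thesis
  proof (rule bnd_iter[OF b])
   fix c assume bc0: "b \<in> bnd c"
   have "b k \<in> G (c + 1)" for k
    by (subst tp[of k N], rule G_mult[OF _ tg]) (use bc0 in \<open>simp add: bnd_def\<close>)
   thus "b \<in> bnd (c + 1)" by (simp add: bnd_def)
  qed
 next
  case False
  have canc: "a = \<zero>" if a: "a \<in> carrier Q" "a \<otimes> t = \<zero>" for a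
  proof -
   obtain n where n: "N = Suc n" using N_pos by (cases N) auto
   have "a \<otimes> t [^] N = a \<otimes> t \<otimes> t [^] n" unfolding n nat_pow_Suc2[OF t_closed] using a(1) by (simp add: m_assoc)
   hence "a \<otimes> t [^] N = \<zero>" using a by simp
   hence "a \<otimes> T = \<zero>" using TN a(1) by (auto simp: r_minus)
   thus ?thesis by (rule T_dichotomy[OF False a(1)])
  qed
  have "b k = \<zero>" for k
  proof (induction k)
   case 0 show ?case by (rule canc[OF bc h0])
  next
   case (Suc k) show ?case by (rule canc[OF bc]) (use h[of k] Suc in simp)
  qed
  thus ?thesis by (auto simp: S_zero)
 qed
qed

lemma diff_zero_eq: "a \<in> carrier Q ==> b \<in> carrier Q ==> a \<ominus> b = \<zero> ==> a = b" by simp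

lemma \<sigma>_inv_map: assumes b: "b \<in> carrier S" obtains b' where "b' \<in> carrier S" "b = (\<lambda>k. \<sigma> (b' k))"
proof -
 have "\<forall>k. \<exists>q. q \<in> carrier Q \<and> \<sigma> q = b k"
  using \<sigma>_bij S_coeff[OF b] unfolding bij_betw_def by (metis imageE)
 then obtain b' where b': "\<forall>k. b' k \<in> carrier Q \<and> \<sigma> (b' k) = b k" using choice by (metis (no_types, lifting))
 obtain c where c: "b \<in> bnd c" using b S_carrier by blast
 have "b' k \<in> G (c - C)" for k
  by (rule \<sigma>_inv) (use b' c in \<open>simp_all add: bnd_def\<close>)
 hence "b' \<in> bnd (c - C)" by (simp add: bnd_def)
 thus ?thesis using that[of b'] b' by auto
qed

text \<open>Regularity on either side reduces to \<open>t_chain\<close>: y a = 0 reads \<sigma>(a) y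
  = 0, and \<sigma> is injective on coefficients.\<close>

sublocale y: normal_element S y
proof
 show "y \<in> carrier S" by simp
 show "a = \<zero>\<^bsub>S\<^esub>" if a: "a \<in> carrier S" "y \<otimes>\<^bsub>S\<^esub> a = \<zero>\<^bsub>S\<^esub>" for a
 proof (rule \<sigma>_map_inj[OF a(1)])
  have c: "a k \<in> carrier Q" for k by (rule S_coeff[OF a(1)])
  have e: "(if k = 0 then \<zero> else \<sigma> (a (k - 1))) \<ominus> \<sigma> (a k) \<otimes> t = \<zero>" for k
   using y_mult_left[OF a(1), of k] a(2) by (simp add: S_zero)
  have "(\<lambda>k. \<sigma> (a k)) = \<zero>\<^bsub>S\<^esub>"
  proof (rule t_chain[OF map_S(1)[OF a(1)]])
   show "\<sigma> (a 0) \<otimes> t = \<zero>" using e[of 0] c[of 0] by (simp add: minus_eq)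
   fix k show "\<sigma> (a k) = \<sigma> (a (Suc k)) \<otimes> t"
    by (rule diff_zero_eq) (use e[of "Suc k"] c[of k] c[of "Suc k"] in simp_all)
  qed
  thus "(\<lambda>k. \<sigma> (a k)) = (\<lambda>k. \<zero>)" by (simp add: S_zero)
 qed
 show "a = \<zero>\<^bsub>S\<^esub>" if a: "a \<in> carrier S" "a \<otimes>\<^bsub>S\<^esub> y = \<zero>\<^bsub>S\<^esub>" for a
 proof -
  have c: "a k \<in> carrier Q" for k by (rule S_coeff[OF a(1)])
  have e: "(if k = 0 then \<zero> else a (k - 1)) \<ominus> a k \<otimes> t = \<zero>" for k
   using y_mult_right[OF a(1), of k] a(2) by (simp add: S_zero)
  show ?thesis
  proof (rule t_chain[OF a(1)])
   show "a 0 \<otimes> t = \<zero>" using e[of 0] c[of 0] by (simp add: minus_eq)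
   fix k show "a k = a (Suc k) \<otimes> t"
    by (rule diff_zero_eq) (use e[of "Suc k"] c[of k] c[of "Suc k"] in simp_all)
  qed
 qed
 show "\<exists>s'\<in>carrier S. y \<otimes>\<^bsub>S\<^esub> s = s' \<otimes>\<^bsub>S\<^esub> y" if s: "s \<in> carrier S" for s
  using y_map[OF s] map_S(1)[OF s] by blast
qed

end

section \<open>Triangular change of basis over a subring\<close>

context ring begin

definition combination :: "'a set \<Rightarrow> (nat \<Rightarrow> 'a) \<Rightarrow> nat \<Rightarrow> 'a \<Rightarrow> bool" where
 "combination B f n a \<longleftrightarrow> (\<exists>c. (\<forall>j. c j \<in> B) \<and> a = (\<Oplus>j\<in>{..<n}. c j \<otimes> f j))"

context
 fixes B :: "'a set" and f :: "nat \<Rightarrow> 'a"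
 assumes B: "subring B R" and f: "\<And>j. f j \<in> carrier R"
begin

lemma combination_add: assumes "combination B f n a" "combination B f n b" shows "combination B f n (a \<oplus> b)"
proof -
 obtain c d where c: "\<forall>j. c j \<in> B" "a = (\<Oplus>j\<in>{..<n}. c j \<otimes> f j)"
  and d: "\<forall>j. d j \<in> B" "b = (\<Oplus>j\<in>{..<n}. d j \<otimes> f j)"
  using assms unfolding combination_def by blast
 have cc: "c j \<in> carrier R" "d j \<in> carrier R" for j using c(1) d(1) subringE(1)[OF B] by auto
 have "(\<Oplus>j\<in>{..<n}. (c j \<oplus> d j) \<otimes> f j) = (\<Oplus>j\<in>{..<n}. c j \<otimes> f j \<oplus> d j \<otimes> f j)"
  by (rule finsum_cong') (use cc f in \<open>auto simp: l_distr\<close>)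
 also have "\<dots> = a \<oplus> b" unfolding c(2) d(2) by (rule finsum_addf) (use cc f in auto)
 finally show ?thesis unfolding combination_def using c(1) d(1) subringE(7)[OF B] by metis
qed

lemma combination_lmult: assumes "b \<in> B" "combination B f n a" shows "combination B f n (b \<otimes> a)"
proof -
 obtain c where c: "\<forall>j. c j \<in> B" "a = (\<Oplus>j\<in>{..<n}. c j \<otimes> f j)"
  using assms unfolding combination_def by blast
 have cc: "c j \<in> carrier R" for j using c(1) subringE(1)[OF B] by auto
 have bc: "b \<in> carrier R" using assms(1) subringE(1)[OF B] by auto
 have "b \<otimes> a = (\<Oplus>j\<in>{..<n}. b \<otimes> (c j \<otimes> f j))"
  unfolding c(2) by (rule finsum_rdistr) (use cc f bc in auto)
 also have "\<dots> = (\<Oplus>j\<in>{..<n}. (b \<otimes> c j) \<otimes> f j)"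
  by (rule finsum_cong') (use cc f bc in \<open>auto simp: m_assoc\<close>)
 finally show ?thesis unfolding combination_def using c(1) assms(1) subringE(6)[OF B]
  by (intro exI[of _ "\<lambda>j. b \<otimes> c j"]) auto
qed

lemma combination_mono: assumes "combination B f n a" "n \<le> m"
 shows "combination B f m a"
proof -
 obtain c where c: "\<forall>j. c j \<in> B" "a = (\<Oplus>j\<in>{..<n}. c j \<otimes> f j)"
  using assms unfolding combination_def by blast
 have cc: "c j \<in> carrier R" for j using c(1) subringE(1)[OF B] by auto
 have "(\<Oplus>j\<in>{..<m}. (if j < n then c j else \<zero>) \<otimes> f j) = (\<Oplus>j\<in>{..<n}. (if j < n then c j else \<zero>) \<otimes> f j)"
  by (rule add.finprod_mono_neutral_cong_left[symmetric]) (use assms(2) cc f in auto)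
 also have "\<dots> = a" unfolding c(2) by (rule finsum_cong') (use cc f in auto)
 finally show ?thesis unfolding combination_def
  using c(1) subringE(2)[OF B] by (intro exI[of _ "\<lambda>j. if j < n then c j else \<zero>"]) auto
qed

lemma combination_triangular:
 assumes tri: "\<And>i. combination B f (Suc i) (e i)" and b: "\<And>i. b i \<in> B"
 shows "combination B f n (\<Oplus>i\<in>{..<n}. b i \<otimes> e i)"
proof (induction n)
 case 0
 have "\<forall>j::nat. \<zero> \<in> B" using subringE(2)[OF B] by simp
 thus ?case unfolding combination_def by (intro exI[of _ "\<lambda>_. \<zero>"]) simp
next
 case (Suc n)
 have ec: "e i \<in> carrier R" for i
 proof -
  obtain c where c: "\<forall>j. c j \<in> B" "e i = (\<Oplus>j\<in>{..<Suc i}. c j \<otimes> f j)"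
   using tri[of i] unfolding combination_def by blast
  have "c j \<in> carrier R" for j using c(1) subringE(1)[OF B] by auto
  thus ?thesis unfolding c(2) using f by (intro finsum_closed) auto
 qed
 have "(\<Oplus>i\<in>{..<Suc n}. b i \<otimes> e i) = (\<Oplus>i\<in>{..<n}. b i \<otimes> e i) \<oplus> b n \<otimes> e n"
  by (rule finsum_lessThan_Suc) (use ec b subringE(1)[OF B] in auto)
 moreover have "combination B f (Suc n) (\<Oplus>i\<in>{..<n}. b i \<otimes> e i)"
  by (rule combination_mono[OF Suc]) simp
 moreover have "combination B f (Suc n) (b n \<otimes> e n)" by (rule combination_lmult[OF b tri])
 ultimately show ?case using combination_add by metis
qed

text \<open>When the relation is rewritten in terms of f, the coefficient of f n is v n, since only
  e n involves f n. So v n = 0, and the relation becomes shorter.\<close>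

lemma triangular_indep:
 assumes tri: "\<And>i. \<exists>r. combination B f i r \<and> e i = f i \<oplus> r"
  and ind: "\<And>v. (\<And>i. v i \<in> B) ==> (\<Oplus>i\<in>{..<N}. v i \<otimes> f i) = \<zero> ==> \<forall>j<N. v j = \<zero>"
  and v: "\<And>i. v i \<in> B" "(\<Oplus>i\<in>{..<n}. v i \<otimes> e i) = \<zero>" "n \<le> N" "j < n"
 shows "v j = \<zero>"
 using v(2-4)
proof (induction n arbitrary: j)
 case (Suc n)
 have vc: "v i \<in> carrier R" for i using v(1) subringE(1)[OF B] by auto
 have comb_c: "r \<in> carrier R" if h: "combination B f i r" for i r
 proof -
  obtain c where c: "\<forall>j. c j \<in> B" "r = (\<Oplus>j\<in>{..<i}. c j \<otimes> f j)"
   using h unfolding combination_def by blast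
  have "c j \<in> carrier R" for j using c(1) subringE(1)[OF B] by auto
  thus ?thesis unfolding c(2) using f by (intro finsum_closed) auto
 qed
 have unit: "combination B f (Suc i) (f i)" for i
 proof -
  have "(\<Oplus>j\<in>{..<Suc i}. (if j = i then \<one> else \<zero>) \<otimes> f j) =
    (\<Oplus>j\<in>{..<i}. (if j = i then \<one> else \<zero>) \<otimes> f j) \<oplus> (if i = i then \<one> else \<zero>) \<otimes> f i"
   by (rule finsum_lessThan_Suc) (use f in auto)
  also have "(\<Oplus>j\<in>{..<i}. (if j = i then \<one> else \<zero>) \<otimes> f j) = (\<Oplus>j\<in>{..<i}. \<zero>)"
   by (rule finsum_cong') (use f in auto)
  finally show ?thesis unfolding combination_def using f[of i] subringE(2,3)[OF B]
   by (intro exI[of _ "\<lambda>j. if j = i then \<one> else \<zero>"]) auto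
 qed
 have tri': "combination B f (Suc i) (e i)" for i
 proof -
  obtain r where r: "combination B f i r" "e i = f i \<oplus> r" using tri by blast
  show ?thesis unfolding r(2) by (rule combination_add[OF unit combination_mono[OF r(1)]]) simp
 qed
 have ec: "e i \<in> carrier R" for i by (rule comb_c[OF tri'])
 obtain r where r: "combination B f n r" "e n = f n \<oplus> r" using tri by blast
 have "combination B f n ((\<Oplus>i\<in>{..<n}. v i \<otimes> e i) \<oplus> v n \<otimes> r)"
  by (rule combination_add[OF combination_triangular[OF tri' v(1)] combination_lmult[OF v(1) r(1)]])
 then obtain c where c: "\<forall>j. c j \<in> B" "(\<Oplus>i\<in>{..<n}. v i \<otimes> e i) \<oplus> v n \<otimes> r = (\<Oplus>j\<in>{..<n}. c j \<otimes> f j)"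
  unfolding combination_def by blast
 have cc: "c j \<in> carrier R" for j using c(1) subringE(1)[OF B] by auto
 define w where "w j = (if j < n then c j else if j = n then v n else \<zero>)" for j
 have wB: "w j \<in> B" for j using c(1) v(1) subringE(2)[OF B] by (simp add: w_def)
 have wc: "w j \<in> carrier R" for j using wB subringE(1)[OF B] by auto
 have sc: "(\<Oplus>i\<in>{..<n}. v i \<otimes> e i) \<in> carrier R" by (rule finsum_closed) (use vc ec in auto)
 have vr: "v n \<otimes> r \<in> carrier R" "v n \<otimes> f n \<in> carrier R" using vc f comb_c[OF r(1)] by auto
 have "(\<Oplus>j\<in>{..<N}. w j \<otimes> f j) = (\<Oplus>j\<in>{..<Suc n}. w j \<otimes> f j)"
  by (rule add.finprod_mono_neutral_cong_right) (use Suc.prems(2) cc vc f in \<open>auto simp: w_def\<close>)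
 also have "\<dots> = (\<Oplus>j\<in>{..<n}. w j \<otimes> f j) \<oplus> w n \<otimes> f n"
  by (rule finsum_lessThan_Suc) (use wc f in auto)
 also have "(\<Oplus>j\<in>{..<n}. w j \<otimes> f j) = (\<Oplus>j\<in>{..<n}. c j \<otimes> f j)"
  by (rule finsum_cong') (use cc f in \<open>auto simp: w_def\<close>)
 also have "(\<Oplus>j\<in>{..<n}. c j \<otimes> f j) \<oplus> w n \<otimes> f n = (\<Oplus>i\<in>{..<n}. v i \<otimes> e i) \<oplus> v n \<otimes> e n"
  unfolding c(2)[symmetric] r(2) using sc vr vc f comb_c[OF r(1)] by (simp add: w_def r_distr a_ac)
 also have "\<dots> = (\<Oplus>i\<in>{..<Suc n}. v i \<otimes> e i)"
  by (rule finsum_lessThan_Suc[symmetric]) (use vc ec in auto)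
 finally have w0: "(\<Oplus>j\<in>{..<N}. w j \<otimes> f j) = \<zero>" using Suc.prems(1) by simp
 have "w n = \<zero>" using ind[OF wB w0] Suc.prems(2) by auto
 hence vn: "v n = \<zero>" by (simp add: w_def)
 have "(\<Oplus>i\<in>{..<Suc n}. v i \<otimes> e i) = (\<Oplus>i\<in>{..<n}. v i \<otimes> e i) \<oplus> v n \<otimes> e n"
  by (rule finsum_lessThan_Suc) (use vc ec in auto)
 hence "(\<Oplus>i\<in>{..<n}. v i \<otimes> e i) = \<zero>" using Suc.prems(1) vn sc ec[of n] by simp
 hence "j < n ==> v j = \<zero>" using Suc.IH[of j] Suc.prems(2) by simp
 thus ?case using vn Suc.prems(3) by (cases "j = n") auto
qed simp

end
end

context skew begin

lemma poly_mon: assumes "\<And>j. c j \<in> carrier Q"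
 shows "(\<Oplus>\<^bsub>S\<^esub>j\<in>{..<n}. cst (c j) \<otimes>\<^bsub>S\<^esub> mon j) k = (if k < n then c k else \<zero>)"
proof -
 have "(\<Oplus>\<^bsub>S\<^esub>j\<in>{..<n}. cst (c j) \<otimes>\<^bsub>S\<^esub> mon j) k = (\<Oplus>j\<in>{..<n}. (cst (c j) \<otimes>\<^bsub>S\<^esub> mon j) k)"
  by (rule S_finsum) (use assms in auto)
 also have "\<dots> = (\<Oplus>j\<in>{..<n}. if k = j then c j else \<zero>)"
 proof (rule finsum_cong')
  show "(cst (c j) \<otimes>\<^bsub>S\<^esub> mon j) k = (if k = j then c j else \<zero>)" for j
   unfolding cst_mult[OF assms mon_S] using assms[of j] by (simp add: smul_def mon_def)
 qed (use assms in auto)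
 also have "\<dots> = (if k < n then c k else \<zero>)"
 proof (cases "k < n")
  case True
  thus ?thesis using finsum_singleton[of k "{..<n}" c] assms by simp
 next
  case False
  have "(\<Oplus>j\<in>{..<n}. if k = j then c j else \<zero>) = (\<Oplus>j\<in>{..<n}. \<zero>)"
   by (rule finsum_cong') (use False in auto)
  thus ?thesis using False by simp
 qed
 finally show ?thesis .
qed

end

section \<open>The subring of series in z, and bases over it\<close>

context skew_tower begin

definition z where "z = y [^]\<^bsub>S\<^esub> N \<oplus>\<^bsub>S\<^esub> cst T"

text \<open>T is chosen to cancel the constant coefficient (-t)^N of y^N.\<close>

lemma z_coeff: "z k = (if k = 0 then \<zero> else add_pow Q (N choose k) ((\<ominus> t) [^] (N - k)))"
 by (simp add: z_def S_add y_pow_coeff cst_eq T_def r_neg)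

lemma z_fixed: "fixed z"
 unfolding z_def by (intro fixed_add fixed_pow fixed_y cst_fixed) (simp_all add: \<sigma>_T \<delta>_T)

lemma z_S [simp, intro]: "z \<in> carrier S" by (rule fixed_S[OF z_fixed])

lemma z_near: "z k \<ominus> mon N k \<in> G 1"
proof -
 consider "k = 0" | "k = N" | "0 < k" "k < N" | "N < k" using N_pos by linarith
 thus ?thesis
 proof cases
  case 3
  have "p dvd (N choose k)" using prime_dvd_choose_prime_power[OF p_prime, of k m] 3 by (simp add: N_def)
  thus ?thesis using 3 p_small by (simp add: z_coeff mon_def minus_eq)
 qed (use N_pos in \<open>simp_all add: z_coeff mon_def minus_eq r_neg binomial_eq_0\<close>)
qed

abbreviation "zp (k::nat) \<equiv> z [^]\<^bsub>S\<^esub> k"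

lemma zp_fixed: "fixed (zp k)" by (rule fixed_pow[OF z_fixed])
lemma zp_S [simp, intro]: "zp k \<in> carrier S" by simp
lemma zp_c: "zp k n \<in> carrier Q" by (rule S_coeff[OF zp_S])

text \<open>z has no constant term. In particular its powers tend to zero in each coefficient, as
  substitution requires.\<close>

lemma zp_low: "n < k ==> zp k n = \<zero>"
proof (induction k arbitrary: n)
 case (Suc k)
 have "zp (Suc k) n = (\<Oplus>i\<in>{..<Suc n}. zp k i \<otimes> z (n - i))"
  using mult_fixed[OF zp_S[of k] z_fixed, of n] by simp
 also have "\<dots> = (\<Oplus>i\<in>{..<Suc n}. \<zero>)"
 proof (rule finsum_cong')
  fix i assume i: "i \<in> {..<Suc n}"
  show "zp k i \<otimes> z (n - i) = \<zero>"
  proof (cases "i < k")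
   case True thus ?thesis using Suc.IH[OF True] S_coeff[OF z_S, of "n - i"] by simp
  next
   case False
   hence "i = n" using i Suc.prems by simp
   thus ?thesis using zp_c[of k n] by (simp add: z_coeff)
  qed
 qed simp_all
 finally show ?case by simp
qed simp

text \<open>Both claims need one another in the induction. Split z as (z - x^N) + x^N: the first
  summand contributes a term in \<open>G 1\<close>, because z^k has level 0, and the second shifts
  z^k by N.\<close>

lemma zp_near: "zp k n \<ominus> mon (N * k) n \<in> G 1" and zp_G: "zp k n \<in> G 0"
proof -
 have both: "(\<forall>n. zp k n \<ominus> mon (N * k) n \<in> G 1) \<and> (\<forall>n. zp k n \<in> G 0)"
 proof (induction k)
  case 0
  show ?case by (simp add: S_one mon_def minus_eq r_neg G_one)
 next
  case (Suc k)
  have e: "fixed (z \<oplus>\<^bsub>S\<^esub> \<ominus>\<^bsub>S\<^esub> mon N)" by (intro fixed_add z_fixed fixed_neg mon_fixed)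
  have ej: "(z \<oplus>\<^bsub>S\<^esub> \<ominus>\<^bsub>S\<^esub> mon N) j \<in> G 1" for j
   using z_near[of j] by (simp add: S_add S_minus minus_eq)
  have zs: "zp (Suc k) = zp k \<otimes>\<^bsub>S\<^esub> (z \<oplus>\<^bsub>S\<^esub> \<ominus>\<^bsub>S\<^esub> mon N) \<oplus>\<^bsub>S\<^esub> zp k \<otimes>\<^bsub>S\<^esub> mon N"
   by (simp add: S.r_distr S.r_minus S.a_assoc S.l_neg)
  have near: "zp (Suc k) n \<ominus> mon (N * Suc k) n \<in> G 1" for n
  proof -
   define a where "a = (zp k \<otimes>\<^bsub>S\<^esub> (z \<oplus>\<^bsub>S\<^esub> \<ominus>\<^bsub>S\<^esub> mon N)) n"
   define b where "b = (zp k \<otimes>\<^bsub>S\<^esub> mon N) n"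
   have a: "a \<in> G 1" unfolding a_def mult_fixed[OF zp_S e]
    by (rule G_finsum, rule G_mult'[OF _ ej]) (use Suc in auto)
   have bc: "b \<in> carrier Q" unfolding b_def by (rule S_coeff) simp
   have beq: "b = (if n < N then \<zero> else zp k (n - N))"
    unfolding b_def S_mult[OF zp_S mon_S] pr_mon_right[OF zp_S] ..
   have b: "b \<ominus> mon (N * Suc k) n \<in> G 1"
   proof (cases "n < N")
    case True
    thus ?thesis using beq by (simp add: mon_def minus_eq)
   next
    case False
    have "mon (N * Suc k) n = mon (N * k) (n - N)" using False by (auto simp: mon_def)
    thus ?thesis using beq False Suc by simp
   qed
   have mc: "mon (N * Suc k) n \<in> carrier Q" by (rule S_coeff[OF mon_S])
   have "zp (Suc k) n = a \<oplus> b" unfolding zs a_def b_def by (rule fun_cong[OF S_add])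
   hence "zp (Suc k) n \<ominus> mon (N * Suc k) n = a \<oplus> (b \<ominus> mon (N * Suc k) n)"
    using a bc mc by (simp only: minus_eq a_assoc G_carrier a_inv_closed)
   thus ?thesis using G_add[OF a b] by simp
  qed
  have "zp (Suc k) n \<in> G 0" for n
  proof (rule G_diff_cancel[OF G_mono[OF near[of n]]])
   show "mon (N * Suc k) n \<in> G 0" using mon_bnd by (simp add: bnd_def)
  qed (use zp_c[of "Suc k" n] in simp_all)
  thus ?case using near by blast
 qed
 show "zp k n \<ominus> mon (N * k) n \<in> G 1" "zp k n \<in> G 0" using both by auto
qed

lemma z_cst': assumes q: "q \<in> carrier Q"
 shows "z \<otimes>\<^bsub>S\<^esub> cst q = cst (Sg q) \<otimes>\<^bsub>S\<^esub> z \<oplus>\<^bsub>S\<^esub> cst (Dl q)"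
proof -
 have e: "T \<otimes> q = Sg q \<otimes> T \<oplus> Dl q" using q by (simp add: Dl_def minus_eq a_ac r_neg r_neg1 r_neg2)
 have "z \<otimes>\<^bsub>S\<^esub> cst q = cst (Sg q) \<otimes>\<^bsub>S\<^esub> y [^]\<^bsub>S\<^esub> N \<oplus>\<^bsub>S\<^esub> cst (T \<otimes> q)"
  unfolding z_def using q by (simp add: S.l_distr cst_cst y_pow_cst Sg_def)
 also have "cst (T \<otimes> q) = cst (Sg q) \<otimes>\<^bsub>S\<^esub> cst T \<oplus>\<^bsub>S\<^esub> cst (Dl q)"
  unfolding e using q by (simp add: cst_add cst_cst)
 finally show ?thesis unfolding z_def using q by (simp add: S.r_distr S.a_assoc)
qed

sublocale Z: skew_subst Q u \<sigma> \<delta> C N0 Sg Dl 0 1 z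
proof (intro skew_subst.intro skew_axioms A.skew_axioms skew_subst_axioms.intro)
 show "z \<in> carrier S" by simp
 show "z \<otimes>\<^bsub>S\<^esub> cst q = cst (Sg q) \<otimes>\<^bsub>S\<^esub> z \<oplus>\<^bsub>S\<^esub> cst (Dl q)" if "q \<in> carrier Q" for q by (rule z_cst'[OF that])
 show "\<exists>\<gamma>. \<forall>k. zp k \<in> bnd \<gamma>" using zp_G by (intro exI[of _ 0]) (simp add: bnd_def)
 show "null (\<lambda>k. zp k n)" for n
  unfolding null_def
 proof (intro conjI allI)
  show "zp k n \<in> carrier Q" for k by (rule zp_c)
  fix c show "\<exists>M. \<forall>k\<ge>M. zp k n \<in> G c"
   by (rule exI[of _ "Suc n"]) (use zp_low in auto)
 qed
qed

definition row :: "(nat \<Rightarrow> 'a) \<Rightarrow> nat \<Rightarrow> nat \<Rightarrow> 'a" where "row g i = (\<lambda>k. g (i + N * k))"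
text \<open>Replaces x^(i + N k) by z^k x^i for i < N. As z is close to x^N this changes a series
  only by terms of higher level, so the map is bijective; that is freeness over the series in z with
  basis 1, x, ..., x^(N-1).\<close>

definition Psi :: "(nat \<Rightarrow> 'a) \<Rightarrow> nat \<Rightarrow> 'a" where
 "Psi g = (\<Oplus>\<^bsub>S\<^esub>i\<in>{..<N}. Z.iota (row g i) \<otimes>\<^bsub>S\<^esub> mon i)"

lemma row_bnd: "g \<in> bnd w ==> row g i \<in> bnd w" by (simp add: bnd_def row_def)
lemma row_S [simp, intro]: "g \<in> carrier S ==> row g i \<in> carrier S" using row_bnd S_carrier by blast
lemma Psi_S: "g \<in> carrier S ==> Psi g \<in> carrier S" unfolding Psi_def by (rule S.finsum_closed) auto

lemma Psi_near: assumes g: "g \<in> bnd w" shows "Psi g n \<ominus> g n \<in> G (w + 1)"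
proof -
 have gS: "g \<in> carrier S" using g by (rule bnd_S)
 have gc: "g k \<in> carrier Q" for k by (rule S_coeff[OF gS])
 let ?x = "\<lambda>i. (Z.iota (row g i) \<otimes>\<^bsub>S\<^esub> mon i) n"
 have xc: "?x i \<in> carrier Q" for i by (rule S_coeff) (use gS in simp)
 have x: "?x i = (if n < i then \<zero> else Z.iota (row g i) (n - i))" for i
  unfolding S_mult[OF Z.iota_S[OF row_S[OF gS]] mon_S] pr_mon_right[OF Z.iota_S[OF row_S[OF gS]]] ..
 have 1: "Psi g n = (\<Oplus>i\<in>{..<N}. ?x i)" unfolding Psi_def by (rule S_finsum) (use gS in simp)
 have 2: "g n = (\<Oplus>i\<in>{..<N}. if n mod N = i then g n else \<zero>)"
  using finsum_singleton[of "n mod N" "{..<N}" "\<lambda>_. g n"] gc N_pos by simp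
 have d: "?x i \<ominus> (if n mod N = i then g n else \<zero>) \<in> G (w + 1)" if i: "i < N" for i
 proof (cases "n < i")
  case True
  hence "n mod N \<noteq> i" using i by (metis mod_less order.strict_trans less_irrefl)
  thus ?thesis using True by (simp add: x minus_eq)
 next
  case False
  have "(if n mod N = i then g n else \<zero>) = (if N dvd (n - i) then row g i ((n - i) div N) else \<zero>)"
  proof (cases "n mod N = i")
   case True
   hence "n - i = N * (n div N)" by (metis minus_mod_eq_mult_div)
   moreover have "i + N * (n div N) = n" using True mod_mult_div_eq[of n N] by simp
   ultimately show ?thesis using True N_pos by (simp add: row_def)
  next
   case f: False
   have "\<not> N dvd (n - i)"
   proof
    assume "N dvd (n - i)"
    then obtain k where "n - i = N * k" by blast
    hence "n = i + N * k" using False by simp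
    thus False using f i by simp
   qed
   thus ?thesis using f by simp
  qed
  thus ?thesis using Z.iota_near[OF zp_near N_pos row_bnd[OF g], of i "n - i"] False by (simp add: x)
 qed
 have "Psi g n \<ominus> g n = (\<Oplus>i\<in>{..<N}. ?x i) \<ominus> (\<Oplus>i\<in>{..<N}. if n mod N = i then g n else \<zero>)"
  using 1 2 by simp
 also have "\<dots> = (\<Oplus>i\<in>{..<N}. ?x i \<ominus> (if n mod N = i then g n else \<zero>))"
  by (rule finsum_diff) (use xc gc in auto)
 also have "\<dots> \<in> G (w + 1)" by (rule G_finsum) (use d in simp)
 finally show ?thesis .
qed

lemma Psi_add: assumes "a \<in> carrier S" "b \<in> carrier S" shows "Psi (a \<oplus>\<^bsub>S\<^esub> b) = Psi a \<oplus>\<^bsub>S\<^esub> Psi b"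
proof -
 have "row (a \<oplus>\<^bsub>S\<^esub> b) i = row a i \<oplus>\<^bsub>S\<^esub> row b i" for i by (simp add: row_def S_add)
 hence "Psi (a \<oplus>\<^bsub>S\<^esub> b) = (\<Oplus>\<^bsub>S\<^esub>i\<in>{..<N}. Z.iota (row a i) \<otimes>\<^bsub>S\<^esub> mon i \<oplus>\<^bsub>S\<^esub> Z.iota (row b i) \<otimes>\<^bsub>S\<^esub> mon i)"
  unfolding Psi_def by (intro S.finsum_cong') (use assms in \<open>auto simp: Z.iota_add S.l_distr\<close>)
 also have "\<dots> = Psi a \<oplus>\<^bsub>S\<^esub> Psi b" unfolding Psi_def by (rule S.finsum_addf) (use assms in auto)
 finally show ?thesis .
qed

text \<open>The map is the identity plus an operator raising the level by one, so the Neumann series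
  applies, with a weight that ignores the degree in x.\<close>

lemma Psi_surj: assumes s: "s \<in> carrier S" obtains g where "g \<in> carrier S" "Psi g = s"
proof -
 obtain c0 where c0: "s \<in> bnd c0" using s S_carrier by blast
 let ?\<mu> = "\<lambda>(w::nat) (k::nat). c0 + int w"
 have ws: "wt_set ?\<mu> w = bnd (c0 + int w)" for w by (simp add: wt_set_def bnd_def)
 define E where "E h = (\<lambda>k. Psi h k \<ominus> h k)" for h
 obtain h where h: "h \<in> wt_set ?\<mu> 0" "(\<lambda>k. h k \<oplus> E h k) = s"
 proof (rule neumann[of ?\<mu> E s])
  fix k :: nat and c :: int show "\<exists>w. c \<le> c0 + int w" by (rule exI[of _ "nat (c - c0)"]) simp
 next
  fix w and h assume h: "h \<in> wt_set ?\<mu> w"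
  show "E h \<in> wt_set ?\<mu> (Suc w)" using Psi_near[of h "c0 + int w"] h
   unfolding ws by (simp add: bnd_def E_def ac_simps)
 next
  fix a b assume "a \<in> wt_set ?\<mu> 0" "b \<in> wt_set ?\<mu> 0"
  hence ab: "a \<in> carrier S" "b \<in> carrier S" unfolding ws by (auto intro: bnd_S)
  have e: "Psi (\<lambda>k. a k \<oplus> b k) = (\<lambda>k. Psi a k \<oplus> Psi b k)" using Psi_add[OF ab] by (simp add: S_add)
  show "E (\<lambda>k. a k \<oplus> b k) = (\<lambda>k. E a k \<oplus> E b k)"
  proof
   fix k show "E (\<lambda>k. a k \<oplus> b k) k = E a k \<oplus> E b k"
    using S_coeff[OF ab(1), of k] S_coeff[OF ab(2), of k] S_coeff[OF Psi_S[OF ab(1)], of k] S_coeff[OF Psi_S[OF ab(2)], of k]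
    by (simp add: E_def e minus_eq minus_add a_ac)
  qed
 qed (use c0 in \<open>simp_all add: ws\<close>)
 have hS: "h \<in> carrier S" using h(1) unfolding ws by (rule bnd_S)
 have "Psi h = s"
 proof
  fix k
  have "h k \<oplus> (Psi h k \<ominus> h k) = Psi h k"
   using S_coeff[OF hS, of k] S_coeff[OF Psi_S[OF hS], of k] by (simp add: minus_eq a_ac r_neg1 r_neg2 r_neg)
  thus "Psi h k = s k" using fun_cong[OF h(2), of k] by (simp add: E_def)
 qed
 thus ?thesis using that hS by blast
qed

lemma Psi_inj: assumes g: "g \<in> carrier S" "Psi g = \<zero>\<^bsub>S\<^esub>" shows "g = \<zero>\<^bsub>S\<^esub>"
proof -
 have gc: "g k \<in> carrier Q" for k by (rule S_coeff[OF g(1)])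
 show ?thesis
 proof (rule bnd_iter[OF g(1)])
  fix c assume gb: "g \<in> bnd c"
  have "g k \<in> G (c + 1)" for k
  proof -
   have "\<zero> \<ominus> g k \<in> G (c + 1)" using Psi_near[OF gb, of k] g(2) by (simp add: S_zero)
   hence "\<ominus> (\<zero> \<ominus> g k) \<in> G (c + 1)" by (rule G_neg)
   thus ?thesis using gc[of k] by (simp add: minus_eq)
  qed
  thus "g \<in> bnd (c + 1)" by (simp add: bnd_def)
 qed
qed

definition B where "B = Z.iota ` carrier S"

lemma B_subring: "subring B S"
proof -
 interpret h: ring_hom_ring A.S S Z.iota
  by (rule ring_hom_ringI2[OF A.S.ring_axioms S.ring_axioms Z.iota_hom])
 have "subring (Z.iota ` carrier A.S) S" by (rule h.img_is_subring[OF A.S.carrier_is_subring])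
 thus ?thesis by (simp add: B_def Z.AS_carrier)
qed

lemma cst_B: "q \<in> carrier Q ==> cst q \<in> B"
 unfolding B_def using Z.iota_cst[of q] by (metis cst_S imageI)

lemma mon_gen: assumes s: "s \<in> carrier S" shows "S.combination B mon N s"
proof -
 obtain g where g: "g \<in> carrier S" "Psi g = s" by (rule Psi_surj[OF s])
 show ?thesis unfolding S.combination_def
  by (rule exI[of _ "\<lambda>i. Z.iota (row g i)"]) (use g in \<open>auto simp: B_def Psi_def\<close>)
qed

lemma mon_indep: assumes v: "\<And>i. v i \<in> B" "(\<Oplus>\<^bsub>S\<^esub>i\<in>{..<N}. v i \<otimes>\<^bsub>S\<^esub> mon i) = \<zero>\<^bsub>S\<^esub>"
 shows "\<forall>j<N. v j = \<zero>\<^bsub>S\<^esub>"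
proof -
 have "\<forall>i. \<exists>a. a \<in> carrier S \<and> v i = Z.iota a" using v(1) unfolding B_def by blast
 from choice[OF this] obtain a where a: "\<And>i. a i \<in> carrier S" "\<And>i. v i = Z.iota (a i)" by blast
 \<comment> \<open>A common bound is needed before the a i can be interleaved into one series of
   \<open>S\<close>.\<close>
 have "\<exists>c. \<forall>i<n. a i \<in> bnd c" for n
 proof (induction n)
  case (Suc n)
  then obtain c where c: "\<forall>i<n. a i \<in> bnd c" by blast
  obtain d where d: "a n \<in> bnd d" using a(1)[of n] S_carrier by blast
  have "\<forall>i<Suc n. a i \<in> bnd (min c d)" using c d by (auto simp: less_Suc_eq intro: bnd_mono)
  thus ?case by blast
 qed simp
 then obtain c where c: "\<forall>i<N. a i \<in> bnd c" by blast
 define g where "g n = a (n mod N) (n div N)" for n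
 have "g \<in> bnd c" using c N_pos by (simp add: g_def bnd_def)
 hence gS: "g \<in> carrier S" by (rule bnd_S)
 have r: "row g i = a i" if "i < N" for i using that by (simp add: row_def g_def)
 have "Psi g = (\<Oplus>\<^bsub>S\<^esub>i\<in>{..<N}. v i \<otimes>\<^bsub>S\<^esub> mon i)" unfolding Psi_def
  by (rule S.finsum_cong') (use a r in auto)
 hence "g = \<zero>\<^bsub>S\<^esub>" using Psi_inj[OF gS] v(2) by simp
 hence "a i = \<zero>\<^bsub>S\<^esub>" if "i < N" for i using r[OF that] by (simp add: row_def S_zero)
 moreover have "Z.iota \<zero>\<^bsub>S\<^esub> = \<zero>\<^bsub>S\<^esub>" using Z.iota_cst[of \<zero>] by (simp add: cst_zero)
 ultimately show ?thesis using a(2) by simp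
qed

lemma iota_zero: "Z.iota \<zero>\<^bsub>S\<^esub> = \<zero>\<^bsub>S\<^esub>" using Z.iota_cst[of \<zero>] by (simp add: cst_zero)

text \<open>x^i is y^i plus lower terms whose coefficients are constants, and constants lie in
  B.\<close>

lemma y_gen: assumes s: "s \<in> carrier S" shows "S.combination B (\<lambda>i. y [^]\<^bsub>S\<^esub> i) N s"
proof -
 obtain b where b: "\<forall>i. b i \<in> B" "s = (\<Oplus>\<^bsub>S\<^esub>i\<in>{..<N}. b i \<otimes>\<^bsub>S\<^esub> mon i)"
  using mon_gen[OF s] unfolding S.combination_def by blast
 show ?thesis unfolding b(2)
 proof (rule S.combination_triangular[OF B_subring])
  show "y [^]\<^bsub>S\<^esub> j \<in> carrier S" for j :: nat by simp
  show "b i \<in> B" for i using b(1) by blast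
  fix i :: nat
  obtain p where p: "p \<in> span i" "mon i = y [^]\<^bsub>S\<^esub> i \<oplus>\<^bsub>S\<^esub> p" using mon_monic by blast
  obtain c where c: "\<forall>j. c j \<in> carrier Q" "p = (\<Oplus>\<^bsub>S\<^esub>j\<in>{..<i}. cst (c j) \<otimes>\<^bsub>S\<^esub> y [^]\<^bsub>S\<^esub> j)"
   using p(1) unfolding span_def by blast
  define d where "d j = cst (if j = i then \<one> else c j)" for j
  have dc: "d j \<in> B" "d j \<in> carrier S" for j using c(1) cst_B by (simp_all add: d_def)
  have pc: "p \<in> carrier S" by (rule span_S[OF p(1)])
  have "(\<Oplus>\<^bsub>S\<^esub>j\<in>{..<Suc i}. d j \<otimes>\<^bsub>S\<^esub> y [^]\<^bsub>S\<^esub> j) = (\<Oplus>\<^bsub>S\<^esub>j\<in>{..<i}. d j \<otimes>\<^bsub>S\<^esub> y [^]\<^bsub>S\<^esub> j) \<oplus>\<^bsub>S\<^esub> d i \<otimes>\<^bsub>S\<^esub> y [^]\<^bsub>S\<^esub> i"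
   by (rule S.finsum_lessThan_Suc) (use dc in simp)
  also have "(\<Oplus>\<^bsub>S\<^esub>j\<in>{..<i}. d j \<otimes>\<^bsub>S\<^esub> y [^]\<^bsub>S\<^esub> j) = p"
   unfolding c(2) by (rule S.finsum_cong') (use c(1) in \<open>auto simp: d_def\<close>)
  also have "p \<oplus>\<^bsub>S\<^esub> d i \<otimes>\<^bsub>S\<^esub> y [^]\<^bsub>S\<^esub> i = mon i"
   unfolding p(2) using pc by (simp add: d_def cst_one S.a_comm)
  finally show "S.combination B (\<lambda>j. y [^]\<^bsub>S\<^esub> j) (Suc i) (mon i)"
   unfolding S.combination_def using dc(1) by (intro exI[of _ d]) simp
 qed
qed

text \<open>Conversely y^i is x^i plus lower powers of x with constant coefficients, so independence
  passes from the powers of x to those of y.\<close>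

lemma y_indep: assumes "\<And>i. v i \<in> B" "(\<Oplus>\<^bsub>S\<^esub>i\<in>{..<N}. v i \<otimes>\<^bsub>S\<^esub> y [^]\<^bsub>S\<^esub> i) = \<zero>\<^bsub>S\<^esub>" "j < N"
 shows "v j = \<zero>\<^bsub>S\<^esub>"
proof (rule S.triangular_indep[OF B_subring mon_S _ mon_indep assms(1,2) order_refl assms(3)])
 fix i :: nat
 define c where "c j = add_pow Q (i choose j) ((\<ominus> t) [^] (i - j))" for j
 have cc: "c j \<in> carrier Q" for j by (simp add: c_def)
 define r where "r = (\<Oplus>\<^bsub>S\<^esub>j\<in>{..<i}. cst (c j) \<otimes>\<^bsub>S\<^esub> mon j)"
 have rk: "r k = (if k < i then c k else \<zero>)" for k unfolding r_def by (rule poly_mon[OF cc])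
 have "y [^]\<^bsub>S\<^esub> i = mon i \<oplus>\<^bsub>S\<^esub> r"
 proof
  fix k
  show "(y [^]\<^bsub>S\<^esub> i) k = (mon i \<oplus>\<^bsub>S\<^esub> r) k"
   using cc[of k] by (cases k i rule: linorder_cases) (simp_all add: y_pow_coeff S_add rk mon_def c_def binomial_eq_0)
 qed
 moreover have "S.combination B mon i r"
  unfolding S.combination_def r_def by (rule exI[of _ "\<lambda>j. cst (c j)"]) (use cst_B cc in auto)
 ultimately show "\<exists>r. S.combination B mon i r \<and> y [^]\<^bsub>S\<^esub> i = mon i \<oplus>\<^bsub>S\<^esub> r" by blast
qed

end

section \<open>Zero divisors among series with commuting coefficients\<close>

context skew_tower begin

text \<open>Choose r nonzero, commuting with all coefficients, and minimal under left divisibility.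
  If j0 and k0 are the first indices with r a_j0 and r b_k0 nonzero, then a b = 0 gives r a_j0 b_k0
  = 0. Minimality gives r = q r a_j0, whence r b_k0 = 0, a contradiction.\<close>

lemma semicentral_domain:
 assumes a: "fixed a" and b: "fixed b" and ab: "a \<otimes>\<^bsub>S\<^esub> b = \<zero>\<^bsub>S\<^esub>"
  and comm: "\<And>i j. a i \<otimes> a j = a j \<otimes> a i" "\<And>i j. b i \<otimes> b j = b j \<otimes> b i" "\<And>i j. a i \<otimes> b j = b j \<otimes> a i"
  and sa: "\<And>q. q \<in> carrier Q ==> \<exists>s\<in>carrier S. cst q \<otimes>\<^bsub>S\<^esub> a = a \<otimes>\<^bsub>S\<^esub> s"
  and sb: "\<And>q. q \<in> carrier Q ==> \<exists>s\<in>carrier S. cst q \<otimes>\<^bsub>S\<^esub> b = b \<otimes>\<^bsub>S\<^esub> s"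
 shows "a = \<zero>\<^bsub>S\<^esub> \<or> b = \<zero>\<^bsub>S\<^esub>"
proof (rule ccontr)
 assume "\<not> ?thesis"
 hence nz: "a \<noteq> \<zero>\<^bsub>S\<^esub>" "b \<noteq> \<zero>\<^bsub>S\<^esub>" by auto
 have aS: "a \<in> carrier S" and bS: "b \<in> carrier S" using a b by (auto intro: fixed_S)
 have ac: "a i \<in> carrier Q" and bc: "b i \<in> carrier Q" for i by (rule S_coeff[OF aS], rule S_coeff[OF bS])
 \<comment> \<open>The left annihilator of the coefficients of f is a two-sided ideal of the simple
   ring Q: if q kills f, then q r f = q f s = 0.\<close>
 have ann: "q = \<zero>" if q: "q \<in> carrier Q" and f: "f \<in> carrier S" "f \<noteq> \<zero>\<^bsub>S\<^esub>" and z: "\<And>k. q \<otimes> f k = \<zero>"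
  and sf: "\<And>r. r \<in> carrier Q ==> \<exists>s\<in>carrier S. cst r \<otimes>\<^bsub>S\<^esub> f = f \<otimes>\<^bsub>S\<^esub> s" for q f
 proof (rule ccontr)
  assume "q \<noteq> \<zero>"
  obtain n :: nat and l r where lr: "\<And>i. l i \<in> carrier Q" "\<And>i. r i \<in> carrier Q"
   "(\<Oplus>i\<in>{..<n}. l i \<otimes> q \<otimes> r i) = \<one>" by (rule simple_sum[OF q \<open>q \<noteq> \<zero>\<close>]) (rule that)
  have fc: "f k \<in> carrier Q" for k by (rule S_coeff[OF f(1)])
  have q0: "cst q \<otimes>\<^bsub>S\<^esub> f = \<zero>\<^bsub>S\<^esub>" unfolding cst_mult[OF q f(1)] smul_def using z by (simp add: S_zero)
  have t0: "l i \<otimes> q \<otimes> r i \<otimes> f k = \<zero>" for i k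
  proof -
   obtain s where s: "s \<in> carrier S" "cst (r i) \<otimes>\<^bsub>S\<^esub> f = f \<otimes>\<^bsub>S\<^esub> s" using sf[OF lr(2)] by blast
   have "cst q \<otimes>\<^bsub>S\<^esub> (cst (r i) \<otimes>\<^bsub>S\<^esub> f) = (cst q \<otimes>\<^bsub>S\<^esub> f) \<otimes>\<^bsub>S\<^esub> s"
    unfolding s(2) by (rule S.m_assoc[symmetric]) (use q f(1) s(1) in simp_all)
   also have "\<dots> = \<zero>\<^bsub>S\<^esub>" unfolding q0 by (rule S.l_null[OF s(1)])
   finally have e: "smul q (smul (r i) f) = \<zero>\<^bsub>S\<^esub>"
    unfolding cst_mult[OF lr(2) f(1)] cst_mult[OF q smul_S[OF lr(2) f(1)]] .
   have "q \<otimes> (r i \<otimes> f k) = smul q (smul (r i) f) k" by (simp only: smul_def)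
   also have "\<dots> = \<zero>" unfolding e by (simp add: S_zero)
   finally have "q \<otimes> (r i \<otimes> f k) = \<zero>" .
   thus ?thesis using lr(1)[of i] lr(2)[of i] q fc[of k] by (simp add: m_assoc)
  qed
  have "f k = \<zero>" for k
  proof -
   have "f k = (\<Oplus>i\<in>{..<n}. l i \<otimes> q \<otimes> r i) \<otimes> f k" unfolding lr(3) using fc[of k] by simp
   also have "\<dots> = (\<Oplus>i\<in>{..<n}. l i \<otimes> q \<otimes> r i \<otimes> f k)"
    by (rule finsum_ldistr) (use lr q fc in auto)
   also have "\<dots> = (\<Oplus>i\<in>{..<n}. \<zero>)" by (rule finsum_cong') (use t0 in auto)
   finally show ?thesis by simp
  qed
  thus False using f(2) by (auto simp: S_zero)
 qed
 \<comment> \<open>The admissible multipliers. As the coefficients commute with each other, W is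
   stable under multiplication by any of them, unless the product is 0.\<close>
 define W where "W = {r \<in> carrier Q. r \<noteq> \<zero> \<and> (\<forall>i. r \<otimes> a i = a i \<otimes> r) \<and> (\<forall>i. r \<otimes> b i = b i \<otimes> r)}"
 have "\<one> \<in> W" using ac bc one_not_zero by (simp add: W_def)
 hence "W \<noteq> {}" by blast
 moreover have "W \<subseteq> carrier Q" by (auto simp: W_def)
 ultimately obtain r where r: "r \<in> W"
  and rmin: "\<forall>r'\<in>W. (\<exists>q\<in>carrier Q. r' = q \<otimes> r) \<longrightarrow> (\<exists>q\<in>carrier Q. r = q \<otimes> r')" using dcc by blast
 have rc: "r \<in> carrier Q" "r \<noteq> \<zero>" "\<And>i. r \<otimes> a i = a i \<otimes> r" "\<And>i. r \<otimes> b i = b i \<otimes> r" using r by (auto simp: W_def)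
 have exa: "\<exists>j. r \<otimes> a j \<noteq> \<zero>" using ann[OF rc(1) aS nz(1) _ sa] rc(2) by blast
 have exb: "\<exists>j. r \<otimes> b j \<noteq> \<zero>" using ann[OF rc(1) bS nz(2) _ sb] rc(2) by blast
 define j0 where "j0 = (LEAST j. r \<otimes> a j \<noteq> \<zero>)"
 define k0 where "k0 = (LEAST j. r \<otimes> b j \<noteq> \<zero>)"
 have j0: "r \<otimes> a j0 \<noteq> \<zero>" "\<And>i. i < j0 ==> r \<otimes> a i = \<zero>"
  unfolding j0_def using LeastI_ex[OF exa] not_less_Least by blast+
 have k0: "r \<otimes> b k0 \<noteq> \<zero>" "\<And>i. i < k0 ==> r \<otimes> b i = \<zero>"
  unfolding k0_def using LeastI_ex[OF exb] not_less_Least by blast+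
 have sum0: "(\<Oplus>i\<in>{..<Suc (j0 + k0)}. a i \<otimes> b (j0 + k0 - i)) = \<zero>"
  using mult_fixed[OF aS b, of "j0 + k0"] ab by (simp add: S_zero)
 \<comment> \<open>For i < j0 the factor r a_i vanishes; for i > j0, r is moved past a_i and kills
   b_(j0+k0-i).\<close>
 have "\<zero> = r \<otimes> (\<Oplus>i\<in>{..<Suc (j0 + k0)}. a i \<otimes> b (j0 + k0 - i))" unfolding sum0 using rc(1) by simp
 also have "\<dots> = (\<Oplus>i\<in>{..<Suc (j0 + k0)}. r \<otimes> (a i \<otimes> b (j0 + k0 - i)))"
  by (rule finsum_rdistr) (use rc(1) ac bc in auto)
 also have "\<dots> = (\<Oplus>i\<in>{..<Suc (j0 + k0)}. if j0 = i then r \<otimes> a j0 \<otimes> b k0 else \<zero>)"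
 proof (rule finsum_cong')
  show "(\<lambda>i. if j0 = i then r \<otimes> a j0 \<otimes> b k0 else \<zero>) \<in> {..<Suc (j0 + k0)} \<rightarrow> carrier Q"
   using rc(1) ac[of j0] bc[of k0] by auto
  fix i assume i: "i \<in> {..<Suc (j0 + k0)}"
  have e: "r \<otimes> (a i \<otimes> b (j0 + k0 - i)) = r \<otimes> a i \<otimes> b (j0 + k0 - i)"
   using rc(1) ac[of i] bc[of "j0 + k0 - i"] by (simp add: m_assoc)
  consider "i < j0" | "i = j0" | "i > j0" by linarith
  thus "r \<otimes> (a i \<otimes> b (j0 + k0 - i)) = (if j0 = i then r \<otimes> a j0 \<otimes> b k0 else \<zero>)"
  proof cases
   case 1
   thus ?thesis unfolding e using j0(2)[OF 1] bc[of "j0 + k0 - i"] by simp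
  next
   case 2
   thus ?thesis unfolding e by simp
  next
   case 3
   have "r \<otimes> a i \<otimes> b (j0 + k0 - i) = a i \<otimes> (r \<otimes> b (j0 + k0 - i))"
    unfolding rc(3) using rc(1) ac[of i] bc[of "j0 + k0 - i"] by (simp add: m_assoc)
   also have "r \<otimes> b (j0 + k0 - i) = \<zero>" by (rule k0(2)) (use 3 i in auto)
   finally show ?thesis unfolding e using 3 ac[of i] by simp
  qed
 qed simp
 also have "\<dots> = r \<otimes> a j0 \<otimes> b k0"
  using finsum_singleton[of j0 "{..<Suc (j0 + k0)}" "\<lambda>_. r \<otimes> a j0 \<otimes> b k0"] rc(1) ac[of j0] bc[of k0] by simp
 finally have z: "r \<otimes> a j0 \<otimes> b k0 = \<zero>" by simp
 \<comment> \<open>This is a left multiple of r, because r commutes with a_j0; so minimality of r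
   applies to it.\<close>
 have "r \<otimes> a j0 \<in> W"
 proof -
  have "r \<otimes> a j0 \<otimes> a i = a i \<otimes> (r \<otimes> a j0)" for i
   using rc(1) ac[of j0] ac[of i] rc(3)[of i] comm(1)[of j0 i] by (metis m_assoc)
  moreover have "r \<otimes> a j0 \<otimes> b i = b i \<otimes> (r \<otimes> a j0)" for i
   using rc(1) ac[of j0] bc[of i] rc(4)[of i] comm(3)[of j0 i] by (metis m_assoc)
  ultimately show ?thesis using rc(1) ac[of j0] j0(1) by (simp add: W_def)
 qed
 moreover have "\<exists>q\<in>carrier Q. r \<otimes> a j0 = q \<otimes> r" using rc(3)[of j0] ac[of j0] by blast
 ultimately obtain q where q: "q \<in> carrier Q" "r = q \<otimes> (r \<otimes> a j0)" using rmin by blast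
 have "r \<otimes> b k0 = q \<otimes> (r \<otimes> a j0) \<otimes> b k0" using q(2) by simp
 also have "\<dots> = q \<otimes> (r \<otimes> a j0 \<otimes> b k0)" using q(1) rc(1) ac[of j0] bc[of k0] by (simp add: m_assoc)
 finally show False using z q(1) k0(1) by simp
qed

lemma fixed_map_pow: assumes "fixed s" shows "(\<lambda>k. (\<sigma> ^^ n) (s k)) = s"
 by (induction n) (simp_all add: fun_eq_iff fixed_\<sigma>[OF assms])

text \<open>Numerators of central fractions satisfy the hypothesis. Taking s = y gives invariance of
  the coefficients under \<sigma>, since y is regular; then s = x shows that \<delta> kills
  them.\<close>

lemma semicentral_fixed:
 assumes a: "a \<in> carrier S" and h: "\<forall>s\<in>carrier S. a \<otimes>\<^bsub>S\<^esub> s = (\<lambda>k. (\<sigma> ^^ n) (s k)) \<otimes>\<^bsub>S\<^esub> a"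
 shows "fixed a" "\<And>c i. c \<in> carrier Q ==> \<sigma> c = c ==> \<delta> c = \<zero> ==> a i \<otimes> c = c \<otimes> a i"
  "\<And>q. q \<in> carrier Q ==> \<exists>s\<in>carrier S. cst q \<otimes>\<^bsub>S\<^esub> a = a \<otimes>\<^bsub>S\<^esub> s"
proof -
 have ac: "a i \<in> carrier Q" for i by (rule S_coeff[OF a])
 have comm: "a \<otimes>\<^bsub>S\<^esub> s = s \<otimes>\<^bsub>S\<^esub> a" if "fixed s" for s
  using bspec[OF h fixed_S[OF that]] unfolding fixed_map_pow[OF that] .
 have "(\<lambda>k. \<sigma> (a k)) \<otimes>\<^bsub>S\<^esub> y [^]\<^bsub>S\<^esub> (1::nat) = a \<otimes>\<^bsub>S\<^esub> y [^]\<^bsub>S\<^esub> (1::nat)"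
  using comm[OF fixed_y] y_map[OF a] by (simp add: S.nat_pow_eone)
 hence "(\<lambda>k. \<sigma> (a k)) = a" by (rule y.rcancel) (use a map_S(1)[OF a] in simp_all)
 hence \<sigma>a: "\<sigma> (a k) = a k" for k by (rule fun_cong)
 have xa: "xi a = (\<lambda>k. if k < 1 then \<zero> else a (k - 1))"
  using comm[OF mon_fixed[of 1]] unfolding var_mult[OF a] S_mult[OF a mon_S] pr_mon_right[OF a] by simp
 have \<delta>a: "\<delta> (a k) = \<zero>" for k
 proof (cases k)
  case 0
  thus ?thesis using fun_cong[OF xa, of 0] by (simp add: xi_0)
 next
  case (Suc j)
  have "a j \<oplus> \<delta> (a (Suc j)) = a j" using fun_cong[OF xa, of "Suc j"] by (simp add: xi_Suc \<sigma>a)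
  thus ?thesis using ac[of j] ac[of "Suc j"] Suc by (simp add: add.r_cancel_one)
 qed
 show "fixed a" using a \<sigma>a \<delta>a by (simp add: fixed_def)
 show "a i \<otimes> c = c \<otimes> a i" if c: "c \<in> carrier Q" "\<sigma> c = c" "\<delta> c = \<zero>" for c i
  using fun_cong[OF comm[OF cst_fixed[OF c]], of i] mult_cst[OF a c, of i]
  unfolding cst_mult[OF c(1) a] by (simp add: smul_def)
 show "\<exists>s\<in>carrier S. cst q \<otimes>\<^bsub>S\<^esub> a = a \<otimes>\<^bsub>S\<^esub> s" if q: "q \<in> carrier Q" for q
 proof -
  obtain q' where q': "q' \<in> carrier Q" "q = (\<sigma> ^^ n) q'"
   using \<sigma>_pow_bij[of n] q unfolding bij_betw_def by blast
  have "(\<sigma> ^^ n) \<zero> = \<zero>" by (induction n) simp_all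
  hence "(\<lambda>k. (\<sigma> ^^ n) (cst q' k)) = cst q" using q'(2) by (auto simp: cst_eq)
  thus ?thesis using bspec[OF h cst_S[OF q'(1)]] q'(1) by (intro bexI[of _ "cst q'"]) auto
 qed
qed

text \<open>The substitution sends X - T, the element \<open>y\<close> of the lower ring, to z -
  T.\<close>

lemma y_N_iota: "y [^]\<^bsub>S\<^esub> N = Z.iota A.y"
proof -
 have Ay: "A.y \<in> carrier S" using A.y_S by (simp add: Z.AS_carrier)
 have "z = Z.iota (mon 1)" using Z.iota_mon[of 1] by (simp add: S.nat_pow_eone)
 also have "\<dots> = Z.iota (A.y \<oplus>\<^bsub>A.S\<^esub> cst T)" using A.var_y by simp
 also have "\<dots> = Z.iota A.y \<oplus>\<^bsub>S\<^esub> Z.iota (cst T)"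
  by (rule ring_hom_add[OF Z.iota_hom]) (use Ay in \<open>simp_all add: Z.AS_carrier\<close>)
 also have "Z.iota (cst T) = cst T" by (rule Z.iota_cst) simp
 finally have "y [^]\<^bsub>S\<^esub> N \<oplus>\<^bsub>S\<^esub> cst T = Z.iota A.y \<oplus>\<^bsub>S\<^esub> cst T" unfolding z_def .
 thus ?thesis using Ay by (simp add: S.add.r_cancel)
qed

lemma Apow_S: "A.y [^]\<^bsub>A.S\<^esub> (n::nat) \<in> carrier S"
 using A.S.nat_pow_closed[OF A.y_S] by (simp add: Z.AS_carrier)

lemma y_pow_iota: "y [^]\<^bsub>S\<^esub> (N * n) = Z.iota (A.y [^]\<^bsub>A.S\<^esub> n)"
proof (induction n)
 case 0
 have "Z.iota \<one>\<^bsub>A.S\<^esub> = \<one>\<^bsub>S\<^esub>" by (rule ring_hom_one[OF Z.iota_hom])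
 thus ?case by simp
next
 case (Suc n)
 have Ay: "A.y \<in> carrier S" using A.y_S by (simp add: Z.AS_carrier)
 have "y [^]\<^bsub>S\<^esub> (N * Suc n) = y [^]\<^bsub>S\<^esub> (N * n) \<otimes>\<^bsub>S\<^esub> y [^]\<^bsub>S\<^esub> N"
  by (simp add: S.nat_pow_mult add.commute)
 also have "\<dots> = Z.iota (A.y [^]\<^bsub>A.S\<^esub> n \<otimes>\<^bsub>A.S\<^esub> A.y)"
  unfolding Suc y_N_iota by (rule Z.iota_mult[symmetric, OF Apow_S Ay])
 finally show ?case by simp
qed

lemma B_carrier: "b \<in> B ==> b \<in> carrier S" using subringE(1)[OF B_subring] by auto

lemma y_pow_B: "y [^]\<^bsub>S\<^esub> (N * n) \<in> B" unfolding y_pow_iota B_def by (rule imageI[OF Apow_S])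

text \<open>Conjugation by X - T in the lower ring is \<Sigma> on coefficients; the substitution
  carries this over to y^N and B.\<close>

lemma B_move: assumes "b \<in> B" shows "\<exists>b'\<in>B. y [^]\<^bsub>S\<^esub> (N * n) \<otimes>\<^bsub>S\<^esub> b = b' \<otimes>\<^bsub>S\<^esub> y [^]\<^bsub>S\<^esub> (N * n)"
proof -
 obtain c where c: "c \<in> carrier S" "b = Z.iota c" using assms unfolding B_def by blast
 have cA: "c \<in> carrier A.S" using c by (simp add: Z.AS_carrier)
 define d where "d = (\<lambda>k. (Sg ^^ n) (c k))"
 have d: "d \<in> carrier S" using A.\<sigma>_funpow_map_S[OF cA, of n] by (simp add: d_def Z.AS_carrier)
 have "Z.iota (A.y [^]\<^bsub>A.S\<^esub> n) \<otimes>\<^bsub>S\<^esub> Z.iota c = Z.iota d \<otimes>\<^bsub>S\<^esub> Z.iota (A.y [^]\<^bsub>A.S\<^esub> n)"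
  using A.y_pow_map[OF cA, of n] Z.iota_mult[OF Apow_S c(1), of n] Z.iota_mult[OF d Apow_S, of n]
  by (simp add: d_def)
 thus ?thesis unfolding y_pow_iota c(2) using d by (intro bexI[of _ "Z.iota d"]) (auto simp: B_def)
qed

text \<open>The powers of z have coefficients fixed by \<sigma>, so only the coefficients of c are
  affected.\<close>

lemma \<sigma>_iota: assumes c: "c \<in> carrier S" shows "(\<lambda>k. \<sigma> (Z.iota c k)) = Z.iota (\<lambda>k. \<sigma> (c k))"
proof
 fix n
 have cc: "c k \<in> carrier Q" for k by (rule S_coeff[OF c])
 have 1: "hsum (\<lambda>k. \<sigma> (c k \<otimes> zp k n)) (\<sigma> (Z.iota c n))"
  by (rule sums_amap[OF Z.iota_hsum[OF c] \<sigma>_amap, where d = "- C"]) (use \<sigma>_G in simp)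
 have 2: "hsum (\<lambda>k. \<sigma> (c k) \<otimes> zp k n) (Z.iota (\<lambda>k. \<sigma> (c k)) n)"
  by (rule Z.iota_hsum[OF map_S(1)[OF c]])
 have "\<sigma> (c k \<otimes> zp k n) = \<sigma> (c k) \<otimes> zp k n" for k
  using cc[of k] zp_c[of k n] by (simp add: \<sigma>_mult fixed_\<sigma>[OF zp_fixed])
 hence "(\<lambda>k. \<sigma> (c k \<otimes> zp k n)) = (\<lambda>k. \<sigma> (c k) \<otimes> zp k n)" by simp
 with 1 2 show "\<sigma> (Z.iota c n) = Z.iota (\<lambda>k. \<sigma> (c k)) n" using sums_unique by metis
qed

lemma y_B: assumes "b \<in> B" shows "\<exists>b'\<in>B. y \<otimes>\<^bsub>S\<^esub> b = b' \<otimes>\<^bsub>S\<^esub> y" "\<exists>b'\<in>B. y \<otimes>\<^bsub>S\<^esub> b' = b \<otimes>\<^bsub>S\<^esub> y"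
proof -
 obtain c where c: "c \<in> carrier S" "b = Z.iota c" using assms unfolding B_def by blast
 have "y \<otimes>\<^bsub>S\<^esub> b = Z.iota (\<lambda>k. \<sigma> (c k)) \<otimes>\<^bsub>S\<^esub> y"
  unfolding c(2) y_map[OF Z.iota_S[OF c(1)]] \<sigma>_iota[OF c(1)] ..
 thus "\<exists>b'\<in>B. y \<otimes>\<^bsub>S\<^esub> b = b' \<otimes>\<^bsub>S\<^esub> y" using map_S(1)[OF c(1)] by (auto simp: B_def)
 obtain d where d: "d \<in> carrier S" "c = (\<lambda>k. \<sigma> (d k))" by (rule \<sigma>_inv_map[OF c(1)])
 have "y \<otimes>\<^bsub>S\<^esub> Z.iota d = b \<otimes>\<^bsub>S\<^esub> y"
  unfolding c(2) y_map[OF Z.iota_S[OF d(1)]] \<sigma>_iota[OF d(1)] d(2) ..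
 thus "\<exists>b'\<in>B. y \<otimes>\<^bsub>S\<^esub> b' = b \<otimes>\<^bsub>S\<^esub> y" using d(1) by (auto simp: B_def)
qed

section \<open>The localisation at y as a ring graded by a cyclic group\<close>

context
 fixes L :: "('b, 'n) ring_scheme" and \<kappa> :: "(nat \<Rightarrow> 'a) \<Rightarrow> 'b"
 assumes loc: "is_localisation S L y \<kappa>"
begin

interpretation loc: is_localisation S L y \<kappa> by (rule loc)

text \<open>The localisation of B at y^N, realised inside L.\<close>

definition BL where "BL = {l \<in> carrier L. \<exists>n. \<exists>b\<in>B. loc.Yp (N * n) \<otimes>\<^bsub>L\<^esub> l = \<kappa> b}"

lemma BL_I: "l \<in> carrier L ==> b \<in> B ==> loc.Yp (N * n) \<otimes>\<^bsub>L\<^esub> l = \<kappa> b ==> l \<in> BL"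
 by (auto simp: BL_def)

lemma BL_raise: assumes "l \<in> carrier L" "b \<in> B" "loc.Yp (N * n) \<otimes>\<^bsub>L\<^esub> l = \<kappa> b"
 shows "\<exists>b'\<in>B. loc.Yp (N * (k + n)) \<otimes>\<^bsub>L\<^esub> l = \<kappa> b'"
proof -
 have "loc.Yp (N * k + N * n) \<otimes>\<^bsub>L\<^esub> l = \<kappa> (y [^]\<^bsub>S\<^esub> (N * k) \<otimes>\<^bsub>S\<^esub> b)"
  by (rule loc.frac_raise[OF assms(3,1) B_carrier[OF assms(2)]])
 thus ?thesis using subringE(6)[OF B_subring y_pow_B assms(2)] by (auto simp: distrib_left)
qed

lemma \<kappa>_BL: assumes "b \<in> B" shows "\<kappa> b \<in> BL"
 by (rule BL_I[OF _ assms, of _ 0]) (use B_carrier[OF assms] in simp_all)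

lemma BL_subring: "subring BL L"
proof (rule loc.L.subringI)
 show "BL \<subseteq> carrier L" by (auto simp: BL_def)
 show "\<one>\<^bsub>L\<^esub> \<in> BL" using \<kappa>_BL[OF subringE(3)[OF B_subring]] by (simp add: loc.\<kappa>_one)
 fix l assume "l \<in> BL"
 then obtain n b where l: "l \<in> carrier L" "b \<in> B" "loc.Yp (N * n) \<otimes>\<^bsub>L\<^esub> l = \<kappa> b" by (auto simp: BL_def)
 have bc: "b \<in> carrier S" by (rule B_carrier[OF l(2)])
 have "\<kappa> (\<ominus>\<^bsub>S\<^esub> b) = \<ominus>\<^bsub>L\<^esub> \<kappa> b"
 proof (rule loc.L.minus_equality[symmetric])
  show "\<kappa> (\<ominus>\<^bsub>S\<^esub> b) \<oplus>\<^bsub>L\<^esub> \<kappa> b = \<zero>\<^bsub>L\<^esub>"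
   using loc.\<kappa>_add[of "\<ominus>\<^bsub>S\<^esub> b" b] bc by (simp add: S.l_neg loc.\<kappa>_zero)
 qed (use bc in simp_all)
 hence "loc.Yp (N * n) \<otimes>\<^bsub>L\<^esub> (\<ominus>\<^bsub>L\<^esub> l) = \<kappa> (\<ominus>\<^bsub>S\<^esub> b)" using l(1,3) by (simp add: loc.L.r_minus)
 thus "\<ominus>\<^bsub>L\<^esub> l \<in> BL" by (rule BL_I[rotated 2]) (use l subringE(5)[OF B_subring] in auto)
 fix l' assume "l' \<in> BL"
 then obtain k b' where l': "l' \<in> carrier L" "b' \<in> B" "loc.Yp (N * k) \<otimes>\<^bsub>L\<^esub> l' = \<kappa> b'" by (auto simp: BL_def)
 have bc': "b' \<in> carrier S" by (rule B_carrier[OF l'(2)])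
 have "loc.Yp (N * (k + n)) \<otimes>\<^bsub>L\<^esub> (l \<oplus>\<^bsub>L\<^esub> l') =
   \<kappa> (y [^]\<^bsub>S\<^esub> (N * k) \<otimes>\<^bsub>S\<^esub> b \<oplus>\<^bsub>S\<^esub> y [^]\<^bsub>S\<^esub> (N * n) \<otimes>\<^bsub>S\<^esub> b')"
  using loc.frac_add[OF l(3,1) bc l'(3,1) bc'] by (simp add: distrib_left)
 thus "l \<oplus>\<^bsub>L\<^esub> l' \<in> BL"
  by (rule BL_I[rotated 2]) (use l(1,2) l'(1,2) y_pow_B subringE(6,7)[OF B_subring] in auto)
 obtain b1 where b1: "b1 \<in> B" "y [^]\<^bsub>S\<^esub> (N * k) \<otimes>\<^bsub>S\<^esub> b = b1 \<otimes>\<^bsub>S\<^esub> y [^]\<^bsub>S\<^esub> (N * k)"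
  using B_move[OF l(2)] by blast
 have "loc.Yp (N * (k + n)) \<otimes>\<^bsub>L\<^esub> (l \<otimes>\<^bsub>L\<^esub> l') = \<kappa> (b1 \<otimes>\<^bsub>S\<^esub> b')"
  using loc.frac_mult[OF l(3,1) bc l'(3,1) bc' B_carrier[OF b1(1)] b1(2)] by (simp add: distrib_left)
 thus "l \<otimes>\<^bsub>L\<^esub> l' \<in> BL"
  by (rule BL_I[rotated 2]) (use l(1,2) l'(1,2) b1 subringE(6)[OF B_subring] in auto)
qed

lemma BL_conj: assumes l: "l \<in> BL"
 shows "\<kappa> y \<otimes>\<^bsub>L\<^esub> l \<otimes>\<^bsub>L\<^esub> inv\<^bsub>L\<^esub> (\<kappa> y) \<in> BL" "inv\<^bsub>L\<^esub> (\<kappa> y) \<otimes>\<^bsub>L\<^esub> l \<otimes>\<^bsub>L\<^esub> \<kappa> y \<in> BL"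
proof -
 obtain n b where l: "l \<in> carrier L" "b \<in> B" "loc.Yp (N * n) \<otimes>\<^bsub>L\<^esub> l = \<kappa> b" using assms by (auto simp: BL_def)
 have bc: "b \<in> carrier S" by (rule B_carrier[OF l(2)])
 let ?k = "\<kappa> y" and ?i = "inv\<^bsub>L\<^esub> (\<kappa> y)" and ?Y = "loc.Yp (N * n)"
 have k: "?k \<in> carrier L" and i: "?i \<in> carrier L" using loc.\<kappa>_y by auto
 have ki: "?k \<otimes>\<^bsub>L\<^esub> ?i = \<one>\<^bsub>L\<^esub>" "?i \<otimes>\<^bsub>L\<^esub> ?k = \<one>\<^bsub>L\<^esub>" using loc.\<kappa>_y by auto
 have Yk: "?Y \<otimes>\<^bsub>L\<^esub> ?k = ?k \<otimes>\<^bsub>L\<^esub> ?Y" using loc.Yp_comm[of "N * n" 1] k by (simp add: loc.L.nat_pow_eone)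
 have Yi: "?Y \<otimes>\<^bsub>L\<^esub> ?i = ?i \<otimes>\<^bsub>L\<^esub> ?Y"
 proof -
  have "?i \<otimes>\<^bsub>L\<^esub> (?Y \<otimes>\<^bsub>L\<^esub> ?k) \<otimes>\<^bsub>L\<^esub> ?i = ?i \<otimes>\<^bsub>L\<^esub> ?Y"
   using k i ki by (simp add: loc.L.m_assoc)
  moreover have "?i \<otimes>\<^bsub>L\<^esub> (?k \<otimes>\<^bsub>L\<^esub> ?Y) \<otimes>\<^bsub>L\<^esub> ?i = ?Y \<otimes>\<^bsub>L\<^esub> ?i"
   using k i ki by (simp add: loc.L.m_assoc[symmetric])
  ultimately show ?thesis using Yk by simp
 qed
 obtain b1 where b1: "b1 \<in> B" "y \<otimes>\<^bsub>S\<^esub> b = b1 \<otimes>\<^bsub>S\<^esub> y" using y_B(1)[OF l(2)] by blast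
 have "?Y \<otimes>\<^bsub>L\<^esub> (?k \<otimes>\<^bsub>L\<^esub> l \<otimes>\<^bsub>L\<^esub> ?i) = (?Y \<otimes>\<^bsub>L\<^esub> ?k) \<otimes>\<^bsub>L\<^esub> l \<otimes>\<^bsub>L\<^esub> ?i"
  using l(1) k i by (simp add: loc.L.m_assoc)
 also have "\<dots> = ?k \<otimes>\<^bsub>L\<^esub> (?Y \<otimes>\<^bsub>L\<^esub> l) \<otimes>\<^bsub>L\<^esub> ?i" unfolding Yk using l(1) k i by (simp add: loc.L.m_assoc)
 also have "\<dots> = \<kappa> (b1 \<otimes>\<^bsub>S\<^esub> y) \<otimes>\<^bsub>L\<^esub> ?i" unfolding l(3) b1(2)[symmetric] using bc by (simp add: loc.\<kappa>_mult)
 also have "\<dots> = \<kappa> b1" using B_carrier[OF b1(1)] k i ki by (simp add: loc.\<kappa>_mult loc.L.m_assoc)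
 finally show "?k \<otimes>\<^bsub>L\<^esub> l \<otimes>\<^bsub>L\<^esub> ?i \<in> BL" by (rule BL_I[rotated 2]) (use l(1) k i b1(1) in auto)
 obtain b2 where b2: "b2 \<in> B" "y \<otimes>\<^bsub>S\<^esub> b2 = b \<otimes>\<^bsub>S\<^esub> y" using y_B(2)[OF l(2)] by blast
 have "?Y \<otimes>\<^bsub>L\<^esub> (?i \<otimes>\<^bsub>L\<^esub> l \<otimes>\<^bsub>L\<^esub> ?k) = (?Y \<otimes>\<^bsub>L\<^esub> ?i) \<otimes>\<^bsub>L\<^esub> l \<otimes>\<^bsub>L\<^esub> ?k"
  using l(1) k i by (simp add: loc.L.m_assoc)
 also have "\<dots> = ?i \<otimes>\<^bsub>L\<^esub> ((?Y \<otimes>\<^bsub>L\<^esub> l) \<otimes>\<^bsub>L\<^esub> ?k)" unfolding Yi using l(1) k i by (simp add: loc.L.m_assoc)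
 also have "(?Y \<otimes>\<^bsub>L\<^esub> l) \<otimes>\<^bsub>L\<^esub> ?k = ?k \<otimes>\<^bsub>L\<^esub> \<kappa> b2"
  unfolding l(3) using bc B_carrier[OF b2(1)] loc.\<kappa>_mult[of b y] loc.\<kappa>_mult[of y b2] b2(2) by simp
 also have "?i \<otimes>\<^bsub>L\<^esub> (?k \<otimes>\<^bsub>L\<^esub> \<kappa> b2) = \<kappa> b2"
  using B_carrier[OF b2(1)] k i ki by (simp add: loc.L.m_assoc[symmetric])
 finally show "?i \<otimes>\<^bsub>L\<^esub> l \<otimes>\<^bsub>L\<^esub> ?k \<in> BL" by (rule BL_I[rotated 2]) (use l(1) k i b2(1) in auto)
qed

lemma \<kappa>_finsum: "(\<And>i. f i \<in> carrier S) ==> \<kappa> (\<Oplus>\<^bsub>S\<^esub>i\<in>{..<n::nat}. f i) = (\<Oplus>\<^bsub>L\<^esub>i\<in>{..<n}. \<kappa> (f i))"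
proof (induction n)
 case (Suc n)
 show ?case
  unfolding S.finsum_lessThan_Suc[OF Suc.prems] loc.L.finsum_lessThan_Suc[of "\<lambda>i. \<kappa> (f i)", OF loc.\<kappa>_c[OF Suc.prems]]
  using Suc by (subst loc.\<kappa>_add) (auto intro!: S.finsum_closed)
qed (simp add: loc.\<kappa>_zero)

lemma Yp_finsum: assumes "\<And>i. v i \<in> carrier L" "\<And>i. i < n ==> loc.Yp M \<otimes>\<^bsub>L\<^esub> v i = \<kappa> (b i)" "\<And>i. b i \<in> carrier S"
 shows "loc.Yp M \<otimes>\<^bsub>L\<^esub> (\<Oplus>\<^bsub>L\<^esub>i\<in>{..<n}. v i \<otimes>\<^bsub>L\<^esub> loc.Yp i) = \<kappa> (\<Oplus>\<^bsub>S\<^esub>i\<in>{..<n}. b i \<otimes>\<^bsub>S\<^esub> y [^]\<^bsub>S\<^esub> i)"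
proof -
 have "loc.Yp M \<otimes>\<^bsub>L\<^esub> (\<Oplus>\<^bsub>L\<^esub>i\<in>{..<n}. v i \<otimes>\<^bsub>L\<^esub> loc.Yp i) = (\<Oplus>\<^bsub>L\<^esub>i\<in>{..<n}. loc.Yp M \<otimes>\<^bsub>L\<^esub> (v i \<otimes>\<^bsub>L\<^esub> loc.Yp i))"
  by (rule loc.L.finsum_rdistr) (use assms(1) in auto)
 also have "\<dots> = (\<Oplus>\<^bsub>L\<^esub>i\<in>{..<n}. \<kappa> (b i \<otimes>\<^bsub>S\<^esub> y [^]\<^bsub>S\<^esub> i))"
 proof (rule loc.L.finsum_cong')
  fix i assume "i \<in> {..<n}"
  hence i: "i < n" by simp
  show "loc.Yp M \<otimes>\<^bsub>L\<^esub> (v i \<otimes>\<^bsub>L\<^esub> loc.Yp i) = \<kappa> (b i \<otimes>\<^bsub>S\<^esub> y [^]\<^bsub>S\<^esub> i)"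
   unfolding loc.\<kappa>_mult[OF assms(3) loc.yp_c] loc.\<kappa>_pow[OF y_S] assms(2)[OF i, symmetric]
   by (rule loc.L.m_assoc[symmetric]) (use assms(1) in auto)
 qed (use assms(3) in auto)
 also have "\<dots> = \<kappa> (\<Oplus>\<^bsub>S\<^esub>i\<in>{..<n}. b i \<otimes>\<^bsub>S\<^esub> y [^]\<^bsub>S\<^esub> i)"
  by (rule \<kappa>_finsum[symmetric]) (use assms(3) in simp)
 finally show ?thesis .
qed

lemma BL_gen: assumes l: "l \<in> carrier L"
 shows "\<exists>b. (\<forall>i. b i \<in> BL) \<and> l = (\<Oplus>\<^bsub>L\<^esub>i\<in>{..<N}. b i \<otimes>\<^bsub>L\<^esub> loc.Yp i)"
proof -
 obtain n :: nat and s where s: "s \<in> carrier S" "loc.Yp n \<otimes>\<^bsub>L\<^esub> l = \<kappa> s" using loc.frac[OF l] by blast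
 \<comment> \<open>The denominator is raised to a power of y^N, so that the coefficients become
   fractions over B.\<close>
 define M where "M = N * n"
 have "n \<le> M" using N_pos by (simp add: M_def)
 define s' where "s' = y [^]\<^bsub>S\<^esub> (M - n) \<otimes>\<^bsub>S\<^esub> s"
 have s': "s' \<in> carrier S" "loc.Yp M \<otimes>\<^bsub>L\<^esub> l = \<kappa> s'"
  using loc.frac_raise[OF s(2) l s(1), of "M - n"] s(1) \<open>n \<le> M\<close> by (simp_all add: s'_def)
 obtain b where b: "\<forall>i. b i \<in> B" "s' = (\<Oplus>\<^bsub>S\<^esub>i\<in>{..<N}. b i \<otimes>\<^bsub>S\<^esub> y [^]\<^bsub>S\<^esub> i)"
  using y_gen[OF s'(1)] unfolding S.combination_def by blast
 have bc: "b i \<in> carrier S" for i using b(1) B_carrier by blast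
 have i: "inv\<^bsub>L\<^esub> (loc.Yp M) \<in> carrier L" using loc.Yp_U by simp
 define v where "v k = inv\<^bsub>L\<^esub> (loc.Yp M) \<otimes>\<^bsub>L\<^esub> \<kappa> (b k)" for k
 have vc: "v k \<in> carrier L" for k using i bc by (simp add: v_def)
 have Yv: "loc.Yp M \<otimes>\<^bsub>L\<^esub> v k = \<kappa> (b k)" for k
  unfolding v_def using loc.Yp_U[of M] i bc[of k] loc.L.m_assoc[OF loc.Yp_c i loc.\<kappa>_c[OF bc[of k]], of M, symmetric] by simp
 have "loc.Yp M \<otimes>\<^bsub>L\<^esub> (\<Oplus>\<^bsub>L\<^esub>i\<in>{..<N}. v i \<otimes>\<^bsub>L\<^esub> loc.Yp i) = loc.Yp M \<otimes>\<^bsub>L\<^esub> l"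
  unfolding s'(2) b(2) by (rule Yp_finsum[OF vc Yv bc])
 hence "(\<Oplus>\<^bsub>L\<^esub>i\<in>{..<N}. v i \<otimes>\<^bsub>L\<^esub> loc.Yp i) = l"
  by (rule loc.Yp_cancel) (use l vc in \<open>auto intro!: loc.L.finsum_closed\<close>)
 moreover have "v k \<in> BL" for k by (rule BL_I[OF vc, of "b k" n]) (use b(1) Yv in \<open>auto simp: M_def\<close>)
 ultimately show ?thesis by blast
qed

lemma BL_indep: assumes v: "\<And>i. v i \<in> BL" "(\<Oplus>\<^bsub>L\<^esub>i\<in>{..<N}. v i \<otimes>\<^bsub>L\<^esub> loc.Yp i) = \<zero>\<^bsub>L\<^esub>" "j < N"
 shows "v j = \<zero>\<^bsub>L\<^esub>"
proof -
 have vc: "v i \<in> carrier L" for i using v(1) by (auto simp: BL_def)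
 \<comment> \<open>A common denominator for finitely many fractions.\<close>
 have "\<exists>n. \<forall>i<k. \<exists>b\<in>B. loc.Yp (N * n) \<otimes>\<^bsub>L\<^esub> v i = \<kappa> b" for k
 proof (induction k)
  case (Suc k)
  then obtain n where n: "\<And>i. i < k ==> \<exists>b\<in>B. loc.Yp (N * n) \<otimes>\<^bsub>L\<^esub> v i = \<kappa> b" by blast
  obtain n' b' where n': "b' \<in> B" "loc.Yp (N * n') \<otimes>\<^bsub>L\<^esub> v k = \<kappa> b'" using v(1)[of k] by (auto simp: BL_def)
  have "\<exists>b\<in>B. loc.Yp (N * (n' + n)) \<otimes>\<^bsub>L\<^esub> v i = \<kappa> b" if "i < Suc k" for i
  proof (cases "i = k")
   case True
   show ?thesis using BL_raise[OF vc n', of n] True by (simp add: add.commute)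
  next
   case False
   then obtain b where b: "b \<in> B" "loc.Yp (N * n) \<otimes>\<^bsub>L\<^esub> v i = \<kappa> b" using n[of i] \<open>i < Suc k\<close> by auto
   show ?thesis by (rule BL_raise[OF vc b])
  qed
  thus ?case by blast
 qed simp
 then obtain n where n: "\<forall>i<N. \<exists>b\<in>B. loc.Yp (N * n) \<otimes>\<^bsub>L\<^esub> v i = \<kappa> b" by blast
 have "\<forall>i. \<exists>b. b \<in> B \<and> (i < N \<longrightarrow> loc.Yp (N * n) \<otimes>\<^bsub>L\<^esub> v i = \<kappa> b)"
  using n subringE(2)[OF B_subring] by blast
 from choice[OF this] obtain b where b: "\<And>i. b i \<in> B" "\<And>i. i < N ==> loc.Yp (N * n) \<otimes>\<^bsub>L\<^esub> v i = \<kappa> (b i)" by blast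
 have bc: "b i \<in> carrier S" for i by (rule B_carrier[OF b(1)])
 have "\<kappa> (\<Oplus>\<^bsub>S\<^esub>i\<in>{..<N}. b i \<otimes>\<^bsub>S\<^esub> y [^]\<^bsub>S\<^esub> i) = \<zero>\<^bsub>L\<^esub>"
  using Yp_finsum[of v N "N * n" b, OF vc b(2) bc] v(2) by simp
 hence "(\<Oplus>\<^bsub>S\<^esub>i\<in>{..<N}. b i \<otimes>\<^bsub>S\<^esub> y [^]\<^bsub>S\<^esub> i) = \<zero>\<^bsub>S\<^esub>"
  by (subst (asm) loc.\<kappa>_eq_zero) (use bc in \<open>auto intro!: S.finsum_closed\<close>)
 hence "b j = \<zero>\<^bsub>S\<^esub>" by (rule y_indep[OF b(1) _ v(3)])
 hence "loc.Yp (N * n) \<otimes>\<^bsub>L\<^esub> v j = loc.Yp (N * n) \<otimes>\<^bsub>L\<^esub> \<zero>\<^bsub>L\<^esub>" using b(2)[OF v(3)] by (simp add: loc.\<kappa>_zero)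
 thus ?thesis by (rule loc.Yp_cancel) (use vc in auto)
qed

text \<open>The preimage of J in the lower power series ring is a nonzero ideal, so
  \<open>y_pow_in_ideal\<close> puts a power of y^N into J; its inverse lies in
  \<open>BL\<close>.\<close>

lemma BL_simple: assumes J: "J \<subseteq> BL" "\<And>a b. a \<in> J ==> b \<in> J ==> a \<oplus>\<^bsub>L\<^esub> b \<in> J"
  "\<And>a r. a \<in> J ==> r \<in> BL ==> a \<otimes>\<^bsub>L\<^esub> r \<in> J" "\<And>a r. a \<in> J ==> r \<in> BL ==> r \<otimes>\<^bsub>L\<^esub> a \<in> J"
  and l: "l \<in> J" "l \<noteq> \<zero>\<^bsub>L\<^esub>"
 shows "\<one>\<^bsub>L\<^esub> \<in> J"
proof -
 obtain n b where b: "l \<in> carrier L" "b \<in> B" "loc.Yp (N * n) \<otimes>\<^bsub>L\<^esub> l = \<kappa> b" using l(1) J(1) by (auto simp: BL_def)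
 have YB: "loc.Yp (N * k) \<in> BL" for k using \<kappa>_BL[OF y_pow_B[of k]] by (simp add: loc.\<kappa>_pow)
 have bJ: "\<kappa> b \<in> J" using J(4)[OF l(1) YB[of n]] b(3) by simp
 have bnz: "b \<noteq> \<zero>\<^bsub>S\<^esub>"
 proof
  assume "b = \<zero>\<^bsub>S\<^esub>"
  hence "loc.Yp (N * n) \<otimes>\<^bsub>L\<^esub> l = loc.Yp (N * n) \<otimes>\<^bsub>L\<^esub> \<zero>\<^bsub>L\<^esub>" using b(3) by (simp add: loc.\<kappa>_zero)
  hence "l = \<zero>\<^bsub>L\<^esub>" by (rule loc.Yp_cancel) (use b(1) in auto)
  thus False using l(2) by simp
 qed
 define I where "I = {a \<in> carrier A.S. \<kappa> (Z.iota a) \<in> J}"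
 have iB: "Z.iota a \<in> B" if "a \<in> carrier A.S" for a using that by (simp add: B_def Z.AS_carrier)
 have addI: "a \<oplus>\<^bsub>A.S\<^esub> a' \<in> I" if "a \<in> I" "a' \<in> I" for a a'
 proof -
  have c: "a \<in> carrier A.S" "a' \<in> carrier A.S" "\<kappa> (Z.iota a) \<in> J" "\<kappa> (Z.iota a') \<in> J" using that by (auto simp: I_def)
  have "\<kappa> (Z.iota (a \<oplus>\<^bsub>A.S\<^esub> a')) = \<kappa> (Z.iota a) \<oplus>\<^bsub>L\<^esub> \<kappa> (Z.iota a')"
   using ring_hom_add[OF Z.iota_hom c(1,2)] c(1,2) by (simp add: loc.\<kappa>_add Z.AS_carrier)
  thus ?thesis using J(2)[OF c(3,4)] c(1,2) by (simp add: I_def)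
 qed
 have multI: "a \<otimes>\<^bsub>A.S\<^esub> r \<in> I" "r \<otimes>\<^bsub>A.S\<^esub> a \<in> I" if "a \<in> I" "r \<in> carrier A.S" for a r
 proof -
  have c: "a \<in> carrier A.S" "\<kappa> (Z.iota a) \<in> J" using that by (auto simp: I_def)
  have "\<kappa> (Z.iota (a \<otimes>\<^bsub>A.S\<^esub> r)) = \<kappa> (Z.iota a) \<otimes>\<^bsub>L\<^esub> \<kappa> (Z.iota r)"
   "\<kappa> (Z.iota (r \<otimes>\<^bsub>A.S\<^esub> a)) = \<kappa> (Z.iota r) \<otimes>\<^bsub>L\<^esub> \<kappa> (Z.iota a)"
   using ring_hom_mult[OF Z.iota_hom c(1) that(2)] ring_hom_mult[OF Z.iota_hom that(2) c(1)] c(1) that(2)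
   by (simp_all add: loc.\<kappa>_mult Z.AS_carrier)
  thus "a \<otimes>\<^bsub>A.S\<^esub> r \<in> I" "r \<otimes>\<^bsub>A.S\<^esub> a \<in> I"
   using J(3)[OF c(2) \<kappa>_BL[OF iB[OF that(2)]]] J(4)[OF c(2) \<kappa>_BL[OF iB[OF that(2)]]] c(1) that(2)
   by (simp_all add: I_def)
 qed
 obtain a where a: "a \<in> carrier S" "b = Z.iota a" using b(2) unfolding B_def by blast
 have aI: "a \<in> I" using a bJ by (simp add: I_def Z.AS_carrier)
 have zero: "\<zero>\<^bsub>A.S\<^esub> \<in> I" using multI(2)[OF aI A.S.zero_closed] aI by (simp add: I_def)
 have neg: "\<ominus>\<^bsub>A.S\<^esub> c \<in> I" if "c \<in> I" for c
 proof -
  have "\<ominus>\<^bsub>A.S\<^esub> c = (\<ominus>\<^bsub>A.S\<^esub> \<one>\<^bsub>A.S\<^esub>) \<otimes>\<^bsub>A.S\<^esub> c" using that by (simp add: I_def A.S.l_minus)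
  thus ?thesis using multI(2)[OF that, of "\<ominus>\<^bsub>A.S\<^esub> \<one>\<^bsub>A.S\<^esub>"] by simp
 qed
 have "ideal I A.S"
 proof (rule idealI[OF A.S.ring_axioms])
  show "subgroup I (add_monoid A.S)"
   by (rule A.S.add.subgroupI) (use zero addI neg in \<open>auto simp: I_def a_inv_def[symmetric]\<close>)
 qed (use multI in auto)
 moreover have "I \<noteq> {\<zero>\<^bsub>A.S\<^esub>}"
 proof
  assume "I = {\<zero>\<^bsub>A.S\<^esub>}"
  hence "a = \<zero>\<^bsub>A.S\<^esub>" using aI by blast
  hence "b = \<zero>\<^bsub>S\<^esub>" using a iota_zero by (simp add: S_zero A.S_zero)
  thus False using bnz by simp
 qed
 ultimately obtain k :: nat where k: "A.y [^]\<^bsub>A.S\<^esub> k \<in> I" using A.y_pow_in_ideal by blast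
 hence Yk: "loc.Yp (N * k) \<in> J" by (simp add: I_def y_pow_iota[symmetric] loc.\<kappa>_pow)
 have i: "inv\<^bsub>L\<^esub> (loc.Yp (N * k)) \<in> carrier L" using loc.Yp_U by simp
 have "inv\<^bsub>L\<^esub> (loc.Yp (N * k)) \<in> BL"
  by (rule BL_I[OF i subringE(3)[OF B_subring], of k]) (use loc.Yp_U in \<open>simp add: loc.\<kappa>_one\<close>)
 from J(4)[OF Yk this] show ?thesis using loc.Yp_U by simp
qed

text \<open>Write f = y^-n a. Moving s past y^n applies \<sigma>^n to it, so centrality of f becomes
  skew centrality of the numerator.\<close>

lemma centre_rep: assumes f: "f \<in> carrier L" "\<And>r. r \<in> carrier L ==> f \<otimes>\<^bsub>L\<^esub> r = r \<otimes>\<^bsub>L\<^esub> f"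
 obtains n :: nat and a where "a \<in> carrier S" "loc.Yp n \<otimes>\<^bsub>L\<^esub> f = \<kappa> a"
  "\<forall>s\<in>carrier S. a \<otimes>\<^bsub>S\<^esub> s = (\<lambda>k. (\<sigma> ^^ n) (s k)) \<otimes>\<^bsub>S\<^esub> a"
proof -
 obtain n :: nat and a where a: "a \<in> carrier S" "loc.Yp n \<otimes>\<^bsub>L\<^esub> f = \<kappa> a" using loc.frac[OF f(1)] by blast
 have "a \<otimes>\<^bsub>S\<^esub> s = (\<lambda>k. (\<sigma> ^^ n) (s k)) \<otimes>\<^bsub>S\<^esub> a" if s: "s \<in> carrier S" for s
 proof -
  let ?s = "\<lambda>k. (\<sigma> ^^ n) (s k)"
  have sc: "?s \<in> carrier S" by (rule \<sigma>_funpow_map_S[OF s])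
  have "\<kappa> (a \<otimes>\<^bsub>S\<^esub> s) = loc.Yp n \<otimes>\<^bsub>L\<^esub> (f \<otimes>\<^bsub>L\<^esub> \<kappa> s)"
   using a s f(1) by (simp add: loc.\<kappa>_mult a(2)[symmetric] loc.L.m_assoc)
  also have "\<dots> = (loc.Yp n \<otimes>\<^bsub>L\<^esub> \<kappa> s) \<otimes>\<^bsub>L\<^esub> f"
   unfolding f(2)[OF loc.\<kappa>_c[OF s]] using s f(1) by (simp add: loc.L.m_assoc)
  also have "loc.Yp n \<otimes>\<^bsub>L\<^esub> \<kappa> s = \<kappa> ?s \<otimes>\<^bsub>L\<^esub> loc.Yp n"
   using arg_cong[OF y_pow_map[OF s, of n], of \<kappa>] s sc by (simp add: loc.\<kappa>_mult loc.\<kappa>_pow)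
  also have "\<kappa> ?s \<otimes>\<^bsub>L\<^esub> loc.Yp n \<otimes>\<^bsub>L\<^esub> f = \<kappa> ?s \<otimes>\<^bsub>L\<^esub> (loc.Yp n \<otimes>\<^bsub>L\<^esub> f)"
   by (rule loc.L.m_assoc) (use sc f(1) in auto)
  also have "\<dots> = \<kappa> (?s \<otimes>\<^bsub>S\<^esub> a)" unfolding a(2) using sc a(1) by (simp add: loc.\<kappa>_mult)
  finally show ?thesis using loc.\<kappa>_eq[of "a \<otimes>\<^bsub>S\<^esub> s" "?s \<otimes>\<^bsub>S\<^esub> a"] a(1) s sc by simp
 qed
 thus ?thesis using that a by blast
qed

text \<open>The numerators a and b have coefficients fixed by \<sigma> and killed by \<delta>, so by
  \<open>semicentral_fixed\<close> all these coefficients commute; moreover a b = y^n y^m f g =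
  0.\<close>

lemma centre_domain:
 assumes f: "f \<in> carrier L" "\<And>r. r \<in> carrier L ==> f \<otimes>\<^bsub>L\<^esub> r = r \<otimes>\<^bsub>L\<^esub> f"
  and g: "g \<in> carrier L" "\<And>r. r \<in> carrier L ==> g \<otimes>\<^bsub>L\<^esub> r = r \<otimes>\<^bsub>L\<^esub> g" and fg: "f \<otimes>\<^bsub>L\<^esub> g = \<zero>\<^bsub>L\<^esub>"
 shows "f = \<zero>\<^bsub>L\<^esub> \<or> g = \<zero>\<^bsub>L\<^esub>"
proof -
 obtain n :: nat and a where a: "a \<in> carrier S" "loc.Yp n \<otimes>\<^bsub>L\<^esub> f = \<kappa> a"
  "\<forall>s\<in>carrier S. a \<otimes>\<^bsub>S\<^esub> s = (\<lambda>k. (\<sigma> ^^ n) (s k)) \<otimes>\<^bsub>S\<^esub> a"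
  by (rule centre_rep[OF f(1) f(2)]) (assumption, rule that)
 obtain m :: nat and b where b: "b \<in> carrier S" "loc.Yp m \<otimes>\<^bsub>L\<^esub> g = \<kappa> b"
  "\<forall>s\<in>carrier S. b \<otimes>\<^bsub>S\<^esub> s = (\<lambda>k. (\<sigma> ^^ m) (s k)) \<otimes>\<^bsub>S\<^esub> b"
  by (rule centre_rep[OF g(1) g(2)]) (assumption, rule that)
 note fa = semicentral_fixed[OF a(1,3)] and fb = semicentral_fixed[OF b(1,3)]
 have "\<kappa> (a \<otimes>\<^bsub>S\<^esub> b) = loc.Yp n \<otimes>\<^bsub>L\<^esub> (f \<otimes>\<^bsub>L\<^esub> loc.Yp m) \<otimes>\<^bsub>L\<^esub> g"
  using a(1) b(1) f(1) g(1) by (simp add: loc.\<kappa>_mult a(2)[symmetric] b(2)[symmetric] loc.L.m_assoc)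
 also have "\<dots> = loc.Yp n \<otimes>\<^bsub>L\<^esub> loc.Yp m \<otimes>\<^bsub>L\<^esub> (f \<otimes>\<^bsub>L\<^esub> g)"
  unfolding f(2)[OF loc.Yp_c] using f(1) g(1) by (simp add: loc.L.m_assoc)
 finally have "\<kappa> (a \<otimes>\<^bsub>S\<^esub> b) = \<zero>\<^bsub>L\<^esub>" unfolding fg by simp
 hence ab: "a \<otimes>\<^bsub>S\<^esub> b = \<zero>\<^bsub>S\<^esub>" using loc.\<kappa>_eq_zero a(1) b(1) by simp
 have ac: "a i \<in> carrier Q" "b i \<in> carrier Q" for i by (rule S_coeff[OF a(1)], rule S_coeff[OF b(1)])
 have "a = \<zero>\<^bsub>S\<^esub> \<or> b = \<zero>\<^bsub>S\<^esub>"
 proof (rule semicentral_domain[OF fa(1) fb(1) ab _ _ _ fa(3) fb(3)])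
  show "a i \<otimes> a j = a j \<otimes> a i" for i j by (rule fa(2)[OF ac(1) fixed_\<sigma>[OF fa(1)] fixed_\<delta>[OF fa(1)]])
  show "b i \<otimes> b j = b j \<otimes> b i" for i j by (rule fb(2)[OF ac(2) fixed_\<sigma>[OF fb(1)] fixed_\<delta>[OF fb(1)]])
  show "a i \<otimes> b j = b j \<otimes> a i" for i j by (rule fa(2)[OF ac(2) fixed_\<sigma>[OF fb(1)] fixed_\<delta>[OF fb(1)]])
 qed
 moreover have "f = \<zero>\<^bsub>L\<^esub>" if "a = \<zero>\<^bsub>S\<^esub>"
  by (rule loc.Yp_cancel[of n]) (use a(2) that f(1) in \<open>simp_all add: loc.\<kappa>_zero\<close>)
 moreover have "g = \<zero>\<^bsub>L\<^esub>" if "b = \<zero>\<^bsub>S\<^esub>"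
  by (rule loc.Yp_cancel[of m]) (use b(2) that g(1) in \<open>simp_all add: loc.\<kappa>_zero\<close>)
 ultimately show ?thesis by blast
qed

theorem localisation_simple: "simple_ring L"
proof -
 have "cyclic_graded L BL (\<kappa> y) N"
 proof (intro cyclic_graded.intro loc.L.ring_axioms cyclic_graded_axioms.intro)
  show "subring BL L" by (rule BL_subring)
  show "\<kappa> y \<in> Units L" by (rule loc.\<kappa>_y)
  have "\<one>\<^bsub>S\<^esub> \<noteq> \<zero>\<^bsub>S\<^esub>" using one_not_zero by (auto simp: S_one S_zero fun_eq_iff)
  thus "\<one>\<^bsub>L\<^esub> \<noteq> \<zero>\<^bsub>L\<^esub>" using loc.\<kappa>_eq[of "\<one>\<^bsub>S\<^esub>" "\<zero>\<^bsub>S\<^esub>"] by (simp add: loc.\<kappa>_one loc.\<kappa>_zero)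
 qed (rule BL_conj BL_gen BL_indep BL_simple centre_domain; assumption)+
 then interpret g: cyclic_graded L BL "\<kappa> y" N .
 show ?thesis by (rule g.graded_simple)
qed

end
end

section \<open>From the hypotheses of the theorem to the tower\<close>

context ring begin

lemma minus_one_pow: "(\<ominus> \<one>) [^] (n::nat) = (if even n then \<one> else \<ominus> \<one>)"
 by (induction n) (auto simp: l_minus r_minus)

lemma diff_exchange:
 assumes "a \<ominus> b = c \<ominus> d" "a \<in> carrier R" "b \<in> carrier R" "c \<in> carrier R" "d \<in> carrier R"
 shows "a \<ominus> c = b \<ominus> d"
proof -
 have "a \<ominus> c = (a \<ominus> b) \<oplus> (b \<ominus> c)" using assms(2-4) by (simp add: minus_eq a_assoc r_neg1)
 also have "\<dots> = (b \<ominus> c) \<oplus> (c \<ominus> d)" unfolding assms(1) using assms(3-5) by (simp add: a_comm)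
 also have "\<dots> = b \<ominus> d" using assms(3-5) by (simp add: minus_eq a_assoc r_neg1)
 finally show ?thesis .
qed

lemma minus_pow: "a \<in> carrier R ==> (\<ominus> a) [^] (n::nat) = (if even n then a [^] n else \<ominus> (a [^] n))"
 by (induction n) (auto simp: l_minus r_minus)

end

lemma Fin_le_less: "Fin (n::int) \<le> a ==> a < b ==> Fin (n + 1) \<le> b"
 by (cases a; cases b) auto

context filtered_ring begin

lemma degree_iff: "filtered_of_degree Q u f d \<longleftrightarrow>
  f \<in> hom (add_monoid Q) (add_monoid Q) \<and> (\<forall>n. \<forall>q\<in>G n. f q \<in> G (n + d))"
 unfolding filtered_of_degree_def G_def by (simp add: image_subset_iff)

lemma degree_mono: "filtered_of_degree Q u f d ==> c \<le> d ==> filtered_of_degree Q u f c"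
 unfolding degree_iff using G_mono by (metis add_left_mono)

text \<open>\<open>filt_deg\<close> is a GREATEST, so a maximum must be exhibited: the admissible
  degrees are nonempty, closed downwards, and miss some integer e.\<close>

lemma filt_deg_le: assumes ex: "filtered_map Q u f" and c: "Fin c \<le> filt_deg Q u f"
 shows "filtered_of_degree Q u f c"
proof (cases "\<forall>d. filtered_of_degree Q u f d")
 case False
 define P where "P = filtered_of_degree Q u f"
 obtain d0 where d0: "P d0" using ex by (auto simp: filtered_map_def P_def)
 obtain e where e: "\<not> P e" using False by (auto simp: P_def)
 have bound: "d < e" if "P d" for d using e degree_mono[of f d e] that by (fastforce simp: P_def)
 have "finite {d. P d \<and> d0 \<le> d}" by (rule finite_subset[of _ "{d0..<e}"]) (use bound in auto)
 moreover have "{d. P d \<and> d0 \<le> d} \<noteq> {}" using d0 by auto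
 ultimately have m: "P (Max {d. P d \<and> d0 \<le> d})" "\<And>d. P d ==> d0 \<le> d ==> d \<le> Max {d. P d \<and> d0 \<le> d}"
  using Max_in by (blast, intro Max_ge) auto
 have "(GREATEST d. P d) = Max {d. P d \<and> d0 \<le> d}"
 proof (rule Greatest_equality)
  fix d assume d: "P d"
  show "d \<le> Max {d. P d \<and> d0 \<le> d}"
  proof (cases "d0 \<le> d")
   case False
   thus ?thesis using m(2)[OF d0] by linarith
  qed (use m(2) d in blast)
 qed (rule m(1))
 moreover have "filt_deg Q u f = Fin (GREATEST d. P d)" using False by (auto simp: filt_deg_def P_def)
 ultimately have "Fin c \<le> Fin (Max {d. P d \<and> d0 \<le> d})" using c by (simp only:)
 hence "c \<le> Max {d. P d \<and> d0 \<le> d}" by (simp only: less_eq_extended.simps)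
 thus ?thesis unfolding P_def by (rule degree_mono[OF m(1)[unfolded P_def]])
qed simp

lemma hom_amap: "f \<in> hom (add_monoid Q) (add_monoid Q) \<longleftrightarrow> amap f"
 by (auto simp: hom_def amap_def)

lemma filtered_map_comp: assumes "filtered_map Q u f" "filtered_map Q u g" shows "filtered_map Q u (f \<circ> g)"
proof -
 obtain c d where "filtered_of_degree Q u f c" "filtered_of_degree Q u g d"
  using assms by (auto simp: filtered_map_def)
 hence "filtered_of_degree Q u (f \<circ> g) (d + c)"
  unfolding degree_iff hom_amap using amap_comp[of f g] by (simp add: comp_def add.assoc[symmetric])
 thus ?thesis by (auto simp: filtered_map_def)
qed

lemma filtered_map_funpow: assumes "filtered_map Q u f" shows "filtered_map Q u (f ^^ n)"
proof (induction n)
 case 0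
 have "filtered_of_degree Q u id 0" unfolding degree_iff hom_amap by (simp add: amap_def)
 thus ?case unfolding filtered_map_def by (auto simp: id_def)
next
 case (Suc n)
 show ?case unfolding funpow.simps by (rule filtered_map_comp[OF assms Suc])
qed

lemma quasi_compatible_skew:
 fixes \<sigma> \<delta> :: "'a \<Rightarrow> 'a"
 assumes qc: "quasi_compatible Q u \<sigma> \<delta>"
 obtains C N0 where "skew Q u \<sigma> \<delta> C N0"
  "\<And>q n. q \<in> carrier Q ==> \<sigma> q \<in> G n ==> q \<in> G (n - C)"
proof -
 have csd: "commuting_skew_derivation Q \<sigma> \<delta>" and fm: "filtered_map Q u \<sigma>"
  "filtered_map Q u (inv_into (carrier Q) \<sigma>)" "filtered_map Q u \<delta>" using qc by (auto simp: quasi_compatible_def)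
 obtain c where c: "\<And>i j. Fin c \<le> filt_deg Q u (aut_pow Q \<sigma> i \<circ> (\<delta> ^^ j))"
  using qc by (auto simp: quasi_compatible_def)
 obtain N where N: "0 < filt_deg Q u (\<delta> ^^ N)" using qc by (auto simp: quasi_compatible_def)
 have iso: "\<sigma> \<in> ring_iso Q Q" and \<delta>h: "\<delta> \<in> hom (add_monoid Q) (add_monoid Q)"
  and leib: "\<And>r s. r \<in> carrier Q ==> s \<in> carrier Q ==> \<delta> (r \<otimes> s) = \<delta> r \<otimes> s \<oplus> \<sigma> r \<otimes> \<delta> s"
  and comm: "\<And>r. r \<in> carrier Q ==> \<sigma> (\<delta> r) = \<delta> (\<sigma> r)"
  using csd by (auto simp: commuting_skew_derivation_def skew_derivation_def)
 note im = ring_iso_memE[OF iso]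
 have \<sigma>a: "amap \<sigma>" using im(1,3) by (auto simp: amap_def)
 have \<delta>a: "amap \<delta>" using \<delta>h by (simp add: hom_amap)
 have fa: "filtered_map Q u (aut_pow Q \<sigma> i)" for i
  unfolding aut_pow_def using filtered_map_funpow[OF fm(1)] filtered_map_funpow[OF fm(2)] by simp
 have deg: "(aut_pow Q \<sigma> i) ((\<delta> ^^ j) q) \<in> G (n + c)" if "q \<in> G n" for i j q n
  using filt_deg_le[OF filtered_map_comp[OF fa filtered_map_funpow[OF fm(3)]] c, of i j] that
  by (auto simp: degree_iff)
 have "Fin 1 \<le> filt_deg Q u (\<delta> ^^ N)"
  using Fin_le_less[of 0 "Fin 0" "filt_deg Q u (\<delta> ^^ N)"] N by (simp add: zero_extended_def)
 hence "filtered_of_degree Q u (\<delta> ^^ N) 1" by (rule filt_deg_le[OF filtered_map_funpow[OF fm(3)]])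
 hence dN: "(\<delta> ^^ N) q \<in> G (n + 1)" if "q \<in> G n" for q n using that by (auto simp: degree_iff)
 \<comment> \<open>\<delta>^0 is the identity, whose degree is not positive because 1 is
   nonzero.\<close>
 have Npos: "0 < N"
 proof (rule ccontr)
  assume "\<not> 0 < N"
  hence st: "\<one> \<in> G n ==> \<one> \<in> G (n + 1)" for n using dN[of \<one> n] by simp
  have "\<one> = \<zero>" by (rule G_iter) (use st in simp_all)
  thus False using one_not_zero by simp
 qed
 have dNk: "((\<delta> ^^ N) ^^ k) q \<in> G (n + int k)" if "q \<in> G n" for q n k
 proof (induction k)
  case (Suc k)
  show ?case using dN[OF Suc] by (simp add: ac_simps)
 qed (use that in simp)
 define C where "C = max 0 (- c)"
 have "skew Q u \<sigma> \<delta> C N"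
 proof
  show "amap \<sigma>" "amap \<delta>" by (rule \<sigma>a, rule \<delta>a)
  show "bij_betw \<sigma> (carrier Q) (carrier Q)" by (rule im(5))
  show "0 \<le> C" by (simp add: C_def)
  show "0 < N" by (rule Npos)
  show "(\<sigma> ^^ i) ((\<delta> ^^ j) q) \<in> G (n + int (j div N) - C)" if q: "q \<in> G n" for q n i j
  proof -
   \<comment> \<open>Write j = (j mod N) + N (j div N): each block \<delta>^N gains a level, and the
     remaining factors together with \<sigma>^i cost at most a constant.\<close>
   have "\<delta> ^^ j = (\<delta> ^^ (j mod N)) \<circ> ((\<delta> ^^ N) ^^ (j div N))"
    unfolding funpow_mult funpow_add[symmetric] by (simp add: mult.commute)
   moreover have "\<sigma> ^^ i = aut_pow Q \<sigma> (int i)" by (simp add: aut_pow_def)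
   ultimately have "(\<sigma> ^^ i) ((\<delta> ^^ j) q) \<in> G (n + int (j div N) + c)" using deg[OF dNk[OF q]] by simp
   thus ?thesis by (rule G_mono) (simp add: C_def)
  qed
 qed (use im leib comm in auto)
 moreover have "q \<in> G (n - C)" if q: "q \<in> carrier Q" "\<sigma> q \<in> G n" for q n
 proof -
  have "inv_into (carrier Q) \<sigma> (\<sigma> q) \<in> G (n + c)" using deg[OF q(2), of "-1" 0] by (simp add: aut_pow_def)
  moreover have "inv_into (carrier Q) \<sigma> (\<sigma> q) = q" using im(5) q(1) by (auto simp: bij_betw_def)
  ultimately have "q \<in> G (n + c)" by simp
  thus ?thesis by (rule G_mono) (simp add: C_def)
 qed
 ultimately show ?thesis by (rule that)
qed

text \<open>\<open>e k\<close> is the integer k as a p-adic integer. Since p has valuation at least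
  1, the axiom of a filtered algebra bounds its image.\<close>

lemma p_in_G:
 assumes p: "Factorial_Ring.prime p" and alg: "filtered_Zp_algebra p Q u \<eta>"
 shows "add_pow Q p \<one> \<in> G 1"
proof -
 let ?Z = "padic_int p"
 define e where "e k = (\<lambda>n. int k mod int p ^ n)" for k :: nat
 have p0: "0 < int p" using p by (simp add: prime_gt_0_nat)
 have ec: "e k \<in> carrier ?Z" for k
  using p0 by (auto simp: padic_int_def e_def mod_mod_cancel)
 have hom: "\<eta> \<in> ring_hom ?Z Q" using alg by (simp add: filtered_Zp_algebra_def)
 have one: "e 1 = \<one>\<^bsub>?Z\<^esub>" by (simp add: e_def padic_int_def)
 have add: "e k \<oplus>\<^bsub>?Z\<^esub> e l = e (k + l)" for k l
  by (simp add: e_def padic_int_def mod_add_eq)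
 \<comment> \<open>The induction starts at 1, where \<eta> is known by the definition of a ring
   homomorphism.\<close>
 have ek: "\<eta> (e (Suc k)) = add_pow Q (Suc k) \<one>" for k
 proof (induction k)
  case 0
  show ?case using ring_hom_one[OF hom] one by simp
 next
  case (Suc k)
  have "\<eta> (e (Suc k + 1)) = \<eta> (e (Suc k)) \<oplus> \<eta> (e 1)"
   unfolding add[symmetric] by (rule ring_hom_add[OF hom ec ec])
  thus ?case using ring_hom_one[OF hom] Suc by (simp add: one[simplified])
 qed
 obtain k where k: "p = Suc k" using p0 by (cases p) auto
 have "Fin 1 \<le> padic_val (e p)"
 proof (cases "\<forall>n. e p n = 0")
  case False
  \<comment> \<open>p^2 does not divide p; this bounds the indices with residue 0, as the GREATEST
    in \<open>padic_val\<close> requires.\<close>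
  have bd: "n \<le> 1" if "e p n = 0" for n
  proof (rule ccontr)
   assume "\<not> n \<le> 1"
   hence "p ^ 2 dvd p ^ n" by (intro le_imp_power_dvd) simp
   moreover have "p ^ n dvd p" using that by (auto simp: e_def mod_eq_0_iff_dvd simp flip: of_nat_power)
   ultimately have "p * p dvd p" by (metis dvd_trans power2_eq_square)
   thus False using p by (simp add: prime_gt_1_nat)
  qed
  have "e p 1 = 0" by (simp add: e_def)
  hence "1 \<le> (GREATEST n. e p n = 0)" by (rule Greatest_le_nat) (rule bd)
  thus ?thesis using False by (auto simp: padic_val_def)
 qed (simp add: padic_val_def)
 also have "padic_val (e p) \<le> u (\<eta> (e p))" using alg ec by (simp add: filtered_Zp_algebra_def)
 finally show ?thesis unfolding G_iff using ek[of k] k by simp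
qed

end

context std_ring begin

lemma semicentral_zero:
 assumes bij: "bij_betw \<tau> (carrier Q) (carrier Q)" and inn: "\<not> inner_automorphism Q \<tau>"
  and c: "c \<in> carrier Q" "\<And>r. r \<in> carrier Q ==> c \<otimes> r = \<tau> r \<otimes> c"
 shows "c = \<zero>"
proof (rule ccontr)
 assume "c \<noteq> \<zero>"
 hence cu: "c \<in> Units Q" by (rule semicentral_unit[OF c(1) _ bij c(2)])
 have "\<tau> r = c \<otimes> r \<otimes> inv c" if r: "r \<in> carrier Q" for r
 proof -
  have "\<tau> r \<in> carrier Q" using bij r by (auto simp: bij_betw_def)
  thus ?thesis unfolding c(2)[OF r] using cu c(1) by (simp add: m_assoc)
 qed
 thus False using inn cu by (auto simp: inner_automorphism_def)
qed

text \<open>Expanding \<sigma>(\<delta>(q)) = \<delta>(\<sigma>(q)) gives (\<sigma>(t) - t)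
  \<sigma>(q) = \<sigma>(\<sigma>(q)) (\<sigma>(t) - t). So \<sigma>(t) - t is semicentral for
  \<sigma>, which is not inner.\<close>

lemma inner_derivation_fixed:
 fixes \<sigma> \<delta> :: "'a \<Rightarrow> 'a"
 assumes bij: "bij_betw \<sigma> (carrier Q) (carrier Q)"
  and add: "\<And>a b. a \<in> carrier Q ==> b \<in> carrier Q ==> \<sigma> (a \<ominus> b) = \<sigma> a \<ominus> \<sigma> b"
  and mult: "\<And>a b. a \<in> carrier Q ==> b \<in> carrier Q ==> \<sigma> (a \<otimes> b) = \<sigma> a \<otimes> \<sigma> b"
  and inn: "\<not> inner_automorphism Q \<sigma>" and t: "t \<in> carrier Q"
  and \<delta>: "\<And>q. q \<in> carrier Q ==> \<delta> q = t \<otimes> q \<ominus> \<sigma> q \<otimes> t"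
  and comm: "\<And>q. q \<in> carrier Q ==> \<sigma> (\<delta> q) = \<delta> (\<sigma> q)"
 shows "\<sigma> t = t"
proof -
 have \<sigma>c: "\<sigma> q \<in> carrier Q" if "q \<in> carrier Q" for q using bij that by (auto simp: bij_betw_def)
 have "\<sigma> t \<ominus> t = \<zero>"
 proof (rule semicentral_zero[OF bij inn])
  show "\<sigma> t \<ominus> t \<in> carrier Q" using t \<sigma>c by simp
  fix r assume "r \<in> carrier Q"
  then obtain q where q: "q \<in> carrier Q" "r = \<sigma> q" using bij by (auto simp: bij_betw_def)
  note c = q(1) t \<sigma>c[OF q(1)] \<sigma>c[OF \<sigma>c[OF q(1)]] \<sigma>c[OF t]
  have "\<sigma> t \<otimes> \<sigma> q \<ominus> \<sigma> (\<sigma> q) \<otimes> \<sigma> t = t \<otimes> \<sigma> q \<ominus> \<sigma> (\<sigma> q) \<otimes> t"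
   using comm[OF q(1)] c by (simp add: \<delta> add mult)
  hence "\<sigma> t \<otimes> \<sigma> q \<ominus> t \<otimes> \<sigma> q = \<sigma> (\<sigma> q) \<otimes> \<sigma> t \<ominus> \<sigma> (\<sigma> q) \<otimes> t"
   by (rule diff_exchange) (use c in simp_all)
  thus "(\<sigma> t \<ominus> t) \<otimes> r = \<sigma> r \<otimes> (\<sigma> t \<ominus> t)"
   unfolding q(2) using c by (simp add: minus_eq l_distr r_distr l_minus r_minus)
 qed
 thus ?thesis using \<sigma>c[OF t] t by simp
qed

end

lemma skew_tower_exists:
 fixes Q :: "('a, 'm) ring_scheme" (structure)
 assumes p: "Factorial_Ring.prime p" and alg: "filtered_Zp_algebra p Q u \<eta>"
  and std: "standard_filtered_artinian Q u" and qc: "quasi_compatible Q u \<sigma> \<delta>"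
  and t: "t \<in> carrier Q" and \<delta>: "\<And>q. q \<in> carrier Q ==> \<delta> q = t \<otimes> q \<ominus> \<sigma> q \<otimes> t"
  and compat: "\<exists>M. \<forall>m\<ge>M. compatible Q u (\<sigma> ^^ (p ^ m))
    (\<lambda>q. (\<ominus> \<one>) [^] (p + 1) \<otimes> t [^] (p ^ m) \<otimes> q \<ominus> (\<sigma> ^^ (p ^ m)) q \<otimes> ((\<ominus> \<one>) [^] (p + 1) \<otimes> t [^] (p ^ m)))"
  and inn: "\<And>n. n > 0 ==> \<not> inner_automorphism Q (\<sigma> ^^ n)"
  and case_split: "ring_char Q = p \<or> 0 \<le> u t"
 obtains C N0 m where "skew_tower Q u \<sigma> \<delta> C N0 t p m"
proof -
 have filt: "filtration Q u" using alg by (simp add: filtered_Zp_algebra_def)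
 obtain s F D \<pi> \<phi> where "matrix_over_dvr Q (F :: 'a ring) D \<pi> s \<phi> u"
  by (rule standard_matrix_over_dvr[OF filt std])
 then interpret M: matrix_over_dvr Q F D \<pi> s \<phi> u .
 obtain C N0 where sk: "skew Q u \<sigma> \<delta> C N0" and inv: "\<And>q n. q \<in> carrier Q ==> \<sigma> q \<in> M.G n ==> q \<in> M.G (n - C)"
  by (rule M.quasi_compatible_skew[OF qc]) (rule that)
 interpret sk: skew Q u \<sigma> \<delta> C N0 by (rule sk)
 have \<sigma>t: "\<sigma> t = t"
  by (rule M.inner_derivation_fixed[OF sk.\<sigma>_bij _ _ _ t \<delta> sk.comm])
    (use sk.\<sigma>_simps(3) sk.\<sigma>_mult inn[of 1] in simp_all)
 interpret si: skew_inner Q u \<sigma> \<delta> C N0 t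
  by (intro skew_inner.intro sk skew_inner_axioms.intro) (use t \<sigma>t \<delta> in auto)
 obtain M0 where M0: "\<And>m. m \<ge> M0 ==> compatible Q u (\<sigma> ^^ (p ^ m))
    (\<lambda>q. (\<ominus> \<one>) [^] (p + 1) \<otimes> t [^] (p ^ m) \<otimes> q \<ominus> (\<sigma> ^^ (p ^ m)) q \<otimes> ((\<ominus> \<one>) [^] (p + 1) \<otimes> t [^] (p ^ m)))"
  using compat by blast
 \<comment> \<open>With m \<ge> 1 the power p^m has the parity of p, which identifies (-1)^(p+1)
   t^(p^m) with -(-t)^(p^m). For p = 2 and m = 0 the signs would differ.\<close>
 define m where "m = max M0 1"
 have Teq: "(\<ominus> \<one>) [^] (p + 1) \<otimes> t [^] (p ^ m) = \<ominus> ((\<ominus> t) [^] (p ^ m))"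
 proof -
  have "even (p ^ m) = even p" by (simp add: m_def less_max_iff_disj)
  thus ?thesis unfolding M.minus_one_pow M.minus_pow[OF t] using t by (auto simp: M.l_minus)
 qed
 have cp: "compatible Q u (\<sigma> ^^ (p ^ m)) (\<lambda>q. \<ominus> ((\<ominus> t) [^] (p ^ m)) \<otimes> q \<ominus> (\<sigma> ^^ (p ^ m)) q \<otimes> \<ominus> ((\<ominus> t) [^] (p ^ m)))"
  using M0[of m] unfolding Teq by (simp add: m_def)
 have near: "(\<sigma> ^^ (p ^ m)) r \<ominus> r \<in> M.G (n + 1)"
  "\<ominus> ((\<ominus> t) [^] (p ^ m)) \<otimes> r \<ominus> (\<sigma> ^^ (p ^ m)) r \<otimes> \<ominus> ((\<ominus> t) [^] (p ^ m)) \<in> M.G (n + 1)" if r: "r \<in> M.G n" for r n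
 proof -
  have rc: "r \<in> carrier Q" "Fin n \<le> u r" using r by (auto simp: M.G_iff)
  show "(\<sigma> ^^ (p ^ m)) r \<ominus> r \<in> M.G (n + 1)"
   "\<ominus> ((\<ominus> t) [^] (p ^ m)) \<otimes> r \<ominus> (\<sigma> ^^ (p ^ m)) r \<otimes> \<ominus> ((\<ominus> t) [^] (p ^ m)) \<in> M.G (n + 1)"
  proof (atomize (full), cases "r = \<zero>")
   case True
   have "(\<sigma> ^^ k) \<zero> = \<zero>" for k by (induction k) simp_all
   thus "(\<sigma> ^^ (p ^ m)) r \<ominus> r \<in> M.G (n + 1) \<and> \<ominus> ((\<ominus> t) [^] (p ^ m)) \<otimes> r \<ominus> (\<sigma> ^^ (p ^ m)) r \<otimes> \<ominus> ((\<ominus> t) [^] (p ^ m)) \<in> M.G (n + 1)"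
    using True t by (simp add: M.minus_eq)
  next
   case False
   have "u r < u ((\<sigma> ^^ (p ^ m)) r \<ominus> r)"
    "u r < u (\<ominus> ((\<ominus> t) [^] (p ^ m)) \<otimes> r \<ominus> (\<sigma> ^^ (p ^ m)) r \<otimes> \<ominus> ((\<ominus> t) [^] (p ^ m)))"
    using cp False rc(1) by (auto simp: compatible_def)
   thus "(\<sigma> ^^ (p ^ m)) r \<ominus> r \<in> M.G (n + 1) \<and> \<ominus> ((\<ominus> t) [^] (p ^ m)) \<otimes> r \<ominus> (\<sigma> ^^ (p ^ m)) r \<otimes> \<ominus> ((\<ominus> t) [^] (p ^ m)) \<in> M.G (n + 1)"
    unfolding M.G_iff using Fin_le_less[OF rc(2)] rc(1) t by simp
  qed
 qed
 have small: "add_pow Q b ((\<ominus> t) [^] i) \<in> M.G 1" if dvd: "p dvd b" for b i :: nat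
 proof -
  obtain k where k: "b = k * p" using dvd by (auto simp: dvd_def mult.commute)
  have c: "(\<ominus> t) [^] i \<in> carrier Q" using t by simp
  have e: "add_pow Q b ((\<ominus> t) [^] i) = add_pow Q p \<one> \<otimes> add_pow Q k ((\<ominus> t) [^] i)"
   unfolding k using c by (simp add: M.add.nat_pow_pow[symmetric] M.add_pow_ldistr)
  \<comment> \<open>In characteristic p the factor p is 0. Otherwise it lies in \<open>G 1\<close>,
    and u(t) \<ge> 0 keeps the other factor in \<open>G 0\<close>.\<close>
  show ?thesis using case_split
  proof
   assume "ring_char Q = p"
   moreover have "0 < p" using p by (simp add: prime_gt_0_nat)
   ultimately have "add_pow Q p \<one> = \<zero>"
    unfolding ring_char_def by (metis (mono_tags, lifting) LeastI_ex less_irrefl)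
   thus ?thesis unfolding e using c by simp
  next
   assume "0 \<le> u t"
   hence "t \<in> M.G 0" using t by (simp add: M.G_iff zero_extended_def)
   hence "add_pow Q k ((\<ominus> t) [^] i) \<in> M.G 0" by (intro M.G_nat M.G_one_pow M.G_neg)
   thus ?thesis unfolding e by (rule M.G_mult'[OF M.p_in_G[OF p alg]]) simp
  qed
 qed
 have "skew_tower Q u \<sigma> \<delta> C N0 t p m"
 proof (intro skew_tower.intro si.skew_inner_axioms M.std_ring_axioms skew_tower_axioms.intro)
  fix k :: nat and c assume k: "0 < k" "c \<in> carrier Q" and h: "\<And>r. r \<in> carrier Q ==> c \<otimes> r = (\<sigma> ^^ k) r \<otimes> c"
  show "c = \<zero>" by (rule M.semicentral_zero[OF sk.\<sigma>_pow_bij inn[OF k(1)] k(2) h])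
 qed (rule p inv small near M.left_dcc; assumption)+
 thus ?thesis by (rule that)
qed

text \<open>c is a central unit with c^2 = 1, so the powers of \<theta> y and of Y differ by units:
  inverting one inverts the other.\<close>

lemma localisation_transport:
 assumes S: "normal_element S y" and A: "ring A" and \<theta>: "\<theta> \<in> ring_iso S A"
  and c: "c \<in> carrier A" "c \<otimes>\<^bsub>A\<^esub> c = \<one>\<^bsub>A\<^esub>" "\<And>a. a \<in> carrier A ==> c \<otimes>\<^bsub>A\<^esub> a = a \<otimes>\<^bsub>A\<^esub> c"
  and Y: "Y = c \<otimes>\<^bsub>A\<^esub> \<theta> y"
 shows "\<exists>\<kappa>. is_localisation S (localisation A Y) y \<kappa>"
proof -
 interpret S: normal_element S y by (rule S)
 interpret A: ring A by (rule A)
 note th = ring_iso_memE[OF \<theta>]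
 have y\<theta>: "\<theta> y \<in> carrier A" by (rule th(1)[OF S.y])
 have inj: "inj_on \<theta> (carrier S)" using th(5) by (simp add: bij_betw_def)
 have surj: "\<exists>s\<in>carrier S. a = \<theta> s" if "a \<in> carrier A" for a using th(5) that by (auto simp: bij_betw_def)
 have hom: "\<theta> \<in> ring_hom S A" using \<theta> by (simp add: ring_iso_def)
 have zero: "\<theta> \<zero>\<^bsub>S\<^esub> = \<zero>\<^bsub>A\<^esub>" by (rule ring_hom_zero[OF hom S.ring_axioms A])
 have ker: "s = \<zero>\<^bsub>S\<^esub>" if "s \<in> carrier S" "\<theta> s = \<zero>\<^bsub>A\<^esub>" for s
  using inj_onD[OF inj, of s "\<zero>\<^bsub>S\<^esub>"] that zero by simp
 have cc: "c \<otimes>\<^bsub>A\<^esub> (c \<otimes>\<^bsub>A\<^esub> a) = a" if "a \<in> carrier A" for a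
  using c(1,2) that by (simp add: A.m_assoc[symmetric])
 have Yc: "Y \<in> carrier A" unfolding Y using c(1) y\<theta> by simp
 have \<theta>y: "\<theta> y = c \<otimes>\<^bsub>A\<^esub> Y" unfolding Y using cc[OF y\<theta>] by simp
 interpret N: normal_element A Y
 proof
  show "Y \<in> carrier A" by (rule Yc)
  show "a = \<zero>\<^bsub>A\<^esub>" if a: "a \<in> carrier A" "Y \<otimes>\<^bsub>A\<^esub> a = \<zero>\<^bsub>A\<^esub>" for a
  proof -
   obtain s where s: "s \<in> carrier S" "a = \<theta> s" using surj[OF a(1)] by blast
   have "\<theta> (y \<otimes>\<^bsub>S\<^esub> s) = c \<otimes>\<^bsub>A\<^esub> (Y \<otimes>\<^bsub>A\<^esub> a)"
    using th(2)[OF S.y s(1)] \<theta>y s c(1) Yc a(1) by (simp add: A.m_assoc)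
   hence "\<theta> (y \<otimes>\<^bsub>S\<^esub> s) = \<zero>\<^bsub>A\<^esub>" using a(2) c(1) by simp
   hence "y \<otimes>\<^bsub>S\<^esub> s = \<zero>\<^bsub>S\<^esub>" using ker S.y s(1) by simp
   hence "s = \<zero>\<^bsub>S\<^esub>" by (rule S.reg_left[OF s(1)])
   thus ?thesis using s(2) zero by simp
  qed
  show "a = \<zero>\<^bsub>A\<^esub>" if a: "a \<in> carrier A" "a \<otimes>\<^bsub>A\<^esub> Y = \<zero>\<^bsub>A\<^esub>" for a
  proof -
   obtain s where s: "s \<in> carrier S" "a = \<theta> s" using surj[OF a(1)] by blast
   have "\<theta> (s \<otimes>\<^bsub>S\<^esub> y) = a \<otimes>\<^bsub>A\<^esub> (Y \<otimes>\<^bsub>A\<^esub> c)"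
    using th(2)[OF s(1) S.y] \<theta>y s c(3)[OF Yc] by simp
   also have "\<dots> = \<zero>\<^bsub>A\<^esub>" using a c(1) Yc by (simp add: A.m_assoc[symmetric])
   finally have "s \<otimes>\<^bsub>S\<^esub> y = \<zero>\<^bsub>S\<^esub>" using ker S.y s(1) by simp
   hence "s = \<zero>\<^bsub>S\<^esub>" by (rule S.reg_right[OF s(1)])
   thus ?thesis using s(2) zero by simp
  qed
  show "\<exists>a'\<in>carrier A. Y \<otimes>\<^bsub>A\<^esub> a = a' \<otimes>\<^bsub>A\<^esub> Y" if a: "a \<in> carrier A" for a
  proof -
   obtain s where s: "s \<in> carrier S" "a = \<theta> s" using surj[OF a] by blast
   obtain s' where s': "s' \<in> carrier S" "y \<otimes>\<^bsub>S\<^esub> s = s' \<otimes>\<^bsub>S\<^esub> y" using S.normal[OF s(1)] by blast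
   note sc = th(1)[OF s(1)] th(1)[OF s'(1)]
   have "Y \<otimes>\<^bsub>A\<^esub> a = c \<otimes>\<^bsub>A\<^esub> \<theta> (y \<otimes>\<^bsub>S\<^esub> s)"
    unfolding Y s(2) th(2)[OF S.y s(1)] using c(1) y\<theta> sc by (simp add: A.m_assoc)
   also have "\<dots> = (c \<otimes>\<^bsub>A\<^esub> \<theta> s') \<otimes>\<^bsub>A\<^esub> \<theta> y"
    unfolding s'(2) th(2)[OF s'(1) S.y] using c(1) y\<theta> sc by (simp add: A.m_assoc)
   also have "\<dots> = \<theta> s' \<otimes>\<^bsub>A\<^esub> Y" unfolding c(3)[OF sc(2)] Y using c(1) y\<theta> sc by (simp add: A.m_assoc)
   finally show ?thesis using sc(2) by blast
  qed
 qed
 interpret K: is_localisation A "localisation A Y" Y "N.cls 0" by (rule N.localisation_is_localisation)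
 let ?k = "N.cls 0" and ?L = "localisation A Y"
 have "?k c \<otimes>\<^bsub>?L\<^esub> ?k c = \<one>\<^bsub>?L\<^esub>" using K.\<kappa>_mult[OF c(1,1)] c(2) K.\<kappa>_one by simp
 hence cU: "?k c \<in> Units ?L" using c(1) by (auto simp: Units_def)
 have pow: "\<theta> y [^]\<^bsub>A\<^esub> (n::nat) = c [^]\<^bsub>A\<^esub> n \<otimes>\<^bsub>A\<^esub> Y [^]\<^bsub>A\<^esub> n" for n
 proof (induction n)
  case (Suc n)
  have cn: "c \<otimes>\<^bsub>A\<^esub> Y [^]\<^bsub>A\<^esub> n = Y [^]\<^bsub>A\<^esub> n \<otimes>\<^bsub>A\<^esub> c" by (rule c(3)) (use Yc in simp)
  have "\<theta> y [^]\<^bsub>A\<^esub> Suc n = c [^]\<^bsub>A\<^esub> n \<otimes>\<^bsub>A\<^esub> (Y [^]\<^bsub>A\<^esub> n \<otimes>\<^bsub>A\<^esub> c) \<otimes>\<^bsub>A\<^esub> Y"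
  proof -
   have "\<theta> y [^]\<^bsub>A\<^esub> Suc n = c [^]\<^bsub>A\<^esub> n \<otimes>\<^bsub>A\<^esub> Y [^]\<^bsub>A\<^esub> n \<otimes>\<^bsub>A\<^esub> (c \<otimes>\<^bsub>A\<^esub> Y)"
    unfolding A.nat_pow_Suc Suc by (simp only: \<theta>y[symmetric])
   thus ?thesis using c(1) Yc by (simp add: A.m_assoc)
  qed
  also have "\<dots> = c [^]\<^bsub>A\<^esub> Suc n \<otimes>\<^bsub>A\<^esub> Y [^]\<^bsub>A\<^esub> Suc n"
   unfolding cn[symmetric] using c(1) Yc by (simp add: A.m_assoc)
  finally show ?case .
 qed simp
 have "is_localisation S ?L y (?k \<circ> \<theta>)"
 proof (intro is_localisation.intro S.ring_axioms N.L_ring is_localisation_axioms.intro)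
  show "y \<in> carrier S" by (rule S.y)
  show "\<exists>s'\<in>carrier S. y [^]\<^bsub>S\<^esub> n \<otimes>\<^bsub>S\<^esub> s = s' \<otimes>\<^bsub>S\<^esub> y [^]\<^bsub>S\<^esub> n" if "s \<in> carrier S" for s and n :: nat
   by (rule S.normal_pow[OF that])
  show "?k \<circ> \<theta> \<in> ring_hom S ?L" by (rule ring_hom_trans[OF hom K.\<kappa>])
  show "inj_on (?k \<circ> \<theta>) (carrier S)"
   by (rule comp_inj_on[OF inj]) (rule inj_on_subset[OF K.\<kappa>_inj], use th(1) in blast)
  have "?k (\<theta> y) = ?k c \<otimes>\<^bsub>?L\<^esub> ?k Y" unfolding \<theta>y by (rule K.\<kappa>_mult[OF c(1) Yc])
  thus "(?k \<circ> \<theta>) y \<in> Units ?L" using K.L.Units_m_closed[OF cU K.\<kappa>_y] by simp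
  fix l assume l: "l \<in> carrier ?L"
  obtain n :: nat and a where a: "a \<in> carrier A" "?k Y [^]\<^bsub>?L\<^esub> n \<otimes>\<^bsub>?L\<^esub> l = ?k a" using K.frac[OF l] by blast
  obtain s where s: "s \<in> carrier S" "c [^]\<^bsub>A\<^esub> n \<otimes>\<^bsub>A\<^esub> a = \<theta> s" using surj[of "c [^]\<^bsub>A\<^esub> n \<otimes>\<^bsub>A\<^esub> a"] a(1) c(1) by auto
  have "?k (\<theta> y) [^]\<^bsub>?L\<^esub> n = ?k (c [^]\<^bsub>A\<^esub> n) \<otimes>\<^bsub>?L\<^esub> ?k Y [^]\<^bsub>?L\<^esub> n"
   unfolding K.\<kappa>_pow[OF y\<theta>, symmetric] pow using c(1) Yc by (simp add: K.\<kappa>_mult K.\<kappa>_pow)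
  hence "?k (\<theta> y) [^]\<^bsub>?L\<^esub> n \<otimes>\<^bsub>?L\<^esub> l = ?k (c [^]\<^bsub>A\<^esub> n) \<otimes>\<^bsub>?L\<^esub> ?k a"
   using a(2) l c(1) Yc by (simp add: K.L.m_assoc)
  also have "\<dots> = ?k (\<theta> s)" unfolding s(2)[symmetric] using a(1) c(1) by (simp add: K.\<kappa>_mult)
  finally show "\<exists>(n::nat). \<exists>s\<in>carrier S. (?k \<circ> \<theta>) y [^]\<^bsub>?L\<^esub> n \<otimes>\<^bsub>?L\<^esub> l = (?k \<circ> \<theta>) s" using s(1) by auto
 qed
 thus ?thesis by blast
qed

section \<open>Changing the sign of the inner derivation\<close>

text \<open>The situation for m = 0, with e = (-1)^(p+1): there \<delta>' is the derivation that is
  inner by e t.\<close>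

locale skew_sign = skew_inner Q u \<sigma> \<delta> C N0 t
 for Q :: "('a, 'm) ring_scheme" (structure) and u \<sigma> \<delta> C N0 t +
 fixes e \<delta>'
 assumes e: "e = \<one> \<or> e = \<ominus> \<one>" and \<delta>': "\<And>q. q \<in> carrier Q ==> \<delta>' q = e \<otimes> \<delta> q"
begin

lemma e_c [simp, intro]: "e \<in> carrier Q" using e by auto
lemma e_central: "q \<in> carrier Q ==> q \<otimes> e = e \<otimes> q" using e by (auto simp: l_minus r_minus)
lemma e_e: "e \<otimes> e = \<one>" using e by (auto simp: l_minus r_minus)
lemma e_e': "q \<in> carrier Q ==> e \<otimes> (e \<otimes> q) = q" by (simp add: m_assoc[symmetric] e_e)
lemma e_G: "e \<in> G 0" using e G_one G_neg by auto
lemma \<sigma>_e: "\<sigma> e = e" using e by (auto simp: \<sigma>_simps)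
lemma \<delta>_e: "\<delta> e = \<zero>" using e by (auto simp: \<delta>_simps)

lemma \<delta>'_pow: "q \<in> carrier Q ==> (\<delta>' ^^ j) q = e [^] j \<otimes> (\<delta> ^^ j) q"
proof (induction j)
 case (Suc j)
 have ep: "e [^] j \<otimes> e = e \<otimes> e [^] j" "\<sigma> (e [^] j) = e [^] j" "\<delta> (e [^] j) = \<zero>"
 proof -
  show "\<sigma> (e [^] j) = e [^] j" by (induction j) (auto simp: \<sigma>_mult \<sigma>_e)
  show "\<delta> (e [^] j) = \<zero>" by (induction j) (auto simp: leib \<delta>_e)
 qed (simp add: e_central)
 have c: "e [^] j \<otimes> (\<delta> ^^ j) q \<in> carrier Q" using Suc.prems by simp
 have "(\<delta>' ^^ Suc j) q = e \<otimes> \<delta> (e [^] j \<otimes> (\<delta> ^^ j) q)" using Suc \<delta>'[OF c] by simp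
 also have "\<dots> = e \<otimes> e [^] j \<otimes> \<delta> ((\<delta> ^^ j) q)" using Suc.prems by (simp add: leib ep m_assoc)
 finally show ?case using Suc.prems by (simp add: ep(1))
qed simp

lemma A_skew: "skew Q u \<sigma> \<delta>' C N0"
proof
 show "amap \<sigma>" by (rule \<sigma>_amap)
 show "amap \<delta>'" unfolding amap_def by (auto simp: \<delta>' \<delta>_simps r_distr)
 show "bij_betw \<sigma> (carrier Q) (carrier Q)" by (rule \<sigma>_bij)
 show "\<delta>' (r \<otimes> s) = \<delta>' r \<otimes> s \<oplus> \<sigma> r \<otimes> \<delta>' s" if "r \<in> carrier Q" "s \<in> carrier Q" for r s
 proof -
  have "e \<otimes> (\<sigma> r \<otimes> \<delta> s) = \<sigma> r \<otimes> (e \<otimes> \<delta> s)" using that e_central[of "\<sigma> r"] by (simp add: m_assoc[symmetric])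
  thus ?thesis using that by (simp add: \<delta>' leib r_distr m_assoc)
 qed
 show "\<sigma> (\<delta>' r) = \<delta>' (\<sigma> r)" if "r \<in> carrier Q" for r
  using that by (simp add: \<delta>' \<sigma>_mult \<sigma>_e comm)
 show "(\<sigma> ^^ i) ((\<delta>' ^^ j) q) \<in> G (n + int (j div N0) - C)" if q: "q \<in> G n" for q n i j
 proof -
  have m: "(\<sigma> ^^ i) (e [^] j \<otimes> r) = e [^] j \<otimes> (\<sigma> ^^ i) r" if "r \<in> carrier Q" for r
  proof -
   have "\<sigma> (e [^] j) = e [^] j" by (induction j) (auto simp: \<sigma>_mult \<sigma>_e)
   thus ?thesis using that by (induction i) (auto simp: \<sigma>_mult)
  qed
  have qc: "q \<in> carrier Q" using q by simp
  have "(\<sigma> ^^ i) ((\<delta>' ^^ j) q) = e [^] j \<otimes> (\<sigma> ^^ i) ((\<delta> ^^ j) q)"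
   unfolding \<delta>'_pow[OF qc] by (rule m) (use qc in simp)
  thus ?thesis using G_mult[OF G_one_pow[OF e_G] adm[OF q]] by simp
 qed
qed (simp_all add: \<sigma>_mult C_nonneg N0_pos)

sublocale A: skew Q u \<sigma> \<delta>' C N0 by (rule A_skew)

lemma AS_carrier: "carrier A.S = carrier S" by (auto simp: S_carrier A.S_carrier)

text \<open>The element e x of the ring of (\<sigma>, \<delta>'). It obeys the commutation rule of
  (\<sigma>, \<delta>), because e^2 = 1 gives e \<delta>' = \<delta>.\<close>

definition ez where "ez = smul e (mon 1)"

lemma ez_S: "ez \<in> carrier A.S" unfolding ez_def by (rule A.smul_S) simp_all

lemma ez_eq: "ez = cst e \<otimes>\<^bsub>A.S\<^esub> mon 1" unfolding ez_def by (rule A.cst_mult[symmetric]) simp_all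

lemma cst_central: assumes a: "a \<in> carrier A.S" shows "cst e \<otimes>\<^bsub>A.S\<^esub> a = a \<otimes>\<^bsub>A.S\<^esub> cst e"
proof
 fix k
 have d: "\<delta>' e = \<zero>" by (simp add: \<delta>' \<delta>_e)
 show "(cst e \<otimes>\<^bsub>A.S\<^esub> a) k = (a \<otimes>\<^bsub>A.S\<^esub> cst e) k"
  unfolding A.mult_cst[OF a e_c \<sigma>_e d] A.cst_mult[OF e_c a]
  using e_central[OF A.S_coeff[OF a, of k]] by (simp add: smul_def)
qed

lemma ez_pow: "ez [^]\<^bsub>A.S\<^esub> (k::nat) = smul (e [^] k) (mon k)"
proof (induction k)
 case 0
 show ?case by (auto simp: A.S_one smul_def mon_def)
next
 case (Suc k)
 have m: "mon 1 \<in> carrier A.S" "mon k \<in> carrier A.S" "cst (e [^] k) \<in> carrier A.S" "cst e \<in> carrier A.S"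
  using A.mon_S A.cst_S by simp_all
 have "ez [^]\<^bsub>A.S\<^esub> Suc k = smul (e [^] k) (mon k) \<otimes>\<^bsub>A.S\<^esub> ez" using Suc by simp
 also have "\<dots> = (cst (e [^] k) \<otimes>\<^bsub>A.S\<^esub> mon k) \<otimes>\<^bsub>A.S\<^esub> (cst e \<otimes>\<^bsub>A.S\<^esub> mon 1)"
  unfolding ez_eq A.cst_mult[OF nat_pow_closed[OF e_c] m(2)] ..
 also have "\<dots> = cst (e [^] k) \<otimes>\<^bsub>A.S\<^esub> (mon k \<otimes>\<^bsub>A.S\<^esub> cst e) \<otimes>\<^bsub>A.S\<^esub> mon 1"
  using m by (simp only: A.S.m_assoc A.S.m_closed)
 also have "mon k \<otimes>\<^bsub>A.S\<^esub> cst e = cst e \<otimes>\<^bsub>A.S\<^esub> mon k" by (rule cst_central[OF m(2), symmetric])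
 also have "cst (e [^] k) \<otimes>\<^bsub>A.S\<^esub> (cst e \<otimes>\<^bsub>A.S\<^esub> mon k) \<otimes>\<^bsub>A.S\<^esub> mon 1 = cst (e [^] k) \<otimes>\<^bsub>A.S\<^esub> cst e \<otimes>\<^bsub>A.S\<^esub> (mon k \<otimes>\<^bsub>A.S\<^esub> mon 1)"
  using m by (simp only: A.S.m_assoc A.S.m_closed)
 also have "mon k \<otimes>\<^bsub>A.S\<^esub> mon 1 = mon (Suc k)"
  using A.mon_pow[of k] A.mon_pow[of "Suc k"] by simp
 also have "cst (e [^] k) \<otimes>\<^bsub>A.S\<^esub> cst e = cst (e [^] Suc k)" using A.cst_cst[of "e [^] k" e] by simp
 finally show ?case using A.cst_mult[of "e [^] Suc k" "mon (Suc k)"] A.mon_S[of "Suc k"] by simp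
qed

lemma ez_coeff: "(ez [^]\<^bsub>A.S\<^esub> (k::nat)) n = (if n = k then e [^] k else \<zero>)"
 unfolding ez_pow by (simp add: smul_def mon_def)

sublocale E: skew_subst Q u \<sigma> \<delta>' C N0 \<sigma> \<delta> C N0 ez
proof (intro skew_subst.intro A_skew skew_axioms skew_subst_axioms.intro)
 show "ez \<in> carrier A.S" by (rule ez_S)
 show "ez \<otimes>\<^bsub>A.S\<^esub> cst q = cst (\<sigma> q) \<otimes>\<^bsub>A.S\<^esub> ez \<oplus>\<^bsub>A.S\<^esub> cst (\<delta> q)" if q: "q \<in> carrier Q" for q
 proof -
  have m: "mon 1 \<in> carrier A.S" "cst e \<in> carrier A.S" "cst q \<in> carrier A.S" "cst (\<sigma> q) \<in> carrier A.S" "cst (\<delta>' q) \<in> carrier A.S"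
   using A.mon_S A.cst_S q A.\<delta>_closed[OF q] by simp_all
  have "ez \<otimes>\<^bsub>A.S\<^esub> cst q = cst e \<otimes>\<^bsub>A.S\<^esub> (mon 1 \<otimes>\<^bsub>A.S\<^esub> cst q)"
   unfolding ez_eq using m by (simp only: A.S.m_assoc A.S.m_closed)
  also have "\<dots> = cst e \<otimes>\<^bsub>A.S\<^esub> cst (\<sigma> q) \<otimes>\<^bsub>A.S\<^esub> mon 1 \<oplus>\<^bsub>A.S\<^esub> cst e \<otimes>\<^bsub>A.S\<^esub> cst (\<delta>' q)"
   unfolding A.var_cst[OF q] using m by (simp only: A.S.r_distr A.S.m_assoc A.S.m_closed)
  also have "cst e \<otimes>\<^bsub>A.S\<^esub> cst (\<delta>' q) = cst (\<delta> q)"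
   using A.cst_cst[of e "\<delta>' q"] q by (simp add: \<delta>' e_e')
  also have "cst e \<otimes>\<^bsub>A.S\<^esub> cst (\<sigma> q) \<otimes>\<^bsub>A.S\<^esub> mon 1 = cst (\<sigma> q) \<otimes>\<^bsub>A.S\<^esub> ez"
   unfolding ez_eq cst_central[OF m(4)] using m by (simp only: A.S.m_assoc)
  finally show ?thesis .
 qed
 show "\<exists>\<gamma>. \<forall>k::nat. ez [^]\<^bsub>A.S\<^esub> k \<in> bnd \<gamma>"
  using G_one_pow[OF e_G] by (intro exI[of _ 0]) (simp add: bnd_def ez_coeff)
 show "null (\<lambda>k::nat. (ez [^]\<^bsub>A.S\<^esub> k) n)" for n
  unfolding null_def ez_coeff
 proof (intro conjI allI)
  show "\<exists>N. \<forall>k\<ge>N. (if n = k then e [^] k else \<zero>) \<in> G c" for c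
   by (rule exI[of _ "Suc n"]) simp
 qed simp
qed

lemma E_iota: assumes a: "a \<in> carrier S" shows "E.iota a n = a n \<otimes> e [^] n"
proof -
 have ac: "a n \<in> carrier Q" by (rule S_coeff[OF a])
 have "hsum (\<lambda>k. a k \<otimes> (ez [^]\<^bsub>A.S\<^esub> k) n) (E.iota a n)"
  by (rule E.iota_hsum) (simp add: AS_carrier a)
 moreover have "(\<lambda>k. a k \<otimes> (ez [^]\<^bsub>A.S\<^esub> k) n) = (\<lambda>k. if k = n then a n \<otimes> e [^] n else \<zero>)"
  using S_coeffs[OF a] by (auto simp: ez_coeff)
 moreover have "hsum (\<lambda>k. if k = n then a n \<otimes> e [^] n else \<zero>) (a n \<otimes> e [^] n)"
  by (rule sums_single) (use ac in simp)
 ultimately show ?thesis using sums_unique by metis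
qed

lemma e_pow_pow: "q \<in> carrier Q ==> q \<otimes> e [^] (n::nat) \<otimes> e [^] n = q"
proof (induction n)
 case (Suc n)
 have "q \<otimes> e [^] Suc n \<otimes> e [^] Suc n = q \<otimes> e [^] n \<otimes> e \<otimes> (e \<otimes> e [^] n)"
  using Suc.prems e_central[of "e [^] n"] by (simp add: m_assoc)
 also have "\<dots> = q \<otimes> e [^] n \<otimes> (e \<otimes> (e \<otimes> e [^] n))" using Suc.prems by (simp add: m_assoc)
 also have "\<dots> = q" using Suc by (simp add: e_e')
 finally show ?case .
qed simp

text \<open>The substitution of e x for x multiplies coefficient n by e^n, so it is its own
  inverse.\<close>

lemma E_iso: "E.iota \<in> ring_iso S A.S"
proof -
 have "bij_betw E.iota (carrier S) (carrier A.S)"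
 proof (rule bij_betwI[where g = E.iota])
  have c: "E.iota a \<in> carrier S" if "a \<in> carrier S" for a
   using E.iota_S[of a] that by (simp add: AS_carrier)
  show "E.iota \<in> carrier S \<rightarrow> carrier A.S" "E.iota \<in> carrier A.S \<rightarrow> carrier S" using c by (auto simp: AS_carrier)
  have "E.iota (E.iota a) = a" if a: "a \<in> carrier S" for a
  proof
   fix n show "E.iota (E.iota a) n = a n"
    unfolding E_iota[OF c[OF a]] E_iota[OF a] by (rule e_pow_pow[OF S_coeff[OF a]])
  qed
  thus "E.iota (E.iota a) = a" if "a \<in> carrier S" for a using that .
  thus "E.iota (E.iota a) = a" if "a \<in> carrier A.S" for a using that by (simp add: AS_carrier)
 qed
 thus ?thesis using E.iota_hom by (simp add: ring_iso_def)
qed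

text \<open>x - e t = e (e x - t), and e x - t is the image of y.\<close>

lemma E_y: "mon 1 \<ominus>\<^bsub>A.S\<^esub> cst (e \<otimes> t) = cst e \<otimes>\<^bsub>A.S\<^esub> E.iota y"
proof
 fix k
 have m: "mon 1 \<in> carrier A.S" "cst (e \<otimes> t) \<in> carrier A.S" using A.mon_S A.cst_S by simp_all
 have i: "E.iota y \<in> carrier A.S" using E.iota_S[of y] by (simp add: AS_carrier)
 have yk: "y k = mon 1 k \<ominus> cst t k" using S_diff[of "mon 1" "cst t"] by (simp add: y_def)
 show "(mon 1 \<ominus>\<^bsub>A.S\<^esub> cst (e \<otimes> t)) k = (cst e \<otimes>\<^bsub>A.S\<^esub> E.iota y) k"
  unfolding A.S_diff[OF m] A.cst_mult[OF e_c i] smul_def E_iota[OF y_S] yk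
  by (cases "k = 0"; cases "k = 1") (auto simp: mon_def cst_eq minus_eq r_minus e_e)
qed

lemma A_localisation:
 assumes y: "normal_element S y"
 shows "\<exists>\<kappa>. is_localisation S (localisation A.S (mon 1 \<ominus>\<^bsub>A.S\<^esub> cst (e \<otimes> t))) y \<kappa>"
proof (rule localisation_transport)
 show "normal_element S y" by (rule y)
 show "ring A.S" by (rule A.S.ring_axioms)
 show "E.iota \<in> ring_iso S A.S" by (rule E_iso)
 show "mon 1 \<ominus>\<^bsub>A.S\<^esub> cst (e \<otimes> t) = cst e \<otimes>\<^bsub>A.S\<^esub> E.iota y" by (rule E_y)
 show "cst e \<in> carrier A.S" using A.cst_S by simp
 show "cst e \<otimes>\<^bsub>A.S\<^esub> cst e = \<one>\<^bsub>A.S\<^esub>" using A.cst_cst[of e e] by (simp add: e_e A.cst_one)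
qed (rule cst_central)

text \<open>This embedding differs from \<open>E.iota\<close>: the variable goes to y + e t = x + (e
  t - t), not to e x. The hypothesis makes the powers of this element tend to zero in each
  coefficient and keeps the substitution close to the identity, hence injective.\<close>

lemma A_subseries:
 assumes w: "e \<otimes> t \<ominus> t \<in> G 1"
 shows "subseries_ring_in Q u A.S S (y \<oplus>\<^bsub>S\<^esub> cst (e \<otimes> t))"
proof -
 define w where "w = e \<otimes> t \<ominus> t"
 define z where "z = mon 1 \<oplus>\<^bsub>S\<^esub> cst w"
 have wc: "w \<in> carrier Q" by (simp add: w_def)
 have \<sigma>w: "\<sigma> w = w" by (simp add: w_def \<sigma>_simps \<sigma>_mult \<sigma>_e)
 have \<delta>w: "\<delta> w = \<zero>" by (simp add: w_def \<delta>_simps leib \<delta>_e \<sigma>_e minus_eq)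
 have zS: "z \<in> carrier S" using wc by (simp add: z_def)
 have zy: "z = y \<oplus>\<^bsub>S\<^esub> cst (e \<otimes> t)"
 proof
  fix k
  have "y k = mon 1 k \<ominus> cst t k" using S_diff[of "mon 1" "cst t"] by (simp add: y_def)
  thus "z k = (y \<oplus>\<^bsub>S\<^esub> cst (e \<otimes> t)) k"
   by (cases "k = 0") (auto simp: z_def w_def S_add mon_def cst_eq minus_eq a_comm)
 qed
 have zp: "(z [^]\<^bsub>S\<^esub> (k::nat)) n = add_pow Q (k choose n) (w [^] (k - n))" for k n
  unfolding z_def by (rule linear_pow_coeff[OF wc \<sigma>w \<delta>w])
 have wn: "w [^] (n::nat) \<in> G (int n)" for n
 proof (induction n)
  case (Suc n)
  show ?case using G_mult[OF Suc assms[folded w_def]] by (simp add: ac_simps)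
 qed (simp add: G_one)
 have zpG: "(z [^]\<^bsub>S\<^esub> (k::nat)) n \<in> G (int (k - n))" for k n unfolding zp by (rule G_nat[OF wn])
 have sub: "skew_subst Q u \<sigma> \<delta> C N0 \<sigma> \<delta>' C N0 z"
 proof (intro skew_subst.intro A_skew skew_axioms skew_subst_axioms.intro zS)
  show "z \<otimes>\<^bsub>S\<^esub> cst q = cst (\<sigma> q) \<otimes>\<^bsub>S\<^esub> z \<oplus>\<^bsub>S\<^esub> cst (\<delta>' q)" if q: "q \<in> carrier Q" for q
  proof -
   have "\<sigma> q \<otimes> (e \<otimes> t) = e \<otimes> (\<sigma> q \<otimes> t)" using e_central[of "\<sigma> q"] q by (simp add: m_assoc[symmetric])
   hence eq: "e \<otimes> t \<otimes> q = \<sigma> q \<otimes> (e \<otimes> t) \<oplus> \<delta>' q"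
    using q by (simp add: \<delta>' \<delta>_eq minus_eq r_distr r_minus m_assoc a_ac r_neg r_neg1 r_neg2)
   have "z \<otimes>\<^bsub>S\<^esub> cst q = cst (\<sigma> q) \<otimes>\<^bsub>S\<^esub> y \<oplus>\<^bsub>S\<^esub> cst (e \<otimes> t \<otimes> q)"
    unfolding zy using q by (simp add: S.l_distr y_cst cst_cst)
   also have "cst (e \<otimes> t \<otimes> q) = cst (\<sigma> q) \<otimes>\<^bsub>S\<^esub> cst (e \<otimes> t) \<oplus>\<^bsub>S\<^esub> cst (\<delta>' q)"
    unfolding eq using q A.\<delta>_closed[OF q] by (simp add: cst_add cst_cst)
   finally show ?thesis unfolding zy using q A.\<delta>_closed[OF q] by (simp add: S.r_distr S.a_assoc)
  qed
  show "\<exists>\<gamma>. \<forall>k::nat. z [^]\<^bsub>S\<^esub> k \<in> bnd \<gamma>"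
   using G_mono[OF zpG, of 0] by (intro exI[of _ 0]) (simp add: bnd_def)
  show "null (\<lambda>k::nat. (z [^]\<^bsub>S\<^esub> k) n)" for n
   unfolding null_def
  proof (intro conjI allI)
   show "(z [^]\<^bsub>S\<^esub> k) n \<in> carrier Q" for k :: nat by (rule G_carrier[OF zpG])
   fix c
   show "\<exists>M::nat. \<forall>k\<ge>M. (z [^]\<^bsub>S\<^esub> k) n \<in> G c"
    by (rule exI[of _ "n + nat c"], intro allI impI, rule G_mono[OF zpG]) linarith
  qed
 qed
 interpret W: skew_subst Q u \<sigma> \<delta> C N0 \<sigma> \<delta>' C N0 z by (rule sub)
 \<comment> \<open>The case N = 1 of the closeness condition: z^k is x^k modulo
   \<open>G 1\<close>.\<close>
 have near: "(z [^]\<^bsub>S\<^esub> (k::nat)) n \<ominus> mon (1 * k) n \<in> G 1" for k n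
 proof (cases k n rule: linorder_cases)
  case greater
  thus ?thesis using G_mono[OF zpG[of k n], of 1] by (simp add: mon_def minus_eq)
 qed (simp_all add: zp mon_def minus_eq r_neg binomial_eq_0 wc)
 show ?thesis unfolding subseries_ring_in_def zy[symmetric]
 proof (intro conjI zS bexI[OF _ W.iota_hom] ballI allI)
  show "inj_on W.iota (carrier A.S)" unfolding AS_carrier by (rule W.iota_inj[OF near]) simp
  fix q n assume "q \<in> carrier A.S"
  hence q: "q \<in> carrier S" by (simp add: AS_carrier)
  have "(series_const Q (q k) \<otimes>\<^bsub>S\<^esub> z [^]\<^bsub>S\<^esub> k) n = q k \<otimes> (z [^]\<^bsub>S\<^esub> k) n" for k :: nat
   unfolding cst_def[symmetric] cst_mult[OF S_coeff[OF q] S.nat_pow_closed[OF zS]] smul_def ..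
  thus "filt_sums Q u (\<lambda>k. (series_const Q (q k) \<otimes>\<^bsub>S\<^esub> z [^]\<^bsub>S\<^esub> k) n) (W.iota q n)"
   using filt_sums_iff[of "\<lambda>k. q k \<otimes> (z [^]\<^bsub>S\<^esub> k) n"] sumsD(1)[OF W.iota_hsum[OF q]] W.iota_hsum[OF q, of n]
   by simp
 qed
qed

end

theorem theoremC:
 fixes Q :: "('a, 'm) ring_scheme" (structure)
  and u :: "'a \<Rightarrow> int extended" and p :: nat and \<eta> :: "(nat \<Rightarrow> int) \<Rightarrow> 'a"
  and \<sigma> \<delta> :: "'a \<Rightarrow> 'a" and t :: 'a
  and T :: "nat \<Rightarrow> 'a" and \<Sigma> \<Delta> :: "nat \<Rightarrow> 'a \<Rightarrow> 'a"
  and S :: "(nat \<Rightarrow> 'a) ring" and y :: "nat \<Rightarrow> 'a" and Xm :: "nat \<Rightarrow> nat \<Rightarrow> 'a"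
  and A :: "nat \<Rightarrow> (nat \<Rightarrow> 'a) ring" and Y :: "nat \<Rightarrow> nat \<Rightarrow> 'a"
 assumes "Factorial_Ring.prime p"
  and "filtered_Zp_algebra p Q u \<eta>"
  and "standard_filtered_artinian Q u"
  and "quasi_compatible Q u \<sigma> \<delta>"
  and "t \<in> carrier Q"
  and "\<And>q. q \<in> carrier Q \<Longrightarrow> \<delta> q = t \<otimes> q \<ominus> \<sigma> q \<otimes> t"
  and T: "T = (\<lambda>m. (\<ominus> \<one>) [^] (p + 1) \<otimes> t [^] (p ^ m))"
  and \<Sigma>: "\<Sigma> = (\<lambda>m. \<sigma> ^^ (p ^ m))"
  and \<Delta>: "\<Delta> = (\<lambda>m q. T m \<otimes> q \<ominus> \<Sigma> m q \<otimes> T m)"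
  and S: "S = skew_series_ring Q u \<sigma> \<delta>"
  and y: "y = series_var Q \<ominus>\<^bsub>S\<^esub> series_const Q t"
  and Xm: "Xm = (\<lambda>m. y [^]\<^bsub>S\<^esub> (p ^ m) \<oplus>\<^bsub>S\<^esub> series_const Q (T m))"
  and A: "A = (\<lambda>m. skew_series_ring Q u (\<Sigma> m) (\<Delta> m))"
  and Y: "Y = (\<lambda>m. series_var Q \<ominus>\<^bsub>A m\<^esub> series_const Q (T m))"
  and "\<exists>M. \<forall>m\<ge>M. compatible Q u (\<Sigma> m) (\<Delta> m)"
  and "\<And>n. n > 0 \<Longrightarrow> \<not> inner_automorphism Q (\<sigma> ^^ n)"
 shows "(ring_char Q = p \<longrightarrow> simple_ring (localisation S y)) \<and>
     (ring_char Q = 0 \<and> 0 \<le> u t \<longrightarrow>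
      (\<exists>k m. subseries_ring_in Q u (A m) S (Xm m) \<and>
          simple_ring (localisation (A m) (Y m)) \<and>
          localisation S y \<simeq> RDirProd_list (replicate k (localisation (A m) (Y m)))))"
proof (intro conjI impI)
 note compat = assms(15)[unfolded \<Delta> \<Sigma> T]
 note tower = skew_tower_exists[OF assms(1-6) compat assms(16)]
 {
  assume "ring_char Q = p"
  then obtain C N0 m where tw: "skew_tower Q u \<sigma> \<delta> C N0 t p m" using tower by blast
  interpret tw: skew_tower Q u \<sigma> \<delta> C N0 t p m by (rule tw)
  have "y = tw.y" by (simp add: y S tw.y_def tw.S_def tw.var_eq tw.cst_def)
  thus "simple_ring (localisation S y)"
   using tw.localisation_simple[OF tw.y.localisation_is_localisation] by (simp add: S tw.S_def)
 }
 assume "ring_char Q = 0 \<and> 0 \<le> u t"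
 hence ut: "0 \<le> u t" by simp
 \<comment> \<open>This m is large and serves to prove simplicity; the witness in the conclusion is
   0.\<close>
 then obtain C N0 m where tw: "skew_tower Q u \<sigma> \<delta> C N0 t p m" using tower by blast
 interpret tw: skew_tower Q u \<sigma> \<delta> C N0 t p m by (rule tw)
 define e where "e = (\<ominus> \<one>) [^] (p + 1)"
 have e: "e = \<one> \<or> e = \<ominus> \<one>" unfolding e_def tw.minus_one_pow by simp
 have ec: "e \<in> carrier Q" using e by auto
 have T0: "T 0 = e \<otimes> t" by (simp add: T e_def tw.nat_pow_eone)
 have \<Sigma>0: "\<Sigma> 0 = \<sigma>" by (simp add: \<Sigma>)
 have \<Delta>0: "\<Delta> 0 q = e \<otimes> \<delta> q" if q: "q \<in> carrier Q" for q
 proof -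
  have "\<sigma> q \<otimes> (e \<otimes> t) = e \<otimes> (\<sigma> q \<otimes> t)" using e q by (auto simp: tw.l_minus tw.r_minus)
  thus ?thesis using q ec by (simp add: \<Delta> T0 \<Sigma>0 tw.\<delta>_eq tw.minus_eq tw.r_distr tw.r_minus tw.m_assoc)
 qed
 interpret sg: skew_sign Q u \<sigma> \<delta> C N0 t e "\<Delta> 0"
  by (intro skew_sign.intro tw.skew_inner_axioms skew_sign_axioms.intro e \<Delta>0)
 have Se: "S = tw.S" by (simp add: S tw.S_def)
 have ye: "y = tw.y" by (simp add: y S tw.y_def tw.S_def tw.var_eq tw.cst_def)
 have Ae: "A 0 = sg.A.S" by (simp add: A sg.A.S_def \<Sigma>0)
 have Ye: "Y 0 = tw.mon 1 \<ominus>\<^bsub>sg.A.S\<^esub> tw.cst (e \<otimes> t)" by (simp add: Y Ae T0 tw.var_eq tw.cst_def)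
 have Xe: "Xm 0 = tw.y \<oplus>\<^bsub>tw.S\<^esub> tw.cst (e \<otimes> t)" by (simp add: Xm ye Se T0 tw.cst_def)
 \<comment> \<open>For odd p we have e = 1 and the difference is 0. For p = 2 it is -2 t, where 2 =
   p lies in \<open>G 1\<close> and u(t) \<ge> 0.\<close>
 have w: "e \<otimes> t \<ominus> t \<in> tw.G 1"
 proof (cases "p = 2")
  case True
  have t0: "t \<in> tw.G 0" using ut by (simp add: tw.G_iff zero_extended_def)
  have "e = \<ominus> \<one>" unfolding e_def tw.minus_one_pow using True by simp
  hence "e \<otimes> t \<ominus> t = \<ominus> (add_pow Q p \<one> \<otimes> t)"
   using True by (simp add: tw.add_pow_ldistr numeral_2_eq_2 tw.l_minus tw.minus_eq tw.minus_add tw.l_distr)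
  also have "\<dots> \<in> tw.G 1"
   by (rule tw.G_neg, rule tw.G_mult'[OF tw.p_in_G[OF assms(1,2)] t0]) simp
  finally show ?thesis .
 next
  case False
  hence "odd p" using assms(1) prime_odd_nat[of p] prime_ge_2_nat[of p] by linarith
  hence "e = \<one>" unfolding e_def tw.minus_one_pow by simp
  thus ?thesis by (simp add: tw.minus_eq tw.r_neg)
 qed
 \<comment> \<open>The localisation of \<open>A 0\<close> at \<open>Y 0\<close> is also a
   localisation of S at y. Hence it is isomorphic to the given one, and the simplicity theorem
   applies to it directly.\<close>
 obtain \<kappa> where \<kappa>: "is_localisation S (localisation (A 0) (Y 0)) y \<kappa>"
  using sg.A_localisation[OF tw.y.normal_element_axioms] unfolding Se ye Ae Ye by blast
 have "\<exists>\<psi>. \<psi> \<in> ring_iso (localisation S y) (localisation (A 0) (Y 0))"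
  using localisations_isomorphic[OF tw.y.localisation_is_localisation] \<kappa> unfolding Se ye by blast
 \<comment> \<open>With k = 1 the product has a single factor.\<close>
 hence iso: "localisation S y \<simeq> RDirProd_list (replicate 1 (localisation (A 0) (Y 0)))"
  using ring_iso_set_trans RDirProd_list_iso3 unfolding is_ring_iso_def by fastforce
 have "simple_ring (localisation (A 0) (Y 0))"
  using tw.localisation_simple \<kappa> unfolding Se ye by blast
 moreover have "subseries_ring_in Q u (A 0) S (Xm 0)"
  unfolding Ae Se Xe by (rule sg.A_subseries[OF w])
 ultimately show "\<exists>k m. subseries_ring_in Q u (A m) S (Xm m) \<and>
          simple_ring (localisation (A m) (Y m)) \<and>
          localisation S y \<simeq> RDirProd_list (replicate k (localisation (A m) (Y m)))"
  using iso by blast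
qed

end
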